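(* Let $\mathcal G$ be a (not necessarily Hausdorff) étale groupoid with locally compact Hausdorff unit space $X=\mathcal G^{(0)}$, equipped with a Fell line bundle $\mathcal L$. Let $A=C_0(X)$ and let $B$ be either $C^*(\mathcal G,\mathcal L)$ or $C^*_{\mathrm{red}}(\mathcal G,\mathcal L)$. Consider the following statements: (i) $\mathcal G$ is topologically free; (ii) the interior of $\mathcal G'\setminus X$ is empty; (iii) every normalizer in $N_{\mathcal G}$ is smooth (relative to the inclusion $(A,B)$). Then (i) $\Rightarrow$ (ii) $\Rightarrow$ (iii). If $\mathcal G$ is second countable then also (iii) $\Rightarrow$ (i).
   Context: An étale groupoid is a topological groupoid $\mathcal G$ (not necessarily Hausdorff) whose unit space $X$ is locally compact Hausdorff and whose range map $r:\mathcal G\to X$ (hence also the source map $s$) is a local homeomorphism. $\mathcal G(x)=\{\gamma:s(\gamma)=r(\gamma)=x\}$ and $\mathcal G'=\{\gamma:s(\gamma)=r(\gamma)\}$; $\mathcal G$ is topologically free if $\{x\in X:\mathcal G(x)=\{x\}\}$ is dense in $X$. An open bisection is an open $U\subseteq\mathcal G$ on which $r$ and $s$ are injective. A Fell line bundle over $\mathcal G$ is a topological space $\mathcal L=\bigsqcup_{\gamma}\mathcal L_\gamma$ of one-dimensional complex Banach spaces, restricting to a continuous Banach bundle on every open bisection, with a continuous, bilinear, associative, submultiplicative multiplication $\mathcal L_{\gamma_1}\times\mathcal L_{\gamma_2}\to\mathcal L_{\gamma_1\gamma_2}$ (for composable pairs) and a continuous conjugate-linear, involutive, antimultiplicative adjoint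 $\mathcal L_\gamma\to\mathcal L_{\gamma^{-1}}$ with $\|\xi^*\xi\|=\|\xi\|^2$ and $\xi^*\xi\ge0$; for $x\in X$, $\mathcal L_x\cong\mathbb C$ canonically. For an open bisection $U$, $\mathscr C_c(U,\mathcal L)$ (resp. $\mathscr C_0(U,\mathcal L)$) is the set of sections of $\mathcal L$ over $\mathcal G$ obtained by extending by zero the continuous sections over $U$ that are compactly supported (resp. vanish at infinity); $\mathscr C_c(\mathcal G,\mathcal L)$ is the linear span of the $\mathscr C_c(U,\mathcal L)$, a $*$-algebra with $(f*g)(\gamma)=\sum_{\gamma_1\gamma_2=\gamma}f(\gamma_1)g(\gamma_2)$, $f^*(\gamma)=f(\gamma^{-1})^*$. $C^*(\mathcal G,\mathcal L)$ is its completion in the largest C*-norm; $C^*_{\mathrm{red}}(\mathcal G,\mathcal L)$ its completion in $\|f\|_{\mathrm{red}}=\sup_{x\in X}\|\pi_x(f)\|$, where $\pi_x$ acts on the square-summable sections of $\mathcal L$ over $s^{-1}(x)$ by $(\pi_x(f)\xi)(\gamma)=\sum_{\gamma_1\gamma_2=\gamma}f(\gamma_1)\xi(\gamma_2)$. Both norms restrict to the uniform norm on each $\mathscr C_c(U,\mathcal L)$, so $\mathscr C_0(U,\mathcal L)$ embeds in both completions; in particular so does $C_0(X)$. $N_{\mathcal G}$ is the union (not span) of all $\mathscr C_0(U,\mathcal L)$, $U$ an open bisection; it consists of normalizers of $A$ in $B$, i.e. elements $n$ with $nAn^*\subseteq A$, $n^*An\subseteq A$. For $b\in B$, a point $x\in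 X$ is free relative to $b$ if any two states of $B$ extending the evaluation state of $C_0(X)$ at $x$ agree at $b$; $F_b$ is the set of such points and $b$ is smooth if the interior of $F_b$ is dense in $X$. *)

theory Defs
  imports "HOL-Analysis.Analysis" "HOL-Algebra.FiniteProduct"
begin

section \<open>Etale groupoids\<close>

record 'g tgroupoid =
  gtop :: "'g topology"
  rng :: "'g \<Rightarrow> 'g"
  src :: "'g \<Rightarrow> 'g"
  gmul :: "'g \<Rightarrow> 'g \<Rightarrow> 'g"
  ginv :: "'g \<Rightarrow> 'g"

definition arrows :: "'g tgroupoid \<Rightarrow> 'g set" where
  "arrows \<G> = topspace (gtop \<G>)"

definition units :: "'g tgroupoid \<Rightarrow> 'g set" where
  "units \<G> = rng \<G> ` arrows \<G>"

definition unit_top :: "'g tgroupoid \<Rightarrow> 'g topology" where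
  "unit_top \<G> = subtopology (gtop \<G>) (units \<G>)"

definition composable :: "'g tgroupoid \<Rightarrow> ('g \<times> 'g) set" where
  "composable \<G> = {(\<gamma>, \<delta>). \<gamma> \<in> arrows \<G> \<and> \<delta> \<in> arrows \<G> \<and> src \<G> \<gamma> = rng \<G> \<delta>}"

locale topological_groupoid =
  fixes \<G> :: "'g tgroupoid"
  assumes rng_closed: "\<gamma> \<in> arrows \<G> \<Longrightarrow> rng \<G> \<gamma> \<in> arrows \<G>"
    and src_closed: "\<gamma> \<in> arrows \<G> \<Longrightarrow> src \<G> \<gamma> \<in> arrows \<G>"
    and rng_rng: "\<gamma> \<in> arrows \<G> \<Longrightarrow> rng \<G> (rng \<G> \<gamma>) = rng \<G> \<gamma>"
    and src_rng: "\<gamma> \<in> arrows \<G> \<Longrightarrow> src \<G> (rng \<G> \<gamma>) = rng \<G> \<gamma>"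
    and rng_src: "\<gamma> \<in> arrows \<G> \<Longrightarrow> rng \<G> (src \<G> \<gamma>) = src \<G> \<gamma>"
    and src_src: "\<gamma> \<in> arrows \<G> \<Longrightarrow> src \<G> (src \<G> \<gamma>) = src \<G> \<gamma>"
    and mul_closed: "(\<gamma>, \<delta>) \<in> composable \<G> \<Longrightarrow> gmul \<G> \<gamma> \<delta> \<in> arrows \<G>"
    and rng_mul: "(\<gamma>, \<delta>) \<in> composable \<G> \<Longrightarrow> rng \<G> (gmul \<G> \<gamma> \<delta>) = rng \<G> \<gamma>"
    and src_mul: "(\<gamma>, \<delta>) \<in> composable \<G> \<Longrightarrow> src \<G> (gmul \<G> \<gamma> \<delta>) = src \<G> \<delta>"
    and mul_assoc: "\<lbrakk>(\<gamma>, \<delta>) \<in> composable \<G>; (\<delta>, \<kappa>) \<in> composable \<G>\<rbrakk>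
          \<Longrightarrow> gmul \<G> (gmul \<G> \<gamma> \<delta>) \<kappa> = gmul \<G> \<gamma> (gmul \<G> \<delta> \<kappa>)"
    and mul_rng: "\<gamma> \<in> arrows \<G> \<Longrightarrow> gmul \<G> (rng \<G> \<gamma>) \<gamma> = \<gamma>"
    and mul_src: "\<gamma> \<in> arrows \<G> \<Longrightarrow> gmul \<G> \<gamma> (src \<G> \<gamma>) = \<gamma>"
    and inv_closed: "\<gamma> \<in> arrows \<G> \<Longrightarrow> ginv \<G> \<gamma> \<in> arrows \<G>"
    and rng_inv: "\<gamma> \<in> arrows \<G> \<Longrightarrow> rng \<G> (ginv \<G> \<gamma>) = src \<G> \<gamma>"
    and src_inv: "\<gamma> \<in> arrows \<G> \<Longrightarrow> src \<G> (ginv \<G> \<gamma>) = rng \<G> \<gamma>"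
    and mul_inv: "\<gamma> \<in> arrows \<G> \<Longrightarrow> gmul \<G> \<gamma> (ginv \<G> \<gamma>) = rng \<G> \<gamma>"
    and inv_mul: "\<gamma> \<in> arrows \<G> \<Longrightarrow> gmul \<G> (ginv \<G> \<gamma>) \<gamma> = src \<G> \<gamma>"
    and continuous_mul:
      "continuous_map (subtopology (prod_topology (gtop \<G>) (gtop \<G>)) (composable \<G>)) (gtop \<G>)
         (\<lambda>(\<gamma>, \<delta>). gmul \<G> \<gamma> \<delta>)"
    and continuous_inv: "continuous_map (gtop \<G>) (gtop \<G>) (ginv \<G>)"

locale etale_groupoid = topological_groupoid +
  assumes unit_Hausdorff: "Hausdorff_space (unit_top \<G>)"
    and unit_locally_compact: "locally_compact_space (unit_top \<G>)"
    and rng_local_homeomorphism: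
      "\<gamma> \<in> arrows \<G> \<Longrightarrow>
        \<exists>U. openin (gtop \<G>) U \<and> \<gamma> \<in> U \<and> openin (unit_top \<G>) (rng \<G> ` U)
          \<and> homeomorphic_map (subtopology (gtop \<G>) U) (subtopology (unit_top \<G>) (rng \<G> ` U)) (rng \<G>)"

definition isotropy_at :: "'g tgroupoid \<Rightarrow> 'g \<Rightarrow> 'g set" where
  "isotropy_at \<G> x = {\<gamma> \<in> arrows \<G>. src \<G> \<gamma> = x \<and> rng \<G> \<gamma> = x}"

definition isotropy :: "'g tgroupoid \<Rightarrow> 'g set" where
  "isotropy \<G> = {\<gamma> \<in> arrows \<G>. src \<G> \<gamma> = rng \<G> \<gamma>}"

definition topologically_free :: "'g tgroupoid \<Rightarrow> bool" where
  "topologically_free \<G> \<longleftrightarrow>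
     unit_top \<G> closure_of {x \<in> units \<G>. isotropy_at \<G> x = {x}} = units \<G>"

definition open_bisection :: "'g tgroupoid \<Rightarrow> 'g set \<Rightarrow> bool" where
  "open_bisection \<G> U \<longleftrightarrow> openin (gtop \<G>) U \<and> inj_on (rng \<G>) U \<and> inj_on (src \<G>) U"


section \<open>Fell line bundles\<close>

text \<open>The operations on the total space are only meaningful fibrewise: \<open>badd\<close> on pairs lying in
  the same fibre, \<open>bmult\<close> on pairs lying over composable arrows.\<close>

record ('g, 'l) line_bundle =
  btop :: "'l topology"
  proj :: "'l \<Rightarrow> 'g"
  badd :: "'l \<Rightarrow> 'l \<Rightarrow> 'l"
  bzero :: "'g \<Rightarrow> 'l"
  bscale :: "complex \<Rightarrow> 'l \<Rightarrow> 'l"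
  bnorm :: "'l \<Rightarrow> real"
  bmult :: "'l \<Rightarrow> 'l \<Rightarrow> 'l"
  bstar :: "'l \<Rightarrow> 'l"

definition fibre :: "('g, 'l) line_bundle \<Rightarrow> 'g \<Rightarrow> 'l set" where
  "fibre \<L> \<gamma> = {u \<in> topspace (btop \<L>). proj \<L> u = \<gamma>}"

definition fibre_group :: "('g, 'l) line_bundle \<Rightarrow> 'g \<Rightarrow> 'l monoid" where
  "fibre_group \<L> \<gamma> = \<lparr>carrier = fibre \<L> \<gamma>, monoid.mult = badd \<L>, one = bzero \<L> \<gamma>\<rparr>"

definition bdiff :: "('g, 'l) line_bundle \<Rightarrow> 'l \<Rightarrow> 'l \<Rightarrow> 'l" where
  "bdiff \<L> u v = badd \<L> u (bscale \<L> (-1) v)"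

locale complex_banach_fibre =
  fixes \<L> :: "('g, 'l) line_bundle" and \<gamma> :: 'g
  assumes add_group: "comm_group (fibre_group \<L> \<gamma>)"
    and scale_closed: "u \<in> fibre \<L> \<gamma> \<Longrightarrow> bscale \<L> c u \<in> fibre \<L> \<gamma>"
    and scale_one: "u \<in> fibre \<L> \<gamma> \<Longrightarrow> bscale \<L> 1 u = u"
    and scale_scale: "u \<in> fibre \<L> \<gamma> \<Longrightarrow> bscale \<L> c (bscale \<L> d u) = bscale \<L> (c * d) u"
    and scale_add_left:
      "u \<in> fibre \<L> \<gamma> \<Longrightarrow> bscale \<L> (c + d) u = badd \<L> (bscale \<L> c u) (bscale \<L> d u)"
    and scale_add_right:
      "\<lbrakk>u \<in> fibre \<L> \<gamma>; v \<in> fibre \<L> \<gamma>\<rbrakk>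
        \<Longrightarrow> bscale \<L> c (badd \<L> u v) = badd \<L> (bscale \<L> c u) (bscale \<L> c v)"
    and norm_nonneg: "u \<in> fibre \<L> \<gamma> \<Longrightarrow> 0 \<le> bnorm \<L> u"
    and norm_eq_zero: "u \<in> fibre \<L> \<gamma> \<Longrightarrow> bnorm \<L> u = 0 \<longleftrightarrow> u = bzero \<L> \<gamma>"
    and norm_scale: "u \<in> fibre \<L> \<gamma> \<Longrightarrow> bnorm \<L> (bscale \<L> c u) = cmod c * bnorm \<L> u"
    and norm_triangle:
      "\<lbrakk>u \<in> fibre \<L> \<gamma>; v \<in> fibre \<L> \<gamma>\<rbrakk> \<Longrightarrow> bnorm \<L> (badd \<L> u v) \<le> bnorm \<L> u + bnorm \<L> v"
    and complete: "Metric_space.mcomplete (fibre \<L> \<gamma>) (\<lambda>u v. bnorm \<L> (bdiff \<L> u v))"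

definition one_dimensional_fibre :: "('g, 'l) line_bundle \<Rightarrow> 'g \<Rightarrow> bool" where
  "one_dimensional_fibre \<L> \<gamma> \<longleftrightarrow>
     (\<exists>e \<in> fibre \<L> \<gamma>. e \<noteq> bzero \<L> \<gamma> \<and> fibre \<L> \<gamma> = range (\<lambda>c. bscale \<L> c e))"

text \<open>Continuous Banach bundles in the sense of Fell and Doran, for the restriction of \<open>\<L>\<close> to
  \<open>U\<close>. The last axiom is the neighbourhood form of: if \<open>proj u\<^sub>i \<longlonglongrightarrow> \<gamma>\<close> and \<open>bnorm u\<^sub>i \<longlonglongrightarrow> 0\<close> for a
  net \<open>(u\<^sub>i)\<close>, then \<open>u\<^sub>i\<close> converges to the zero of the fibre at \<open>\<gamma>\<close>. Hausdorffness of the total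
  space over a Hausdorff base follows from these axioms and is not listed.\<close>

definition total_over :: "('g, 'l) line_bundle \<Rightarrow> 'g set \<Rightarrow> 'l topology" where
  "total_over \<L> U = subtopology (btop \<L>) {u \<in> topspace (btop \<L>). proj \<L> u \<in> U}"

locale continuous_banach_bundle_over =
  fixes \<G> :: "'g tgroupoid" and \<L> :: "('g, 'l) line_bundle" and U :: "'g set"
  assumes proj_continuous: "continuous_map (total_over \<L> U) (subtopology (gtop \<G>) U) (proj \<L>)"
    and proj_open: "open_map (total_over \<L> U) (subtopology (gtop \<G>) U) (proj \<L>)"
    and proj_surj: "proj \<L> ` topspace (total_over \<L> U) = U"
    and fibres: "\<gamma> \<in> U \<Longrightarrow> complex_banach_fibre \<L> \<gamma>"
    and norm_continuous: "continuous_map (total_over \<L> U) euclideanreal (bnorm \<L>)"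
    and add_continuous:
      "continuous_map
         (subtopology (prod_topology (total_over \<L> U) (total_over \<L> U)) {(u, v). proj \<L> u = proj \<L> v})
         (total_over \<L> U) (\<lambda>(u, v). badd \<L> u v)"
    and scale_continuous: "continuous_map (total_over \<L> U) (total_over \<L> U) (bscale \<L> c)"
    and zero_neighbourhoods:
      "\<lbrakk>\<gamma> \<in> U; openin (total_over \<L> U) W; bzero \<L> \<gamma> \<in> W\<rbrakk>
        \<Longrightarrow> \<exists>V \<epsilon>. openin (subtopology (gtop \<G>) U) V \<and> \<gamma> \<in> V \<and> \<epsilon> > 0
              \<and> {u \<in> topspace (total_over \<L> U). proj \<L> u \<in> V \<and> bnorm \<L> u < \<epsilon>} \<subseteq> W"

text \<open>The unit of the one-dimensional C*-algebra \<open>fibre \<L> x\<close>, \<open>x\<close> a unit of the groupoid; the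
  canonical isomorphism with the complex numbers is \<open>c \<mapsto> bscale \<L> c (bunit \<L> x)\<close>.\<close>

definition bunit :: "('g, 'l) line_bundle \<Rightarrow> 'g \<Rightarrow> 'l" where
  "bunit \<L> x = (THE e. e \<in> fibre \<L> x \<and> (\<forall>u \<in> fibre \<L> x. bmult \<L> e u = u \<and> bmult \<L> u e = u))"

locale fell_line_bundle = etale_groupoid \<G> for \<G> :: "'g tgroupoid" +
  fixes \<L> :: "('g, 'l) line_bundle"
  assumes proj_continuous: "continuous_map (btop \<L>) (gtop \<G>) (proj \<L>)"
    and one_dimensional: "\<gamma> \<in> arrows \<G> \<Longrightarrow> one_dimensional_fibre \<L> \<gamma>"
    and banach_bundle: "open_bisection \<G> U \<Longrightarrow> continuous_banach_bundle_over \<G> \<L> U"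
    and mult_closed:
      "\<lbrakk>(\<gamma>, \<delta>) \<in> composable \<G>; u \<in> fibre \<L> \<gamma>; v \<in> fibre \<L> \<delta>\<rbrakk>
        \<Longrightarrow> bmult \<L> u v \<in> fibre \<L> (gmul \<G> \<gamma> \<delta>)"
    and mult_add_left:
      "\<lbrakk>(\<gamma>, \<delta>) \<in> composable \<G>; u \<in> fibre \<L> \<gamma>; u' \<in> fibre \<L> \<gamma>; v \<in> fibre \<L> \<delta>\<rbrakk>
        \<Longrightarrow> bmult \<L> (badd \<L> u u') v = badd \<L> (bmult \<L> u v) (bmult \<L> u' v)"
    and mult_add_right:
      "\<lbrakk>(\<gamma>, \<delta>) \<in> composable \<G>; u \<in> fibre \<L> \<gamma>; v \<in> fibre \<L> \<delta>; v' \<in> fibre \<L> \<delta>\<rbrakk>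
        \<Longrightarrow> bmult \<L> u (badd \<L> v v') = badd \<L> (bmult \<L> u v) (bmult \<L> u v')"
    and mult_scale_left:
      "\<lbrakk>(\<gamma>, \<delta>) \<in> composable \<G>; u \<in> fibre \<L> \<gamma>; v \<in> fibre \<L> \<delta>\<rbrakk>
        \<Longrightarrow> bmult \<L> (bscale \<L> c u) v = bscale \<L> c (bmult \<L> u v)"
    and mult_scale_right:
      "\<lbrakk>(\<gamma>, \<delta>) \<in> composable \<G>; u \<in> fibre \<L> \<gamma>; v \<in> fibre \<L> \<delta>\<rbrakk>
        \<Longrightarrow> bmult \<L> u (bscale \<L> c v) = bscale \<L> c (bmult \<L> u v)"
    and mult_assoc:
      "\<lbrakk>(\<gamma>, \<delta>) \<in> composable \<G>; (\<delta>, \<kappa>) \<in> composable \<G>;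
        u \<in> fibre \<L> \<gamma>; v \<in> fibre \<L> \<delta>; w \<in> fibre \<L> \<kappa>\<rbrakk>
        \<Longrightarrow> bmult \<L> (bmult \<L> u v) w = bmult \<L> u (bmult \<L> v w)"
    and norm_mult:
      "\<lbrakk>(\<gamma>, \<delta>) \<in> composable \<G>; u \<in> fibre \<L> \<gamma>; v \<in> fibre \<L> \<delta>\<rbrakk>
        \<Longrightarrow> bnorm \<L> (bmult \<L> u v) \<le> bnorm \<L> u * bnorm \<L> v"
    and mult_continuous:
      "continuous_map
         (subtopology (prod_topology (btop \<L>) (btop \<L>)) {(u, v). src \<G> (proj \<L> u) = rng \<G> (proj \<L> v)})
         (btop \<L>) (\<lambda>(u, v). bmult \<L> u v)"
    and star_closed:
      "\<lbrakk>\<gamma> \<in> arrows \<G>; u \<in> fibre \<L> \<gamma>\<rbrakk> \<Longrightarrow> bstar \<L> u \<in> fibre \<L> (ginv \<G> \<gamma>)"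
    and star_add:
      "\<lbrakk>\<gamma> \<in> arrows \<G>; u \<in> fibre \<L> \<gamma>; v \<in> fibre \<L> \<gamma>\<rbrakk>
        \<Longrightarrow> bstar \<L> (badd \<L> u v) = badd \<L> (bstar \<L> u) (bstar \<L> v)"
    and star_scale:
      "\<lbrakk>\<gamma> \<in> arrows \<G>; u \<in> fibre \<L> \<gamma>\<rbrakk> \<Longrightarrow> bstar \<L> (bscale \<L> c u) = bscale \<L> (cnj c) (bstar \<L> u)"
    and star_star: "\<lbrakk>\<gamma> \<in> arrows \<G>; u \<in> fibre \<L> \<gamma>\<rbrakk> \<Longrightarrow> bstar \<L> (bstar \<L> u) = u"
    and star_mult:
      "\<lbrakk>(\<gamma>, \<delta>) \<in> composable \<G>; u \<in> fibre \<L> \<gamma>; v \<in> fibre \<L> \<delta>\<rbrakk>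
        \<Longrightarrow> bstar \<L> (bmult \<L> u v) = bmult \<L> (bstar \<L> v) (bstar \<L> u)"
    and star_continuous: "continuous_map (btop \<L>) (btop \<L>) (bstar \<L>)"
    and norm_star_mult:
      "\<lbrakk>\<gamma> \<in> arrows \<G>; u \<in> fibre \<L> \<gamma>\<rbrakk> \<Longrightarrow> bnorm \<L> (bmult \<L> (bstar \<L> u) u) = (bnorm \<L> u)\<^sup>2"
    and star_mult_positive:
      "\<lbrakk>\<gamma> \<in> arrows \<G>; u \<in> fibre \<L> \<gamma>\<rbrakk>
        \<Longrightarrow> \<exists>t::real. t \<ge> 0 \<and> bmult \<L> (bstar \<L> u) u = bscale \<L> (of_real t) (bunit \<L> (src \<G> \<gamma>))"


section \<open>The *-algebra of compactly supported sections\<close>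

text \<open>Sections over a set of arrows are extensional functions.\<close>

definition sections_on :: "('g, 'l) line_bundle \<Rightarrow> 'g set \<Rightarrow> ('g \<Rightarrow> 'l) set" where
  "sections_on \<L> S = (\<Pi>\<^sub>E \<gamma>\<in>S. fibre \<L> \<gamma>)"

definition continuous_sections :: "'g tgroupoid \<Rightarrow> ('g, 'l) line_bundle \<Rightarrow> 'g set \<Rightarrow> ('g \<Rightarrow> 'l) set" where
  "continuous_sections \<G> \<L> U =
     {f \<in> sections_on \<L> (arrows \<G>).
        continuous_map (subtopology (gtop \<G>) U) (btop \<L>) f
        \<and> (\<forall>\<gamma> \<in> arrows \<G> - U. f \<gamma> = bzero \<L> \<gamma>)}"

definition Cc_on :: "'g tgroupoid \<Rightarrow> ('g, 'l) line_bundle \<Rightarrow> 'g set \<Rightarrow> ('g \<Rightarrow> 'l) set" where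
  "Cc_on \<G> \<L> U =
     {f \<in> continuous_sections \<G> \<L> U.
        \<exists>K \<subseteq> U. compactin (gtop \<G>) K \<and> (\<forall>\<gamma> \<in> U - K. f \<gamma> = bzero \<L> \<gamma>)}"

definition C0_on :: "'g tgroupoid \<Rightarrow> ('g, 'l) line_bundle \<Rightarrow> 'g set \<Rightarrow> ('g \<Rightarrow> 'l) set" where
  "C0_on \<G> \<L> U =
     {f \<in> continuous_sections \<G> \<L> U.
        \<forall>\<epsilon>>0. compactin (gtop \<G>) {\<gamma> \<in> U. \<epsilon> \<le> bnorm \<L> (f \<gamma>)}}"

definition sec_zero :: "'g tgroupoid \<Rightarrow> ('g, 'l) line_bundle \<Rightarrow> 'g \<Rightarrow> 'l" where
  "sec_zero \<G> \<L> = (\<lambda>\<gamma> \<in> arrows \<G>. bzero \<L> \<gamma>)"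

definition sec_add :: "'g tgroupoid \<Rightarrow> ('g, 'l) line_bundle \<Rightarrow> ('g \<Rightarrow> 'l) \<Rightarrow> ('g \<Rightarrow> 'l) \<Rightarrow> 'g \<Rightarrow> 'l" where
  "sec_add \<G> \<L> f g = (\<lambda>\<gamma> \<in> arrows \<G>. badd \<L> (f \<gamma>) (g \<gamma>))"

definition sec_scale :: "'g tgroupoid \<Rightarrow> ('g, 'l) line_bundle \<Rightarrow> complex \<Rightarrow> ('g \<Rightarrow> 'l) \<Rightarrow> 'g \<Rightarrow> 'l" where
  "sec_scale \<G> \<L> c f = (\<lambda>\<gamma> \<in> arrows \<G>. bscale \<L> c (f \<gamma>))"

inductive_set Cc :: "'g tgroupoid \<Rightarrow> ('g, 'l) line_bundle \<Rightarrow> ('g \<Rightarrow> 'l) set"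
  for \<G> :: "'g tgroupoid" and \<L> :: "('g, 'l) line_bundle"
  where
    gen: "\<lbrakk>open_bisection \<G> U; f \<in> Cc_on \<G> \<L> U\<rbrakk> \<Longrightarrow> f \<in> Cc \<G> \<L>"
  | add: "\<lbrakk>f \<in> Cc \<G> \<L>; g \<in> Cc \<G> \<L>\<rbrakk> \<Longrightarrow> sec_add \<G> \<L> f g \<in> Cc \<G> \<L>"
  | scale: "f \<in> Cc \<G> \<L> \<Longrightarrow> sec_scale \<G> \<L> c f \<in> Cc \<G> \<L>"

text \<open>The sum, in the fibre over \<open>\<gamma>\<close>, of \<open>f \<alpha> g \<beta>\<close> over all factorizations \<open>\<gamma> = \<alpha>\<beta>\<close>. Only the
  nonzero terms are summed, since \<^const>\<open>finprod\<close> needs a finite index set; for \<open>f\<close> in \<open>Cc\<close>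
  there are finitely many of them.\<close>

definition conv_at ::
  "'g tgroupoid \<Rightarrow> ('g, 'l) line_bundle \<Rightarrow> ('g \<Rightarrow> 'l) \<Rightarrow> ('g \<Rightarrow> 'l) \<Rightarrow> 'g \<Rightarrow> 'l" where
  "conv_at \<G> \<L> f g \<gamma> =
     finprod (fibre_group \<L> \<gamma>) (\<lambda>(\<alpha>, \<beta>). bmult \<L> (f \<alpha>) (g \<beta>))
       {(\<alpha>, \<beta>) \<in> composable \<G>. gmul \<G> \<alpha> \<beta> = \<gamma> \<and> bmult \<L> (f \<alpha>) (g \<beta>) \<noteq> bzero \<L> \<gamma>}"

definition sec_mult :: "'g tgroupoid \<Rightarrow> ('g, 'l) line_bundle \<Rightarrow> ('g \<Rightarrow> 'l) \<Rightarrow> ('g \<Rightarrow> 'l) \<Rightarrow> 'g \<Rightarrow> 'l" where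
  "sec_mult \<G> \<L> f g = (\<lambda>\<gamma> \<in> arrows \<G>. conv_at \<G> \<L> f g \<gamma>)"

definition sec_star :: "'g tgroupoid \<Rightarrow> ('g, 'l) line_bundle \<Rightarrow> ('g \<Rightarrow> 'l) \<Rightarrow> 'g \<Rightarrow> 'l" where
  "sec_star \<G> \<L> f = (\<lambda>\<gamma> \<in> arrows \<G>. bstar \<L> (f (ginv \<G> \<gamma>)))"


section \<open>The full and the reduced C*-norm\<close>

definition cstar_norm_on_Cc :: "'g tgroupoid \<Rightarrow> ('g, 'l) line_bundle \<Rightarrow> (('g \<Rightarrow> 'l) \<Rightarrow> real) \<Rightarrow> bool" where
  "cstar_norm_on_Cc \<G> \<L> \<nu> \<longleftrightarrow>
     (\<forall>f \<in> Cc \<G> \<L>. 0 \<le> \<nu> f \<and> (\<nu> f = 0 \<longleftrightarrow> f = sec_zero \<G> \<L>)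
        \<and> (\<forall>c. \<nu> (sec_scale \<G> \<L> c f) = cmod c * \<nu> f)
        \<and> \<nu> (sec_mult \<G> \<L> (sec_star \<G> \<L> f) f) = (\<nu> f)\<^sup>2)
     \<and> (\<forall>f \<in> Cc \<G> \<L>. \<forall>g \<in> Cc \<G> \<L>.
          \<nu> (sec_add \<G> \<L> f g) \<le> \<nu> f + \<nu> g \<and> \<nu> (sec_mult \<G> \<L> f g) \<le> \<nu> f * \<nu> g)"

definition largest_cstar_norm_on_Cc ::
  "'g tgroupoid \<Rightarrow> ('g, 'l) line_bundle \<Rightarrow> (('g \<Rightarrow> 'l) \<Rightarrow> real) \<Rightarrow> bool" where
  "largest_cstar_norm_on_Cc \<G> \<L> \<nu> \<longleftrightarrow>
     cstar_norm_on_Cc \<G> \<L> \<nu>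
     \<and> (\<forall>\<nu>'. cstar_norm_on_Cc \<G> \<L> \<nu>' \<longrightarrow> (\<forall>f \<in> Cc \<G> \<L>. \<nu>' f \<le> \<nu> f))"

definition src_fibre :: "'g tgroupoid \<Rightarrow> 'g \<Rightarrow> 'g set" where
  "src_fibre \<G> x = {\<gamma> \<in> arrows \<G>. src \<G> \<gamma> = x}"

definition l2_sections :: "'g tgroupoid \<Rightarrow> ('g, 'l) line_bundle \<Rightarrow> 'g \<Rightarrow> ('g \<Rightarrow> 'l) set" where
  "l2_sections \<G> \<L> x =
     {\<xi> \<in> sections_on \<L> (src_fibre \<G> x). (\<lambda>\<gamma>. (bnorm \<L> (\<xi> \<gamma>))\<^sup>2) summable_on src_fibre \<G> x}"

definition l2_norm :: "'g tgroupoid \<Rightarrow> ('g, 'l) line_bundle \<Rightarrow> 'g \<Rightarrow> ('g \<Rightarrow> 'l) \<Rightarrow> real" where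
  "l2_norm \<G> \<L> x \<xi> = sqrt (\<Sum>\<^sub>\<infinity>\<gamma> \<in> src_fibre \<G> x. (bnorm \<L> (\<xi> \<gamma>))\<^sup>2)"

definition regular_rep ::
  "'g tgroupoid \<Rightarrow> ('g, 'l) line_bundle \<Rightarrow> 'g \<Rightarrow> ('g \<Rightarrow> 'l) \<Rightarrow> ('g \<Rightarrow> 'l) \<Rightarrow> 'g \<Rightarrow> 'l" where
  "regular_rep \<G> \<L> x f \<xi> = (\<lambda>\<gamma> \<in> src_fibre \<G> x. conv_at \<G> \<L> f \<xi> \<gamma>)"

definition regular_rep_norm :: "'g tgroupoid \<Rightarrow> ('g, 'l) line_bundle \<Rightarrow> 'g \<Rightarrow> ('g \<Rightarrow> 'l) \<Rightarrow> real" where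
  "regular_rep_norm \<G> \<L> x f =
     Sup {l2_norm \<G> \<L> x (regular_rep \<G> \<L> x f \<xi>) |\<xi>. \<xi> \<in> l2_sections \<G> \<L> x \<and> l2_norm \<G> \<L> x \<xi> \<le> 1}"

text \<open>Inserting 0 only matters for the empty groupoid.\<close>

definition reduced_norm :: "'g tgroupoid \<Rightarrow> ('g, 'l) line_bundle \<Rightarrow> ('g \<Rightarrow> 'l) \<Rightarrow> real" where
  "reduced_norm \<G> \<L> f = Sup (insert 0 ((\<lambda>x. regular_rep_norm \<G> \<L> x f) ` units \<G>))"


section \<open>C*-algebras and completions\<close>

class cstar_algebra = real_normed_algebra + banach +
  fixes cscale :: "complex \<Rightarrow> 'a \<Rightarrow> 'a"
    and cadj :: "'a \<Rightarrow> 'a"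
  assumes cscale_add_right: "cscale c (a + b) = cscale c a + cscale c b"
    and cscale_add_left: "cscale (c + d) a = cscale c a + cscale d a"
    and cscale_cscale: "cscale c (cscale d a) = cscale (c * d) a"
    and cscale_of_real: "cscale (of_real t) a = t *\<^sub>R a"
    and cscale_mult_left: "cscale c a * b = cscale c (a * b)"
    and cscale_mult_right: "a * cscale c b = cscale c (a * b)"
    and norm_cscale: "norm (cscale c a) = cmod c * norm a"
    and cadj_add: "cadj (a + b) = cadj a + cadj b"
    and cadj_cscale: "cadj (cscale c a) = cscale (cnj c) (cadj a)"
    and cadj_mult: "cadj (a * b) = cadj b * cadj a"
    and cadj_cadj: "cadj (cadj a) = a"
    and norm_cadj_mult: "norm (cadj a * a) = (norm a)\<^sup>2"

text \<open>\<open>\<iota>\<close> exhibits the C*-algebra \<open>'b\<close> as the completion of \<open>Cc \<G> \<L>\<close> in the norm \<open>\<nu>\<close>; this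
  determines \<open>'b\<close> up to a unique isomorphism compatible with \<open>\<iota>\<close>.\<close>

definition is_completion ::
  "'g tgroupoid \<Rightarrow> ('g, 'l) line_bundle \<Rightarrow> (('g \<Rightarrow> 'l) \<Rightarrow> real) \<Rightarrow> (('g \<Rightarrow> 'l) \<Rightarrow> 'b::cstar_algebra) \<Rightarrow> bool" where
  "is_completion \<G> \<L> \<nu> \<iota> \<longleftrightarrow>
     (\<forall>f \<in> Cc \<G> \<L>. norm (\<iota> f) = \<nu> f
        \<and> \<iota> (sec_star \<G> \<L> f) = cadj (\<iota> f)
        \<and> (\<forall>c. \<iota> (sec_scale \<G> \<L> c f) = cscale c (\<iota> f)))
     \<and> (\<forall>f \<in> Cc \<G> \<L>. \<forall>g \<in> Cc \<G> \<L>.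
          \<iota> (sec_add \<G> \<L> f g) = \<iota> f + \<iota> g \<and> \<iota> (sec_mult \<G> \<L> f g) = \<iota> f * \<iota> g)
     \<and> closure (\<iota> ` Cc \<G> \<L>) = UNIV"

definition is_full_cstar_algebra ::
  "'g tgroupoid \<Rightarrow> ('g, 'l) line_bundle \<Rightarrow> (('g \<Rightarrow> 'l) \<Rightarrow> 'b::cstar_algebra) \<Rightarrow> bool" where
  "is_full_cstar_algebra \<G> \<L> \<iota> \<longleftrightarrow>
     (\<exists>\<nu>. largest_cstar_norm_on_Cc \<G> \<L> \<nu> \<and> is_completion \<G> \<L> \<nu> \<iota>)"

definition is_reduced_cstar_algebra ::
  "'g tgroupoid \<Rightarrow> ('g, 'l) line_bundle \<Rightarrow> (('g \<Rightarrow> 'l) \<Rightarrow> 'b::cstar_algebra) \<Rightarrow> bool" where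
  "is_reduced_cstar_algebra \<G> \<L> \<iota> \<longleftrightarrow> is_completion \<G> \<L> (reduced_norm \<G> \<L>) \<iota>"

text \<open>The embedding of \<open>C0_on \<G> \<L> U\<close> into the completion, as a relation: \<open>b\<close> is the image of \<open>h\<close>
  if \<open>b\<close> is the limit of \<open>\<iota> (f n)\<close> for some \<open>f n \<in> Cc_on \<G> \<L> U\<close> converging uniformly to \<open>h\<close>.\<close>

definition C0_image ::
  "'g tgroupoid \<Rightarrow> ('g, 'l) line_bundle \<Rightarrow> (('g \<Rightarrow> 'l) \<Rightarrow> 'b::cstar_algebra) \<Rightarrow> 'g set \<Rightarrow> ('g \<Rightarrow> 'l) \<Rightarrow> 'b \<Rightarrow> bool"
  where
  "C0_image \<G> \<L> \<iota> U h b \<longleftrightarrow>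
     h \<in> C0_on \<G> \<L> U
     \<and> (\<exists>f. (\<forall>n::nat. f n \<in> Cc_on \<G> \<L> U)
          \<and> (\<forall>\<epsilon>>0. \<exists>N. \<forall>n\<ge>N. \<forall>\<gamma> \<in> arrows \<G>. bnorm \<L> (bdiff \<L> (f n \<gamma>) (h \<gamma>)) < \<epsilon>)
          \<and> (\<lambda>n. \<iota> (f n)) \<longlonglongrightarrow> b)"

definition groupoid_normalizers ::
  "'g tgroupoid \<Rightarrow> ('g, 'l) line_bundle \<Rightarrow> (('g \<Rightarrow> 'l) \<Rightarrow> 'b::cstar_algebra) \<Rightarrow> 'b set" where
  "groupoid_normalizers \<G> \<L> \<iota> = {b. \<exists>U h. open_bisection \<G> U \<and> C0_image \<G> \<L> \<iota> U h b}"


section \<open>Free points and smooth elements\<close>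

definition states :: "('b::cstar_algebra \<Rightarrow> complex) set" where
  "states = {\<phi>. bounded_linear \<phi> \<and> (\<forall>c b. \<phi> (cscale c b) = c * \<phi> b)
                \<and> (\<forall>b. \<phi> (cadj b * b) \<in> \<real>\<^sub>\<ge>\<^sub>0) \<and> onorm \<phi> = 1}"

text \<open>\<open>C\<^sub>0(X)\<close>, \<open>X\<close> the unit space; values off \<open>X\<close> are irrelevant.\<close>

definition C0_units :: "'g tgroupoid \<Rightarrow> ('g \<Rightarrow> complex) set" where
  "C0_units \<G> = {a. continuous_map (unit_top \<G>) euclidean a
                   \<and> (\<forall>\<epsilon>>0. compactin (unit_top \<G>) {x \<in> units \<G>. \<epsilon> \<le> cmod (a x)})}"

definition unit_section ::
  "'g tgroupoid \<Rightarrow> ('g, 'l) line_bundle \<Rightarrow> ('g \<Rightarrow> complex) \<Rightarrow> 'g \<Rightarrow> 'l" where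
  "unit_section \<G> \<L> a =
     (\<lambda>\<gamma> \<in> arrows \<G>. if \<gamma> \<in> units \<G> then bscale \<L> (a \<gamma>) (bunit \<L> \<gamma>) else bzero \<L> \<gamma>)"

definition states_extending_eval ::
  "'g tgroupoid \<Rightarrow> ('g, 'l) line_bundle \<Rightarrow> (('g \<Rightarrow> 'l) \<Rightarrow> 'b::cstar_algebra) \<Rightarrow> 'g \<Rightarrow> ('b \<Rightarrow> complex) set" where
  "states_extending_eval \<G> \<L> \<iota> x =
     {\<phi> \<in> states. \<forall>a \<in> C0_units \<G>. \<forall>b.
        C0_image \<G> \<L> \<iota> (units \<G>) (unit_section \<G> \<L> a) b \<longrightarrow> \<phi> b = a x}"

definition free_points ::
  "'g tgroupoid \<Rightarrow> ('g, 'l) line_bundle \<Rightarrow> (('g \<Rightarrow> 'l) \<Rightarrow> 'b::cstar_algebra) \<Rightarrow> 'b \<Rightarrow> 'g set" where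
  "free_points \<G> \<L> \<iota> b =
     {x \<in> units \<G>. \<forall>\<phi> \<in> states_extending_eval \<G> \<L> \<iota> x. \<forall>\<psi> \<in> states_extending_eval \<G> \<L> \<iota> x. \<phi> b = \<psi> b}"

definition smooth_element ::
  "'g tgroupoid \<Rightarrow> ('g, 'l) line_bundle \<Rightarrow> (('g \<Rightarrow> 'l) \<Rightarrow> 'b::cstar_algebra) \<Rightarrow> 'b \<Rightarrow> bool" where
  "smooth_element \<G> \<L> \<iota> b \<longleftrightarrow>
     unit_top \<G> closure_of (unit_top \<G> interior_of free_points \<G> \<L> \<iota> b) = units \<G>"

end

theory Submission
  imports Defs
begin

text \<open>
  Everything rests on the states of the completion that extend the evaluation at a unit \<open>x\<close>, and on
  their values on sections compactly supported in an open bisection \<open>U\<close>.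

  If the nontrivial isotropy contains a nonempty open set, then the range of this set is open in the
  unit space and consists of points with nontrivial isotropy, which contradicts topological freeness.

  A state extending the evaluation at \<open>x\<close> satisfies \<open>\<phi>(f a) = a(x) \<phi>(f) = \<phi>(a f)\<close> for functions \<open>a\<close> on
  the unit space, by the Cauchy-Schwarz inequality (\<open>extending_eval_module\<close>). Cutting \<open>f\<close> down by
  functions \<open>a\<close> concentrated near \<open>x\<close>, one finds that \<open>\<phi>(f)\<close> is 0 if \<open>U\<close> has no arrow with range \<open>x\<close>, or
  if this arrow has a source different from \<open>x\<close>, and that \<open>\<phi>(f)\<close> is the value of \<open>f\<close> at \<open>x\<close> if the arrow
  is the unit \<open>x\<close>. So only the ranges of nontrivial isotropy arrows of \<open>U\<close> can fail to be free for a
  normalizer supported in \<open>U\<close>. The nontrivial isotropy is closed; if it has empty interior, then these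
  ranges form a nowhere dense set, and the normalizer is smooth.

  Conversely let \<open>\<gamma>\<close> be a nontrivial isotropy arrow at \<open>x\<close> and let \<open>f\<close> be nonzero at \<open>\<gamma>\<close>. In the regular
  representation over the source fibre of \<open>x\<close>, the unit vectors proportional to \<open>\<delta>\<^sub>x + c \<delta>\<^sub>\<gamma>\<close>, \<open>c\<close> in
  the circle, define states extending the evaluation at \<open>x\<close>, whose values at \<open>f\<close> depend on \<open>c\<close>
  (\<open>not_free_at_isotropy\<close>). So \<open>x\<close> is not free for \<open>f\<close>. In the second countable case countably many such
  sections detect all nontrivial isotropy arrows, and the Baire property of the unit space gives a
  dense set of points with trivial isotropy.

  Three ingredients are needed for the converse. Sections that are nonzero at a given arrow exist
  because an averaging argument over the circle yields continuous local sections of the bundle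
  (\<open>local_section\<close>). The vector states are bounded for the norm at hand because the regular
  representations define C*-seminorms, which are dominated by the largest C*-norm and by the reduced
  norm (\<open>rep_norm_le_largest\<close>, \<open>rep_norm_le_reduced\<close>); here unit vectors in the fibres turn sections
  into complex functions and the multiplication of the bundle into a 2-cocycle. They have norm 1
  because functions with values between 0 and 1 have norm at most 1 in every C*-norm
  (\<open>norm_bump_le_1\<close>).
\<close>

section \<open>Groupoid algebra\<close>

context topological_groupoid
begin

lemma units_subset_arrows: "units \<G> \<subseteq> arrows \<G>"
  using rng_closed by (auto simp: units_def)

lemma units_arrows: "x \<in> units \<G> \<Longrightarrow> x \<in> arrows \<G>"
  using units_subset_arrows by auto

lemma unit_rng: "x \<in> units \<G> \<Longrightarrow> rng \<G> x = x"
  using rng_rng by (auto simp: units_def)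

lemma unit_src: "x \<in> units \<G> \<Longrightarrow> src \<G> x = x"
  using src_rng by (auto simp: units_def)

lemma rng_in_units: "\<gamma> \<in> arrows \<G> \<Longrightarrow> rng \<G> \<gamma> \<in> units \<G>"
  by (auto simp: units_def)

lemma src_in_units: "\<gamma> \<in> arrows \<G> \<Longrightarrow> src \<G> \<gamma> \<in> units \<G>"
  using rng_inv inv_closed by (force simp: units_def)

lemma unit_iff_rng: "\<gamma> \<in> arrows \<G> \<Longrightarrow> \<gamma> \<in> units \<G> \<longleftrightarrow> rng \<G> \<gamma> = \<gamma>"
  using unit_rng rng_in_units by metis

lemma composableI:
  "\<lbrakk>\<gamma> \<in> arrows \<G>; \<delta> \<in> arrows \<G>; src \<G> \<gamma> = rng \<G> \<delta>\<rbrakk> \<Longrightarrow> (\<gamma>, \<delta>) \<in> composable \<G>"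
  by (simp add: composable_def)

lemma composableD:
  assumes "(\<gamma>, \<delta>) \<in> composable \<G>"
  shows "\<gamma> \<in> arrows \<G>" "\<delta> \<in> arrows \<G>" "src \<G> \<gamma> = rng \<G> \<delta>"
  using assms by (auto simp: composable_def)

lemma inv_mul_cancel:
  assumes "(\<alpha>, \<beta>) \<in> composable \<G>"
  shows "gmul \<G> (ginv \<G> \<alpha>) (gmul \<G> \<alpha> \<beta>) = \<beta>"
proof -
  note c = composableD[OF assms]
  have "gmul \<G> (gmul \<G> (ginv \<G> \<alpha>) \<alpha>) \<beta> = gmul \<G> (ginv \<G> \<alpha>) (gmul \<G> \<alpha> \<beta>)"
    using c assms by (intro mul_assoc composableI) (auto simp: inv_closed src_inv)
  then show ?thesis using c by (simp add: inv_mul mul_rng)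
qed

lemma mul_inv_cancel:
  assumes "\<alpha> \<in> arrows \<G>" "\<gamma> \<in> arrows \<G>" "rng \<G> \<alpha> = rng \<G> \<gamma>"
  shows "gmul \<G> \<alpha> (gmul \<G> (ginv \<G> \<alpha>) \<gamma>) = \<gamma>"
proof -
  have "gmul \<G> (gmul \<G> \<alpha> (ginv \<G> \<alpha>)) \<gamma> = gmul \<G> \<alpha> (gmul \<G> (ginv \<G> \<alpha>) \<gamma>)"
    using assms by (intro mul_assoc composableI) (auto simp: inv_closed src_inv rng_inv)
  then show ?thesis using assms by (simp add: mul_inv mul_rng)
qed

lemma mul_cancel_right:
  assumes "(\<alpha>, \<beta>) \<in> composable \<G>"
  shows "gmul \<G> (gmul \<G> \<alpha> \<beta>) (ginv \<G> \<beta>) = \<alpha>"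
proof -
  note c = composableD[OF assms]
  have "gmul \<G> (gmul \<G> \<alpha> \<beta>) (ginv \<G> \<beta>) = gmul \<G> \<alpha> (gmul \<G> \<beta> (ginv \<G> \<beta>))"
    using c assms by (intro mul_assoc composableI) (auto simp: inv_closed rng_inv)
  then show ?thesis using c mul_src[OF c(1)] by (simp add: mul_inv)
qed

lemma mul_inv_cancel_right:
  assumes "\<gamma> \<in> arrows \<G>" "\<beta> \<in> arrows \<G>" "src \<G> \<gamma> = src \<G> \<beta>"
  shows "gmul \<G> (gmul \<G> \<gamma> (ginv \<G> \<beta>)) \<beta> = \<gamma>"
proof -
  have "gmul \<G> (gmul \<G> \<gamma> (ginv \<G> \<beta>)) \<beta> = gmul \<G> \<gamma> (gmul \<G> (ginv \<G> \<beta>) \<beta>)"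
    using assms by (intro mul_assoc composableI) (auto simp: inv_closed src_inv rng_inv)
  then show ?thesis using assms mul_src[OF assms(1)] by (simp add: inv_mul)
qed

lemma inv_inv: "\<gamma> \<in> arrows \<G> \<Longrightarrow> ginv \<G> (ginv \<G> \<gamma>) = \<gamma>"
  using mul_inv_cancel_right[of "ginv \<G> (ginv \<G> \<gamma>)" \<gamma>] inv_mul[of "ginv \<G> \<gamma>"] mul_rng[of \<gamma>]
  by (simp add: inv_closed src_inv rng_inv)

lemma inv_unit: "x \<in> units \<G> \<Longrightarrow> ginv \<G> x = x"
  using mul_inv[of x] mul_rng[of "ginv \<G> x"]
  by (simp add: units_arrows inv_closed rng_inv unit_src unit_rng)

lemma inv_gmul:
  assumes "(\<alpha>, \<beta>) \<in> composable \<G>"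
  shows "ginv \<G> (gmul \<G> \<alpha> \<beta>) = gmul \<G> (ginv \<G> \<beta>) (ginv \<G> \<alpha>)"
proof -
  note c = composableD[OF assms]
  let ?c = "gmul \<G> (ginv \<G> \<beta>) (ginv \<G> \<alpha>)"
  have comp: "(ginv \<G> \<beta>, ginv \<G> \<alpha>) \<in> composable \<G>"
    using c by (intro composableI) (auto simp: inv_closed src_inv rng_inv)
  have "gmul \<G> (gmul \<G> ?c \<alpha>) \<beta> = gmul \<G> ?c (gmul \<G> \<alpha> \<beta>)"
    using c comp assms by (intro mul_assoc composableI) (auto simp: mul_closed src_mul src_inv inv_closed)
  moreover have "gmul \<G> ?c \<alpha> = ginv \<G> \<beta>"
    using mul_cancel_right[OF comp] c by (simp add: inv_inv)
  ultimately have "gmul \<G> ?c (gmul \<G> \<alpha> \<beta>) = src \<G> \<beta>"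
    using c by (simp add: inv_mul)
  moreover have "gmul \<G> (gmul \<G> ?c (gmul \<G> \<alpha> \<beta>)) (ginv \<G> (gmul \<G> \<alpha> \<beta>)) = ?c"
    using c comp assms by (intro mul_cancel_right composableI) (auto simp: mul_closed src_mul rng_mul src_inv)
  ultimately have e: "gmul \<G> (src \<G> \<beta>) (ginv \<G> (gmul \<G> \<alpha> \<beta>)) = ?c"
    by simp
  have "rng \<G> (ginv \<G> (gmul \<G> \<alpha> \<beta>)) = src \<G> \<beta>"
    using assms by (simp add: mul_closed rng_inv src_mul)
  then show ?thesis
    using e mul_rng[OF inv_closed[OF mul_closed[OF assms]]] by simp
qed

section \<open>Open bisections\<close>

lemma topspace_gtop [simp]: "topspace (gtop \<G>) = arrows \<G>"
  by (simp add: arrows_def)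

lemma topspace_unit_top [simp]: "topspace (unit_top \<G>) = units \<G>"
  using units_subset_arrows by (auto simp: unit_top_def)

lemma continuous_map_gmul:
  assumes "continuous_map Y (gtop \<G>) f" "continuous_map Y (gtop \<G>) g"
    and "\<And>y. y \<in> topspace Y \<Longrightarrow> src \<G> (f y) = rng \<G> (g y)"
  shows "continuous_map Y (gtop \<G>) (\<lambda>y. gmul \<G> (f y) (g y))"
proof -
  have "continuous_map Y (subtopology (prod_topology (gtop \<G>) (gtop \<G>)) (composable \<G>))
          (\<lambda>y. (f y, g y))"
    using assms continuous_map_image_subset_topspace[OF assms(1)]
      continuous_map_image_subset_topspace[OF assms(2)]
    by (auto simp: continuous_map_in_subtopology continuous_map_pairedI composable_def)
  from continuous_map_compose[OF this continuous_mul] show ?thesis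
    by (simp add: o_def)
qed

lemma continuous_rng: "continuous_map (gtop \<G>) (gtop \<G>) (rng \<G>)"
proof -
  have "continuous_map (gtop \<G>) (gtop \<G>) (\<lambda>\<gamma>. gmul \<G> \<gamma> (ginv \<G> \<gamma>))"
    by (rule continuous_map_gmul) (auto simp: continuous_inv rng_inv continuous_map_id[unfolded id_def])
  then show ?thesis
    by (rule continuous_map_eq) (simp add: mul_inv)
qed

lemma continuous_src: "continuous_map (gtop \<G>) (gtop \<G>) (src \<G>)"
  using continuous_map_compose[OF continuous_inv continuous_rng]
  by (rule continuous_map_eq) (simp add: rng_inv)

lemma continuous_rng_unit_top: "continuous_map (gtop \<G>) (unit_top \<G>) (rng \<G>)"
  by (auto simp: unit_top_def continuous_map_in_subtopology continuous_rng rng_in_units)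

lemma continuous_src_unit_top: "continuous_map (gtop \<G>) (unit_top \<G>) (src \<G>)"
  by (auto simp: unit_top_def continuous_map_in_subtopology continuous_src src_in_units)

lemma openin_rng_vimage: "openin (unit_top \<G>) V \<Longrightarrow> openin (gtop \<G>) {\<gamma> \<in> arrows \<G>. rng \<G> \<gamma> \<in> V}"
  using openin_continuous_map_preimage[OF continuous_rng_unit_top] by simp

lemma openin_src_vimage: "openin (unit_top \<G>) V \<Longrightarrow> openin (gtop \<G>) {\<gamma> \<in> arrows \<G>. src \<G> \<gamma> \<in> V}"
  using openin_continuous_map_preimage[OF continuous_src_unit_top] by simp

lemma openin_inv_image: "openin (gtop \<G>) U \<Longrightarrow> openin (gtop \<G>) (ginv \<G> ` U)"
proof -
  assume U: "openin (gtop \<G>) U"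
  have "ginv \<G> ` U = {\<gamma> \<in> arrows \<G>. ginv \<G> \<gamma> \<in> U}"
    using openin_subset[OF U] inv_inv inv_closed by force
  with openin_continuous_map_preimage[OF continuous_inv U] show ?thesis by simp
qed

lemma open_bisectionD:
  assumes "open_bisection \<G> U"
  shows "openin (gtop \<G>) U" "inj_on (rng \<G>) U" "inj_on (src \<G>) U" "U \<subseteq> arrows \<G>"
  using assms openin_subset by (fastforce simp: open_bisection_def)+

lemma open_bisection_subset:
  "\<lbrakk>open_bisection \<G> U; openin (gtop \<G>) V; V \<subseteq> U\<rbrakk> \<Longrightarrow> open_bisection \<G> V"
  unfolding open_bisection_def using inj_on_subset by metis

lemma open_bisection_inv:
  assumes "open_bisection \<G> U" shows "open_bisection \<G> (ginv \<G> ` U)"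
proof -
  note U = open_bisectionD[OF assms]
  have "inj_on (rng \<G>) (ginv \<G> ` U)" "inj_on (src \<G>) (ginv \<G> ` U)"
    using U(2-4) by (auto simp: inj_on_def rng_inv src_inv subset_iff)
  with U show ?thesis by (simp add: open_bisection_def openin_inv_image)
qed

end

context etale_groupoid
begin

text \<open>Where the range map is injective near a unit \<open>x\<close>, an arrow \<open>\<gamma>\<close> close to \<open>x\<close> has the same
  range as the nearby arrow \<open>rng \<G> \<gamma>\<close>, so they coincide.\<close>

lemma units_open: "openin (gtop \<G>) (units \<G>)"
proof (subst openin_subopen, intro ballI)
  fix x assume x: "x \<in> units \<G>"
  then obtain U where U: "openin (gtop \<G>) U" "x \<in> U"
      "homeomorphic_map (subtopology (gtop \<G>) U) (subtopology (unit_top \<G>) (rng \<G> ` U)) (rng \<G>)"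
    using rng_local_homeomorphism[OF units_arrows[OF x]] by blast
  have inj: "inj_on (rng \<G>) U"
    using homeomorphic_imp_injective_map[OF U(3)] openin_subset[OF U(1)] by (simp add: Int_absorb1)
  let ?V = "{\<gamma> \<in> U. rng \<G> \<gamma> \<in> U}"
  have "openin (gtop \<G>) (U \<inter> {\<gamma> \<in> topspace (gtop \<G>). rng \<G> \<gamma> \<in> U})"
    using openin_continuous_map_preimage[OF continuous_rng U(1)] U(1) by blast
  moreover have "U \<inter> {\<gamma> \<in> topspace (gtop \<G>). rng \<G> \<gamma> \<in> U} = ?V"
    using openin_subset[OF U(1)] by auto
  moreover have "?V \<subseteq> units \<G>"
  proof
    fix \<gamma> assume g: "\<gamma> \<in> ?V"
    then have "\<gamma> \<in> arrows \<G>" using openin_subset[OF U(1)] by auto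
    moreover have "rng \<G> \<gamma> = \<gamma>"
      using inj g calculation by (auto simp: inj_on_def rng_rng)
    ultimately show "\<gamma> \<in> units \<G>" by (simp add: unit_iff_rng)
  qed
  ultimately show "\<exists>T. openin (gtop \<G>) T \<and> x \<in> T \<and> T \<subseteq> units \<G>"
    using x U(2) unit_rng by (intro exI[of _ ?V]) auto
qed

lemma openin_unit_top_iff: "openin (unit_top \<G>) V \<longleftrightarrow> openin (gtop \<G>) V \<and> V \<subseteq> units \<G>"
  unfolding unit_top_def using openin_open_subtopology[OF units_open] by auto

lemma openin_rng_image:
  assumes "openin (gtop \<G>) W" shows "openin (unit_top \<G>) (rng \<G> ` W)"
proof (subst openin_subopen, intro ballI)
  fix x assume "x \<in> rng \<G> ` W"
  then obtain \<gamma> where \<gamma>: "\<gamma> \<in> W" "x = rng \<G> \<gamma>" by auto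
  then have "\<gamma> \<in> arrows \<G>" using openin_subset[OF assms] by auto
  then obtain U where U: "openin (gtop \<G>) U" "\<gamma> \<in> U" "openin (unit_top \<G>) (rng \<G> ` U)"
      "homeomorphic_map (subtopology (gtop \<G>) U) (subtopology (unit_top \<G>) (rng \<G> ` U)) (rng \<G>)"
    using rng_local_homeomorphism by blast
  have "openin (subtopology (gtop \<G>) U) (U \<inter> W)"
    using assms by (simp add: openin_subtopology_Int2)
  then have "openin (subtopology (unit_top \<G>) (rng \<G> ` U)) (rng \<G> ` (U \<inter> W))"
    using homeomorphic_imp_open_map[OF U(4)] by (simp add: open_map_def)
  then have "openin (unit_top \<G>) (rng \<G> ` (U \<inter> W))"
    using U(3) openin_trans_full by blast
  then show "\<exists>T. openin (unit_top \<G>) T \<and> x \<in> T \<and> T \<subseteq> rng \<G> ` W"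
    using \<gamma> U(2) by (intro exI[of _ "rng \<G> ` (U \<inter> W)"]) auto
qed

lemma open_bisection_units: "open_bisection \<G> (units \<G>)"
  by (auto simp: open_bisection_def units_open inj_on_def unit_rng unit_src)

lemma open_bisection_basis:
  assumes "openin (gtop \<G>) W" "\<gamma> \<in> W"
  obtains U where "open_bisection \<G> U" "\<gamma> \<in> U" "U \<subseteq> W"
proof -
  have g: "\<gamma> \<in> arrows \<G>" "ginv \<G> \<gamma> \<in> arrows \<G>"
    using assms openin_subset[OF assms(1)] inv_closed by auto
  have *: "\<exists>U. openin (gtop \<G>) U \<and> \<delta> \<in> U \<and> inj_on (rng \<G>) U" if "\<delta> \<in> arrows \<G>" for \<delta>
  proof -
    obtain U where U: "openin (gtop \<G>) U" "\<delta> \<in> U"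
      "homeomorphic_map (subtopology (gtop \<G>) U) (subtopology (unit_top \<G>) (rng \<G> ` U)) (rng \<G>)"
      using rng_local_homeomorphism[OF \<open>\<delta> \<in> arrows \<G>\<close>] by blast
    have "inj_on (rng \<G>) U"
      using homeomorphic_imp_injective_map[OF U(3)] openin_subset[OF U(1)] by (simp add: Int_absorb1)
    with U show ?thesis by blast
  qed
  obtain U where U: "openin (gtop \<G>) U" "\<gamma> \<in> U" "inj_on (rng \<G>) U" using *[OF g(1)] by blast
  obtain V where V: "openin (gtop \<G>) V" "ginv \<G> \<gamma> \<in> V" "inj_on (rng \<G>) V" using *[OF g(2)] by blast
  let ?B = "U \<inter> ginv \<G> ` V \<inter> W"
  have "inj_on (src \<G>) (ginv \<G> ` V)"
    using V(3) openin_subset[OF V(1)] by (auto simp: inj_on_def src_inv subset_iff)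
  then have "open_bisection \<G> ?B"
    unfolding open_bisection_def using U V assms openin_inv_image[OF V(1)]
    by (auto intro: inj_on_subset)
  moreover have "\<gamma> \<in> ?B" using U V assms g inv_inv by force
  ultimately show thesis using that by blast
qed

lemma arrow_in_bisection:
  assumes "\<gamma> \<in> arrows \<G>" obtains U where "open_bisection \<G> U" "\<gamma> \<in> U"
  using open_bisection_basis[of "arrows \<G>" \<gamma>] assms topspace_gtop openin_topspace by metis

lemma bisection_homeomorphic:
  assumes "open_bisection \<G> U"
  shows "homeomorphic_map (subtopology (gtop \<G>) U) (subtopology (unit_top \<G>) (rng \<G> ` U)) (rng \<G>)"
proof (rule bijective_open_imp_homeomorphic_map)
  note U = open_bisectionD[OF assms]
  have rU: "openin (unit_top \<G>) (rng \<G> ` U)" by (rule openin_rng_image[OF U(1)])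
  show "continuous_map (subtopology (gtop \<G>) U) (subtopology (unit_top \<G>) (rng \<G> ` U)) (rng \<G>)"
    by (auto simp: continuous_map_in_subtopology continuous_rng_unit_top continuous_map_from_subtopology)
  show "open_map (subtopology (gtop \<G>) U) (subtopology (unit_top \<G>) (rng \<G> ` U)) (rng \<G>)"
    unfolding open_map_def openin_open_subtopology[OF U(1)] openin_open_subtopology[OF rU]
    using openin_rng_image by blast
  show "rng \<G> ` topspace (subtopology (gtop \<G>) U) = topspace (subtopology (unit_top \<G>) (rng \<G> ` U))"
    using U(4) openin_subset[OF rU] by (auto simp: subset_iff)
  show "inj_on (rng \<G>) (topspace (subtopology (gtop \<G>) U))"
    using U by (auto intro: inj_on_subset)
qed

text \<open>The range map restricts to a homeomorphism of \<open>U\<close> onto an open set of units, and \<open>lift U\<close> is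
  the inverse of this restriction composed with the range map, a retraction onto \<open>U\<close>. Only its
  values at arrows whose range lies in the range of \<open>U\<close> have a meaning.\<close>

definition lift :: "'a set \<Rightarrow> 'a \<Rightarrow> 'a" where
  "lift U \<gamma> = inv_into U (rng \<G>) (rng \<G> \<gamma>)"

lemma lift:
  assumes "\<alpha> \<in> U" "rng \<G> \<alpha> = rng \<G> \<gamma>"
  shows "lift U \<gamma> \<in> U" "rng \<G> (lift U \<gamma>) = rng \<G> \<gamma>"
proof -
  have "rng \<G> \<gamma> \<in> rng \<G> ` U" using assms by (metis imageI)
  then show "lift U \<gamma> \<in> U" "rng \<G> (lift U \<gamma>) = rng \<G> \<gamma>"
    unfolding lift_def by (rule inv_into_into, rule f_inv_into_f)
qed

lemma lift_eq:
  assumes "open_bisection \<G> U" "\<alpha> \<in> U" "rng \<G> \<alpha> = rng \<G> \<gamma>"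
  shows "lift U \<gamma> = \<alpha>"
  using lift[OF assms(2,3)] open_bisectionD(2)[OF assms(1)] assms(2,3) by (auto simp: inj_on_def)

lemma continuous_lift:
  assumes "open_bisection \<G> U"
  shows "continuous_map (subtopology (gtop \<G>) {\<gamma> \<in> arrows \<G>. rng \<G> \<gamma> \<in> rng \<G> ` U}) (gtop \<G>) (lift U)"
proof -
  note U = open_bisectionD[OF assms]
  obtain g where g: "homeomorphic_maps (subtopology (gtop \<G>) U) (subtopology (unit_top \<G>) (rng \<G> ` U)) (rng \<G>) g"
    using bisection_homeomorphic[OF assms] homeomorphic_map_maps by blast
  let ?Y = "subtopology (gtop \<G>) {\<gamma> \<in> arrows \<G>. rng \<G> \<gamma> \<in> rng \<G> ` U}"
  have "continuous_map ?Y (subtopology (unit_top \<G>) (rng \<G> ` U)) (rng \<G>)"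
    by (auto simp: continuous_map_in_subtopology continuous_rng_unit_top continuous_map_from_subtopology)
  moreover have "continuous_map (subtopology (unit_top \<G>) (rng \<G> ` U)) (gtop \<G>) g"
    using g by (auto simp: homeomorphic_maps_def continuous_map_in_subtopology)
  ultimately have "continuous_map ?Y (gtop \<G>) (g \<circ> rng \<G>)"
    by (rule continuous_map_compose)
  then show ?thesis
  proof (rule continuous_map_eq)
    fix \<gamma> assume "\<gamma> \<in> topspace ?Y"
    then obtain \<alpha> where a: "\<alpha> \<in> U" "rng \<G> \<alpha> = rng \<G> \<gamma>" by force
    have "g (rng \<G> \<alpha>) = \<alpha>" using g U(4) a(1) by (auto simp: homeomorphic_maps_def)
    then show "(g \<circ> rng \<G>) \<gamma> = lift U \<gamma>" using lift_eq[OF assms a] a by simp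
  qed
qed

definition product_set :: "'a set \<Rightarrow> 'a set \<Rightarrow> 'a set" where
  "product_set U V = {gmul \<G> \<alpha> \<beta> |\<alpha> \<beta>. \<alpha> \<in> U \<and> \<beta> \<in> V \<and> src \<G> \<alpha> = rng \<G> \<beta>}"

text \<open>The condition that \<open>\<gamma>\<close> has a left factor in \<open>U\<close> and a right factor in \<open>V\<close> is open because
  the left factor can only be \<open>lift U \<gamma>\<close>, which is continuous in \<open>\<gamma>\<close>.\<close>

lemma open_bisection_product:
  assumes "open_bisection \<G> U" "open_bisection \<G> V"
  shows "open_bisection \<G> (product_set U V)"
proof -
  note U = open_bisectionD[OF assms(1)] and V = open_bisectionD[OF assms(2)]
  define D where "D = {\<gamma> \<in> arrows \<G>. rng \<G> \<gamma> \<in> rng \<G> ` U}"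
  have D: "openin (gtop \<G>) D"
    unfolding D_def using openin_rng_vimage[OF openin_rng_image[OF U(1)]] .
  have DU: "lift U \<gamma> \<in> U" "rng \<G> (lift U \<gamma>) = rng \<G> \<gamma>" if "\<gamma> \<in> D" for \<gamma>
    using lift[of _ U \<gamma>] that by (force simp: D_def)+
  have "continuous_map (subtopology (gtop \<G>) D) (gtop \<G>) (\<lambda>\<gamma>. gmul \<G> (ginv \<G> (lift U \<gamma>)) \<gamma>)"
  proof (rule continuous_map_gmul)
    show "continuous_map (subtopology (gtop \<G>) D) (gtop \<G>) (\<lambda>\<gamma>. ginv \<G> (lift U \<gamma>))"
      using continuous_map_compose[OF continuous_lift[OF assms(1)] continuous_inv]
      by (simp add: o_def D_def)
    show "continuous_map (subtopology (gtop \<G>) D) (gtop \<G>) (\<lambda>\<gamma>. \<gamma>)"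
      by (simp add: continuous_map_from_subtopology continuous_map_id[unfolded id_def])
    show "src \<G> (ginv \<G> (lift U y)) = rng \<G> y" if "y \<in> topspace (subtopology (gtop \<G>) D)" for y
      using that DU U(4) by (auto simp: src_inv subset_iff)
  qed
  from openin_continuous_map_preimage[OF this V(1)]
  have "openin (gtop \<G>) {\<gamma> \<in> topspace (subtopology (gtop \<G>) D). gmul \<G> (ginv \<G> (lift U \<gamma>)) \<gamma> \<in> V}"
    using openin_trans_full[OF _ D] by blast
  moreover have "{\<gamma> \<in> topspace (subtopology (gtop \<G>) D). gmul \<G> (ginv \<G> (lift U \<gamma>)) \<gamma> \<in> V} = product_set U V"
  proof (intro equalityI subsetI)
    fix \<gamma> assume "\<gamma> \<in> {\<gamma> \<in> topspace (subtopology (gtop \<G>) D). gmul \<G> (ginv \<G> (lift U \<gamma>)) \<gamma> \<in> V}"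
    then have g: "\<gamma> \<in> arrows \<G>" "\<gamma> \<in> D" "gmul \<G> (ginv \<G> (lift U \<gamma>)) \<gamma> \<in> V" by auto
    have l: "lift U \<gamma> \<in> arrows \<G>" using DU g U(4) by auto
    have c: "(ginv \<G> (lift U \<gamma>), \<gamma>) \<in> composable \<G>"
      using l g DU by (intro composableI) (auto simp: inv_closed src_inv)
    have "\<gamma> = gmul \<G> (lift U \<gamma>) (gmul \<G> (ginv \<G> (lift U \<gamma>)) \<gamma>)"
      using mul_inv_cancel[OF l g(1)] DU g by simp
    moreover have "src \<G> (lift U \<gamma>) = rng \<G> (gmul \<G> (ginv \<G> (lift U \<gamma>)) \<gamma>)"
      using rng_mul[OF c] l by (simp add: rng_inv)
    ultimately show "\<gamma> \<in> product_set U V" unfolding product_set_def using DU(1)[OF g(2)] g(3) by blast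
  next
    fix \<gamma> assume "\<gamma> \<in> product_set U V"
    then obtain \<alpha> \<beta> where ab: "\<gamma> = gmul \<G> \<alpha> \<beta>" "\<alpha> \<in> U" "\<beta> \<in> V" "src \<G> \<alpha> = rng \<G> \<beta>"
      by (auto simp: product_set_def)
    then have c: "(\<alpha>, \<beta>) \<in> composable \<G>" using U V by (auto intro: composableI)
    have r: "rng \<G> \<alpha> = rng \<G> \<gamma>" using rng_mul[OF c] ab by simp
    have l: "lift U \<gamma> = \<alpha>" using lift_eq[OF assms(1) ab(2) r] .
    have "rng \<G> \<gamma> \<in> rng \<G> ` U" using imageI[OF ab(2), of "rng \<G>"] r by simp
    moreover have "\<gamma> \<in> arrows \<G>" "gmul \<G> (ginv \<G> (lift U \<gamma>)) \<gamma> \<in> V"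
      using ab mul_closed[OF c] inv_mul_cancel[OF c] l by simp_all
    ultimately show "\<gamma> \<in> {\<gamma> \<in> topspace (subtopology (gtop \<G>) D). gmul \<G> (ginv \<G> (lift U \<gamma>)) \<gamma> \<in> V}"
      by (simp add: D_def)
  qed
  moreover have "inj_on (rng \<G>) (product_set U V)" "inj_on (src \<G>) (product_set U V)"
  proof -
    have eq: "\<alpha> = \<alpha>' \<and> \<beta> = \<beta>'"
      if "\<alpha> \<in> U" "\<beta> \<in> V" "src \<G> \<alpha> = rng \<G> \<beta>" "\<alpha>' \<in> U" "\<beta>' \<in> V" "src \<G> \<alpha>' = rng \<G> \<beta>'"
        "rng \<G> \<alpha> = rng \<G> \<alpha>' \<or> src \<G> \<beta> = src \<G> \<beta>'" for \<alpha> \<alpha>' \<beta> \<beta>'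
      using that U(2,3) V(2,3) by (metis inj_onD)
    show "inj_on (rng \<G>) (product_set U V)"
    proof (rule inj_onI)
      fix g h assume "g \<in> product_set U V" "h \<in> product_set U V" and e: "rng \<G> g = rng \<G> h"
      then obtain \<alpha> \<beta> \<alpha>' \<beta>' where ab: "g = gmul \<G> \<alpha> \<beta>" "\<alpha> \<in> U" "\<beta> \<in> V" "src \<G> \<alpha> = rng \<G> \<beta>"
        and ab': "h = gmul \<G> \<alpha>' \<beta>'" "\<alpha>' \<in> U" "\<beta>' \<in> V" "src \<G> \<alpha>' = rng \<G> \<beta>'"
        by (auto simp: product_set_def)
      have "(\<alpha>, \<beta>) \<in> composable \<G>" "(\<alpha>', \<beta>') \<in> composable \<G>"
        using ab ab' U V by (auto intro: composableI)
      then have "rng \<G> \<alpha> = rng \<G> \<alpha>'" using e ab ab' rng_mul by metis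
      then show "g = h" using eq[of \<alpha> \<beta> \<alpha>' \<beta>'] ab ab' by blast
    qed
    show "inj_on (src \<G>) (product_set U V)"
    proof (rule inj_onI)
      fix g h assume "g \<in> product_set U V" "h \<in> product_set U V" and e: "src \<G> g = src \<G> h"
      then obtain \<alpha> \<beta> \<alpha>' \<beta>' where ab: "g = gmul \<G> \<alpha> \<beta>" "\<alpha> \<in> U" "\<beta> \<in> V" "src \<G> \<alpha> = rng \<G> \<beta>"
        and ab': "h = gmul \<G> \<alpha>' \<beta>'" "\<alpha>' \<in> U" "\<beta>' \<in> V" "src \<G> \<alpha>' = rng \<G> \<beta>'"
        by (auto simp: product_set_def)
      have "(\<alpha>, \<beta>) \<in> composable \<G>" "(\<alpha>', \<beta>') \<in> composable \<G>"
        using ab ab' U V by (auto intro: composableI)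
      then have "src \<G> \<beta> = src \<G> \<beta>'" using e ab ab' src_mul by metis
      then show "g = h" using eq[of \<alpha> \<beta> \<alpha>' \<beta>'] ab ab' by blast
    qed
  qed
  ultimately show ?thesis by (simp add: open_bisection_def)
qed

lemma bisection_Hausdorff:
  assumes "open_bisection \<G> U" shows "Hausdorff_space (subtopology (gtop \<G>) U)"
proof -
  have "Hausdorff_space (subtopology (unit_top \<G>) (rng \<G> ` U))"
    using unit_Hausdorff Hausdorff_space_subtopology by blast
  moreover have "subtopology (gtop \<G>) U homeomorphic_space subtopology (unit_top \<G>) (rng \<G> ` U)"
    using bisection_homeomorphic[OF assms] homeomorphic_map_imp_homeomorphic_space by blast
  ultimately show ?thesis using homeomorphic_Hausdorff_space by blast
qed

lemma unit_regular: "regular_space (unit_top \<G>)"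
  using locally_compact_Hausdorff_imp_regular_space unit_locally_compact unit_Hausdorff by blast

text \<open>Compact neighbourhoods of the points of \<open>K\<close> inside \<open>V\<close> give an open set with compact closure
  between \<open>K\<close> and \<open>V\<close>; Urysohn's lemma for \<open>K\<close> and the complement of this open set yields a function of
  compact support.\<close>

lemma bump_function:
  assumes "compactin (unit_top \<G>) K" "openin (unit_top \<G>) V" "K \<subseteq> V"
  obtains a :: "'a \<Rightarrow> real" and C where
    "continuous_map (unit_top \<G>) euclideanreal a" "\<And>x. x \<in> units \<G> \<Longrightarrow> 0 \<le> a x \<and> a x \<le> 1"
    "\<And>x. x \<in> K \<Longrightarrow> a x = 1" "compactin (unit_top \<G>) C" "C \<subseteq> V"
    "\<And>x. x \<in> units \<G> - C \<Longrightarrow> a x = 0"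
proof -
  have "neighbourhood_base_of (\<lambda>C. compactin (unit_top \<G>) C \<and> closedin (unit_top \<G>) C) (unit_top \<G>)"
    by (rule iffD1[OF locally_compact_space_neighbourhood_base_closedin[OF disjI1[OF unit_Hausdorff]]
          unit_locally_compact])
  then have "\<exists>W C. openin (unit_top \<G>) W \<and> compactin (unit_top \<G>) C \<and> x \<in> W \<and> W \<subseteq> C \<and> C \<subseteq> V" if "x \<in> K" for x
    using assms(2,3) that unfolding neighbourhood_base_of by (meson subsetD)
  then obtain W C where WC: "\<And>x. x \<in> K \<Longrightarrow> openin (unit_top \<G>) (W x) \<and> compactin (unit_top \<G>) (C x) \<and>
     x \<in> W x \<and> W x \<subseteq> C x \<and> C x \<subseteq> V"
    by metis
  have "\<exists>\<F>. finite \<F> \<and> \<F> \<subseteq> W ` K \<and> K \<subseteq> \<Union>\<F>"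
    using assms(1) WC unfolding compactin_def by (elim conjE allE[of _ "W ` K"]) blast
  then obtain F where F: "finite F" "F \<subseteq> K" "K \<subseteq> (\<Union>x\<in>F. W x)"
    by (metis finite_subset_image)
  define O' C' where "O' = (\<Union>x\<in>F. W x)" and "C' = (\<Union>x\<in>F. C x)"
  have O': "openin (unit_top \<G>) O'" "K \<subseteq> O'" "O' \<subseteq> C'" and C': "compactin (unit_top \<G>) C'" "C' \<subseteq> V"
    unfolding O'_def C'_def using WC F by (auto intro!: compactin_Union)
  have cr: "completely_regular_space (unit_top \<G>)"
    using locally_compact_regular_imp_completely_regular_space unit_locally_compact unit_regular by blast
  have "closedin (unit_top \<G>) (units \<G> - O')"
    using O'(1) topspace_unit_top by (metis closedin_diff closedin_topspace openin_closedin_eq)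
  moreover have "disjnt K (units \<G> - O')" using O' by (auto simp: disjnt_def)
  ultimately obtain f where f: "continuous_map (unit_top \<G>) (top_of_set {0..1::real}) f"
      "f ` (units \<G> - O') \<subseteq> {0}" "f ` K \<subseteq> {1}"
    using Urysohn_completely_regular_compact_closed[of 0 1, OF _ cr assms(1)] by auto
  show thesis
  proof (rule that)
    show "continuous_map (unit_top \<G>) euclideanreal f"
      using f(1) by (simp add: continuous_map_in_subtopology)
    show "0 \<le> f x \<and> f x \<le> 1" if "x \<in> units \<G>" for x
      using f(1) that by (auto simp: continuous_map_in_subtopology Pi_iff)
    show "compactin (unit_top \<G>) C'" "C' \<subseteq> V" by (fact C')+
    show "f x = 1" if "x \<in> K" for x using f(3) that by auto
    show "f x = 0" if "x \<in> units \<G> - C'" for x using f(2) O'(3) that by blast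
  qed
qed

end

section \<open>The fibres of a Fell line bundle\<close>

context fell_line_bundle
begin

lemma banach_fibre:
  assumes "\<gamma> \<in> arrows \<G>" shows "complex_banach_fibre \<L> \<gamma>"
proof -
  obtain U where "open_bisection \<G> U" "\<gamma> \<in> U" using arrow_in_bisection[OF assms] .
  then show ?thesis using continuous_banach_bundle_over.fibres[OF banach_bundle] by blast
qed

lemma fibre_arrow: "u \<in> fibre \<L> \<gamma> \<Longrightarrow> \<gamma> \<in> arrows \<G>"
  using continuous_map_image_subset_topspace[OF proj_continuous] by (auto simp: fibre_def)

lemma fibre_proj: "u \<in> fibre \<L> \<gamma> \<Longrightarrow> proj \<L> u = \<gamma>"
  by (simp add: fibre_def)

lemma fibre_topspace: "u \<in> fibre \<L> \<gamma> \<Longrightarrow> u \<in> topspace (btop \<L>)"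
  by (simp add: fibre_def)

lemma topspace_fibre: "u \<in> topspace (btop \<L>) \<Longrightarrow> u \<in> fibre \<L> (proj \<L> u)"
  by (simp add: fibre_def)

lemma fibre_comm_group: "\<gamma> \<in> arrows \<G> \<Longrightarrow> comm_group (fibre_group \<L> \<gamma>)"
  using complex_banach_fibre.add_group[OF banach_fibre] .

lemma fibre_group_simps [simp]:
  "carrier (fibre_group \<L> \<gamma>) = fibre \<L> \<gamma>"
  "monoid.mult (fibre_group \<L> \<gamma>) = badd \<L>"
  "one (fibre_group \<L> \<gamma>) = bzero \<L> \<gamma>"
  by (simp_all add: fibre_group_def)

lemma zero_closed: "\<gamma> \<in> arrows \<G> \<Longrightarrow> bzero \<L> \<gamma> \<in> fibre \<L> \<gamma>"
  using monoid.one_closed[OF group.is_monoid[OF comm_group.axioms(2)[OF fibre_comm_group]]] by simp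

lemma add_closed:
  assumes "u \<in> fibre \<L> \<gamma>" "v \<in> fibre \<L> \<gamma>" shows "badd \<L> u v \<in> fibre \<L> \<gamma>"
proof -
  interpret comm_group "fibre_group \<L> \<gamma>" using fibre_comm_group fibre_arrow assms by blast
  show ?thesis using m_closed assms by simp
qed

lemma add_zero: "u \<in> fibre \<L> \<gamma> \<Longrightarrow> badd \<L> u (bzero \<L> \<gamma>) = u"
proof -
  assume u: "u \<in> fibre \<L> \<gamma>"
  interpret comm_group "fibre_group \<L> \<gamma>" using fibre_comm_group fibre_arrow u by blast
  show ?thesis using r_one u by simp
qed

lemma scale_closed: "u \<in> fibre \<L> \<gamma> \<Longrightarrow> bscale \<L> c u \<in> fibre \<L> \<gamma>"
  using complex_banach_fibre.scale_closed[OF banach_fibre] fibre_arrow by blast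

lemma scale_one: "u \<in> fibre \<L> \<gamma> \<Longrightarrow> bscale \<L> 1 u = u"
  using complex_banach_fibre.scale_one[OF banach_fibre] fibre_arrow by blast

lemma scale_scale: "u \<in> fibre \<L> \<gamma> \<Longrightarrow> bscale \<L> c (bscale \<L> d u) = bscale \<L> (c * d) u"
  using complex_banach_fibre.scale_scale[OF banach_fibre] fibre_arrow by blast

lemma scale_add_left: "u \<in> fibre \<L> \<gamma> \<Longrightarrow> bscale \<L> (c + d) u = badd \<L> (bscale \<L> c u) (bscale \<L> d u)"
  using complex_banach_fibre.scale_add_left[OF banach_fibre] fibre_arrow by blast

lemma norm_nonneg: "u \<in> fibre \<L> \<gamma> \<Longrightarrow> 0 \<le> bnorm \<L> u"
  using complex_banach_fibre.norm_nonneg[OF banach_fibre] fibre_arrow by blast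

lemma norm_eq_zero: "u \<in> fibre \<L> \<gamma> \<Longrightarrow> bnorm \<L> u = 0 \<longleftrightarrow> u = bzero \<L> \<gamma>"
  using complex_banach_fibre.norm_eq_zero[OF banach_fibre] fibre_arrow by blast

lemma norm_scale: "u \<in> fibre \<L> \<gamma> \<Longrightarrow> bnorm \<L> (bscale \<L> c u) = cmod c * bnorm \<L> u"
  using complex_banach_fibre.norm_scale[OF banach_fibre] fibre_arrow by blast

lemma norm_zero: "\<gamma> \<in> arrows \<G> \<Longrightarrow> bnorm \<L> (bzero \<L> \<gamma>) = 0"
  using norm_eq_zero zero_closed by blast

lemma scale_zero: "u \<in> fibre \<L> \<gamma> \<Longrightarrow> bscale \<L> 0 u = bzero \<L> \<gamma>"
  using norm_scale[of u \<gamma> 0] norm_eq_zero[OF scale_closed] by auto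

lemma scale_bzero: "\<gamma> \<in> arrows \<G> \<Longrightarrow> bscale \<L> c (bzero \<L> \<gamma>) = bzero \<L> \<gamma>"
  using norm_scale[OF zero_closed] norm_eq_zero[OF scale_closed[OF zero_closed]] norm_zero by simp

lemma scale_inject:
  assumes "u \<in> fibre \<L> \<gamma>" "u \<noteq> bzero \<L> \<gamma>" "bscale \<L> c u = bscale \<L> d u"
  shows "c = d"
proof -
  have "bscale \<L> (c - d) u = badd \<L> (bscale \<L> c u) (bscale \<L> (- d) u)"
    using scale_add_left[OF assms(1), of c "- d"] by simp
  also have "\<dots> = bscale \<L> (d + - d) u" unfolding assms(3) by (rule scale_add_left[OF assms(1), symmetric])
  also have "\<dots> = bzero \<L> \<gamma>" using scale_zero assms(1) by simp
  finally have "cmod (c - d) * bnorm \<L> u = 0"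
    using norm_scale[OF assms(1), of "c - d"] norm_zero fibre_arrow[OF assms(1)] by simp
  then show ?thesis using norm_eq_zero assms by auto
qed

lemma fibre_spanned:
  assumes "e \<in> fibre \<L> \<gamma>" "e \<noteq> bzero \<L> \<gamma>" "u \<in> fibre \<L> \<gamma>"
  obtains c where "u = bscale \<L> c e"
proof -
  obtain f where f: "f \<in> fibre \<L> \<gamma>" "fibre \<L> \<gamma> = range (\<lambda>c. bscale \<L> c f)"
    using one_dimensional[OF fibre_arrow[OF assms(1)]] by (auto simp: one_dimensional_fibre_def)
  then obtain c d where cd: "e = bscale \<L> c f" "u = bscale \<L> d f" using assms by blast
  then have "c \<noteq> 0" using assms(2) scale_zero f(1) by auto
  then have "u = bscale \<L> (d / c) e" using cd scale_scale[OF f(1)] by simp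
  then show thesis by (rule that)
qed

lemma fibre_nontrivial:
  assumes "\<gamma> \<in> arrows \<G>" obtains e where "e \<in> fibre \<L> \<gamma>" "e \<noteq> bzero \<L> \<gamma>"
  using one_dimensional[OF assms] by (auto simp: one_dimensional_fibre_def)

lemma comp_inv_left: "\<gamma> \<in> arrows \<G> \<Longrightarrow> (ginv \<G> \<gamma>, \<gamma>) \<in> composable \<G>"
  by (simp add: composable_def inv_closed src_inv)

lemma comp_inv_right: "\<gamma> \<in> arrows \<G> \<Longrightarrow> (\<gamma>, ginv \<G> \<gamma>) \<in> composable \<G>"
  by (simp add: composable_def inv_closed rng_inv)

lemma comp_inv_mul: "(\<alpha>, \<beta>) \<in> composable \<G> \<Longrightarrow> (ginv \<G> \<alpha>, gmul \<G> \<alpha> \<beta>) \<in> composable \<G>"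
  using mul_closed rng_mul by (auto simp: composable_def inv_closed src_inv)

lemma comp_inv_inv: "(\<alpha>, \<beta>) \<in> composable \<G> \<Longrightarrow> (ginv \<G> \<beta>, ginv \<G> \<alpha>) \<in> composable \<G>"
  by (auto simp: composable_def inv_closed src_inv rng_inv)

lemma comp_rng: "\<gamma> \<in> arrows \<G> \<Longrightarrow> (rng \<G> \<gamma>, \<gamma>) \<in> composable \<G>"
  by (simp add: composable_def rng_closed src_rng)

lemma comp_src: "\<gamma> \<in> arrows \<G> \<Longrightarrow> (\<gamma>, src \<G> \<gamma>) \<in> composable \<G>"
  by (simp add: composable_def src_closed rng_src)

lemma comp_unit: "x \<in> units \<G> \<Longrightarrow> (x, x) \<in> composable \<G>"
  using comp_rng[OF units_arrows] by (simp add: unit_rng)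

lemma gmul_unit: "x \<in> units \<G> \<Longrightarrow> gmul \<G> x x = x"
  using mul_rng[OF units_arrows] by (simp add: unit_rng)

lemma mult_bzero_left:
  assumes "(\<gamma>, \<delta>) \<in> composable \<G>" "v \<in> fibre \<L> \<delta>"
  shows "bmult \<L> (bzero \<L> \<gamma>) v = bzero \<L> (gmul \<G> \<gamma> \<delta>)"
proof -
  note z = zero_closed[OF composableD(1)[OF assms(1)]]
  show ?thesis
    using mult_scale_left[OF assms(1) z assms(2), of 0] scale_zero[OF mult_closed[OF assms(1) z assms(2)]]
      scale_zero[OF z] by simp
qed

lemma star_bzero: "\<gamma> \<in> arrows \<G> \<Longrightarrow> bstar \<L> (bzero \<L> \<gamma>) = bzero \<L> (ginv \<G> \<gamma>)"
  using star_scale[OF _ zero_closed, of \<gamma> 0] scale_zero[OF star_closed[OF _ zero_closed]]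
    scale_zero[OF zero_closed] by simp

text \<open>A nonzero \<open>e\<close> in the fibre over a unit satisfies \<open>e\<^sup>* e \<noteq> 0\<close>; as \<open>e\<^sup>*\<close> is a multiple of
  \<open>e\<close>, also \<open>e e = d e\<close> with \<open>d \<noteq> 0\<close>, and \<open>e / d\<close> is the unit.\<close>

lemma bunit_unique:
  assumes x: "x \<in> units \<G>"
  shows "\<exists>!e. e \<in> fibre \<L> x \<and> (\<forall>u \<in> fibre \<L> x. bmult \<L> e u = u \<and> bmult \<L> u e = u)"
proof -
  note c = comp_unit[OF x] and xa = units_arrows[OF x]
  note mc = mult_closed[OF c, unfolded gmul_unit[OF x]]
  obtain e where e: "e \<in> fibre \<L> x" "e \<noteq> bzero \<L> x" using fibre_nontrivial[OF xa] .
  have "bstar \<L> e \<in> fibre \<L> x" using star_closed[OF xa e(1)] inv_unit[OF x] by simp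
  then obtain k where k: "bstar \<L> e = bscale \<L> k e" using fibre_spanned[OF e] by blast
  obtain d where d: "bmult \<L> e e = bscale \<L> d e" using fibre_spanned[OF e mc[OF e(1) e(1)]] .
  have "bnorm \<L> e \<noteq> 0" using norm_eq_zero e by blast
  then have "bnorm \<L> (bscale \<L> k (bscale \<L> d e)) \<noteq> 0"
    using norm_star_mult[OF xa e(1)] k d mult_scale_left[OF c e(1) e(1)] by simp
  then have d0: "d \<noteq> 0" using scale_zero[OF e(1)] scale_bzero[OF xa] norm_zero[OF xa] by auto
  define f where "f = bscale \<L> (1 / d) e"
  have f: "f \<in> fibre \<L> x" using f_def scale_closed e(1) by simp
  have "bmult \<L> f u = u \<and> bmult \<L> u f = u" if u: "u \<in> fibre \<L> x" for u
  proof -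
    obtain a where a: "u = bscale \<L> a e" using fibre_spanned[OF e u] .
    have "bmult \<L> (bscale \<L> p e) (bscale \<L> q e) = bscale \<L> (p * q * d) e" for p q
      using mult_scale_left[OF c e(1) scale_closed[OF e(1)]] mult_scale_right[OF c e(1) e(1)] d
        scale_scale[OF e(1)] scale_scale[OF scale_closed[OF e(1)]] by (simp add: mult.assoc)
    then show ?thesis using a d0 by (simp add: f_def)
  qed
  with f show ?thesis by (intro ex1I[of _ f]) metis+
qed

lemma bunit_props:
  assumes "x \<in> units \<G>"
  shows "bunit \<L> x \<in> fibre \<L> x"
    "u \<in> fibre \<L> x \<Longrightarrow> bmult \<L> (bunit \<L> x) u = u" "u \<in> fibre \<L> x \<Longrightarrow> bmult \<L> u (bunit \<L> x) = u"
  using theI'[OF bunit_unique[OF assms]] by (auto simp: bunit_def)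

lemma bunit_nonzero: assumes "x \<in> units \<G>" shows "bunit \<L> x \<noteq> bzero \<L> x"
proof
  assume 0: "bunit \<L> x = bzero \<L> x"
  obtain e where e: "e \<in> fibre \<L> x" "e \<noteq> bzero \<L> x" using fibre_nontrivial[OF units_arrows[OF assms]] .
  then show False
    using mult_bzero_left[OF comp_unit[OF assms] e(1)] bunit_props(2)[OF assms e(1)] 0 gmul_unit[OF assms]
    by simp
qed

lemma star_bunit:
  assumes x: "x \<in> units \<G>" shows "bstar \<L> (bunit \<L> x) = bunit \<L> x"
proof -
  let ?s = "bstar \<L> (bunit \<L> x)"
  note b = bunit_props[OF x] and xa = units_arrows[OF x]
  have s: "?s \<in> fibre \<L> x" using star_closed[OF xa b(1)] inv_unit[OF x] by simp
  have "bunit \<L> x = bstar \<L> (bmult \<L> ?s (bunit \<L> x))" using b(3)[OF s] star_star[OF xa b(1)] by simp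
  also have "\<dots> = bmult \<L> ?s (bunit \<L> x)"
    using star_mult[OF comp_unit[OF x] s b(1)] star_star[OF xa b(1)] by simp
  also have "\<dots> = ?s" by (rule b(3)[OF s])
  finally show ?thesis by simp
qed

lemma norm_bunit:
  assumes x: "x \<in> units \<G>" shows "bnorm \<L> (bunit \<L> x) = 1"
  using norm_star_mult[OF units_arrows[OF x] bunit_props(1)[OF x]] star_bunit[OF x]
    bunit_props(1,2)[OF x] norm_eq_zero bunit_nonzero[OF x] by (simp add: power2_eq_square)

text \<open>Multiplication by the unit over \<open>rng \<G> \<gamma>\<close> is an idempotent scalar on the fibre over \<open>\<gamma>\<close>; it
  cannot be 0, as \<open>e e\<^sup>*\<close> lies over \<open>rng \<G> \<gamma>\<close> and is nonzero.\<close>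

lemma bunit_mult_left:
  assumes u: "u \<in> fibre \<L> \<gamma>" shows "bmult \<L> (bunit \<L> (rng \<G> \<gamma>)) u = u"
proof -
  note g = fibre_arrow[OF u]
  let ?x = "rng \<G> \<gamma>" let ?b = "bunit \<L> ?x"
  have x: "?x \<in> units \<G>" using rng_in_units[OF g] .
  note c = comp_rng[OF g] and b = bunit_props[OF x]
  obtain e where e: "e \<in> fibre \<L> \<gamma>" "e \<noteq> bzero \<L> \<gamma>" using fibre_nontrivial[OF g] .
  have be: "bmult \<L> ?b e \<in> fibre \<L> \<gamma>" using mult_closed[OF c b(1) e(1)] mul_rng[OF g] by simp
  obtain l where l: "bmult \<L> ?b e = bscale \<L> l e" using fibre_spanned[OF e be] .
  have se: "bstar \<L> e \<in> fibre \<L> (ginv \<G> \<gamma>)" using star_closed[OF g e(1)] .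
  have "bmult \<L> ?b (bmult \<L> ?b e) = bmult \<L> ?b e"
    using mult_assoc[OF comp_unit[OF x] c b(1) b(1) e(1)] b(2)[OF b(1)] by simp
  then have "bscale \<L> (l * l) e = bscale \<L> l e"
    using l mult_scale_right[OF c b(1) e(1)] scale_scale[OF e(1)] by simp
  then have ll: "l * l = l" using scale_inject[OF e] by blast
  have "l \<noteq> 0"
  proof
    assume "l = 0"
    then have z: "bmult \<L> ?b e = bzero \<L> \<gamma>" using l scale_zero[OF e(1)] by simp
    have w: "bmult \<L> e (bstar \<L> e) \<in> fibre \<L> ?x"
      using mult_closed[OF comp_inv_right[OF g] e(1) se] mul_inv[OF g] by simp
    have "bmult \<L> e (bstar \<L> e) = bmult \<L> (bmult \<L> ?b e) (bstar \<L> e)"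
      using mult_assoc[OF c comp_inv_right[OF g] b(1) e(1) se] b(2)[OF w] by simp
    also have "\<dots> = bzero \<L> ?x"
      using z mult_bzero_left[OF comp_inv_right[OF g] se] mul_inv[OF g] by simp
    finally have "bnorm \<L> (bstar \<L> e) = 0"
      using norm_star_mult[OF inv_closed[OF g] se] star_star[OF g e(1)] norm_zero[OF units_arrows[OF x]] by simp
    then have "bstar \<L> e = bzero \<L> (ginv \<G> \<gamma>)" using norm_eq_zero[OF se] by simp
    then have "e = bzero \<L> \<gamma>"
      using star_star[OF g e(1)] star_bzero[OF inv_closed[OF g]] inv_inv[OF g] by simp
    then show False using e by simp
  qed
  with ll have "l = 1" by simp
  obtain a where a: "u = bscale \<L> a e" using fibre_spanned[OF e u] .
  show ?thesis using a l \<open>l = 1\<close> mult_scale_right[OF c b(1) e(1)] scale_one[OF e(1)] by simp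
qed

lemma bunit_mult_right:
  assumes u: "u \<in> fibre \<L> \<gamma>" shows "bmult \<L> u (bunit \<L> (src \<G> \<gamma>)) = u"
proof -
  note g = fibre_arrow[OF u]
  have x: "src \<G> \<gamma> \<in> units \<G>" using src_in_units[OF g] .
  note b = bunit_props(1)[OF x]
  have c: "bmult \<L> u (bunit \<L> (src \<G> \<gamma>)) \<in> fibre \<L> \<gamma>"
    using mult_closed[OF comp_src[OF g] u b] mul_src[OF g] by simp
  have "bstar \<L> (bmult \<L> u (bunit \<L> (src \<G> \<gamma>))) = bstar \<L> u"
    using star_mult[OF comp_src[OF g] u b] star_bunit[OF x] bunit_mult_left[OF star_closed[OF g u]]
      rng_inv[OF g] by simp
  then show ?thesis using star_star[OF g u] star_star[OF g c] by metis
qed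

lemma star_mult_self:
  assumes u: "u \<in> fibre \<L> \<gamma>"
  shows "bmult \<L> (bstar \<L> u) u = bscale \<L> (of_real ((bnorm \<L> u)\<^sup>2)) (bunit \<L> (src \<G> \<gamma>))"
proof -
  note g = fibre_arrow[OF u]
  obtain t :: real where t: "t \<ge> 0" "bmult \<L> (bstar \<L> u) u = bscale \<L> (of_real t) (bunit \<L> (src \<G> \<gamma>))"
    using star_mult_positive[OF g u] by blast
  have "bnorm \<L> (bmult \<L> (bstar \<L> u) u) = t"
    using t norm_scale[OF bunit_props(1)[OF src_in_units[OF g]]] norm_bunit[OF src_in_units[OF g]] by simp
  then show ?thesis using norm_star_mult[OF g u] t by simp
qed

lemma star_mult_cancel:
  assumes "(\<alpha>, \<beta>) \<in> composable \<G>" "u \<in> fibre \<L> \<alpha>" "v \<in> fibre \<L> \<beta>"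
  shows "bmult \<L> (bstar \<L> u) (bmult \<L> u v) = bscale \<L> (of_real ((bnorm \<L> u)\<^sup>2)) v"
proof -
  note g = composableD[OF assms(1)]
  have "bmult \<L> (bstar \<L> u) (bmult \<L> u v) = bmult \<L> (bmult \<L> (bstar \<L> u) u) v"
    using mult_assoc[OF comp_inv_left[OF g(1)] assms(1) star_closed[OF g(1) assms(2)] assms(2,3)] by simp
  also have "\<dots> = bscale \<L> (of_real ((bnorm \<L> u)\<^sup>2)) (bmult \<L> (bunit \<L> (rng \<G> \<beta>)) v)"
    unfolding star_mult_self[OF assms(2)] g(3)
    by (rule mult_scale_left[OF comp_rng[OF g(2)] bunit_props(1)[OF rng_in_units[OF g(2)]] assms(3)])
  finally show ?thesis using bunit_mult_left[OF assms(3)] by simp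
qed

text \<open>Submultiplicativity is an equality in a line bundle, since
  \<open>(u v)\<^sup>* (u v) = v\<^sup>* (u\<^sup>* u) v\<close> and \<open>u\<^sup>* u\<close> is a scalar multiple of a unit.\<close>

lemma norm_mult_eq:
  assumes "(\<alpha>, \<beta>) \<in> composable \<G>" "u \<in> fibre \<L> \<alpha>" "v \<in> fibre \<L> \<beta>"
  shows "bnorm \<L> (bmult \<L> u v) = bnorm \<L> u * bnorm \<L> v"
proof -
  note g = composableD[OF assms(1)] and uv = mult_closed[OF assms]
  note su = star_closed[OF g(1) assms(2)] and sv = star_closed[OF g(2) assms(3)]
  have "bmult \<L> (bstar \<L> (bmult \<L> u v)) (bmult \<L> u v) = bmult \<L> (bmult \<L> (bstar \<L> v) (bstar \<L> u)) (bmult \<L> u v)"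
    using star_mult[OF assms] by simp
  also have "\<dots> = bmult \<L> (bstar \<L> v) (bmult \<L> (bstar \<L> u) (bmult \<L> u v))"
    by (rule mult_assoc[OF comp_inv_inv[OF assms(1)] comp_inv_mul[OF assms(1)] sv su uv])
  also have "\<dots> = bscale \<L> (of_real ((bnorm \<L> u)\<^sup>2)) (bmult \<L> (bstar \<L> v) v)"
    unfolding star_mult_cancel[OF assms] by (rule mult_scale_right[OF comp_inv_left[OF g(2)] sv assms(3)])
  finally have "(bnorm \<L> (bmult \<L> u v))\<^sup>2 = (bnorm \<L> u)\<^sup>2 * (bnorm \<L> v)\<^sup>2"
    using norm_star_mult[OF mul_closed[OF assms(1)] uv] norm_star_mult[OF g(2) assms(3)]
      norm_scale[OF mult_closed[OF comp_inv_left[OF g(2)] sv assms(3)]] by (simp add: norm_power)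
  then have "(bnorm \<L> (bmult \<L> u v))\<^sup>2 = (bnorm \<L> u * bnorm \<L> v)\<^sup>2" by (simp add: power_mult_distrib)
  then show ?thesis using norm_nonneg[OF uv] norm_nonneg[OF assms(2)] norm_nonneg[OF assms(3)]
    by (simp add: power2_eq_iff_nonneg)
qed

section \<open>Coordinates\<close>

text \<open>A unit vector in each fibre, chosen without any continuity; over the units it is the
  canonical one.\<close>

definition frame :: "'g \<Rightarrow> 'l" where
  "frame \<gamma> = (if \<gamma> \<in> units \<G> then bunit \<L> \<gamma> else (SOME u. u \<in> fibre \<L> \<gamma> \<and> bnorm \<L> u = 1))"

definition coef :: "'l \<Rightarrow> complex" where
  "coef u = (SOME c. u = bscale \<L> c (frame (proj \<L> u)))"

lemma frame:
  assumes "\<gamma> \<in> arrows \<G>" shows "frame \<gamma> \<in> fibre \<L> \<gamma>" "bnorm \<L> (frame \<gamma>) = 1"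
proof -
  obtain e where e: "e \<in> fibre \<L> \<gamma>" "e \<noteq> bzero \<L> \<gamma>" using fibre_nontrivial[OF assms] .
  then have "bnorm \<L> e > 0" using norm_eq_zero norm_nonneg by force
  then have "bscale \<L> (1 / bnorm \<L> e) e \<in> fibre \<L> \<gamma> \<and> bnorm \<L> (bscale \<L> (1 / bnorm \<L> e) e) = 1"
    using scale_closed[OF e(1)] norm_scale[OF e(1)] by (simp add: norm_divide)
  then have "(SOME u. u \<in> fibre \<L> \<gamma> \<and> bnorm \<L> u = 1) \<in> fibre \<L> \<gamma> \<and> bnorm \<L> (SOME u. u \<in> fibre \<L> \<gamma> \<and> bnorm \<L> u = 1) = 1"
    by (rule someI)
  then show "frame \<gamma> \<in> fibre \<L> \<gamma>" "bnorm \<L> (frame \<gamma>) = 1"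
    by (auto simp: frame_def bunit_props norm_bunit)
qed

lemma frame_unit: "x \<in> units \<G> \<Longrightarrow> frame x = bunit \<L> x"
  by (simp add: frame_def)

lemma frame_nonzero: "\<gamma> \<in> arrows \<G> \<Longrightarrow> frame \<gamma> \<noteq> bzero \<L> \<gamma>"
  using frame norm_zero by force

lemma coef_eq:
  assumes "u \<in> fibre \<L> \<gamma>" shows "u = bscale \<L> (coef u) (frame \<gamma>)"
proof -
  note g = fibre_arrow[OF assms]
  obtain c where "u = bscale \<L> c (frame \<gamma>)"
    using fibre_spanned[OF frame(1)[OF g] frame_nonzero[OF g] assms] .
  then have "u = bscale \<L> c (frame (proj \<L> u))" using fibre_proj[OF assms] by simp
  then show ?thesis unfolding coef_def fibre_proj[OF assms] by (rule someI)
qed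

lemma coef_scale_frame: "\<gamma> \<in> arrows \<G> \<Longrightarrow> coef (bscale \<L> c (frame \<gamma>)) = c"
  using scale_inject[OF frame(1) frame_nonzero] coef_eq[OF scale_closed[OF frame(1)]] by metis

lemma coef_scale: assumes "u \<in> fibre \<L> \<gamma>" shows "coef (bscale \<L> c u) = c * coef u"
proof -
  note g = fibre_arrow[OF assms]
  have "bscale \<L> c u = bscale \<L> (c * coef u) (frame \<gamma>)"
    using coef_eq[OF assms] scale_scale[OF frame(1)[OF g]] by metis
  then show ?thesis using coef_scale_frame[OF g] by simp
qed

lemma coef_add: assumes "u \<in> fibre \<L> \<gamma>" "v \<in> fibre \<L> \<gamma>" shows "coef (badd \<L> u v) = coef u + coef v"
proof -
  note g = fibre_arrow[OF assms(1)]
  have "badd \<L> u v = bscale \<L> (coef u + coef v) (frame \<gamma>)"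
    using coef_eq[OF assms(1)] coef_eq[OF assms(2)] scale_add_left[OF frame(1)[OF g]] by metis
  then show ?thesis using coef_scale_frame[OF g] by simp
qed

lemma coef_frame: "\<gamma> \<in> arrows \<G> \<Longrightarrow> coef (frame \<gamma>) = 1"
  using coef_scale_frame[of \<gamma> 1] scale_one[OF frame(1)] by simp

lemma coef_norm: assumes "u \<in> fibre \<L> \<gamma>" shows "cmod (coef u) = bnorm \<L> u"
proof -
  note g = fibre_arrow[OF assms]
  have "bnorm \<L> u = cmod (coef u) * bnorm \<L> (frame \<gamma>)"
    using coef_eq[OF assms] norm_scale[OF frame(1)[OF g]] by metis
  then show ?thesis using frame(2)[OF g] by simp
qed

lemma coef_zero: "\<gamma> \<in> arrows \<G> \<Longrightarrow> coef (bzero \<L> \<gamma>) = 0"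
  using coef_norm[OF zero_closed] norm_zero by fastforce

lemma coef_eq_0_iff: "u \<in> fibre \<L> \<gamma> \<Longrightarrow> coef u = 0 \<longleftrightarrow> u = bzero \<L> \<gamma>"
  using coef_norm norm_eq_zero norm_eq_zero by (metis Real_Vector_Spaces.norm_eq_zero)

lemma coef_inject: "\<lbrakk>u \<in> fibre \<L> \<gamma>; v \<in> fibre \<L> \<gamma>; coef u = coef v\<rbrakk> \<Longrightarrow> u = v"
  using coef_eq by metis

lemma coef_bdiff: "\<lbrakk>u \<in> fibre \<L> \<gamma>; v \<in> fibre \<L> \<gamma>\<rbrakk> \<Longrightarrow> coef (bdiff \<L> u v) = coef u - coef v"
  unfolding bdiff_def by (simp add: coef_add[OF _ scale_closed] coef_scale)

lemma bdiff_closed: "\<lbrakk>u \<in> fibre \<L> \<gamma>; v \<in> fibre \<L> \<gamma>\<rbrakk> \<Longrightarrow> bdiff \<L> u v \<in> fibre \<L> \<gamma>"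
  unfolding bdiff_def by (simp add: add_closed scale_closed)

lemma norm_bdiff: "\<lbrakk>u \<in> fibre \<L> \<gamma>; v \<in> fibre \<L> \<gamma>\<rbrakk> \<Longrightarrow> bnorm \<L> (bdiff \<L> u v) = cmod (coef u - coef v)"
  using coef_norm[OF bdiff_closed] coef_bdiff by metis

text \<open>In the coordinates given by \<open>frame\<close> the product of the bundle is the product of the
  coefficients, twisted by a circle-valued 2-cocycle.\<close>

definition cocycle :: "'g \<Rightarrow> 'g \<Rightarrow> complex" where
  "cocycle \<alpha> \<beta> = coef (bmult \<L> (frame \<alpha>) (frame \<beta>))"

lemma coef_mult:
  assumes "(\<alpha>, \<beta>) \<in> composable \<G>" "u \<in> fibre \<L> \<alpha>" "v \<in> fibre \<L> \<beta>"
  shows "coef (bmult \<L> u v) = coef u * coef v * cocycle \<alpha> \<beta>"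
proof -
  note f = frame(1)[OF composableD(1)[OF assms(1)]] frame(1)[OF composableD(2)[OF assms(1)]]
  have "bmult \<L> u v = bmult \<L> (bscale \<L> (coef u) (frame \<alpha>)) (bscale \<L> (coef v) (frame \<beta>))"
    using coef_eq[OF assms(2)] coef_eq[OF assms(3)] by simp
  also have "\<dots> = bscale \<L> (coef u) (bscale \<L> (coef v) (bmult \<L> (frame \<alpha>) (frame \<beta>)))"
    using mult_scale_left[OF assms(1) f(1) scale_closed[OF f(2)]] mult_scale_right[OF assms(1) f] by simp
  finally show ?thesis
    using coef_scale[OF scale_closed[OF mult_closed[OF assms(1) f]]] coef_scale[OF mult_closed[OF assms(1) f]]
    by (simp add: cocycle_def)
qed

lemma norm_cocycle: assumes "(\<alpha>, \<beta>) \<in> composable \<G>" shows "cmod (cocycle \<alpha> \<beta>) = 1"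
proof -
  note a = composableD[OF assms] and f = frame[OF composableD(1)[OF assms]] frame[OF composableD(2)[OF assms]]
  show ?thesis
    using coef_norm[OF mult_closed[OF assms f(1,3)]] norm_mult_eq[OF assms f(1,3)] f by (simp add: cocycle_def)
qed

lemma cocycle_nonzero: "(\<alpha>, \<beta>) \<in> composable \<G> \<Longrightarrow> cocycle \<alpha> \<beta> \<noteq> 0"
  using norm_cocycle by force

lemma cocycle_identity:
  assumes c: "(\<alpha>, \<beta>) \<in> composable \<G>" "(\<beta>, \<kappa>) \<in> composable \<G>"
  shows "cocycle \<alpha> \<beta> * cocycle (gmul \<G> \<alpha> \<beta>) \<kappa> = cocycle \<alpha> (gmul \<G> \<beta> \<kappa>) * cocycle \<beta> \<kappa>"
proof -
  note a = composableD[OF c(1)] composableD[OF c(2)]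
  note f = frame(1)[OF a(1)] frame(1)[OF a(2)] frame(1)[OF a(5)]
  have c': "(gmul \<G> \<alpha> \<beta>, \<kappa>) \<in> composable \<G>" "(\<alpha>, gmul \<G> \<beta> \<kappa>) \<in> composable \<G>"
    using a c by (auto intro!: composableI simp: mul_closed src_mul rng_mul)
  have "coef (bmult \<L> (bmult \<L> (frame \<alpha>) (frame \<beta>)) (frame \<kappa>)) = cocycle \<alpha> \<beta> * cocycle (gmul \<G> \<alpha> \<beta>) \<kappa>"
    using coef_mult[OF c'(1) mult_closed[OF c(1) f(1,2)] f(3)] coef_frame[OF a(5)] by (simp add: cocycle_def)
  moreover have "coef (bmult \<L> (frame \<alpha>) (bmult \<L> (frame \<beta>) (frame \<kappa>))) = cocycle \<alpha> (gmul \<G> \<beta> \<kappa>) * cocycle \<beta> \<kappa>"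
    using coef_mult[OF c'(2) f(1) mult_closed[OF c(2) f(2,3)]] coef_frame[OF a(1)] by (simp add: cocycle_def)
  ultimately show ?thesis using mult_assoc[OF c f] by simp
qed

lemma cocycle_rng: "\<gamma> \<in> arrows \<G> \<Longrightarrow> cocycle (rng \<G> \<gamma>) \<gamma> = 1"
  unfolding cocycle_def
  by (simp add: frame_unit[OF rng_in_units] bunit_mult_left[OF frame(1)] coef_frame)

lemma cocycle_src: "\<gamma> \<in> arrows \<G> \<Longrightarrow> cocycle \<gamma> (src \<G> \<gamma>) = 1"
  unfolding cocycle_def
  by (simp add: frame_unit[OF src_in_units] bunit_mult_right[OF frame(1)] coef_frame)

lemma coef_star:
  assumes "u \<in> fibre \<L> \<gamma>" shows "coef (bstar \<L> u) = cnj (coef u) * coef (bstar \<L> (frame \<gamma>))"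
proof -
  note g = fibre_arrow[OF assms]
  have "bstar \<L> u = bscale \<L> (cnj (coef u)) (bstar \<L> (frame \<gamma>))"
    using coef_eq[OF assms] star_scale[OF g frame(1)[OF g]] by metis
  then show ?thesis using coef_scale[OF star_closed[OF g frame(1)[OF g]]] by simp
qed

text \<open>The adjoint of \<open>frame \<alpha>\<close> is determined by \<open>e\<^sup>* (e v) = v\<close> for unit vectors \<open>e\<close>. This is the
  identity that makes the convolution by the adjoint section the adjoint matrix.\<close>

lemma cocycle_star:
  assumes "(\<alpha>, \<beta>) \<in> composable \<G>"
  shows "coef (bstar \<L> (frame \<alpha>)) * cocycle (ginv \<G> \<alpha>) (gmul \<G> \<alpha> \<beta>) = cnj (cocycle \<alpha> \<beta>)"
proof -
  note a = composableD[OF assms]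
  note f = frame[OF a(1)] frame[OF a(2)]
  define a s b where "a = coef (bstar \<L> (frame \<alpha>))" and "s = cocycle \<alpha> \<beta>"
    and "b = cocycle (ginv \<G> \<alpha>) (gmul \<G> \<alpha> \<beta>)"
  have 1: "a * s * b = 1"
    using arg_cong[OF star_mult_cancel[OF assms f(1,3)], of coef]
      coef_mult[OF comp_inv_mul[OF assms] star_closed[OF a(1) f(1)] mult_closed[OF assms f(1,3)]]
      f coef_scale[OF f(3)] coef_frame[OF a(2)] by (simp add: cocycle_def a_def s_def b_def)
  have 2: "s * cnj s = 1"
    using norm_cocycle[OF assms] by (simp add: complex_norm_square[symmetric] s_def)
  have "a * b = a * b * (s * cnj s)" using 2 by simp
  also have "\<dots> = (a * s * b) * cnj s" by (simp only: ac_simps)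
  finally have "a * b = cnj s" using 1 by simp
  then show ?thesis by (simp add: a_def s_def b_def)
qed

lemma norm_star: assumes "u \<in> fibre \<L> \<gamma>" shows "bnorm \<L> (bstar \<L> u) = bnorm \<L> u"
proof -
  note g = fibre_arrow[OF assms] note s = star_closed[OF g assms]
  have "bnorm \<L> (bstar \<L> u) * bnorm \<L> u = bnorm \<L> u * bnorm \<L> u"
    using norm_mult_eq[OF comp_inv_left[OF g] s assms] norm_star_mult[OF g assms]
    by (simp only: power2_eq_square)
  moreover have "bnorm \<L> u = 0 \<Longrightarrow> bnorm \<L> (bstar \<L> u) = 0"
    using norm_eq_zero[OF assms] star_bzero[OF g] norm_zero[OF inv_closed[OF g]] by simp
  ultimately show ?thesis by (cases "bnorm \<L> u = 0") simp_all
qed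

end

section \<open>Continuity in the total space\<close>

lemma continuous_map_neighbourhoods:
  assumes "\<And>y. y \<in> topspace Y \<Longrightarrow> f y \<in> topspace Z"
    and "\<And>y W. \<lbrakk>y \<in> topspace Y; openin Z W; f y \<in> W\<rbrakk>
           \<Longrightarrow> \<exists>V. openin Y V \<and> y \<in> V \<and> (\<forall>y'\<in>V. f y' \<in> W)"
  shows "continuous_map Y Z f"
  unfolding continuous_map_def
proof (intro conjI allI impI)
  show "f \<in> topspace Y \<rightarrow> topspace Z" using assms(1) by blast
  fix W assume W: "openin Z W"
  show "openin Y {y \<in> topspace Y. f y \<in> W}"
  proof (subst openin_subopen, intro ballI)
    fix y assume "y \<in> {y \<in> topspace Y. f y \<in> W}"
    then obtain V where V: "openin Y V" "y \<in> V" "\<forall>y'\<in>V. f y' \<in> W" using assms(2) W by blast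
    then show "\<exists>V. openin Y V \<and> y \<in> V \<and> V \<subseteq> {y \<in> topspace Y. f y \<in> W}"
      using openin_subset[OF V(1)] by blast
  qed
qed

lemma continuous_map_euclidean_eps:
  fixes f :: "'a \<Rightarrow> 'b::metric_space"
  assumes "\<And>y \<epsilon>. \<lbrakk>y \<in> topspace Y; \<epsilon> > 0\<rbrakk> \<Longrightarrow> \<exists>V. openin Y V \<and> y \<in> V \<and> (\<forall>y'\<in>V. dist (f y') (f y) < \<epsilon>)"
  shows "continuous_map Y euclidean f"
proof (rule continuous_map_neighbourhoods)
  fix y W assume "y \<in> topspace Y" "openin euclidean W" "f y \<in> W"
  then obtain \<epsilon> where e: "\<epsilon> > 0" "\<forall>z. dist z (f y) < \<epsilon> \<longrightarrow> z \<in> W" by (auto simp: open_dist)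
  then show "\<exists>V. openin Y V \<and> y \<in> V \<and> (\<forall>y'\<in>V. f y' \<in> W)"
    using assms[OF \<open>y \<in> topspace Y\<close> e(1)] by blast
qed simp

lemma continuous_map_eps:
  fixes f :: "'a \<Rightarrow> 'b::metric_space"
  assumes "continuous_map Y euclidean f" "y \<in> topspace Y" "\<epsilon> > 0"
  obtains V where "openin Y V" "y \<in> V" "\<And>y'. y' \<in> V \<Longrightarrow> dist (f y') (f y) < \<epsilon>"
proof -
  have "openin Y {y' \<in> topspace Y. f y' \<in> ball (f y) \<epsilon>}"
    using openin_continuous_map_preimage[OF assms(1), of "ball (f y) \<epsilon>"] by simp
  then show thesis using assms(2,3)
    by (intro that[of "{y' \<in> topspace Y. f y' \<in> ball (f y) \<epsilon>}"]) (auto simp: dist_commute)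
qed

lemma continuous_map_complex_of_real:
  "continuous_map Y euclideanreal f \<Longrightarrow> continuous_map Y euclidean (\<lambda>y. complex_of_real (f y))"
  using continuous_map_compose[of Y euclideanreal f euclidean complex_of_real]
  by (simp add: o_def continuous_on_of_real)

context fell_line_bundle
begin

lemma topspace_proj: "u \<in> topspace (btop \<L>) \<Longrightarrow> proj \<L> u \<in> arrows \<G>"
  using fibre_arrow topspace_fibre by blast

lemma openin_proj_vimage:
  "openin (gtop \<G>) U \<Longrightarrow> openin (btop \<L>) {u \<in> topspace (btop \<L>). proj \<L> u \<in> U}"
  using openin_continuous_map_preimage[OF proj_continuous] .

lemma openin_total_over:
  assumes "openin (gtop \<G>) U"
  shows "openin (total_over \<L> U) W \<longleftrightarrow> openin (btop \<L>) W \<and> W \<subseteq> {u \<in> topspace (btop \<L>). proj \<L> u \<in> U}"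
  unfolding total_over_def using openin_open_subtopology[OF openin_proj_vimage[OF assms]] by simp

lemma topspace_total_over: "topspace (total_over \<L> U) = {u \<in> topspace (btop \<L>). proj \<L> u \<in> U}"
  by (auto simp: total_over_def)

lemma continuous_map_proj: "continuous_map Y (btop \<L>) f \<Longrightarrow> continuous_map Y (gtop \<G>) (\<lambda>y. proj \<L> (f y))"
  using continuous_map_compose[OF _ proj_continuous] by (simp add: o_def)

lemma continuous_map_topspace: "\<lbrakk>continuous_map Y Z f; y \<in> topspace Y\<rbrakk> \<Longrightarrow> f y \<in> topspace Z"
  by (auto simp: continuous_map_def)

text \<open>Continuity into the total space is local, so it may be tested over open bisections, where
  the axioms of a Banach bundle apply.\<close>

lemma bisection_neighbourhood:
  assumes "continuous_map Y (btop \<L>) f" "y \<in> topspace Y"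
  obtains U V where "open_bisection \<G> U" "openin Y V" "y \<in> V"
    "continuous_map (subtopology Y V) (total_over \<L> U) f"
proof -
  have "proj \<L> (f y) \<in> arrows \<G>" using topspace_proj continuous_map_topspace[OF assms] by blast
  then obtain U where U: "open_bisection \<G> U" "proj \<L> (f y) \<in> U" using arrow_in_bisection by blast
  let ?V = "{y \<in> topspace Y. proj \<L> (f y) \<in> U}"
  have V: "openin Y ?V"
    using openin_continuous_map_preimage[OF continuous_map_proj[OF assms(1)]] open_bisectionD(1)[OF U(1)] by blast
  have "continuous_map (subtopology Y ?V) (total_over \<L> U) f"
    unfolding total_over_def continuous_map_in_subtopology
    using continuous_map_from_subtopology[OF assms(1)] continuous_map_topspace[OF assms(1)] by auto
  then show thesis using that[OF U(1) V] assms(2) U(2) by blast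
qed

lemma continuous_norm: "continuous_map (btop \<L>) euclideanreal (bnorm \<L>)"
proof (rule continuous_map_euclidean_eps)
  fix u and \<epsilon> :: real assume u: "u \<in> topspace (btop \<L>)" and e: "\<epsilon> > 0"
  obtain U where U: "open_bisection \<G> U" "proj \<L> u \<in> U" using arrow_in_bisection topspace_proj[OF u] by blast
  have "u \<in> topspace (total_over \<L> U)" using u U by (simp add: topspace_total_over)
  then obtain V where "openin (total_over \<L> U) V" "u \<in> V" "\<And>v. v \<in> V \<Longrightarrow> dist (bnorm \<L> v) (bnorm \<L> u) < \<epsilon>"
    using continuous_map_eps[OF continuous_banach_bundle_over.norm_continuous[OF banach_bundle[OF U(1)]] _ e] by blast
  then show "\<exists>V. openin (btop \<L>) V \<and> u \<in> V \<and> (\<forall>v\<in>V. dist (bnorm \<L> v) (bnorm \<L> u) < \<epsilon>)"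
    using openin_total_over[OF open_bisectionD(1)[OF U(1)]] by blast
qed

lemma continuous_map_bnorm:
  "continuous_map Y (btop \<L>) f \<Longrightarrow> continuous_map Y euclideanreal (\<lambda>y. bnorm \<L> (f y))"
  using continuous_map_compose[OF _ continuous_norm] by (simp add: o_def)

lemma continuous_map_scale_const:
  assumes f: "continuous_map Y (btop \<L>) f"
  shows "continuous_map Y (btop \<L>) (\<lambda>y. bscale \<L> c (f y))"
proof (rule continuous_map_neighbourhoods)
  show "bscale \<L> c (f y) \<in> topspace (btop \<L>)" if "y \<in> topspace Y" for y
    using fibre_topspace scale_closed topspace_fibre continuous_map_topspace[OF f that] by blast
  fix y W assume y: "y \<in> topspace Y" and W: "openin (btop \<L>) W" "bscale \<L> c (f y) \<in> W"
  obtain U V where UV: "open_bisection \<G> U" "openin Y V" "y \<in> V"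
      "continuous_map (subtopology Y V) (total_over \<L> U) f"
    using bisection_neighbourhood[OF f y] .
  have "continuous_map (subtopology Y V) (total_over \<L> U) (bscale \<L> c \<circ> f)"
    by (rule continuous_map_compose[OF UV(4) continuous_banach_bundle_over.scale_continuous[OF banach_bundle[OF UV(1)]]])
  then have "continuous_map (subtopology Y V) (btop \<L>) (bscale \<L> c \<circ> f)"
    by (auto simp: total_over_def continuous_map_in_subtopology)
  from openin_continuous_map_preimage[OF this W(1)]
  have "openin (subtopology Y V) {y \<in> topspace (subtopology Y V). bscale \<L> c (f y) \<in> W}"
    by (simp add: o_def)
  then have "openin Y {y \<in> topspace (subtopology Y V). bscale \<L> c (f y) \<in> W}"
    using openin_trans_full UV(2) by blast
  then show "\<exists>V. openin Y V \<and> y \<in> V \<and> (\<forall>y'\<in>V. bscale \<L> c (f y') \<in> W)"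
    using y UV(3) W(2) by (intro exI[of _ "{y \<in> topspace (subtopology Y V). bscale \<L> c (f y) \<in> W}"]) auto
qed

lemma add_neighbourhoods:
  assumes "u \<in> fibre \<L> \<gamma>" "v \<in> fibre \<L> \<gamma>" "openin (btop \<L>) W" "badd \<L> u v \<in> W"
  obtains A B where "openin (btop \<L>) A" "openin (btop \<L>) B" "u \<in> A" "v \<in> B"
    "\<And>a b. \<lbrakk>a \<in> A; b \<in> B; proj \<L> a = proj \<L> b\<rbrakk> \<Longrightarrow> badd \<L> a b \<in> W"
proof -
  obtain U where U: "open_bisection \<G> U" "\<gamma> \<in> U" using arrow_in_bisection fibre_arrow[OF assms(1)] by blast
  let ?T = "total_over \<L> U" and ?D = "{(u, v). proj \<L> u = proj \<L> v}"
  note oT = openin_total_over[OF open_bisectionD(1)[OF U(1)]]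
  have uv: "u \<in> topspace ?T" "v \<in> topspace ?T"
    using assms U by (auto simp: topspace_total_over fibre_def)
  have "continuous_map (subtopology (prod_topology ?T ?T) ?D) (btop \<L>) (\<lambda>(u, v). badd \<L> u v)"
    using continuous_banach_bundle_over.add_continuous[OF banach_bundle[OF U(1)]]
    by (auto simp: total_over_def continuous_map_in_subtopology)
  from openin_continuous_map_preimage[OF this assms(3)]
  have "openin (subtopology (prod_topology ?T ?T) ?D)
      {p \<in> topspace (subtopology (prod_topology ?T ?T) ?D). (\<lambda>(u, v). badd \<L> u v) p \<in> W}" .
  then obtain N where N: "openin (prod_topology ?T ?T) N"
      "{p \<in> topspace (subtopology (prod_topology ?T ?T) ?D). (\<lambda>(u, v). badd \<L> u v) p \<in> W} = N \<inter> ?D"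
    unfolding openin_subtopology by blast
  have "(u, v) \<in> N \<inter> ?D" unfolding N(2)[symmetric] using uv assms by (auto simp: fibre_def)
  then have uvN: "(u, v) \<in> N" by blast
  then obtain A B where AB: "openin ?T A" "openin ?T B" "u \<in> A" "v \<in> B" "A \<times> B \<subseteq> N"
    using N(1)[unfolded openin_prod_topology_alt, rule_format, OF uvN] by blast
  have "badd \<L> a b \<in> W" if "a \<in> A" "b \<in> B" "proj \<L> a = proj \<L> b" for a b
  proof -
    have "(a, b) \<in> N \<inter> ?D" using that AB by auto
    then show ?thesis unfolding N(2)[symmetric] by simp
  qed
  then show thesis using that[of A B] AB oT by blast
qed

lemma continuous_map_badd:
  assumes f: "continuous_map Y (btop \<L>) f" and g: "continuous_map Y (btop \<L>) g"
    and fg: "\<And>y. y \<in> topspace Y \<Longrightarrow> proj \<L> (f y) = proj \<L> (g y)"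
  shows "continuous_map Y (btop \<L>) (\<lambda>y. badd \<L> (f y) (g y))"
proof (rule continuous_map_neighbourhoods)
  have fib: "f y \<in> fibre \<L> (proj \<L> (f y))" "g y \<in> fibre \<L> (proj \<L> (f y))" if "y \<in> topspace Y" for y
    using fg[OF that] topspace_fibre[OF continuous_map_topspace[OF f that]]
      topspace_fibre[OF continuous_map_topspace[OF g that]] by simp_all
  show "badd \<L> (f y) (g y) \<in> topspace (btop \<L>)" if "y \<in> topspace Y" for y
    using fib[OF that] add_closed fibre_topspace by blast
  fix y W assume y: "y \<in> topspace Y" and W: "openin (btop \<L>) W" "badd \<L> (f y) (g y) \<in> W"
  obtain A B where AB: "openin (btop \<L>) A" "openin (btop \<L>) B" "f y \<in> A" "g y \<in> B"
    "\<And>a b. \<lbrakk>a \<in> A; b \<in> B; proj \<L> a = proj \<L> b\<rbrakk> \<Longrightarrow> badd \<L> a b \<in> W"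
    using add_neighbourhoods[OF fib[OF y] W] by metis
  define V where "V = {y \<in> topspace Y. f y \<in> A} \<inter> {y \<in> topspace Y. g y \<in> B}"
  have "openin Y V" unfolding V_def
    by (rule openin_Int[OF openin_continuous_map_preimage[OF f AB(1)] openin_continuous_map_preimage[OF g AB(2)]])
  moreover have "y \<in> V" using y AB(3,4) by (simp add: V_def)
  moreover have "badd \<L> (f y') (g y') \<in> W" if "y' \<in> V" for y'
    using that by (intro AB(5)) (auto simp: V_def fg)
  ultimately show "\<exists>V. openin Y V \<and> y \<in> V \<and> (\<forall>y'\<in>V. badd \<L> (f y') (g y') \<in> W)" by blast
qed

lemma zero_neighbourhood:
  assumes "\<gamma> \<in> arrows \<G>" "openin (btop \<L>) W" "bzero \<L> \<gamma> \<in> W"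
  obtains V \<epsilon> where "openin (gtop \<G>) V" "\<gamma> \<in> V" "\<epsilon> > 0"
    "\<And>u. \<lbrakk>u \<in> topspace (btop \<L>); proj \<L> u \<in> V; bnorm \<L> u < \<epsilon>\<rbrakk> \<Longrightarrow> u \<in> W"
proof -
  obtain U where U: "open_bisection \<G> U" "\<gamma> \<in> U" using arrow_in_bisection assms(1) by blast
  note oU = open_bisectionD(1)[OF U(1)]
  let ?W = "W \<inter> {u \<in> topspace (btop \<L>). proj \<L> u \<in> U}"
  have W1: "openin (total_over \<L> U) ?W"
    using openin_total_over[OF oU] openin_proj_vimage[OF oU] assms(2) by auto
  have W2: "bzero \<L> \<gamma> \<in> ?W"
    using assms(3) zero_closed[OF assms(1)] U(2) by (simp add: fibre_def)
  obtain V \<epsilon> where V: "openin (subtopology (gtop \<G>) U) V" "\<gamma> \<in> V" "\<epsilon> > 0"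
      "{u \<in> topspace (total_over \<L> U). proj \<L> u \<in> V \<and> bnorm \<L> u < \<epsilon>} \<subseteq> ?W"
    using continuous_banach_bundle_over.zero_neighbourhoods[OF banach_bundle[OF U(1)] U(2) W1 W2] by blast
  have "V \<subseteq> U" "openin (gtop \<G>) V" using V(1) openin_open_subtopology[OF oU] by auto
  then show thesis using that[of V \<epsilon>] V(2-4) by (auto simp: topspace_total_over)
qed

text \<open>Joint continuity follows from the continuity of the single scalar multiplications: near \<open>(c, u)\<close>
  write \<open>d v = c v + (d - c) v\<close>, where the second summand has small norm.\<close>

lemma continuous_map_bscale:
  assumes c: "continuous_map Y euclidean c" and f: "continuous_map Y (btop \<L>) f"
  shows "continuous_map Y (btop \<L>) (\<lambda>y. bscale \<L> (c y) (f y))"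
proof (rule continuous_map_neighbourhoods)
  have fib: "f y \<in> fibre \<L> (proj \<L> (f y))" if "y \<in> topspace Y" for y
    using topspace_fibre continuous_map_topspace[OF f that] by auto
  show "bscale \<L> (c y) (f y) \<in> topspace (btop \<L>)" if "y \<in> topspace Y" for y
    using fib[OF that] scale_closed fibre_topspace by blast
  fix y W assume y: "y \<in> topspace Y" and W: "openin (btop \<L>) W" "bscale \<L> (c y) (f y) \<in> W"
  define \<gamma> where "\<gamma> = proj \<L> (f y)"
  have fy: "f y \<in> fibre \<L> \<gamma>" and g: "\<gamma> \<in> arrows \<G>" using fib[OF y] fibre_arrow by (auto simp: \<gamma>_def)
  have "badd \<L> (bscale \<L> (c y) (f y)) (bzero \<L> \<gamma>) \<in> W" using add_zero[OF scale_closed[OF fy]] W(2) by simp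
  then obtain A B where AB: "openin (btop \<L>) A" "openin (btop \<L>) B" "bscale \<L> (c y) (f y) \<in> A" "bzero \<L> \<gamma> \<in> B"
    "\<And>a b. \<lbrakk>a \<in> A; b \<in> B; proj \<L> a = proj \<L> b\<rbrakk> \<Longrightarrow> badd \<L> a b \<in> W"
    using add_neighbourhoods[OF scale_closed[OF fy] zero_closed[OF g] W(1)] by metis
  obtain V \<epsilon> where V: "openin (gtop \<G>) V" "\<gamma> \<in> V" "\<epsilon> > 0"
      "\<And>u. \<lbrakk>u \<in> topspace (btop \<L>); proj \<L> u \<in> V; bnorm \<L> u < \<epsilon>\<rbrakk> \<Longrightarrow> u \<in> B"
    using zero_neighbourhood[OF g AB(2,4)] by metis
  define M where "M = bnorm \<L> (f y) + 1"
  have M: "M > 0" using norm_nonneg[OF fy] by (simp add: M_def)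
  obtain V1 where V1: "openin Y V1" "y \<in> V1" "\<And>y'. y' \<in> V1 \<Longrightarrow> dist (c y') (c y) < \<epsilon> / M"
    using continuous_map_eps[OF c y] V(3) M by (metis divide_pos_pos)
  obtain V2 where V2: "openin Y V2" "y \<in> V2" "\<And>y'. y' \<in> V2 \<Longrightarrow> dist (bnorm \<L> (f y')) (bnorm \<L> (f y)) < 1"
    using continuous_map_eps[OF continuous_map_bnorm[OF f] y zero_less_one] by metis
  define N where "N = V1 \<inter> V2 \<inter> {y' \<in> topspace Y. proj \<L> (f y') \<in> V}
      \<inter> {y' \<in> topspace Y. bscale \<L> (c y) (f y') \<in> A}"
  have "openin Y N"
    unfolding N_def using V1(1) V2(1) openin_continuous_map_preimage[OF continuous_map_proj[OF f] V(1)]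
      openin_continuous_map_preimage[OF continuous_map_scale_const[OF f] AB(1), of "c y"] by (auto intro!: openin_Int)
  moreover have "y \<in> N" using y V1 V2 V(2) AB(3) by (auto simp: \<gamma>_def N_def)
  moreover have "bscale \<L> (c y') (f y') \<in> W" if y': "y' \<in> N" for y'
  proof -
    have yt: "y' \<in> topspace Y" using y' by (simp add: N_def)
    let ?d = "bscale \<L> (c y' - c y) (f y')"
    have d: "?d \<in> fibre \<L> (proj \<L> (f y'))" using scale_closed[OF fib[OF yt]] .
    have n: "bnorm \<L> (f y') \<le> M" using V2(3)[of y'] y' by (auto simp: N_def dist_real_def M_def)
    have "bnorm \<L> ?d = cmod (c y' - c y) * bnorm \<L> (f y')" using norm_scale[OF fib[OF yt]] .
    also have "\<dots> \<le> cmod (c y' - c y) * M" using n by (intro mult_left_mono) auto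
    also have "\<dots> < \<epsilon>" using V1(3)[of y'] y' M by (simp add: N_def dist_norm pos_less_divide_eq)
    finally have "?d \<in> B" using V(4)[of ?d] fibre_topspace[OF d] fibre_proj[OF d] y' by (simp add: N_def)
    moreover have "bscale \<L> (c y) (f y') \<in> A" using y' by (simp add: N_def)
    moreover have "proj \<L> (bscale \<L> (c y) (f y')) = proj \<L> ?d"
      using fibre_proj[OF d] fibre_proj[OF scale_closed[OF fib[OF yt]]] by simp
    ultimately have "badd \<L> (bscale \<L> (c y) (f y')) ?d \<in> W" using AB(5) by blast
    then show ?thesis using scale_add_left[OF fib[OF yt], of "c y" "c y' - c y"] by simp
  qed
  ultimately show "\<exists>V. openin Y V \<and> y \<in> V \<and> (\<forall>y'\<in>V. bscale \<L> (c y') (f y') \<in> W)" by blast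
qed

lemma continuous_map_bmult:
  assumes "continuous_map Y (btop \<L>) f" "continuous_map Y (btop \<L>) g"
    and "\<And>y. y \<in> topspace Y \<Longrightarrow> src \<G> (proj \<L> (f y)) = rng \<G> (proj \<L> (g y))"
  shows "continuous_map Y (btop \<L>) (\<lambda>y. bmult \<L> (f y) (g y))"
proof -
  have "continuous_map Y (subtopology (prod_topology (btop \<L>) (btop \<L>))
      {(u, v). src \<G> (proj \<L> u) = rng \<G> (proj \<L> v)}) (\<lambda>y. (f y, g y))"
    using assms by (auto simp: continuous_map_in_subtopology continuous_map_pairedI)
  from continuous_map_compose[OF this mult_continuous] show ?thesis by (simp add: o_def)
qed

lemma continuous_map_bstar:
  "continuous_map Y (btop \<L>) f \<Longrightarrow> continuous_map Y (btop \<L>) (\<lambda>y. bstar \<L> (f y))"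
  using continuous_map_compose[OF _ star_continuous] by (simp add: o_def)

text \<open>The functions \<open>\<bar>u/v - c\<bar> = \<parallel>u - c v\<parallel> / \<parallel>v\<parallel>\<close>, \<open>c\<close> constant, are continuous, and together they
  control the quotient of the sections \<open>u\<close> and \<open>v\<close>.\<close>

lemma continuous_map_ratio:
  assumes f: "continuous_map Y (btop \<L>) f" and g: "continuous_map Y (btop \<L>) g"
    and fg: "\<And>y. y \<in> topspace Y \<Longrightarrow> proj \<L> (f y) = proj \<L> (g y)"
    and nz: "\<And>y. y \<in> topspace Y \<Longrightarrow> coef (g y) \<noteq> 0"
  shows "continuous_map Y euclidean (\<lambda>y. coef (f y) / coef (g y))"
proof (rule continuous_map_euclidean_eps)
  have fib: "f y \<in> fibre \<L> (proj \<L> (f y))" "g y \<in> fibre \<L> (proj \<L> (f y))" if "y \<in> topspace Y" for y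
    using fg[OF that] topspace_fibre[OF continuous_map_topspace[OF f that]]
      topspace_fibre[OF continuous_map_topspace[OF g that]] by simp_all
  fix y0 and \<epsilon> :: real assume y0: "y0 \<in> topspace Y" and e: "\<epsilon> > 0"
  define c where "c = coef (f y0) / coef (g y0)"
  let ?h = "\<lambda>y. badd \<L> (f y) (bscale \<L> (- c) (g y))"
  have h: "continuous_map Y (btop \<L>) ?h"
  proof (rule continuous_map_badd[OF f continuous_map_scale_const[OF g]])
    show "proj \<L> (f y) = proj \<L> (bscale \<L> (- c) (g y))" if "y \<in> topspace Y" for y
      using fibre_proj[OF scale_closed[OF fib(2)[OF that]]] by simp
  qed
  have hn: "bnorm \<L> (?h y) = cmod (coef (f y) - c * coef (g y))" if "y \<in> topspace Y" for y
    using coef_norm[OF add_closed[OF fib(1)[OF that] scale_closed[OF fib(2)[OF that]]], of "- c"]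
      coef_add[OF fib(1)[OF that] scale_closed[OF fib(2)[OF that]], of "- c"] coef_scale[OF fib(2)[OF that], of "- c"]
    by simp
  have gn: "bnorm \<L> (g y) = cmod (coef (g y))" if "y \<in> topspace Y" for y
    using coef_norm[OF fib(2)[OF that]] by simp
  have rc: "continuous_map Y euclideanreal (\<lambda>y. bnorm \<L> (?h y) / bnorm \<L> (g y))"
    using continuous_map_bnorm[OF h] continuous_map_bnorm[OF g] gn nz
    by (intro continuous_map_real_divide) auto
  obtain V where V: "openin Y V" "y0 \<in> V"
      "\<And>y. y \<in> V \<Longrightarrow> dist (bnorm \<L> (?h y) / bnorm \<L> (g y)) (bnorm \<L> (?h y0) / bnorm \<L> (g y0)) < \<epsilon>"
    using continuous_map_eps[OF rc y0 e] by blast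
  have "dist (coef (f y) / coef (g y)) (coef (f y0) / coef (g y0)) < \<epsilon>" if "y \<in> V" for y
  proof -
    have y: "y \<in> topspace Y" using that openin_subset[OF V(1)] by auto
    have "coef (f y) / coef (g y) - c = (coef (f y) - c * coef (g y)) / coef (g y)"
      using nz[OF y] by (simp add: field_simps)
    then have "dist (coef (f y) / coef (g y)) c = bnorm \<L> (?h y) / bnorm \<L> (g y)"
      using hn[OF y] gn[OF y] by (simp add: dist_norm norm_divide)
    moreover have "bnorm \<L> (?h y0) / bnorm \<L> (g y0) = 0" using hn[OF y0] nz[OF y0] by (simp add: c_def)
    then have "bnorm \<L> (?h y) / bnorm \<L> (g y) < \<epsilon>"
      using V(3)[OF that] unfolding dist_real_def by linarith
    ultimately show ?thesis by (simp add: c_def)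
  qed
  then show "\<exists>V. openin Y V \<and> y0 \<in> V \<and> (\<forall>y\<in>V. dist (coef (f y) / coef (g y)) (coef (f y0) / coef (g y0)) < \<epsilon>)"
    using V(1,2) by blast
qed

lemma openin_proj_image:
  assumes "openin (btop \<L>) N" shows "openin (gtop \<G>) (proj \<L> ` N)"
proof (subst openin_subopen, intro ballI)
  fix \<gamma> assume "\<gamma> \<in> proj \<L> ` N"
  then obtain u where u: "u \<in> N" "\<gamma> = proj \<L> u" by blast
  then have "u \<in> topspace (btop \<L>)" using openin_subset[OF assms] by blast
  then obtain U where U: "open_bisection \<G> U" "\<gamma> \<in> U" using arrow_in_bisection topspace_proj u by blast
  note oU = open_bisectionD(1)[OF U(1)]
  let ?N = "N \<inter> {u \<in> topspace (btop \<L>). proj \<L> u \<in> U}"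
  have "openin (total_over \<L> U) ?N"
    using openin_total_over[OF oU] openin_proj_vimage[OF oU] assms by auto
  then have "openin (subtopology (gtop \<G>) U) (proj \<L> ` ?N)"
    using continuous_banach_bundle_over.proj_open[OF banach_bundle[OF U(1)]] by (simp add: open_map_def)
  then have "openin (gtop \<G>) (proj \<L> ` ?N)" using openin_open_subtopology[OF oU] by blast
  then show "\<exists>T. openin (gtop \<G>) T \<and> \<gamma> \<in> T \<and> T \<subseteq> proj \<L> ` N"
    using u U \<open>u \<in> topspace (btop \<L>)\<close> by (intro exI[of _ "proj \<L> ` ?N"]) auto
qed

definition nonzero_over :: "'g set \<Rightarrow> 'l set" where
  "nonzero_over V = {u \<in> topspace (btop \<L>). proj \<L> u \<in> V \<and> coef u \<noteq> 0}"

lemma nonzero_over_norm: "u \<in> nonzero_over V \<Longrightarrow> bnorm \<L> u \<noteq> 0"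
  using coef_norm[OF topspace_fibre] by (fastforce simp: nonzero_over_def)

lemma openin_nonzero_over:
  assumes "openin (gtop \<G>) V" shows "openin (btop \<L>) (nonzero_over V)"
proof -
  have "nonzero_over V = {u \<in> topspace (btop \<L>). proj \<L> u \<in> V} \<inter> {u \<in> topspace (btop \<L>). bnorm \<L> u \<in> - {0}}"
    using coef_norm[OF topspace_fibre] by (fastforce simp: nonzero_over_def)
  moreover have "openin (btop \<L>) {u \<in> topspace (btop \<L>). bnorm \<L> u \<in> - {0}}"
    using openin_continuous_map_preimage[OF continuous_norm, of "- {0}"] by (simp add: open_Compl)
  ultimately show ?thesis using openin_proj_vimage[OF assms] by (simp only: openin_Int)
qed

text \<open>As \<^term>\<open>proj \<L>\<close> is open, neighbourhoods of nonzero vectors project to neighbourhoods of arrows.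
  This yields continuity of sections whose values can be computed from any nonzero vector.\<close>

lemma continuous_map_descends:
  assumes V: "openin (gtop \<G>) V"
    and q: "continuous_map (subtopology (btop \<L>) (nonzero_over V)) Z q"
    and k: "\<And>u. u \<in> nonzero_over V \<Longrightarrow> q u = k (proj \<L> u)"
  shows "continuous_map (subtopology (gtop \<G>) V) Z k"
proof (rule continuous_map_neighbourhoods)
  have fr: "frame \<gamma> \<in> nonzero_over V" "proj \<L> (frame \<gamma>) = \<gamma>" if "\<gamma> \<in> topspace (subtopology (gtop \<G>) V)" for \<gamma>
    using that frame(1)[of \<gamma>] coef_frame[of \<gamma>] fibre_topspace fibre_proj by (auto simp: nonzero_over_def)
  have top: "topspace (subtopology (btop \<L>) (nonzero_over V)) = nonzero_over V"
    by (auto simp: nonzero_over_def)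
  show "k \<gamma> \<in> topspace Z" if "\<gamma> \<in> topspace (subtopology (gtop \<G>) V)" for \<gamma>
    using continuous_map_topspace[OF q, of "frame \<gamma>"] fr[OF that] k unfolding top by simp
  fix \<gamma> W assume g: "\<gamma> \<in> topspace (subtopology (gtop \<G>) V)" and W: "openin Z W" "k \<gamma> \<in> W"
  let ?N = "{u \<in> topspace (subtopology (btop \<L>) (nonzero_over V)). q u \<in> W}"
  have "openin (subtopology (btop \<L>) (nonzero_over V)) ?N" using openin_continuous_map_preimage[OF q W(1)] .
  then have "openin (btop \<L>) ?N" using openin_trans_full openin_nonzero_over[OF V] by blast
  then have "openin (gtop \<G>) (proj \<L> ` ?N)" by (rule openin_proj_image)
  moreover have "proj \<L> ` ?N \<subseteq> V" by (auto simp: nonzero_over_def)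
  ultimately have "openin (subtopology (gtop \<G>) V) (proj \<L> ` ?N)" using openin_open_subtopology[OF V] by blast
  moreover have "\<gamma> \<in> proj \<L> ` ?N" using fr[OF g] W(2) k top by force
  moreover have "\<forall>\<delta> \<in> proj \<L> ` ?N. k \<delta> \<in> W" using k top by auto
  ultimately show "\<exists>V'. openin (subtopology (gtop \<G>) V) V' \<and> \<gamma> \<in> V' \<and> (\<forall>\<delta>\<in>V'. k \<delta> \<in> W)" by blast
qed

text \<open>For every nonzero vector \<open>u\<close> over a unit of the groupoid, \<open>u\<^sup>* u / \<parallel>u\<parallel>\<^sup>2\<close> is the unit of the fibre, and
  this expression is continuous in \<open>u\<close>.\<close>

lemma continuous_bunit: "continuous_map (unit_top \<G>) (btop \<L>) (bunit \<L>)"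
  unfolding unit_top_def
proof (rule continuous_map_descends[OF units_open])
  let ?Y = "subtopology (btop \<L>) (nonzero_over (units \<G>))"
  let ?q = "\<lambda>u. bscale \<L> (of_real (1 / (bnorm \<L> u)\<^sup>2)) (bmult \<L> (bstar \<L> u) u)"
  have top: "topspace ?Y = nonzero_over (units \<G>)" by (auto simp: nonzero_over_def)
  have id: "continuous_map ?Y (btop \<L>) (\<lambda>u. u)"
    by (simp add: continuous_map_from_subtopology continuous_map_id[unfolded id_def])
  have "continuous_map ?Y euclidean (\<lambda>u. 1 / (bnorm \<L> u)\<^sup>2)"
    using continuous_map_bnorm[OF id] nonzero_over_norm top
    by (intro continuous_map_real_divide) (auto simp: power2_eq_square intro!: continuous_map_real_mult)
  then have c: "continuous_map ?Y euclidean (\<lambda>u. complex_of_real (1 / (bnorm \<L> u)\<^sup>2))"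
    by (rule continuous_map_complex_of_real)
  have "src \<G> (proj \<L> (bstar \<L> u)) = rng \<G> (proj \<L> u)" if u: "u \<in> topspace ?Y" for u
  proof -
    have "u \<in> fibre \<L> (proj \<L> u)" using u topspace_fibre by auto
    then show ?thesis using fibre_proj[OF star_closed] src_inv fibre_arrow by metis
  qed
  then show "continuous_map ?Y (btop \<L>) ?q"
    by (intro continuous_map_bscale[OF c] continuous_map_bmult continuous_map_bstar id)
  fix u assume u: "u \<in> nonzero_over (units \<G>)"
  then have ux: "u \<in> fibre \<L> (proj \<L> u)" "proj \<L> u \<in> units \<G>" using topspace_fibre by (auto simp: nonzero_over_def)
  show "?q u = bunit \<L> (proj \<L> u)"
    using star_mult_self[OF ux(1)] unit_src[OF ux(2)] scale_scale[OF bunit_props(1)[OF ux(2)]]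
      scale_one[OF bunit_props(1)[OF ux(2)]] nonzero_over_norm[OF u] by (simp flip: of_real_mult of_real_power)
qed

end

section \<open>Local sections\<close>

lemma continuous_map_complex_mult:
  fixes f g :: "'a \<Rightarrow> complex"
  assumes "continuous_map Y euclidean f" "continuous_map Y euclidean g"
  shows "continuous_map Y euclidean (\<lambda>y. f y * g y)"
proof -
  have "continuous_map Y (prod_topology euclidean euclidean) (\<lambda>y. (f y, g y))"
    using assms by (rule continuous_map_pairedI)
  then have 1: "continuous_map Y euclidean (\<lambda>y. (f y, g y))" by (simp add: euclidean_product_topology)
  have 2: "continuous_map euclidean euclidean (\<lambda>p::complex \<times> complex. fst p * snd p)"
    by (auto intro!: continuous_intros)
  show ?thesis using continuous_map_compose[OF 1 2] by (simp add: o_def)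
qed

lemma continuous_map_parametric_integral:
  fixes h :: "real \<Rightarrow> 'a \<Rightarrow> 'b::banach"
  assumes h: "continuous_map (prod_topology (top_of_set {a..b}) Y) euclidean (\<lambda>(t, y). h t y)"
    and ab: "a < b"
  shows "continuous_map Y euclidean (\<lambda>y. integral {a..b} (\<lambda>t. h t y))"
proof (rule continuous_map_euclidean_eps)
  have ch: "continuous_on {a..b} (\<lambda>t. h t y)" if y: "y \<in> topspace Y" for y
  proof -
    have "continuous_map (top_of_set {a..b}) (prod_topology (top_of_set {a..b}) Y) (\<lambda>t. (t, y))"
      using y by (intro continuous_map_pairedI) (auto simp: continuous_map_id[unfolded id_def])
    from continuous_map_compose[OF this h] show ?thesis by (simp add: o_def)
  qed
  fix y0 and \<epsilon> :: real assume y0: "y0 \<in> topspace Y" and e: "\<epsilon> > 0"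
  define \<delta> where "\<delta> = \<epsilon> / (2 * (b - a))"
  have d: "\<delta> > 0" using e ab by (simp add: \<delta>_def)
  let ?T = "prod_topology (top_of_set {a..b}) Y"
  define P where "P = {p \<in> topspace ?T. (\<lambda>(t, y). h t y - h t y0) p \<in> ball 0 \<delta>}"
  have "continuous_map ?T euclidean (\<lambda>(t, y). h t y0)"
  proof -
    have "continuous_map ?T euclidean ((\<lambda>t. h t y0) \<circ> fst)"
      by (rule continuous_map_compose[OF continuous_map_fst]) (use ch[OF y0] in simp)
    then show ?thesis by (simp add: o_def case_prod_unfold)
  qed
  then have "continuous_map ?T euclidean (\<lambda>(t, y). h t y - h t y0)"
    using continuous_map_diff[OF h] by (simp add: case_prod_unfold)
  from openin_continuous_map_preimage[OF this, of "ball 0 \<delta>"]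
  have "openin ?T P" by (simp add: P_def)
  moreover have "compactin (top_of_set {a..b}) {a..b}" by (simp add: compactin_subtopology)
  moreover have "{a..b} \<times> {y0} \<subseteq> P" using y0 d by (auto simp: P_def)
  ultimately obtain U V where UV: "openin Y V" "{a..b} \<subseteq> U" "y0 \<in> V" "U \<times> V \<subseteq> P"
    using tube_lemma_left[of "top_of_set {a..b}" Y P "{a..b}" y0] y0 by blast
  have "dist (integral {a..b} (\<lambda>t. h t y)) (integral {a..b} (\<lambda>t. h t y0)) < \<epsilon>" if y: "y \<in> V" for y
  proof -
    have yt: "y \<in> topspace Y" using y openin_subset[OF UV(1)] by auto
    have "integral {a..b} (\<lambda>t. h t y) - integral {a..b} (\<lambda>t. h t y0) = integral {a..b} (\<lambda>t. h t y - h t y0)"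
      by (rule integral_diff[symmetric]) (auto intro!: integrable_continuous_real ch y0 yt)
    moreover have "norm (integral {a..b} (\<lambda>t. h t y - h t y0)) \<le> \<delta> * (b - a)"
    proof (rule integral_bound)
      show "continuous_on {a..b} (\<lambda>t. h t y - h t y0)" by (intro continuous_intros ch y0 yt)
      fix t assume "t \<in> {a..b}"
      then have "(t, y) \<in> P" using UV y by blast
      then show "norm (h t y - h t y0) \<le> \<delta>" by (simp add: P_def)
    qed (use ab in simp)
    moreover have "\<delta> * (b - a) < \<epsilon>" using ab e by (simp add: \<delta>_def field_simps)
    ultimately show ?thesis by (simp add: dist_norm)
  qed
  then show "\<exists>V. openin Y V \<and> y0 \<in> V \<and>
      (\<forall>y\<in>V. dist (integral {a..b} (\<lambda>t. h t y)) (integral {a..b} (\<lambda>t. h t y0)) < \<epsilon>)"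
    using UV by blast
qed

lemma integral_periodic_shift:
  fixes g :: "real \<Rightarrow> 'a::banach"
  assumes g: "continuous_on UNIV g" and per: "\<And>t. g (t + p) = g t" and a: "0 \<le> a" "a \<le> p"
  shows "integral {0..p} (\<lambda>t. g (t + a)) = integral {0..p} g"
proof -
  have i: "g integrable_on {c..d}" for c d
    by (rule integrable_continuous_real) (rule continuous_on_subset[OF g subset_UNIV])
  have "integral {0..p} (\<lambda>t. g (t + a)) = integral {a..p + a} g"
    using integral_shift_real_ivl[of a a "p + a" g] by simp
  also have "\<dots> = integral {a..p} g + integral {p..p + a} g"
    by (rule Henstock_Kurzweil_Integration.integral_combine[symmetric]) (use a i in auto)
  also have "integral {p..p + a} g = integral {0..a} g"
    using integral_shift_real_ivl[of p p "p + a" g] per by simp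
  also have "integral {a..p} g + integral {0..a} g = integral {0..p} g"
    using Henstock_Kurzweil_Integration.integral_combine[OF a i] by (simp add: add.commute)
  finally show ?thesis .
qed

context fell_line_bundle
begin

definition circle_over :: "'g set \<Rightarrow> 'l set" where
  "circle_over K = {u \<in> topspace (btop \<L>). proj \<L> u \<in> K \<and> bnorm \<L> u = 1}"

definition unitize :: "'l \<Rightarrow> 'l" where
  "unitize u = bscale \<L> (of_real (1 / bnorm \<L> u)) u"

lemma unitize:
  assumes "u \<in> nonzero_over V"
  shows "unitize u \<in> fibre \<L> (proj \<L> u)" "bnorm \<L> (unitize u) = 1"
proof -
  have u: "u \<in> fibre \<L> (proj \<L> u)" using assms topspace_fibre by (auto simp: nonzero_over_def)
  show "unitize u \<in> fibre \<L> (proj \<L> u)" unfolding unitize_def by (rule scale_closed[OF u])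
  show "bnorm \<L> (unitize u) = 1"
    unfolding unitize_def norm_scale[OF u] using nonzero_over_norm[OF assms] norm_nonneg[OF u] by (simp add: norm_divide)
qed

lemma topspace_nonzero_over [simp]:
  "topspace (subtopology (btop \<L>) (nonzero_over V)) = nonzero_over V"
  by (auto simp: nonzero_over_def)

lemma continuous_unitize: "continuous_map (subtopology (btop \<L>) (nonzero_over V)) (btop \<L>) unitize"
proof -
  have id: "continuous_map (subtopology (btop \<L>) (nonzero_over V)) (btop \<L>) (\<lambda>u. u)"
    by (simp add: continuous_map_from_subtopology continuous_map_id[unfolded id_def])
  have "continuous_map (subtopology (btop \<L>) (nonzero_over V)) euclideanreal (\<lambda>u. 1 / bnorm \<L> u)"
    using continuous_map_bnorm[OF id] nonzero_over_norm by (intro continuous_map_real_divide) auto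
  then show ?thesis
    unfolding unitize_def by (intro continuous_map_bscale continuous_map_complex_of_real id)
qed

lemma circle_overD:
  assumes "u \<in> circle_over K"
  shows "u \<in> fibre \<L> (proj \<L> u)" "proj \<L> u \<in> K" "bnorm \<L> u = 1" "cmod (coef u) = 1" "u \<in> topspace (btop \<L>)"
    "proj \<L> u \<in> arrows \<G>"
  using assms topspace_fibre coef_norm[OF topspace_fibre] topspace_proj by (auto simp: circle_over_def)

lemma circle_overI: "\<lbrakk>u \<in> fibre \<L> \<gamma>; \<gamma> \<in> K; bnorm \<L> u = 1\<rbrakk> \<Longrightarrow> u \<in> circle_over K"
  by (auto simp: circle_over_def fibre_def)

text \<open>Compactness of the circle bundle over a compact base: if open sets cover the circle
  \<open>T u\<close> then finitely many do, and by the tube lemma these cover \<open>T v\<close> for all \<open>v\<close> near \<open>u\<close>, hence,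
  as the projection is open, all circles over a neighbourhood of the base point.\<close>

lemma compactin_circle_over:
  assumes K: "compactin (gtop \<G>) K"
  shows "compactin (btop \<L>) (circle_over K)"
  unfolding compactin_def
proof (intro conjI allI impI)
  show "circle_over K \<subseteq> topspace (btop \<L>)" by (auto simp: circle_over_def)
  fix \<U> assume \<U>: "Ball \<U> (openin (btop \<L>)) \<and> circle_over K \<subseteq> \<Union>\<U>"
  let ?N = "subtopology (btop \<L>) (nonzero_over (arrows \<G>))"
  let ?S = "sphere 0 1 :: complex set"
  let ?T = "prod_topology (top_of_set ?S) ?N"
  have nz: "openin (btop \<L>) (nonzero_over (arrows \<G>))"
    using openin_nonzero_over openin_topspace topspace_gtop by metis
  have cont: "continuous_map ?T (btop \<L>) (\<lambda>p. bscale \<L> (fst p) (unitize (snd p)))"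
  proof (rule continuous_map_bscale)
    show "continuous_map ?T euclidean fst"
      by (rule continuous_map_into_fulltopology[OF continuous_map_fst])
    show "continuous_map ?T (btop \<L>) (\<lambda>p. unitize (snd p))"
      using continuous_map_compose[OF continuous_map_snd continuous_unitize] by (simp add: o_def)
  qed
  have loc: "\<exists>M \<F>. openin (gtop \<G>) M \<and> \<gamma> \<in> M \<and> finite \<F> \<and> \<F> \<subseteq> \<U> \<and> circle_over (M \<inter> K) \<subseteq> \<Union>\<F>" if g: "\<gamma> \<in> K" for \<gamma>
  proof -
    have ga: "\<gamma> \<in> arrows \<G>" using g compactin_subset_topspace[OF K] by auto
    let ?u = "frame \<gamma>"
    have u: "?u \<in> nonzero_over (arrows \<G>)" "proj \<L> ?u = \<gamma>"
      using frame(1)[OF ga] coef_frame[OF ga] ga fibre_topspace fibre_proj by (auto simp: nonzero_over_def)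
    have "compactin (top_of_set ?S) ?S" by (simp add: compactin_subtopology)
    moreover have "compactin ?N {?u}" using u(1) by (simp add: nonzero_over_def)
    ultimately have cmp: "compactin ?T (?S \<times> {?u})" by (simp add: compactin_Times)
    define W where "W O' = {p \<in> topspace ?T. bscale \<L> (fst p) (unitize (snd p)) \<in> O'}" for O'
    have oW: "openin ?T (W O')" if "O' \<in> \<U>" for O'
      unfolding W_def using openin_continuous_map_preimage[OF cont] \<U> that by blast
    have sub: "?S \<times> {?u} \<subseteq> \<Union>(W ` \<U>)"
    proof
      fix p assume p: "p \<in> ?S \<times> {?u}"
      then have "p \<in> topspace ?T" using u by (auto simp: nonzero_over_def)
      moreover have "bscale \<L> (fst p) (unitize (snd p)) \<in> circle_over K"
        using p unitize[OF u(1)] u(2) g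
        by (intro circle_overI[where \<gamma> = \<gamma>]) (auto simp: scale_closed norm_scale)
      ultimately show "p \<in> \<Union>(W ` \<U>)" using \<U> by (auto simp: W_def)
    qed
    have "\<exists>\<F>'. finite \<F>' \<and> \<F>' \<subseteq> W ` \<U> \<and> ?S \<times> {?u} \<subseteq> \<Union>\<F>'"
      by (rule compactinD[OF cmp _ sub]) (use oW in blast)
    then obtain \<F>' where F': "finite \<F>'" "\<F>' \<subseteq> W ` \<U>" "?S \<times> {?u} \<subseteq> \<Union>\<F>'" by metis
    then obtain \<F> where F: "finite \<F>" "\<F> \<subseteq> \<U>" "\<F>' = W ` \<F>" using finite_subset_image by metis
    have "openin ?T (\<Union>(W ` \<F>))" using oW F by blast
    then obtain A N where N: "openin ?N N" "?S \<subseteq> A" "?u \<in> N" "A \<times> N \<subseteq> \<Union>(W ` \<F>)"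
      using tube_lemma_left[OF _ \<open>compactin (top_of_set ?S) ?S\<close>, of ?N "\<Union>(W ` \<F>)" ?u] F'(3) F(3) u(1) fibre_topspace[OF frame(1)[OF ga]] by auto
    have N1: "openin (btop \<L>) N" "N \<subseteq> nonzero_over (arrows \<G>)" using N(1) openin_open_subtopology[OF nz] by auto
    have "circle_over (proj \<L> ` N \<inter> K) \<subseteq> \<Union>\<F>"
    proof
      fix w assume w: "w \<in> circle_over (proj \<L> ` N \<inter> K)"
      then obtain v where v: "v \<in> N" "proj \<L> w = proj \<L> v" using circle_overD(2) by blast
      have vn: "v \<in> nonzero_over (arrows \<G>)" using v N1 by blast
      note uv = unitize[OF vn]
      have wf: "w \<in> fibre \<L> (proj \<L> v)" using circle_overD(1)[OF w] v(2) by simp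
      have vnz: "unitize v \<noteq> bzero \<L> (proj \<L> v)" using uv norm_zero[OF fibre_arrow[OF uv(1)]] by force
      obtain c where c: "w = bscale \<L> c (unitize v)" by (rule fibre_spanned[OF uv(1) vnz wf])
      then have "cmod c = 1" using norm_scale[OF uv(1)] uv(2) circle_overD(3)[OF w] by simp
      then have "(c, v) \<in> A \<times> N" using N(2) v(1) by auto
      then have "(c, v) \<in> \<Union>(W ` \<F>)" by (rule subsetD[OF N(4)])
      then show "w \<in> \<Union>\<F>" using c by (auto simp: W_def)
    qed
    moreover have "openin (gtop \<G>) (proj \<L> ` N)" by (rule openin_proj_image[OF N1(1)])
    moreover have "\<gamma> \<in> proj \<L> ` N" using N(3) u(2) by force
    ultimately show ?thesis using F(1,2) by blast
  qed
  then obtain M \<F> where MF: "\<And>\<gamma>. \<gamma> \<in> K \<Longrightarrow> openin (gtop \<G>) (M \<gamma>) \<and> \<gamma> \<in> M \<gamma> \<and> finite (\<F> \<gamma>) \<and> \<F> \<gamma> \<subseteq> \<U>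
      \<and> circle_over (M \<gamma> \<inter> K) \<subseteq> \<Union>(\<F> \<gamma>)" by metis
  have "\<exists>\<V>. finite \<V> \<and> \<V> \<subseteq> M ` K \<and> K \<subseteq> \<Union>\<V>"
    by (rule compactinD[OF K]) (use MF in blast)+
  then obtain I where I: "finite I" "I \<subseteq> K" "K \<subseteq> \<Union>(M ` I)" by (metis finite_subset_image)
  show "\<exists>\<F>. finite \<F> \<and> \<F> \<subseteq> \<U> \<and> circle_over K \<subseteq> \<Union>\<F>"
  proof (intro exI conjI)
    show "finite (\<Union>(\<F> ` I))" using I MF by blast
    show "\<Union>(\<F> ` I) \<subseteq> \<U>" using I MF by blast
    show "circle_over K \<subseteq> \<Union>(\<Union>(\<F> ` I))"
    proof
      fix w assume w: "w \<in> circle_over K"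
      then obtain \<gamma> where g: "\<gamma> \<in> I" "proj \<L> w \<in> M \<gamma>" using I(3) circle_overD(2) by blast
      then have "w \<in> circle_over (M \<gamma> \<inter> K)" using w by (auto simp: circle_over_def)
      then show "w \<in> \<Union>(\<Union>(\<F> ` I))" using MF[of \<gamma>] g I(2) by blast
    qed
  qed
qed

text \<open>Two unit vectors \<open>u \<noteq> v\<close> of the same fibre are separated because the quotient of vectors is
  continuous: near \<open>(u, v)\<close> it differs from 1, so no vector is close to both.\<close>

lemma Hausdorff_circle_over:
  assumes U: "open_bisection \<G> U" and K: "K \<subseteq> U"
  shows "Hausdorff_space (subtopology (btop \<L>) (circle_over K))"
  unfolding Hausdorff_space_def
proof (intro allI impI)
  let ?Y = "subtopology (btop \<L>) (circle_over K)"
  have top: "topspace ?Y = circle_over K" by (auto simp: circle_over_def)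
  fix u v assume "u \<in> topspace ?Y \<and> v \<in> topspace ?Y \<and> u \<noteq> v"
  then have uv: "u \<in> circle_over K" "v \<in> circle_over K" "u \<noteq> v" using top by auto
  show "\<exists>A B. openin ?Y A \<and> openin ?Y B \<and> u \<in> A \<and> v \<in> B \<and> disjnt A B"
  proof (cases "proj \<L> u = proj \<L> v")
    case False
    have "proj \<L> u \<in> U" "proj \<L> v \<in> U" using circle_overD(2) uv K by blast+
    then have t: "proj \<L> u \<in> topspace (subtopology (gtop \<G>) U)" "proj \<L> v \<in> topspace (subtopology (gtop \<G>) U)"
      using open_bisectionD(4)[OF U] by auto
    obtain A B where AB: "openin (subtopology (gtop \<G>) U) A" "openin (subtopology (gtop \<G>) U) B"
        "proj \<L> u \<in> A" "proj \<L> v \<in> B" "disjnt A B"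
      using bisection_Hausdorff[OF U, unfolded Hausdorff_space_def, rule_format, OF conjI[OF t(1) conjI[OF t(2) False]]]
      by blast
    then have oAB: "openin (gtop \<G>) A" "openin (gtop \<G>) B"
      using openin_open_subtopology[OF open_bisectionD(1)[OF U]] by auto
    have id: "continuous_map ?Y (gtop \<G>) (proj \<L>)"
      by (rule continuous_map_from_subtopology[OF proj_continuous])
    note oY = openin_continuous_map_preimage[OF id oAB(1), unfolded top]
      openin_continuous_map_preimage[OF id oAB(2), unfolded top]
    show ?thesis
      by (rule exI[of _ "{w \<in> circle_over K. proj \<L> w \<in> A}"], rule exI[of _ "{w \<in> circle_over K. proj \<L> w \<in> B}"])
        (use oY uv(1,2) AB(3-5) in \<open>auto simp: disjnt_iff\<close>)
  next
    case True
    let ?D = "{(a, b). proj \<L> a = proj \<L> b}"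
    let ?P = "subtopology (prod_topology ?Y ?Y) ?D"
    have topP: "topspace ?P = {(a, b). a \<in> circle_over K \<and> b \<in> circle_over K \<and> proj \<L> a = proj \<L> b}"
      using top by auto
    have c1: "continuous_map ?P (btop \<L>) fst" "continuous_map ?P (btop \<L>) snd"
      by (auto intro!: continuous_map_from_subtopology
          continuous_map_into_fulltopology[OF continuous_map_fst] continuous_map_into_fulltopology[OF continuous_map_snd])
    have "continuous_map ?P euclidean (\<lambda>p. coef (fst p) / coef (snd p))"
    proof (rule continuous_map_ratio[OF c1])
      fix p assume p: "p \<in> topspace ?P"
      show "proj \<L> (fst p) = proj \<L> (snd p)" using p by auto
      have "snd p \<in> circle_over K" using p unfolding topP by auto
      then show "coef (snd p) \<noteq> 0" using circle_overD(4) by force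
    qed
    from openin_continuous_map_preimage[OF this, of "- {1}"]
    have "openin ?P {p \<in> topspace ?P. coef (fst p) / coef (snd p) \<noteq> 1}" by (simp add: open_Compl)
    then obtain N where N: "openin (prod_topology ?Y ?Y) N" "{p \<in> topspace ?P. coef (fst p) / coef (snd p) \<noteq> 1} = N \<inter> ?D"
      unfolding openin_subtopology by blast
    have "coef u \<noteq> coef v" using coef_inject[OF circle_overD(1)[OF uv(1)]] circle_overD(1)[OF uv(2)] True uv(3) by auto
    then have "coef u / coef v \<noteq> 1" by auto
    then have "(u, v) \<in> {p \<in> topspace ?P. coef (fst p) / coef (snd p) \<noteq> 1}" using uv True unfolding topP by simp
    then have uvN: "(u, v) \<in> N" unfolding N(2) by blast
    obtain A B where AB: "openin ?Y A" "openin ?Y B" "u \<in> A" "v \<in> B" "A \<times> B \<subseteq> N"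
      using N(1)[unfolded openin_prod_topology_alt, rule_format, OF uvN] by blast
    have "disjnt A B"
      unfolding disjnt_iff
    proof (intro allI notI)
      fix a assume a: "a \<in> A \<and> a \<in> B"
      then have "(a, a) \<in> N \<inter> ?D" using AB(5) by auto
      then have "coef a / coef a \<noteq> 1" unfolding N(2)[symmetric] by simp
      moreover have "a \<in> circle_over K" using a openin_subset[OF AB(1)] unfolding top by blast
      then have "coef a \<noteq> 0" using circle_overD(4)[of a K] by force
      ultimately show False by simp
    qed
    then show ?thesis using AB by blast
  qed
qed

lemma compact_neighbourhood:
  assumes "openin (gtop \<G>) W" "\<gamma> \<in> W"
  obtains U V K where "open_bisection \<G> U" "openin (gtop \<G>) V" "compactin (gtop \<G>) K" "\<gamma> \<in> V" "V \<subseteq> K" "K \<subseteq> U" "U \<subseteq> W"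
proof -
  obtain U where U: "open_bisection \<G> U" "\<gamma> \<in> U" "U \<subseteq> W" using open_bisection_basis[OF assms] .
  let ?R = "rng \<G> ` U"
  have oR: "openin (unit_top \<G>) ?R" by (rule openin_rng_image[OF open_bisectionD(1)[OF U(1)]])
  have "locally_compact_space (subtopology (unit_top \<G>) ?R)"
    using locally_compact_space_open_subset[OF _ unit_locally_compact oR] unit_Hausdorff by blast
  moreover have hom: "subtopology (gtop \<G>) U homeomorphic_space subtopology (unit_top \<G>) ?R"
    using bisection_homeomorphic[OF U(1)] homeomorphic_map_imp_homeomorphic_space by blast
  ultimately have "locally_compact_space (subtopology (gtop \<G>) U)"
    using homeomorphic_locally_compact_space by blast
  moreover have "\<gamma> \<in> topspace (subtopology (gtop \<G>) U)" using U open_bisectionD(4) by auto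
  ultimately obtain V K where VK: "openin (subtopology (gtop \<G>) U) V" "compactin (subtopology (gtop \<G>) U) K"
      "\<gamma> \<in> V" "V \<subseteq> K"
    unfolding locally_compact_space_def by blast
  show thesis
    using VK openin_open_subtopology[OF open_bisectionD(1)[OF U(1)]]
    by (intro that[OF U(1) _ _ VK(3,4) _ U(3)]) (auto simp: compactin_subtopology)
qed

text \<open>Gleason's averaging argument for free actions of compact groups, here the circle acting on
  the unit vectors. A bump function \<open>\<phi>\<close> at the unit vector \<open>e\<close> is averaged to the equivariant function
  \<open>\<Phi>\<close>, whose value at \<open>u\<close> is the integral of \<open>\<phi> (z u) / z\<close> over the circle; then the conjugate of \<open>\<Phi> u\<close>
  times \<open>u\<close> depends only on the base point of \<open>u\<close>. If \<open>\<phi>\<close> vanishes at \<open>z e\<close> whenever the real part of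
  \<open>z\<close> is not positive, then \<open>\<Phi> e\<close> has positive real part. Compactness of the circle bundle provides \<open>\<phi>\<close>
  by Urysohn's lemma.\<close>

lemma local_section:
  assumes "openin (gtop \<G>) W" "\<gamma>0 \<in> W"
  obtains U V s where "open_bisection \<G> U" "U \<subseteq> W" "openin (gtop \<G>) V" "\<gamma>0 \<in> V" "V \<subseteq> U"
    "continuous_map (subtopology (gtop \<G>) V) (btop \<L>) s" "\<And>\<gamma>. \<gamma> \<in> V \<Longrightarrow> s \<gamma> \<in> fibre \<L> \<gamma>" "s \<gamma>0 \<noteq> bzero \<L> \<gamma>0"
proof -
  obtain U V K where UVK: "open_bisection \<G> U" "openin (gtop \<G>) V" "compactin (gtop \<G>) K"
      "\<gamma>0 \<in> V" "V \<subseteq> K" "K \<subseteq> U" "U \<subseteq> W"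
    using compact_neighbourhood[OF assms] .
  have g0: "\<gamma>0 \<in> arrows \<G>" using UVK openin_subset[OF UVK(2)] by auto
  define Y where "Y = subtopology (btop \<L>) (circle_over K)"
  have top: "topspace Y = circle_over K" by (auto simp: circle_over_def Y_def)
  have Yc: "compact_space Y" unfolding Y_def
    using compactin_circle_over[OF UVK(3)] by (rule compact_space_subtopology)
  have YH: "Hausdorff_space Y" unfolding Y_def by (rule Hausdorff_circle_over[OF UVK(1,6)])
  have cr: "completely_regular_space Y"
    using compact_Hausdorff_or_regular_imp_normal_space[OF Yc] YH normal_imp_completely_regular_space by blast
  let ?e = "frame \<gamma>0"
  have e: "?e \<in> circle_over K" using frame[OF g0] UVK by (intro circle_overI[where \<gamma> = \<gamma>0]) auto
  have ef: "?e \<in> fibre \<L> \<gamma>0" using frame(1)[OF g0] .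
  have idY: "continuous_map Y (btop \<L>) (\<lambda>u. u)"
    unfolding Y_def by (simp add: continuous_map_from_subtopology continuous_map_id[unfolded id_def])
  have rot_closed: "bscale \<L> z u \<in> circle_over K" if "cmod z = 1" "u \<in> circle_over K" for z u
    using circle_overD[OF that(2)] that(1) by (intro circle_overI[where \<gamma> = "proj \<L> u"]) (auto simp: scale_closed norm_scale)
  define H where "H = {z :: complex. cmod z = 1 \<and> Re z \<le> 0}"
  define F where "F = (\<lambda>z. bscale \<L> z ?e) ` H"
  have "compact H"
  proof -
    have "H = sphere 0 1 \<inter> {z. Re z \<le> 0}" by (auto simp: H_def)
    then show ?thesis by (simp add: compact_Int_closed closed_halfspace_Re_le)
  qed
  then have "compactin (top_of_set H) H" by (simp add: compactin_subtopology)
  moreover have "continuous_map (top_of_set H) (btop \<L>) (\<lambda>z. bscale \<L> z ?e)"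
    using ef fibre_topspace by (intro continuous_map_bscale) (auto simp: continuous_map_id[unfolded id_def])
  then have "continuous_map (top_of_set H) Y (\<lambda>z. bscale \<L> z ?e)"
    using rot_closed[OF _ e] by (auto simp: Y_def continuous_map_in_subtopology H_def)
  ultimately have "compactin Y F" unfolding F_def using image_compactin by blast
  then have "closedin Y F" using compactin_imp_closedin[OF YH] by blast
  moreover have "disjnt {?e} F"
  proof -
    have "?e \<noteq> bscale \<L> z ?e" if "z \<in> H" for z
    proof
      assume "?e = bscale \<L> z ?e"
      then have "z = 1" using scale_inject[OF ef frame_nonzero[OF g0], of 1 z] scale_one[OF ef] by simp
      then show False using that by (simp add: H_def)
    qed
    then show ?thesis by (auto simp: F_def)
  qed
  moreover have "compactin Y {?e}" using e top by simp
  ultimately obtain \<phi> where \<phi>: "continuous_map Y (top_of_set {0..1::real}) \<phi>" "\<phi> ` F \<subseteq> {0}" "\<phi> ` {?e} \<subseteq> {1}"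
    using Urysohn_completely_regular_compact_closed[of 0 1, OF _ cr] by (metis zero_le_one)
  have \<phi>c: "continuous_map Y euclideanreal \<phi>" using \<phi>(1) by (simp add: continuous_map_in_subtopology)
  have \<phi>0: "0 \<le> \<phi> u" if "u \<in> circle_over K" for u
    using \<phi>(1) that top by (auto simp: continuous_map_in_subtopology Pi_iff)
  define h where "h t u = of_real (\<phi> (bscale \<L> (cis t) u)) * cis (- t)" for t u
  define \<Phi> where "\<Phi> u = integral {0..2*pi} (\<lambda>t. h t u)" for u
  have rot: "continuous_map (prod_topology Z Y) Y (\<lambda>p. bscale \<L> (f (fst p)) (snd p))"
    if "continuous_map Z euclidean f" "\<And>z. z \<in> topspace Z \<Longrightarrow> cmod (f z) = 1" for Z and f :: "real \<Rightarrow> complex"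
  proof -
    have "continuous_map (prod_topology Z Y) (btop \<L>) (\<lambda>p. bscale \<L> (f (fst p)) (snd p))"
    proof (rule continuous_map_bscale)
      show "continuous_map (prod_topology Z Y) euclidean (\<lambda>p. f (fst p))"
        using continuous_map_compose[OF continuous_map_fst that(1)] by (simp add: o_def)
      show "continuous_map (prod_topology Z Y) (btop \<L>) snd"
        using continuous_map_compose[OF continuous_map_snd idY] by (simp add: o_def)
    qed
    then show ?thesis
      unfolding Y_def continuous_map_in_subtopology using rot_closed that(2) top by (auto simp: Y_def)
  qed
  have hc: "continuous_map (prod_topology Z Y) euclidean (\<lambda>(t, u). h t u)" if Z: "Z = top_of_set A" for Z A
  proof -
    have c: "continuous_map Z euclidean (cis :: real \<Rightarrow> complex)" "continuous_map Z euclidean (\<lambda>t. cis (- t))"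
      unfolding Z by (auto intro!: continuous_intros)
    have "continuous_map (prod_topology Z Y) Y (\<lambda>p. bscale \<L> (cis (fst p)) (snd p))"
      by (rule rot[OF c(1)]) simp
    from continuous_map_complex_of_real[OF continuous_map_compose[OF this \<phi>c, unfolded o_def]]
    have "continuous_map (prod_topology Z Y) euclidean (\<lambda>p. complex_of_real (\<phi> (bscale \<L> (cis (fst p)) (snd p))))" .
    moreover have "continuous_map (prod_topology Z Y) euclidean (\<lambda>p. cis (- fst p))"
      using continuous_map_compose[OF continuous_map_fst c(2)] by (simp add: o_def)
    ultimately show ?thesis
      unfolding h_def case_prod_unfold by (rule continuous_map_complex_mult)
  qed
  have \<Phi>c: "continuous_map Y euclidean \<Phi>"
    unfolding \<Phi>_def by (rule continuous_map_parametric_integral[OF hc]) auto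
  have hcont: "continuous_on A (\<lambda>t. h t u)" if u: "u \<in> circle_over K" for u A
  proof -
    have "continuous_map (top_of_set A) (prod_topology (top_of_set A) Y) (\<lambda>t. (t, u))"
      using u top by (intro continuous_map_pairedI) (auto simp: continuous_map_id[unfolded id_def])
    from continuous_map_compose[OF this hc[OF refl]] show ?thesis by (simp add: o_def)
  qed
  have equiv: "\<Phi> (bscale \<L> w u) = w * \<Phi> u" if u: "u \<in> circle_over K" and w: "cmod w = 1" for w u
  proof -
    obtain a where a: "0 \<le> a" "a < 2 * pi" "w = cis a"
      using complex_unimodular_polar[OF w] by (metis cis.ctr complex_eq_iff complex.sel)
    have "h t (bscale \<L> w u) = w * h (t + a) u" for t
      using scale_scale[OF circle_overD(1)[OF u], of "cis t" w] a(3)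
      by (simp add: h_def cis_mult ac_simps flip: cis_cnj)
    then have "\<Phi> (bscale \<L> w u) = w * integral {0..2*pi} (\<lambda>t. h (t + a) u)"
      by (simp add: \<Phi>_def)
    also have "integral {0..2*pi} (\<lambda>t. h (t + a) u) = \<Phi> u"
      unfolding \<Phi>_def
    proof (rule integral_periodic_shift)
      show "continuous_on UNIV (\<lambda>t. h t u)" by (rule hcont[OF u])
      show "h (t + 2 * pi) u = h t u" for t
        by (simp add: h_def flip: cis_mult cis_divide)
    qed (use a in auto)
    finally show ?thesis .
  qed
  have \<Phi>e: "\<Phi> ?e \<noteq> 0"
  proof
    assume "\<Phi> ?e = 0"
    moreover have "Re (\<Phi> ?e) = integral {0..2*pi} (\<lambda>t. Re (h t ?e))"
      unfolding \<Phi>_def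
      using integral_linear[OF integrable_continuous_real[OF hcont[OF e]] bounded_linear_Re]
      by (simp add: o_def)
    ultimately have "integral {0..2*pi} (\<lambda>t. Re (h t ?e)) = 0" by simp
    moreover have "Re (h t ?e) \<ge> 0" for t
    proof (cases "cos t \<ge> 0")
      case True
      then show ?thesis using \<phi>0[OF rot_closed[OF _ e]] by (simp add: h_def)
    next
      case False
      then have "bscale \<L> (cis t) ?e \<in> F" by (auto simp: F_def H_def)
      then have "\<phi> (bscale \<L> (cis t) ?e) = 0" using \<phi>(2) by blast
      then show ?thesis by (simp add: h_def)
    qed
    moreover have "continuous_on {0..2*pi} (\<lambda>t. Re (h t ?e))" by (intro continuous_on_Re hcont e)
    ultimately have "\<forall>t\<in>{0..2*pi}. Re (h t ?e) = 0"
      using integral_eq_0_iff[of 0 "2*pi" "\<lambda>t. Re (h t ?e)"] by simp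
    then have "Re (h 0 ?e) = 0" by simp
    moreover have "h 0 ?e = 1" using \<phi>(3) scale_one[OF ef] by (simp add: h_def)
    ultimately show False by simp
  qed
  define s where "s \<gamma> = bscale \<L> (cnj (\<Phi> (frame \<gamma>))) (frame \<gamma>)" for \<gamma>
  let ?N = "subtopology (btop \<L>) (nonzero_over V)"
  have uc: "unitize u \<in> circle_over K" if "u \<in> nonzero_over V" for u
    using unitize[OF that] that UVK(5) by (intro circle_overI[where \<gamma> = "proj \<L> u"]) (auto simp: nonzero_over_def)
  have "continuous_map (subtopology (gtop \<G>) V) (btop \<L>) s"
  proof (rule continuous_map_descends[OF UVK(2)])
    have "continuous_map ?N Y unitize"
      unfolding Y_def continuous_map_in_subtopology using continuous_unitize uc by auto
    from continuous_map_compose[OF this \<Phi>c] have "continuous_map ?N euclidean (\<lambda>u. \<Phi> (unitize u))"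
      by (simp add: o_def)
    from continuous_map_compose[OF this, of euclidean cnj]
    have "continuous_map ?N euclidean (\<lambda>u. cnj (\<Phi> (unitize u)))"
      by (simp add: o_def continuous_on_cnj)
    then show "continuous_map ?N (btop \<L>) (\<lambda>u. bscale \<L> (cnj (\<Phi> (unitize u))) (unitize u))"
      by (rule continuous_map_bscale[OF _ continuous_unitize])
    fix u assume u: "u \<in> nonzero_over V"
    let ?\<gamma> = "proj \<L> u"
    note uu = unitize[OF u]
    have g: "?\<gamma> \<in> arrows \<G>" "?\<gamma> \<in> V" using fibre_arrow[OF uu(1)] u by (auto simp: nonzero_over_def)
    note f = frame[OF g(1)]
    obtain w where w: "unitize u = bscale \<L> w (frame ?\<gamma>)"
      by (rule fibre_spanned[OF f(1) frame_nonzero[OF g(1)] uu(1)])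
    have w1: "cmod w = 1" using norm_scale[OF f(1)] f(2) uu(2) w by simp
    have fc: "frame ?\<gamma> \<in> circle_over K" using f g UVK(5) by (intro circle_overI[where \<gamma> = ?\<gamma>]) auto
    have "bscale \<L> (cnj (\<Phi> (unitize u))) (unitize u)
        = bscale \<L> (cnj (w * \<Phi> (frame ?\<gamma>)) * w) (frame ?\<gamma>)"
      unfolding w equiv[OF fc w1] by (rule scale_scale[OF f(1)])
    also have "cnj (w * \<Phi> (frame ?\<gamma>)) * w = cnj (\<Phi> (frame ?\<gamma>)) * (w * cnj w)" by (simp add: ac_simps)
    also have "w * cnj w = 1" using w1 by (simp add: complex_norm_square[symmetric])
    finally show "bscale \<L> (cnj (\<Phi> (unitize u))) (unitize u) = s ?\<gamma>" by (simp add: s_def)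
  qed
  moreover have "s \<gamma> \<in> fibre \<L> \<gamma>" if "\<gamma> \<in> V" for \<gamma>
    using scale_closed frame(1) openin_subset[OF UVK(2)] that unfolding s_def by auto
  moreover have "s \<gamma>0 \<noteq> bzero \<L> \<gamma>0"
    using coef_scale_frame[OF g0, of "cnj (\<Phi> ?e)"] \<Phi>e coef_zero[OF g0] unfolding s_def by auto
  ultimately show thesis using that[OF UVK(1,7,2,4)] UVK(5,6) by blast
qed

end

section \<open>The convolution algebra in coordinates\<close>

context fell_line_bundle
begin

lemma sections_onD: "\<lbrakk>f \<in> sections_on \<L> S; \<gamma> \<in> S\<rbrakk> \<Longrightarrow> f \<gamma> \<in> fibre \<L> \<gamma>"
  by (auto simp: sections_on_def)

lemma sections_eqI:
  assumes "f \<in> sections_on \<L> S" "g \<in> sections_on \<L> S" "\<And>\<gamma>. \<gamma> \<in> S \<Longrightarrow> coef (f \<gamma>) = coef (g \<gamma>)"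
  shows "f = g"
  using assms unfolding sections_on_def
  by (intro PiE_ext[OF assms(1,2)[unfolded sections_on_def]] coef_inject) auto

lemma coef_finprod:
  assumes "\<gamma> \<in> arrows \<G>" "finite I" "\<And>i. i \<in> I \<Longrightarrow> h i \<in> fibre \<L> \<gamma>"
  shows "finprod (fibre_group \<L> \<gamma>) h I \<in> fibre \<L> \<gamma> \<and>
    coef (finprod (fibre_group \<L> \<gamma>) h I) = (\<Sum>i\<in>I. coef (h i))"
proof -
  interpret comm_group "fibre_group \<L> \<gamma>" using fibre_comm_group assms by blast
  show ?thesis
    using assms(2,3)
  proof (induction I rule: finite_induct)
    case empty
    then show ?case using assms(1) by (simp add: coef_zero zero_closed)
  next
    case (insert i I)
    then have "finprod (fibre_group \<L> \<gamma>) h (insert i I) = badd \<L> (h i) (finprod (fibre_group \<L> \<gamma>) h I)"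
      by (subst finprod_insert) auto
    then show ?case using insert by (simp add: add_closed coef_add[of _ \<gamma>])
  qed
qed

text \<open>The factorizations \<open>\<gamma> = \<alpha> \<beta>\<close> are parametrized by \<open>\<alpha>\<close>, as \<open>\<beta>\<close> is the product of the inverse
  of \<open>\<alpha>\<close> with \<open>\<gamma>\<close>.\<close>

definition quot :: "'g \<Rightarrow> 'g \<Rightarrow> 'g" where
  "quot \<alpha> \<gamma> = gmul \<G> (ginv \<G> \<alpha>) \<gamma>"

lemma quot:
  assumes "\<alpha> \<in> arrows \<G>" "\<gamma> \<in> arrows \<G>" "rng \<G> \<alpha> = rng \<G> \<gamma>"
  shows "quot \<alpha> \<gamma> \<in> arrows \<G>" "rng \<G> (quot \<alpha> \<gamma>) = src \<G> \<alpha>" "src \<G> (quot \<alpha> \<gamma>) = src \<G> \<gamma>"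
    "(\<alpha>, quot \<alpha> \<gamma>) \<in> composable \<G>" "gmul \<G> \<alpha> (quot \<alpha> \<gamma>) = \<gamma>"
proof -
  have c: "(ginv \<G> \<alpha>, \<gamma>) \<in> composable \<G>" using assms by (intro composableI) (auto simp: inv_closed src_inv)
  show q: "quot \<alpha> \<gamma> \<in> arrows \<G>" "rng \<G> (quot \<alpha> \<gamma>) = src \<G> \<alpha>" "src \<G> (quot \<alpha> \<gamma>) = src \<G> \<gamma>"
    unfolding quot_def using mul_closed[OF c] rng_mul[OF c] src_mul[OF c] rng_inv assms(1) by auto
  show "(\<alpha>, quot \<alpha> \<gamma>) \<in> composable \<G>" using q assms by (intro composableI) auto
  show "gmul \<G> \<alpha> (quot \<alpha> \<gamma>) = \<gamma>" unfolding quot_def by (rule mul_inv_cancel[OF assms])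
qed

lemma quot_gmul: "(\<alpha>, \<beta>) \<in> composable \<G> \<Longrightarrow> quot \<alpha> (gmul \<G> \<alpha> \<beta>) = \<beta>"
  unfolding quot_def by (rule inv_mul_cancel)

lemma conv_at_sum:
  assumes g: "\<gamma> \<in> arrows \<G>"
    and f: "\<And>\<alpha>. \<lbrakk>\<alpha> \<in> arrows \<G>; rng \<G> \<alpha> = rng \<G> \<gamma>\<rbrakk> \<Longrightarrow> f \<alpha> \<in> fibre \<L> \<alpha>"
    and h: "\<And>\<beta>. \<lbrakk>\<beta> \<in> arrows \<G>; src \<G> \<beta> = src \<G> \<gamma>\<rbrakk> \<Longrightarrow> h \<beta> \<in> fibre \<L> \<beta>"
    and A: "finite A" "A \<subseteq> {\<alpha> \<in> arrows \<G>. rng \<G> \<alpha> = rng \<G> \<gamma>}"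
    and z: "\<And>\<alpha>. \<lbrakk>\<alpha> \<in> arrows \<G>; rng \<G> \<alpha> = rng \<G> \<gamma>; \<alpha> \<notin> A\<rbrakk> \<Longrightarrow> coef (f \<alpha>) * coef (h (quot \<alpha> \<gamma>)) = 0"
  shows "conv_at \<G> \<L> f h \<gamma> \<in> fibre \<L> \<gamma>"
    "coef (conv_at \<G> \<L> f h \<gamma>) = (\<Sum>\<alpha>\<in>A. coef (f \<alpha>) * coef (h (quot \<alpha> \<gamma>)) * cocycle \<alpha> (quot \<alpha> \<gamma>))"
proof -
  let ?I = "{(\<alpha>, \<beta>) \<in> composable \<G>. gmul \<G> \<alpha> \<beta> = \<gamma> \<and> bmult \<L> (f \<alpha>) (h \<beta>) \<noteq> bzero \<L> \<gamma>}"
  let ?J = "(\<lambda>\<alpha>. (\<alpha>, quot \<alpha> \<gamma>)) ` A"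
  let ?m = "\<lambda>(\<alpha>, \<beta>). bmult \<L> (f \<alpha>) (h \<beta>)"
  have fac: "\<alpha> \<in> arrows \<G> \<and> rng \<G> \<alpha> = rng \<G> \<gamma> \<and> \<beta> = quot \<alpha> \<gamma>"
    if "(\<alpha>, \<beta>) \<in> composable \<G>" "gmul \<G> \<alpha> \<beta> = \<gamma>" for \<alpha> \<beta>
    using that quot_gmul[OF that(1)] rng_mul[OF that(1)] composableD[OF that(1)] by auto
  have m: "bmult \<L> (f \<alpha>) (h (quot \<alpha> \<gamma>)) \<in> fibre \<L> \<gamma>"
      "coef (bmult \<L> (f \<alpha>) (h (quot \<alpha> \<gamma>))) = coef (f \<alpha>) * coef (h (quot \<alpha> \<gamma>)) * cocycle \<alpha> (quot \<alpha> \<gamma>)"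
    if a: "\<alpha> \<in> arrows \<G>" "rng \<G> \<alpha> = rng \<G> \<gamma>" for \<alpha>
  proof -
    note q = quot[OF a(1) g a(2)]
    show "bmult \<L> (f \<alpha>) (h (quot \<alpha> \<gamma>)) \<in> fibre \<L> \<gamma>"
      using mult_closed[OF q(4) f[OF a] h[OF q(1,3)]] q(5) by simp
    show "coef (bmult \<L> (f \<alpha>) (h (quot \<alpha> \<gamma>))) = coef (f \<alpha>) * coef (h (quot \<alpha> \<gamma>)) * cocycle \<alpha> (quot \<alpha> \<gamma>)"
      by (rule coef_mult[OF q(4) f[OF a] h[OF q(1,3)]])
  qed
  have IJ: "?I \<subseteq> ?J"
  proof
    fix p assume p: "p \<in> ?I"
    then obtain \<alpha> \<beta> where ab: "p = (\<alpha>, \<beta>)" "(\<alpha>, \<beta>) \<in> composable \<G>" "gmul \<G> \<alpha> \<beta> = \<gamma>"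
        "bmult \<L> (f \<alpha>) (h \<beta>) \<noteq> bzero \<L> \<gamma>" by blast
    note fa = fac[OF ab(2,3)]
    have "\<alpha> \<in> A"
    proof (rule ccontr)
      assume "\<alpha> \<notin> A"
      then have "coef (bmult \<L> (f \<alpha>) (h \<beta>)) = 0" using z m(2) fa by auto
      then show False using coef_eq_0_iff[OF m(1)] fa ab(4) by auto
    qed
    then show "p \<in> ?J" using ab(1) fa by auto
  qed
  have finI: "finite ?I" by (rule finite_subset[OF IJ]) (simp add: A(1))
  have cm: "conv_at \<G> \<L> f h \<gamma> \<in> fibre \<L> \<gamma> \<and> coef (conv_at \<G> \<L> f h \<gamma>) = (\<Sum>p\<in>?I. coef (?m p))"
    unfolding conv_at_def
  proof (rule coef_finprod[OF g finI])
    fix p assume "p \<in> ?I"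
    then obtain \<alpha> \<beta> where ab: "p = (\<alpha>, \<beta>)" "(\<alpha>, \<beta>) \<in> composable \<G>" "gmul \<G> \<alpha> \<beta> = \<gamma>" by blast
    show "?m p \<in> fibre \<L> \<gamma>" using m(1)[of \<alpha>] fac[OF ab(2,3)] ab(1) by simp
  qed
  have "(\<Sum>p\<in>?I. coef (?m p)) = (\<Sum>p\<in>?J. coef (?m p))"
  proof (rule sum.mono_neutral_left)
    show "\<forall>p\<in>?J - ?I. coef (?m p) = 0"
    proof
      fix p assume p: "p \<in> ?J - ?I"
      then obtain \<alpha> where a: "\<alpha> \<in> A" "p = (\<alpha>, quot \<alpha> \<gamma>)" by blast
      then have a': "\<alpha> \<in> arrows \<G>" "rng \<G> \<alpha> = rng \<G> \<gamma>" using A(2) by auto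
      then have "bmult \<L> (f \<alpha>) (h (quot \<alpha> \<gamma>)) = bzero \<L> \<gamma>" using p a(2) quot[OF a'(1) g a'(2)] by auto
      then show "coef (?m p) = 0" using a(2) coef_zero[OF g] by simp
    qed
  qed (use IJ A(1) in auto)
  also have "\<dots> = (\<Sum>\<alpha>\<in>A. coef (bmult \<L> (f \<alpha>) (h (quot \<alpha> \<gamma>))))"
    by (subst sum.reindex) (auto simp: inj_on_def)
  also have "\<dots> = (\<Sum>\<alpha>\<in>A. coef (f \<alpha>) * coef (h (quot \<alpha> \<gamma>)) * cocycle \<alpha> (quot \<alpha> \<gamma>))"
    by (rule sum.cong[OF refl]) (use m(2) A(2) in auto)
  finally show "coef (conv_at \<G> \<L> f h \<gamma>) = (\<Sum>\<alpha>\<in>A. coef (f \<alpha>) * coef (h (quot \<alpha> \<gamma>)) * cocycle \<alpha> (quot \<alpha> \<gamma>))"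
    using cm by simp
  show "conv_at \<G> \<L> f h \<gamma> \<in> fibre \<L> \<gamma>" using cm by blast
qed

text \<open>Conditions under which the convolution by \<open>f\<close> is bounded on the spaces \<open>\<ell>\<^sup>2\<close> over all source
  fibres at once: its matrices have finite rows and columns, and the bound of Schur's test does not
  depend on the fibre. Bounding all finite partial sums makes this
  condition visibly stable under addition.\<close>

definition schur_bounded :: "('g \<Rightarrow> 'l) \<Rightarrow> real \<Rightarrow> bool" where
  "schur_bounded f C \<longleftrightarrow> (\<forall>A x. finite A \<and> A \<subseteq> arrows \<G> \<and> (src \<G> ` A \<subseteq> {x} \<or> rng \<G> ` A \<subseteq> {x})
     \<longrightarrow> (\<Sum>\<gamma>\<in>A. cmod (coef (f \<gamma>))) \<le> C)"

definition tame :: "('g \<Rightarrow> 'l) \<Rightarrow> bool" where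
  "tame f \<longleftrightarrow> f \<in> sections_on \<L> (arrows \<G>)
     \<and> (\<forall>x. finite {\<gamma> \<in> arrows \<G>. src \<G> \<gamma> = x \<and> coef (f \<gamma>) \<noteq> 0}
          \<and> finite {\<gamma> \<in> arrows \<G>. rng \<G> \<gamma> = x \<and> coef (f \<gamma>) \<noteq> 0})
     \<and> (\<exists>C. schur_bounded f C)"

lemma tameD:
  assumes "tame f"
  shows "f \<in> sections_on \<L> (arrows \<G>)" "\<gamma> \<in> arrows \<G> \<Longrightarrow> f \<gamma> \<in> fibre \<L> \<gamma>"
    "finite {\<gamma> \<in> arrows \<G>. src \<G> \<gamma> = x \<and> coef (f \<gamma>) \<noteq> 0}"
    "finite {\<gamma> \<in> arrows \<G>. rng \<G> \<gamma> = x \<and> coef (f \<gamma>) \<noteq> 0}"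
  using assms sections_onD by (auto simp: tame_def)

definition conv_support :: "('g \<Rightarrow> 'l) \<Rightarrow> 'g \<Rightarrow> 'g set" where
  "conv_support f \<gamma> = {\<alpha> \<in> arrows \<G>. rng \<G> \<alpha> = rng \<G> \<gamma> \<and> coef (f \<alpha>) \<noteq> 0}"

lemma tame_conv:
  assumes f: "tame f" and g: "\<gamma> \<in> arrows \<G>"
    and h: "\<And>\<beta>. \<lbrakk>\<beta> \<in> arrows \<G>; src \<G> \<beta> = src \<G> \<gamma>\<rbrakk> \<Longrightarrow> h \<beta> \<in> fibre \<L> \<beta>"
    and A: "finite A" "A \<subseteq> {\<alpha> \<in> arrows \<G>. rng \<G> \<alpha> = rng \<G> \<gamma>}" "conv_support f \<gamma> \<subseteq> A"
  shows "conv_at \<G> \<L> f h \<gamma> \<in> fibre \<L> \<gamma>"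
    "coef (conv_at \<G> \<L> f h \<gamma>) = (\<Sum>\<alpha>\<in>A. coef (f \<alpha>) * coef (h (quot \<alpha> \<gamma>)) * cocycle \<alpha> (quot \<alpha> \<gamma>))"
proof -
  have z: "coef (f \<alpha>) * coef (h (quot \<alpha> \<gamma>)) = 0" if "\<alpha> \<in> arrows \<G>" "rng \<G> \<alpha> = rng \<G> \<gamma>" "\<alpha> \<notin> A" for \<alpha>
    using that A(3) unfolding conv_support_def by auto
  show "conv_at \<G> \<L> f h \<gamma> \<in> fibre \<L> \<gamma>"
    by (rule conv_at_sum(1)[OF g tameD(2)[OF f] h A(1,2) z])
  show "coef (conv_at \<G> \<L> f h \<gamma>) = (\<Sum>\<alpha>\<in>A. coef (f \<alpha>) * coef (h (quot \<alpha> \<gamma>)) * cocycle \<alpha> (quot \<alpha> \<gamma>))"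
    by (rule conv_at_sum(2)[OF g tameD(2)[OF f] h A(1,2) z])
qed

lemma tame_mult_section:
  assumes "tame f" "h \<in> sections_on \<L> (arrows \<G>)"
  shows "sec_mult \<G> \<L> f h \<in> sections_on \<L> (arrows \<G>)"
  unfolding sec_mult_def sections_on_def
proof (rule restrict_PiE_iff[THEN iffD2], intro ballI)
  fix \<gamma> assume g: "\<gamma> \<in> arrows \<G>"
  show "conv_at \<G> \<L> f h \<gamma> \<in> fibre \<L> \<gamma>"
    by (rule tame_conv(1)[OF assms(1) g, of h "conv_support f \<gamma>"])
      (use sections_onD[OF assms(2)] tameD(4)[OF assms(1)] in \<open>auto simp: conv_support_def\<close>)
qed

lemma tame_mult_coef:
  assumes "tame f" "h \<in> sections_on \<L> (arrows \<G>)" "\<gamma> \<in> arrows \<G>"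
    "finite A" "A \<subseteq> {\<alpha> \<in> arrows \<G>. rng \<G> \<alpha> = rng \<G> \<gamma>}" "conv_support f \<gamma> \<subseteq> A"
  shows "coef (sec_mult \<G> \<L> f h \<gamma>) = (\<Sum>\<alpha>\<in>A. coef (f \<alpha>) * coef (h (quot \<alpha> \<gamma>)) * cocycle \<alpha> (quot \<alpha> \<gamma>))"
  using tame_conv(2)[OF assms(1,3) _ assms(4-6), of h] sections_onD[OF assms(2)] assms(3)
  by (simp add: sec_mult_def)

lemma sec_add_section:
  "\<lbrakk>f \<in> sections_on \<L> (arrows \<G>); g \<in> sections_on \<L> (arrows \<G>)\<rbrakk> \<Longrightarrow> sec_add \<G> \<L> f g \<in> sections_on \<L> (arrows \<G>)"
  by (auto simp: sec_add_def sections_on_def intro!: add_closed)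

lemma sec_add_coef:
  "\<lbrakk>f \<in> sections_on \<L> (arrows \<G>); g \<in> sections_on \<L> (arrows \<G>); \<gamma> \<in> arrows \<G>\<rbrakk>
    \<Longrightarrow> coef (sec_add \<G> \<L> f g \<gamma>) = coef (f \<gamma>) + coef (g \<gamma>)"
  using coef_add[OF sections_onD sections_onD] by (simp add: sec_add_def)

lemma sec_scale_section:
  "f \<in> sections_on \<L> (arrows \<G>) \<Longrightarrow> sec_scale \<G> \<L> c f \<in> sections_on \<L> (arrows \<G>)"
  by (auto simp: sec_scale_def sections_on_def intro!: scale_closed)

lemma sec_scale_coef:
  "\<lbrakk>f \<in> sections_on \<L> (arrows \<G>); \<gamma> \<in> arrows \<G>\<rbrakk> \<Longrightarrow> coef (sec_scale \<G> \<L> c f \<gamma>) = c * coef (f \<gamma>)"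
  using coef_scale[OF sections_onD] by (simp add: sec_scale_def)

lemma sec_star_section:
  assumes "f \<in> sections_on \<L> (arrows \<G>)" shows "sec_star \<G> \<L> f \<in> sections_on \<L> (arrows \<G>)"
proof -
  have "bstar \<L> (f (ginv \<G> \<gamma>)) \<in> fibre \<L> \<gamma>" if "\<gamma> \<in> arrows \<G>" for \<gamma>
    using star_closed[OF inv_closed[OF that] sections_onD[OF assms inv_closed[OF that]]] inv_inv[OF that] by simp
  then show ?thesis by (auto simp: sec_star_def sections_on_def)
qed

lemma sec_star_coef:
  assumes "f \<in> sections_on \<L> (arrows \<G>)" "\<gamma> \<in> arrows \<G>"
  shows "coef (sec_star \<G> \<L> f \<gamma>) = cnj (coef (f (ginv \<G> \<gamma>))) * coef (bstar \<L> (frame (ginv \<G> \<gamma>)))"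
  using coef_star[OF sections_onD[OF assms(1) inv_closed[OF assms(2)]]] assms(2) by (simp add: sec_star_def)

lemma cmod_sec_star_coef:
  assumes "f \<in> sections_on \<L> (arrows \<G>)" "\<gamma> \<in> arrows \<G>"
  shows "cmod (coef (sec_star \<G> \<L> f \<gamma>)) = cmod (coef (f (ginv \<G> \<gamma>)))"
proof -
  note i = inv_closed[OF assms(2)]
  have "cmod (coef (bstar \<L> (frame (ginv \<G> \<gamma>)))) = 1"
    using coef_norm[OF star_closed[OF i frame(1)[OF i]]] norm_star[OF frame(1)[OF i]] frame(2)[OF i] by simp
  then show ?thesis unfolding sec_star_coef[OF assms] by (simp add: Real_Vector_Spaces.norm_mult)
qed

lemma tame_add:
  assumes f: "tame f" and g: "tame g" shows "tame (sec_add \<G> \<L> f g)"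
  unfolding tame_def
proof (intro conjI allI)
  note s = tameD(1)[OF f] tameD(1)[OF g]
  note c = sec_add_coef[OF s]
  show "sec_add \<G> \<L> f g \<in> sections_on \<L> (arrows \<G>)" by (rule sec_add_section[OF s])
  show "finite {\<gamma> \<in> arrows \<G>. src \<G> \<gamma> = x \<and> coef (sec_add \<G> \<L> f g \<gamma>) \<noteq> 0}" for x
    by (rule finite_subset[OF _ finite_UnI[OF tameD(3)[OF f, of x] tameD(3)[OF g, of x]]]) (auto simp: c)
  show "finite {\<gamma> \<in> arrows \<G>. rng \<G> \<gamma> = x \<and> coef (sec_add \<G> \<L> f g \<gamma>) \<noteq> 0}" for x
    by (rule finite_subset[OF _ finite_UnI[OF tameD(4)[OF f, of x] tameD(4)[OF g, of x]]]) (auto simp: c)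
  obtain C D where CD: "schur_bounded f C" "schur_bounded g D" using f g by (auto simp: tame_def)
  have "(\<Sum>\<gamma>\<in>A. cmod (coef (sec_add \<G> \<L> f g \<gamma>))) \<le> C + D"
    if A: "finite A" "A \<subseteq> arrows \<G>" "src \<G> ` A \<subseteq> {x} \<or> rng \<G> ` A \<subseteq> {x}" for A x
  proof -
    have "(\<Sum>\<gamma>\<in>A. cmod (coef (sec_add \<G> \<L> f g \<gamma>))) \<le> (\<Sum>\<gamma>\<in>A. cmod (coef (f \<gamma>)) + cmod (coef (g \<gamma>)))"
      using A(2) by (intro sum_mono) (auto simp: c subset_iff intro: norm_triangle_ineq)
    also have "\<dots> = (\<Sum>\<gamma>\<in>A. cmod (coef (f \<gamma>))) + (\<Sum>\<gamma>\<in>A. cmod (coef (g \<gamma>)))" by (rule sum.distrib)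
    also have "\<dots> \<le> C + D" using CD A unfolding schur_bounded_def by (intro add_mono) blast+
    finally show ?thesis .
  qed
  then show "\<exists>C. schur_bounded (sec_add \<G> \<L> f g) C" unfolding schur_bounded_def by blast
qed

lemma tame_scale:
  assumes f: "tame f" shows "tame (sec_scale \<G> \<L> k f)"
  unfolding tame_def
proof (intro conjI allI)
  note s = tameD(1)[OF f]
  note c = sec_scale_coef[OF s]
  show "sec_scale \<G> \<L> k f \<in> sections_on \<L> (arrows \<G>)" by (rule sec_scale_section[OF s])
  show "finite {\<gamma> \<in> arrows \<G>. src \<G> \<gamma> = x \<and> coef (sec_scale \<G> \<L> k f \<gamma>) \<noteq> 0}" for x
    by (rule finite_subset[OF _ tameD(3)[OF f, of x]]) (auto simp: c)
  show "finite {\<gamma> \<in> arrows \<G>. rng \<G> \<gamma> = x \<and> coef (sec_scale \<G> \<L> k f \<gamma>) \<noteq> 0}" for x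
    by (rule finite_subset[OF _ tameD(4)[OF f, of x]]) (auto simp: c)
  obtain C where C: "schur_bounded f C" using f by (auto simp: tame_def)
  have "(\<Sum>\<gamma>\<in>A. cmod (coef (sec_scale \<G> \<L> k f \<gamma>))) \<le> cmod k * C"
    if A: "finite A" "A \<subseteq> arrows \<G>" "src \<G> ` A \<subseteq> {x} \<or> rng \<G> ` A \<subseteq> {x}" for A x
  proof -
    have "(\<Sum>\<gamma>\<in>A. cmod (coef (sec_scale \<G> \<L> k f \<gamma>))) = cmod k * (\<Sum>\<gamma>\<in>A. cmod (coef (f \<gamma>)))"
      unfolding sum_distrib_left using A(2) by (intro sum.cong) (auto simp: c subset_iff Real_Vector_Spaces.norm_mult)
    also have "\<dots> \<le> cmod k * C" using C A unfolding schur_bounded_def by (intro mult_left_mono) auto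
    finally show ?thesis .
  qed
  then show "\<exists>C. schur_bounded (sec_scale \<G> \<L> k f) C" unfolding schur_bounded_def by blast
qed

lemma tame_star:
  assumes f: "tame f" shows "tame (sec_star \<G> \<L> f)"
  unfolding tame_def
proof (intro conjI allI)
  note s = tameD(1)[OF f]
  note c = cmod_sec_star_coef[OF s]
  have c0: "coef (sec_star \<G> \<L> f \<gamma>) \<noteq> 0 \<longleftrightarrow> coef (f (ginv \<G> \<gamma>)) \<noteq> 0" if "\<gamma> \<in> arrows \<G>" for \<gamma>
    using c[OF that] by (metis Real_Vector_Spaces.norm_eq_zero)
  show "sec_star \<G> \<L> f \<in> sections_on \<L> (arrows \<G>)" by (rule sec_star_section[OF s])
  show "finite {\<gamma> \<in> arrows \<G>. src \<G> \<gamma> = x \<and> coef (sec_star \<G> \<L> f \<gamma>) \<noteq> 0}" for x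
  proof (rule finite_subset[OF _ finite_imageI[OF tameD(4)[OF f, of x], of "ginv \<G>"]], intro subsetI)
    fix \<gamma> assume a: "\<gamma> \<in> {\<gamma> \<in> arrows \<G>. src \<G> \<gamma> = x \<and> coef (sec_star \<G> \<L> f \<gamma>) \<noteq> 0}"
    then show "\<gamma> \<in> ginv \<G> ` {\<gamma> \<in> arrows \<G>. rng \<G> \<gamma> = x \<and> coef (f \<gamma>) \<noteq> 0}"
      by (intro image_eqI[of _ _ "ginv \<G> \<gamma>"]) (auto simp: inv_inv inv_closed rng_inv c0)
  qed
  show "finite {\<gamma> \<in> arrows \<G>. rng \<G> \<gamma> = x \<and> coef (sec_star \<G> \<L> f \<gamma>) \<noteq> 0}" for x
  proof (rule finite_subset[OF _ finite_imageI[OF tameD(3)[OF f, of x], of "ginv \<G>"]], intro subsetI)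
    fix \<gamma> assume a: "\<gamma> \<in> {\<gamma> \<in> arrows \<G>. rng \<G> \<gamma> = x \<and> coef (sec_star \<G> \<L> f \<gamma>) \<noteq> 0}"
    then show "\<gamma> \<in> ginv \<G> ` {\<gamma> \<in> arrows \<G>. src \<G> \<gamma> = x \<and> coef (f \<gamma>) \<noteq> 0}"
      by (intro image_eqI[of _ _ "ginv \<G> \<gamma>"]) (auto simp: inv_inv inv_closed src_inv c0)
  qed
  obtain C where C: "schur_bounded f C" using f by (auto simp: tame_def)
  have "(\<Sum>\<gamma>\<in>A. cmod (coef (sec_star \<G> \<L> f \<gamma>))) \<le> C"
    if A: "finite A" "A \<subseteq> arrows \<G>" "src \<G> ` A \<subseteq> {x} \<or> rng \<G> ` A \<subseteq> {x}" for A x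
  proof -
    have inj: "inj_on (ginv \<G>) A" using A(2) inv_inv by (intro inj_on_inverseI[of _ "ginv \<G>"]) auto
    have "(\<Sum>\<gamma>\<in>A. cmod (coef (sec_star \<G> \<L> f \<gamma>))) = (\<Sum>\<gamma>\<in>A. cmod (coef (f (ginv \<G> \<gamma>))))"
      using A(2) c by (intro sum.cong) auto
    also have "\<dots> = (\<Sum>\<gamma>\<in>ginv \<G> ` A. cmod (coef (f \<gamma>)))" by (simp add: sum.reindex[OF inj])
    also have "\<dots> \<le> C"
    proof -
      have "ginv \<G> ` A \<subseteq> arrows \<G>" "src \<G> ` ginv \<G> ` A \<subseteq> {x} \<or> rng \<G> ` ginv \<G> ` A \<subseteq> {x}"
        using A(2,3) inv_closed src_inv rng_inv by (force simp: image_subset_iff subset_iff)+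
      then show ?thesis using C A(1) unfolding schur_bounded_def by (metis finite_imageI)
    qed
    finally show ?thesis .
  qed
  then show "\<exists>C. schur_bounded (sec_star \<G> \<L> f) C" unfolding schur_bounded_def by blast
qed

section \<open>Compactly supported sections\<close>

lemma Cc_onD:
  assumes "f \<in> Cc_on \<G> \<L> U"
  shows "f \<in> sections_on \<L> (arrows \<G>)" "continuous_map (subtopology (gtop \<G>) U) (btop \<L>) f"
    "\<And>\<gamma>. \<gamma> \<in> arrows \<G> - U \<Longrightarrow> f \<gamma> = bzero \<L> \<gamma>" "\<gamma> \<in> arrows \<G> \<Longrightarrow> f \<gamma> \<in> fibre \<L> \<gamma>"
  using assms sections_onD by (auto simp: Cc_on_def continuous_sections_def)

lemma Cc_on_compact:
  assumes "f \<in> Cc_on \<G> \<L> U"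
  obtains K where "K \<subseteq> U" "compactin (gtop \<G>) K" "\<And>\<gamma>. \<gamma> \<in> arrows \<G> - K \<Longrightarrow> f \<gamma> = bzero \<L> \<gamma>"
  using assms Cc_onD(3)[OF assms] unfolding Cc_on_def by blast

lemma Cc_onI:
  assumes "f \<in> sections_on \<L> (arrows \<G>)" "continuous_map (subtopology (gtop \<G>) U) (btop \<L>) f"
    "K \<subseteq> U" "compactin (gtop \<G>) K" "\<And>\<gamma>. \<gamma> \<in> arrows \<G> - K \<Longrightarrow> f \<gamma> = bzero \<L> \<gamma>" "U \<subseteq> arrows \<G>"
  shows "f \<in> Cc_on \<G> \<L> U"
  using assms unfolding Cc_on_def continuous_sections_def by blast

lemma Cc_on_bounded:
  assumes U: "open_bisection \<G> U" and f: "f \<in> Cc_on \<G> \<L> U"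
  obtains B where "B \<ge> 0" "\<And>\<gamma>. \<gamma> \<in> arrows \<G> \<Longrightarrow> cmod (coef (f \<gamma>)) \<le> B"
proof -
  obtain K where K: "K \<subseteq> U" "compactin (gtop \<G>) K" "\<And>\<gamma>. \<gamma> \<in> arrows \<G> - K \<Longrightarrow> f \<gamma> = bzero \<L> \<gamma>"
    using Cc_on_compact[OF f] by metis
  have "compactin (subtopology (gtop \<G>) U) K" using K by (simp add: compactin_subtopology)
  from image_compactin[OF this continuous_map_bnorm[OF Cc_onD(2)[OF f]]]
  have "bounded ((\<lambda>\<gamma>. bnorm \<L> (f \<gamma>)) ` K)" by (simp add: compact_imp_bounded)
  then obtain B where B: "\<And>\<gamma>. \<gamma> \<in> K \<Longrightarrow> norm (bnorm \<L> (f \<gamma>)) \<le> B" by (auto simp: bounded_iff)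
  have "cmod (coef (f \<gamma>)) \<le> max B 0" if g: "\<gamma> \<in> arrows \<G>" for \<gamma>
  proof (cases "\<gamma> \<in> K")
    case True
    then show ?thesis using B[OF True] coef_norm[OF Cc_onD(4)[OF f g]] by auto
  next
    case False
    then show ?thesis using K(3) g coef_zero[OF g] by simp
  qed
  then show thesis using that[of "max B 0"] by simp
qed

text \<open>On a bisection every source or range fibre has at most one arrow, so a bound for the section
  is a bound for the sums.\<close>

lemma Cc_on_tame:
  assumes U: "open_bisection \<G> U" and f: "f \<in> Cc_on \<G> \<L> U"
  shows "tame f"
  unfolding tame_def
proof (intro conjI allI)
  show "f \<in> sections_on \<L> (arrows \<G>)" by (rule Cc_onD(1)[OF f])
  have nz: "\<gamma> \<in> U" if "\<gamma> \<in> arrows \<G>" "coef (f \<gamma>) \<noteq> 0" for \<gamma>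
    using that Cc_onD(3)[OF f] coef_zero by (metis DiffI)
  note inj = open_bisectionD(2,3)[OF U]
  have sub: "finite A \<and> card A \<le> 1" if eq: "\<forall>\<gamma>\<in>A. \<forall>\<delta>\<in>A. \<gamma> = \<delta>" for A :: "'g set"
  proof (cases "A = {}")
    case False
    then obtain a where "A = {a}" using eq by blast
    then show ?thesis by simp
  qed simp
  show "finite {\<gamma> \<in> arrows \<G>. src \<G> \<gamma> = x \<and> coef (f \<gamma>) \<noteq> 0}" for x
    using sub[of "{\<gamma> \<in> arrows \<G>. src \<G> \<gamma> = x \<and> coef (f \<gamma>) \<noteq> 0}"] nz inj by (force dest: inj_onD)
  show "finite {\<gamma> \<in> arrows \<G>. rng \<G> \<gamma> = x \<and> coef (f \<gamma>) \<noteq> 0}" for x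
    using sub[of "{\<gamma> \<in> arrows \<G>. rng \<G> \<gamma> = x \<and> coef (f \<gamma>) \<noteq> 0}"] nz inj by (force dest: inj_onD)
  obtain B where B: "B \<ge> 0" "\<And>\<gamma>. \<gamma> \<in> arrows \<G> \<Longrightarrow> cmod (coef (f \<gamma>)) \<le> B" using Cc_on_bounded[OF U f] by blast
  have "(\<Sum>\<gamma>\<in>A. cmod (coef (f \<gamma>))) \<le> B"
    if A: "finite A" "A \<subseteq> arrows \<G>" "src \<G> ` A \<subseteq> {x} \<or> rng \<G> ` A \<subseteq> {x}" for A x
  proof -
    have one: "\<forall>\<gamma>\<in>A \<inter> U. \<forall>\<delta>\<in>A \<inter> U. \<gamma> = \<delta>"
    proof (intro ballI)
      fix \<gamma> \<delta> assume gd: "\<gamma> \<in> A \<inter> U" "\<delta> \<in> A \<inter> U"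
      then have "src \<G> \<gamma> = src \<G> \<delta> \<or> rng \<G> \<gamma> = rng \<G> \<delta>" using A(3) by blast
      then show "\<gamma> = \<delta>" using inj_onD[OF inj(1), of \<gamma> \<delta>] inj_onD[OF inj(2), of \<gamma> \<delta>] gd by blast
    qed
    have "(\<Sum>\<gamma>\<in>A. cmod (coef (f \<gamma>))) = (\<Sum>\<gamma>\<in>A \<inter> U. cmod (coef (f \<gamma>)))"
      using A nz by (intro sum.mono_neutral_right) auto
    also have "\<dots> \<le> real (card (A \<inter> U)) * B"
      by (rule sum_bounded_above) (use B A in auto)
    also have "\<dots> \<le> 1 * B" using sub[OF one] B(1) by (intro mult_right_mono) auto
    finally show ?thesis by simp
  qed
  then show "\<exists>C. schur_bounded f C" unfolding schur_bounded_def by blast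
qed

lemma Cc_tame: "f \<in> Cc \<G> \<L> \<Longrightarrow> tame f"
  by (induction rule: Cc.induct) (simp_all add: Cc_on_tame tame_add tame_scale)

lemma Cc_section: "f \<in> Cc \<G> \<L> \<Longrightarrow> f \<in> sections_on \<L> (arrows \<G>)"
  using Cc_tame tameD(1) by blast

end

lemma continuous_map_open_cover:
  assumes "openin Y A" "openin Y B" "topspace Y \<subseteq> A \<union> B"
    and "continuous_map (subtopology Y A) Z f" "continuous_map (subtopology Y B) Z f"
  shows "continuous_map Y Z f"
proof (rule continuous_map_neighbourhoods)
  show "f y \<in> topspace Z" if "y \<in> topspace Y" for y
    using that assms(3-5) by (auto simp: continuous_map_def Pi_iff)
  fix y W assume y: "y \<in> topspace Y" and W: "openin Z W" "f y \<in> W"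
  have "\<exists>V. openin Y V \<and> y \<in> V \<and> (\<forall>y'\<in>V. f y' \<in> W)"
    if S: "openin Y S" "y \<in> S" "continuous_map (subtopology Y S) Z f" for S
  proof -
    let ?V = "{y \<in> topspace (subtopology Y S). f y \<in> W}"
    have "openin Y ?V"
      using openin_trans_full[OF openin_continuous_map_preimage[OF S(3) W(1)] S(1)] .
    then show ?thesis using y S(2) W(2) by (intro exI[of _ ?V]) auto
  qed
  then show "\<exists>V. openin Y V \<and> y \<in> V \<and> (\<forall>y'\<in>V. f y' \<in> W)" using assms y by blast
qed

context fell_line_bundle
begin

lemma sec_star_add:
  assumes "f \<in> sections_on \<L> (arrows \<G>)" "g \<in> sections_on \<L> (arrows \<G>)"
  shows "sec_star \<G> \<L> (sec_add \<G> \<L> f g) = sec_add \<G> \<L> (sec_star \<G> \<L> f) (sec_star \<G> \<L> g)"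
proof (rule sections_eqI)
  note s = sec_star_section[OF assms(1)] sec_star_section[OF assms(2)] and fg = sec_add_section[OF assms]
  show "sec_star \<G> \<L> (sec_add \<G> \<L> f g) \<in> sections_on \<L> (arrows \<G>)" by (rule sec_star_section[OF fg])
  show "sec_add \<G> \<L> (sec_star \<G> \<L> f) (sec_star \<G> \<L> g) \<in> sections_on \<L> (arrows \<G>)" by (rule sec_add_section[OF s])
  fix \<gamma> assume g: "\<gamma> \<in> arrows \<G>"
  show "coef (sec_star \<G> \<L> (sec_add \<G> \<L> f g) \<gamma>) = coef (sec_add \<G> \<L> (sec_star \<G> \<L> f) (sec_star \<G> \<L> g) \<gamma>)"
    unfolding sec_star_coef[OF fg g] sec_add_coef[OF s g] sec_star_coef[OF assms(1) g] sec_star_coef[OF assms(2) g]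
      sec_add_coef[OF assms inv_closed[OF g]] by (simp add: distrib_right)
qed

lemma sec_star_scale:
  assumes "f \<in> sections_on \<L> (arrows \<G>)"
  shows "sec_star \<G> \<L> (sec_scale \<G> \<L> c f) = sec_scale \<G> \<L> (cnj c) (sec_star \<G> \<L> f)"
proof (rule sections_eqI)
  note s = sec_star_section[OF assms] and cf = sec_scale_section[OF assms]
  show "sec_star \<G> \<L> (sec_scale \<G> \<L> c f) \<in> sections_on \<L> (arrows \<G>)" by (rule sec_star_section[OF cf])
  show "sec_scale \<G> \<L> (cnj c) (sec_star \<G> \<L> f) \<in> sections_on \<L> (arrows \<G>)" by (rule sec_scale_section[OF s])
  fix \<gamma> assume g: "\<gamma> \<in> arrows \<G>"
  show "coef (sec_star \<G> \<L> (sec_scale \<G> \<L> c f) \<gamma>) = coef (sec_scale \<G> \<L> (cnj c) (sec_star \<G> \<L> f) \<gamma>)"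
    unfolding sec_star_coef[OF cf g] sec_scale_coef[OF s g] sec_star_coef[OF assms g]
      sec_scale_coef[OF assms inv_closed[OF g]] by simp
qed

lemma conv_support_finite: "tame f \<Longrightarrow> finite (conv_support f \<gamma>)"
  unfolding conv_support_def by (rule tameD(4))

lemma conv_support_subset: "conv_support f \<gamma> \<subseteq> {\<alpha> \<in> arrows \<G>. rng \<G> \<alpha> = rng \<G> \<gamma>}"
  unfolding conv_support_def by blast

lemma sec_mult_add_left:
  assumes f: "tame f" and g: "tame g" and h: "h \<in> sections_on \<L> (arrows \<G>)"
  shows "sec_mult \<G> \<L> (sec_add \<G> \<L> f g) h = sec_add \<G> \<L> (sec_mult \<G> \<L> f h) (sec_mult \<G> \<L> g h)"
proof (rule sections_eqI)
  note t = tame_add[OF f g] and m = tame_mult_section[OF f h] tame_mult_section[OF g h]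
  show "sec_mult \<G> \<L> (sec_add \<G> \<L> f g) h \<in> sections_on \<L> (arrows \<G>)" by (rule tame_mult_section[OF t h])
  show "sec_add \<G> \<L> (sec_mult \<G> \<L> f h) (sec_mult \<G> \<L> g h) \<in> sections_on \<L> (arrows \<G>)" by (rule sec_add_section[OF m])
  fix \<gamma> assume g': "\<gamma> \<in> arrows \<G>"
  define A where "A = conv_support f \<gamma> \<union> conv_support g \<gamma>"
  have A: "finite A" "A \<subseteq> {\<alpha> \<in> arrows \<G>. rng \<G> \<alpha> = rng \<G> \<gamma>}"
    unfolding A_def using conv_support_finite f g conv_support_subset by auto
  have c: "coef (sec_add \<G> \<L> f g \<alpha>) = coef (f \<alpha>) + coef (g \<alpha>)" if "\<alpha> \<in> arrows \<G>" for \<alpha>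
    by (rule sec_add_coef[OF tameD(1)[OF f] tameD(1)[OF g] that])
  have "conv_support (sec_add \<G> \<L> f g) \<gamma> \<subseteq> A" unfolding A_def conv_support_def using c by auto
  note e = tame_mult_coef[OF t h g' A this]
  have "coef (sec_mult \<G> \<L> (sec_add \<G> \<L> f g) h \<gamma>)
      = (\<Sum>\<alpha>\<in>A. coef (f \<alpha>) * coef (h (quot \<alpha> \<gamma>)) * cocycle \<alpha> (quot \<alpha> \<gamma>) +
               coef (g \<alpha>) * coef (h (quot \<alpha> \<gamma>)) * cocycle \<alpha> (quot \<alpha> \<gamma>))"
    unfolding e using A(2) c by (intro sum.cong) (auto simp: distrib_right)
  also have "\<dots> = coef (sec_mult \<G> \<L> f h \<gamma>) + coef (sec_mult \<G> \<L> g h \<gamma>)"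
    unfolding sum.distrib
    by (subst (1 2) tame_mult_coef[OF _ h g' A]) (simp_all add: f g A_def)
  finally show "coef (sec_mult \<G> \<L> (sec_add \<G> \<L> f g) h \<gamma>) = coef (sec_add \<G> \<L> (sec_mult \<G> \<L> f h) (sec_mult \<G> \<L> g h) \<gamma>)"
    unfolding sec_add_coef[OF m g'] .
qed

lemma sec_mult_add_right:
  assumes f: "tame f" and g: "g \<in> sections_on \<L> (arrows \<G>)" and h: "h \<in> sections_on \<L> (arrows \<G>)"
  shows "sec_mult \<G> \<L> f (sec_add \<G> \<L> g h) = sec_add \<G> \<L> (sec_mult \<G> \<L> f g) (sec_mult \<G> \<L> f h)"
proof (rule sections_eqI)
  note gh = sec_add_section[OF g h] and m = tame_mult_section[OF f g] tame_mult_section[OF f h]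
  show "sec_mult \<G> \<L> f (sec_add \<G> \<L> g h) \<in> sections_on \<L> (arrows \<G>)" by (rule tame_mult_section[OF f gh])
  show "sec_add \<G> \<L> (sec_mult \<G> \<L> f g) (sec_mult \<G> \<L> f h) \<in> sections_on \<L> (arrows \<G>)" by (rule sec_add_section[OF m])
  fix \<gamma> assume g': "\<gamma> \<in> arrows \<G>"
  note e = tame_mult_coef[OF f _ g' conv_support_finite[OF f] conv_support_subset order_refl]
  have "coef (sec_mult \<G> \<L> f (sec_add \<G> \<L> g h) \<gamma>) = coef (sec_mult \<G> \<L> f g \<gamma>) + coef (sec_mult \<G> \<L> f h \<gamma>)"
    unfolding e[OF gh] e[OF g] e[OF h] sum.distrib[symmetric]
  proof (rule sum.cong[OF refl])
    fix \<alpha> assume "\<alpha> \<in> conv_support f \<gamma>"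
    then have "quot \<alpha> \<gamma> \<in> arrows \<G>" using quot(1)[OF _ g'] unfolding conv_support_def by simp
    from sec_add_coef[OF g h this]
    show "coef (f \<alpha>) * coef (sec_add \<G> \<L> g h (quot \<alpha> \<gamma>)) * cocycle \<alpha> (quot \<alpha> \<gamma>) =
        coef (f \<alpha>) * coef (g (quot \<alpha> \<gamma>)) * cocycle \<alpha> (quot \<alpha> \<gamma>) + coef (f \<alpha>) * coef (h (quot \<alpha> \<gamma>)) * cocycle \<alpha> (quot \<alpha> \<gamma>)"
      by (simp add: algebra_simps)
  qed
  then show "coef (sec_mult \<G> \<L> f (sec_add \<G> \<L> g h) \<gamma>) = coef (sec_add \<G> \<L> (sec_mult \<G> \<L> f g) (sec_mult \<G> \<L> f h) \<gamma>)"
    unfolding sec_add_coef[OF m g'] .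
qed

lemma sec_mult_scale_left:
  assumes f: "tame f" and h: "h \<in> sections_on \<L> (arrows \<G>)"
  shows "sec_mult \<G> \<L> (sec_scale \<G> \<L> c f) h = sec_scale \<G> \<L> c (sec_mult \<G> \<L> f h)"
proof (rule sections_eqI)
  note t = tame_scale[OF f] and m = tame_mult_section[OF f h]
  show "sec_mult \<G> \<L> (sec_scale \<G> \<L> c f) h \<in> sections_on \<L> (arrows \<G>)" by (rule tame_mult_section[OF t h])
  show "sec_scale \<G> \<L> c (sec_mult \<G> \<L> f h) \<in> sections_on \<L> (arrows \<G>)" by (rule sec_scale_section[OF m])
  fix \<gamma> assume g': "\<gamma> \<in> arrows \<G>"
  note A = conv_support_finite[OF f] conv_support_subset
  have cf: "coef (sec_scale \<G> \<L> c f \<alpha>) = c * coef (f \<alpha>)" if "\<alpha> \<in> arrows \<G>" for \<alpha>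
    by (rule sec_scale_coef[OF tameD(1)[OF f] that])
  have sub: "conv_support (sec_scale \<G> \<L> c f) \<gamma> \<subseteq> conv_support f \<gamma>" unfolding conv_support_def using cf by auto
  show "coef (sec_mult \<G> \<L> (sec_scale \<G> \<L> c f) h \<gamma>) = coef (sec_scale \<G> \<L> c (sec_mult \<G> \<L> f h) \<gamma>)"
    unfolding sec_scale_coef[OF m g'] tame_mult_coef[OF t h g' A sub] tame_mult_coef[OF f h g' A order_refl] sum_distrib_left
  proof (rule sum.cong[OF refl])
    fix \<alpha> assume "\<alpha> \<in> conv_support f \<gamma>"
    then have "\<alpha> \<in> arrows \<G>" unfolding conv_support_def by simp
    from cf[OF this]
    show "coef (sec_scale \<G> \<L> c f \<alpha>) * coef (h (quot \<alpha> \<gamma>)) * cocycle \<alpha> (quot \<alpha> \<gamma>) =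
        c * (coef (f \<alpha>) * coef (h (quot \<alpha> \<gamma>)) * cocycle \<alpha> (quot \<alpha> \<gamma>))"
      by simp
  qed
qed

lemma sec_mult_scale_right:
  assumes f: "tame f" and h: "h \<in> sections_on \<L> (arrows \<G>)"
  shows "sec_mult \<G> \<L> f (sec_scale \<G> \<L> c h) = sec_scale \<G> \<L> c (sec_mult \<G> \<L> f h)"
proof (rule sections_eqI)
  note t = sec_scale_section[OF h] and m = tame_mult_section[OF f h]
  show "sec_mult \<G> \<L> f (sec_scale \<G> \<L> c h) \<in> sections_on \<L> (arrows \<G>)" by (rule tame_mult_section[OF f t])
  show "sec_scale \<G> \<L> c (sec_mult \<G> \<L> f h) \<in> sections_on \<L> (arrows \<G>)" by (rule sec_scale_section[OF m])
  fix \<gamma> assume g': "\<gamma> \<in> arrows \<G>"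
  note e = tame_mult_coef[OF f _ g' conv_support_finite[OF f] conv_support_subset order_refl]
  show "coef (sec_mult \<G> \<L> f (sec_scale \<G> \<L> c h) \<gamma>) = coef (sec_scale \<G> \<L> c (sec_mult \<G> \<L> f h) \<gamma>)"
    unfolding sec_scale_coef[OF m g'] e[OF t] e[OF h] sum_distrib_left
  proof (rule sum.cong[OF refl])
    fix \<alpha> assume "\<alpha> \<in> conv_support f \<gamma>"
    then have "quot \<alpha> \<gamma> \<in> arrows \<G>" using quot(1)[OF _ g'] unfolding conv_support_def by simp
    from sec_scale_coef[OF h this]
    show "coef (f \<alpha>) * coef (sec_scale \<G> \<L> c h (quot \<alpha> \<gamma>)) * cocycle \<alpha> (quot \<alpha> \<gamma>) =
        c * (coef (f \<alpha>) * coef (h (quot \<alpha> \<gamma>)) * cocycle \<alpha> (quot \<alpha> \<gamma>))"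
      by simp
  qed
qed

lemma sec_star_Cc_on:
  assumes U: "open_bisection \<G> U" and f: "f \<in> Cc_on \<G> \<L> U"
  shows "sec_star \<G> \<L> f \<in> Cc_on \<G> \<L> (ginv \<G> ` U)"
proof -
  note Ua = open_bisectionD(4)[OF U] and Va = open_bisectionD(4)[OF open_bisection_inv[OF U]]
  obtain K where K: "K \<subseteq> U" "compactin (gtop \<G>) K" "\<And>\<gamma>. \<gamma> \<in> arrows \<G> - K \<Longrightarrow> f \<gamma> = bzero \<L> \<gamma>"
    using Cc_on_compact[OF f] by metis
  show ?thesis
  proof (rule Cc_onI[OF sec_star_section[OF Cc_onD(1)[OF f]] _ _ _ _ Va])
    have inv: "continuous_map (subtopology (gtop \<G>) (ginv \<G> ` U)) (subtopology (gtop \<G>) U) (ginv \<G>)"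
      using Ua inv_inv
      by (auto simp: continuous_map_in_subtopology continuous_map_from_subtopology[OF continuous_inv] subset_iff)
    have "continuous_map (subtopology (gtop \<G>) (ginv \<G> ` U)) (btop \<L>) (\<lambda>\<gamma>. bstar \<L> ((f \<circ> ginv \<G>) \<gamma>))"
      by (rule continuous_map_bstar[OF continuous_map_compose[OF inv Cc_onD(2)[OF f]]])
    then show "continuous_map (subtopology (gtop \<G>) (ginv \<G> ` U)) (btop \<L>) (sec_star \<G> \<L> f)"
      by (rule continuous_map_eq) (auto simp: sec_star_def)
    show "ginv \<G> ` K \<subseteq> ginv \<G> ` U" using K(1) by blast
    show "compactin (gtop \<G>) (ginv \<G> ` K)" by (rule image_compactin[OF K(2) continuous_inv])
    fix \<gamma> assume g: "\<gamma> \<in> arrows \<G> - ginv \<G> ` K"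
    then have "ginv \<G> \<gamma> \<notin> K" using inv_inv by (metis DiffD1 DiffD2 imageI)
    then have "f (ginv \<G> \<gamma>) = bzero \<L> (ginv \<G> \<gamma>)" using K(3) inv_closed g by blast
    then show "sec_star \<G> \<L> f \<gamma> = bzero \<L> \<gamma>" using g star_bzero[OF inv_closed] inv_inv by (simp add: sec_star_def)
  qed
qed

lemma closedin_composable: "closedin (prod_topology (gtop \<G>) (gtop \<G>)) (composable \<G>)"
proof -
  let ?P = "prod_topology (gtop \<G>) (gtop \<G>)"
  have "continuous_map ?P (unit_top \<G>) (\<lambda>p. src \<G> (fst p))" "continuous_map ?P (unit_top \<G>) (\<lambda>p. rng \<G> (snd p))"
    using continuous_map_compose[OF continuous_map_fst continuous_src_unit_top]
      continuous_map_compose[OF continuous_map_snd continuous_rng_unit_top] by (simp_all add: o_def)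
  then have "closedin ?P {p \<in> topspace ?P. src \<G> (fst p) = rng \<G> (snd p)}"
    by (rule closedin_continuous_maps_eq[OF unit_Hausdorff])
  moreover have "{p \<in> topspace ?P. src \<G> (fst p) = rng \<G> (snd p)} = composable \<G>"
    by (auto simp: composable_def)
  ultimately show ?thesis by simp
qed

lemma compactin_product_set:
  assumes K: "compactin (gtop \<G>) K" and M: "compactin (gtop \<G>) M"
  shows "compactin (gtop \<G>) (product_set K M)"
proof -
  let ?P = "prod_topology (gtop \<G>) (gtop \<G>)"
  have Ka: "K \<subseteq> arrows \<G>" "M \<subseteq> arrows \<G>" using compactin_subset_topspace[OF K] compactin_subset_topspace[OF M] by simp_all
  have "compactin ?P (K \<times> M)" using K M by (simp add: compactin_Times)
  then have "compactin ?P (composable \<G> \<inter> (K \<times> M))" by (rule closed_Int_compactin[OF closedin_composable])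
  then have "compactin (subtopology ?P (composable \<G>)) (composable \<G> \<inter> (K \<times> M))"
    by (simp add: compactin_subtopology)
  from image_compactin[OF this continuous_mul]
  have "compactin (gtop \<G>) ((\<lambda>(\<gamma>, \<delta>). gmul \<G> \<gamma> \<delta>) ` (composable \<G> \<inter> (K \<times> M)))" .
  moreover have "(\<lambda>(\<gamma>, \<delta>). gmul \<G> \<gamma> \<delta>) ` (composable \<G> \<inter> (K \<times> M)) = product_set K M"
  proof (intro equalityI subsetI)
    fix x assume "x \<in> (\<lambda>(\<gamma>, \<delta>). gmul \<G> \<gamma> \<delta>) ` (composable \<G> \<inter> (K \<times> M))"
    then show "x \<in> product_set K M" unfolding product_set_def composable_def by auto
  next
    fix x assume "x \<in> product_set K M"
    then obtain \<alpha> \<beta> where ab: "x = gmul \<G> \<alpha> \<beta>" "\<alpha> \<in> K" "\<beta> \<in> M" "src \<G> \<alpha> = rng \<G> \<beta>" by (auto simp: product_set_def)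
    then have "(\<alpha>, \<beta>) \<in> composable \<G> \<inter> (K \<times> M)" using Ka by (auto intro: composableI)
    then show "x \<in> (\<lambda>(\<gamma>, \<delta>). gmul \<G> \<gamma> \<delta>) ` (composable \<G> \<inter> (K \<times> M))" using ab(1) by force
  qed
  ultimately show ?thesis by simp
qed

text \<open>For sections supported in bisections the convolution has a single term: the left factor of
  \<open>\<gamma>\<close> has to be the arrow of \<open>U\<close> with the range of \<open>\<gamma>\<close>, which depends continuously on \<open>\<gamma>\<close>.\<close>

lemma sec_mult_Cc_on:
  assumes U: "open_bisection \<G> U" and V: "open_bisection \<G> V"
    and f: "f \<in> Cc_on \<G> \<L> U" and h: "h \<in> Cc_on \<G> \<L> V"
  shows "sec_mult \<G> \<L> f h \<in> Cc_on \<G> \<L> (product_set U V)"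
proof -
  note Ua = open_bisectionD(4)[OF U] and Va = open_bisectionD(4)[OF V]
  note P = open_bisection_product[OF U V]
  note ft = Cc_on_tame[OF U f] and hs = Cc_onD(1)[OF h]
  note ms = tame_mult_section[OF ft hs]
  obtain K where K: "K \<subseteq> U" "compactin (gtop \<G>) K" "\<And>\<gamma>. \<gamma> \<in> arrows \<G> - K \<Longrightarrow> f \<gamma> = bzero \<L> \<gamma>"
    using Cc_on_compact[OF f] by metis
  obtain M where M: "M \<subseteq> V" "compactin (gtop \<G>) M" "\<And>\<gamma>. \<gamma> \<in> arrows \<G> - M \<Longrightarrow> h \<gamma> = bzero \<L> \<gamma>"
    using Cc_on_compact[OF h] by metis
  have inU: "\<alpha> \<in> U" if "\<alpha> \<in> arrows \<G>" "coef (f \<alpha>) \<noteq> 0" for \<alpha>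
    using that Cc_onD(3)[OF f] coef_zero by (metis DiffI)
  have val: "sec_mult \<G> \<L> f h \<gamma> = bmult \<L> (f \<alpha>) (h (quot \<alpha> \<gamma>))"
    if a: "\<alpha> \<in> U" "rng \<G> \<alpha> = rng \<G> \<gamma>" "\<gamma> \<in> arrows \<G>" for \<alpha> \<gamma>
  proof -
    have aa: "\<alpha> \<in> arrows \<G>" using a Ua by auto
    note q = quot[OF aa a(3,2)]
    note m = mult_closed[OF q(4) Cc_onD(4)[OF f aa] Cc_onD(4)[OF h q(1)], unfolded q(5)]
    have "conv_support f \<gamma> \<subseteq> {\<alpha>}"
    proof
      fix \<alpha>' assume a': "\<alpha>' \<in> conv_support f \<gamma>"
      then have "\<alpha>' \<in> U" "rng \<G> \<alpha>' = rng \<G> \<alpha>" using inU a(2) unfolding conv_support_def by auto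
      then show "\<alpha>' \<in> {\<alpha>}" using inj_onD[OF open_bisectionD(2)[OF U]] a(1) by blast
    qed
    then have "coef (sec_mult \<G> \<L> f h \<gamma>) = coef (bmult \<L> (f \<alpha>) (h (quot \<alpha> \<gamma>)))"
      using tame_mult_coef[OF ft hs a(3), of "{\<alpha>}"] aa a(2)
        coef_mult[OF q(4) Cc_onD(4)[OF f aa] Cc_onD(4)[OF h q(1)]] by simp
    then show ?thesis by (rule coef_inject[OF sections_onD[OF ms a(3)] m])
  qed
  have decomp: "lift U \<gamma> \<in> U \<and> rng \<G> (lift U \<gamma>) = rng \<G> \<gamma> \<and> quot (lift U \<gamma>) \<gamma> \<in> V \<and> \<gamma> \<in> arrows \<G>"
    if g: "\<gamma> \<in> product_set U V" for \<gamma>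
  proof -
    obtain \<alpha> \<beta> where ab: "\<gamma> = gmul \<G> \<alpha> \<beta>" "\<alpha> \<in> U" "\<beta> \<in> V" "src \<G> \<alpha> = rng \<G> \<beta>"
      using g by (auto simp: product_set_def)
    then have c: "(\<alpha>, \<beta>) \<in> composable \<G>" using Ua Va by (auto intro: composableI)
    have r: "rng \<G> \<alpha> = rng \<G> \<gamma>" using rng_mul[OF c] ab(1) by simp
    have "lift U \<gamma> = \<alpha>" by (rule lift_eq[OF U ab(2) r])
    then show ?thesis using ab quot_gmul[OF c] r mul_closed[OF c] by simp
  qed
  show ?thesis
  proof (rule Cc_onI[OF ms])
    let ?S = "subtopology (gtop \<G>) (product_set U V)"
    have topS: "topspace ?S = product_set U V" using open_bisectionD(4)[OF P] by auto
    have "subtopology (subtopology (gtop \<G>) {\<gamma> \<in> arrows \<G>. rng \<G> \<gamma> \<in> rng \<G> ` U}) (product_set U V) = ?S"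
    proof -
      have "product_set U V \<subseteq> {\<gamma> \<in> arrows \<G>. rng \<G> \<gamma> \<in> rng \<G> ` U}"
      proof
        fix \<gamma> assume "\<gamma> \<in> product_set U V"
        then show "\<gamma> \<in> {\<gamma> \<in> arrows \<G>. rng \<G> \<gamma> \<in> rng \<G> ` U}"
          using decomp[of \<gamma>] imageI[of "lift U \<gamma>" U "rng \<G>"] by simp
      qed
      then show ?thesis by (simp add: subtopology_subtopology Int_absorb1)
    qed
    then have cl: "continuous_map ?S (gtop \<G>) (lift U)"
      using continuous_map_from_subtopology[OF continuous_lift[OF U], of "product_set U V"] by simp
    then have clU: "continuous_map ?S (subtopology (gtop \<G>) U) (lift U)"
      using decomp topS by (simp add: continuous_map_in_subtopology image_subset_iff)
    have "continuous_map ?S (gtop \<G>) (\<lambda>\<gamma>. quot (lift U \<gamma>) \<gamma>)"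
      unfolding quot_def
    proof (rule continuous_map_gmul)
      show "continuous_map ?S (gtop \<G>) (\<lambda>\<gamma>. ginv \<G> (lift U \<gamma>))"
        using continuous_map_compose[OF cl continuous_inv] by (simp add: o_def)
      show "continuous_map ?S (gtop \<G>) (\<lambda>\<gamma>. \<gamma>)"
        by (simp add: continuous_map_from_subtopology continuous_map_id[unfolded id_def])
      fix \<gamma> assume "\<gamma> \<in> topspace ?S"
      then have d: "lift U \<gamma> \<in> U" "rng \<G> (lift U \<gamma>) = rng \<G> \<gamma>" using decomp topS by auto
      then have "lift U \<gamma> \<in> arrows \<G>" using Ua by blast
      then show "src \<G> (ginv \<G> (lift U \<gamma>)) = rng \<G> \<gamma>" using d(2) by (simp add: src_inv)
    qed
    then have cqV: "continuous_map ?S (subtopology (gtop \<G>) V) (\<lambda>\<gamma>. quot (lift U \<gamma>) \<gamma>)"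
      using decomp topS by (simp add: continuous_map_in_subtopology image_subset_iff)
    have "continuous_map ?S (btop \<L>) (\<lambda>\<gamma>. bmult \<L> (f (lift U \<gamma>)) (h (quot (lift U \<gamma>) \<gamma>)))"
    proof (rule continuous_map_bmult)
      show "continuous_map ?S (btop \<L>) (\<lambda>\<gamma>. f (lift U \<gamma>))"
        using continuous_map_compose[OF clU Cc_onD(2)[OF f]] by (simp add: o_def)
      show "continuous_map ?S (btop \<L>) (\<lambda>\<gamma>. h (quot (lift U \<gamma>) \<gamma>))"
        using continuous_map_compose[OF cqV Cc_onD(2)[OF h]] by (simp add: o_def)
      fix \<gamma> assume "\<gamma> \<in> topspace ?S"
      then have d: "lift U \<gamma> \<in> U" "rng \<G> (lift U \<gamma>) = rng \<G> \<gamma>" "\<gamma> \<in> arrows \<G>" using decomp topS by auto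
      then have la: "lift U \<gamma> \<in> arrows \<G>" using Ua by blast
      note q = quot[OF la d(3,2)]
      show "src \<G> (proj \<L> (f (lift U \<gamma>))) = rng \<G> (proj \<L> (h (quot (lift U \<gamma>) \<gamma>)))"
        using fibre_proj[OF Cc_onD(4)[OF f la]] fibre_proj[OF Cc_onD(4)[OF h q(1)]] q(2) by simp
    qed
    then show "continuous_map ?S (btop \<L>) (sec_mult \<G> \<L> f h)"
    proof (rule continuous_map_eq)
      fix \<gamma> assume "\<gamma> \<in> topspace ?S"
      then show "bmult \<L> (f (lift U \<gamma>)) (h (quot (lift U \<gamma>) \<gamma>)) = sec_mult \<G> \<L> f h \<gamma>"
        using decomp topS val[of "lift U \<gamma>" \<gamma>] by auto
    qed
    show "product_set K M \<subseteq> product_set U V" using K(1) M(1) unfolding product_set_def by blast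
    show "compactin (gtop \<G>) (product_set K M)" by (rule compactin_product_set[OF K(2) M(2)])
    show "product_set U V \<subseteq> arrows \<G>" by (rule open_bisectionD(4)[OF P])
    fix \<gamma> assume g: "\<gamma> \<in> arrows \<G> - product_set K M"
    then have ga: "\<gamma> \<in> arrows \<G>" by simp
    have "coef (f \<alpha>) * coef (h (quot \<alpha> \<gamma>)) = 0" if a: "\<alpha> \<in> conv_support f \<gamma>" for \<alpha>
    proof -
      have aa: "\<alpha> \<in> arrows \<G>" "rng \<G> \<alpha> = rng \<G> \<gamma>" "coef (f \<alpha>) \<noteq> 0" using a unfolding conv_support_def by auto
      note q = quot[OF aa(1) ga aa(2)]
      have "\<alpha> \<in> K" using K(3) aa coef_zero by (metis DiffI)
      then have "quot \<alpha> \<gamma> \<notin> M" using g q(2,5) unfolding product_set_def by force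
      then show ?thesis using M(3) q(1) coef_zero by simp
    qed
    then have "coef (sec_mult \<G> \<L> f h \<gamma>) = 0"
      using tame_mult_coef[OF ft hs ga conv_support_finite[OF ft] conv_support_subset order_refl]
      by (simp add: sum.neutral)
    then show "sec_mult \<G> \<L> f h \<gamma> = bzero \<L> \<gamma>" using coef_eq_0_iff[OF sections_onD[OF ms ga]] by simp
  qed
qed

lemma Cc_star: "f \<in> Cc \<G> \<L> \<Longrightarrow> sec_star \<G> \<L> f \<in> Cc \<G> \<L>"
proof (induction rule: Cc.induct)
  case (gen U f)
  then show ?case using Cc.gen[OF open_bisection_inv sec_star_Cc_on] by blast
next
  case (add f g)
  then show ?case using sec_star_add[OF Cc_section Cc_section] Cc.add by simp
next
  case (scale f c)
  then show ?case using sec_star_scale[OF Cc_section] Cc.scale by simp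
qed

lemma Cc_mult:
  assumes "f \<in> Cc \<G> \<L>" "g \<in> Cc \<G> \<L>" shows "sec_mult \<G> \<L> f g \<in> Cc \<G> \<L>"
  using assms(1)
proof (induction rule: Cc.induct)
  case (gen U f)
  note ft = Cc_on_tame[OF gen]
  show ?case
    using assms(2)
  proof (induction rule: Cc.induct)
    case (gen V g)
    then show ?case
      using Cc.gen[OF open_bisection_product sec_mult_Cc_on] \<open>open_bisection \<G> U\<close> \<open>f \<in> Cc_on \<G> \<L> U\<close> by blast
  next
    case (add g h)
    then show ?case using sec_mult_add_right[OF ft Cc_section Cc_section] Cc.add by simp
  next
    case (scale g c)
    then show ?case using sec_mult_scale_right[OF ft Cc_section] Cc.scale by simp
  qed
next
  case (add f h)
  then show ?case using sec_mult_add_left[OF Cc_tame Cc_tame Cc_section[OF assms(2)]] Cc.add by simp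
next
  case (scale f c)
  then show ?case using sec_mult_scale_left[OF Cc_tame Cc_section[OF assms(2)]] Cc.scale by simp
qed

section \<open>Functions on the unit space\<close>

definition Cc_units :: "('g \<Rightarrow> complex) set" where
  "Cc_units = {a. continuous_map (unit_top \<G>) euclidean a
     \<and> (\<exists>C. compactin (unit_top \<G>) C \<and> (\<forall>x \<in> units \<G> - C. a x = 0))}"

lemma compactin_units: "compactin (unit_top \<G>) C \<longleftrightarrow> compactin (gtop \<G>) C \<and> C \<subseteq> units \<G>"
  unfolding unit_top_def by (auto simp: compactin_subtopology)

lemma unit_section_coef:
  assumes "\<gamma> \<in> arrows \<G>"
  shows "coef (unit_section \<G> \<L> a \<gamma>) = (if \<gamma> \<in> units \<G> then a \<gamma> else 0)"
proof (cases "\<gamma> \<in> units \<G>")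
  case True
  then show ?thesis
    using coef_scale_frame[OF assms, of "a \<gamma>", unfolded frame_unit[OF True]] assms by (simp add: unit_section_def)
qed (use assms coef_zero in \<open>simp add: unit_section_def\<close>)

lemma unit_section_section: "unit_section \<G> \<L> a \<in> sections_on \<L> (arrows \<G>)"
proof -
  have "(if \<gamma> \<in> units \<G> then bscale \<L> (a \<gamma>) (bunit \<L> \<gamma>) else bzero \<L> \<gamma>) \<in> fibre \<L> \<gamma>" if "\<gamma> \<in> arrows \<G>" for \<gamma>
    using scale_closed[OF bunit_props(1)] zero_closed[OF that] by simp
  then show ?thesis unfolding unit_section_def sections_on_def by (intro restrict_PiE_iff[THEN iffD2]) blast
qed

lemma unit_section_Cc_on:
  assumes a: "a \<in> Cc_units" shows "unit_section \<G> \<L> a \<in> Cc_on \<G> \<L> (units \<G>)"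
proof -
  obtain C where C: "compactin (unit_top \<G>) C" "\<forall>x \<in> units \<G> - C. a x = 0" using a by (auto simp: Cc_units_def)
  have C': "compactin (gtop \<G>) C" "C \<subseteq> units \<G>" using C(1) compactin_units by auto
  show ?thesis
  proof (rule Cc_onI[OF unit_section_section _ C'(2,1) _ units_subset_arrows])
    have "continuous_map (unit_top \<G>) (btop \<L>) (\<lambda>x. bscale \<L> (a x) (bunit \<L> x))"
      using a continuous_bunit by (intro continuous_map_bscale) (auto simp: Cc_units_def)
    then have "continuous_map (unit_top \<G>) (btop \<L>) (unit_section \<G> \<L> a)"
      by (rule continuous_map_eq) (auto simp: unit_section_def units_arrows)
    then show "continuous_map (subtopology (gtop \<G>) (units \<G>)) (btop \<L>) (unit_section \<G> \<L> a)"
      by (simp add: unit_top_def)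
    fix \<gamma> assume g: "\<gamma> \<in> arrows \<G> - C"
    then have "coef (unit_section \<G> \<L> a \<gamma>) = 0" using C(2) by (simp add: unit_section_coef)
    then show "unit_section \<G> \<L> a \<gamma> = bzero \<L> \<gamma>" using coef_eq_0_iff[OF sections_onD[OF unit_section_section]] g by simp
  qed
qed

lemma unit_section_Cc: "a \<in> Cc_units \<Longrightarrow> unit_section \<G> \<L> a \<in> Cc \<G> \<L>"
  by (rule Cc.gen[OF open_bisection_units unit_section_Cc_on])

lemma Cc_units_C0_units:
  assumes a: "a \<in> Cc_units" shows "a \<in> C0_units \<G>"
proof -
  obtain C where C: "compactin (unit_top \<G>) C" "\<forall>x \<in> units \<G> - C. a x = 0" using a by (auto simp: Cc_units_def)
  have ac: "continuous_map (unit_top \<G>) euclidean a" using a by (simp add: Cc_units_def)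
  have "compactin (unit_top \<G>) {x \<in> units \<G>. \<epsilon> \<le> cmod (a x)}" if "\<epsilon> > 0" for \<epsilon>
  proof (rule closed_compactin[OF C(1)])
    show "{x \<in> units \<G>. \<epsilon> \<le> cmod (a x)} \<subseteq> C" using C(2) that by force
    have "closedin (unit_top \<G>) {x \<in> topspace (unit_top \<G>). a x \<in> {z. \<epsilon> \<le> cmod z}}"
      by (rule closedin_continuous_map_preimage[OF ac]) (simp add: closed_Collect_le continuous_intros)
    then show "closedin (unit_top \<G>) {x \<in> units \<G>. \<epsilon> \<le> cmod (a x)}" by simp
  qed
  then show ?thesis using ac by (simp add: C0_units_def)
qed

lemma Cc_on_C0_on:
  assumes U: "open_bisection \<G> U" and f: "f \<in> Cc_on \<G> \<L> U"
  shows "f \<in> C0_on \<G> \<L> U"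
proof -
  obtain K where K: "K \<subseteq> U" "compactin (gtop \<G>) K" "\<And>\<gamma>. \<gamma> \<in> arrows \<G> - K \<Longrightarrow> f \<gamma> = bzero \<L> \<gamma>"
    using Cc_on_compact[OF f] by metis
  note Ua = open_bisectionD(4)[OF U]
  have "compactin (gtop \<G>) {\<gamma> \<in> U. \<epsilon> \<le> bnorm \<L> (f \<gamma>)}" if e: "\<epsilon> > 0" for \<epsilon>
  proof -
    have "compactin (subtopology (gtop \<G>) U) {\<gamma> \<in> U. \<epsilon> \<le> bnorm \<L> (f \<gamma>)}"
    proof (rule closed_compactin[of _ K])
      show "compactin (subtopology (gtop \<G>) U) K" using K by (simp add: compactin_subtopology)
      show "{\<gamma> \<in> U. \<epsilon> \<le> bnorm \<L> (f \<gamma>)} \<subseteq> K"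
      proof
        fix \<gamma> assume g: "\<gamma> \<in> {\<gamma> \<in> U. \<epsilon> \<le> bnorm \<L> (f \<gamma>)}"
        show "\<gamma> \<in> K"
        proof (rule ccontr)
          assume "\<gamma> \<notin> K"
          then show False using K(3)[of \<gamma>] norm_zero[of \<gamma>] g Ua e by auto
        qed
      qed
      have "closedin (subtopology (gtop \<G>) U) {\<gamma> \<in> topspace (subtopology (gtop \<G>) U). bnorm \<L> (f \<gamma>) \<in> {\<epsilon>..}}"
        by (rule closedin_continuous_map_preimage[OF continuous_map_bnorm[OF Cc_onD(2)[OF f]]]) simp
      moreover have "{\<gamma> \<in> topspace (subtopology (gtop \<G>) U). bnorm \<L> (f \<gamma>) \<in> {\<epsilon>..}} = {\<gamma> \<in> U. \<epsilon> \<le> bnorm \<L> (f \<gamma>)}"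
        using Ua by auto
      ultimately show "closedin (subtopology (gtop \<G>) U) {\<gamma> \<in> U. \<epsilon> \<le> bnorm \<L> (f \<gamma>)}" by simp
    qed
    then show ?thesis by (simp add: compactin_subtopology)
  qed
  then show ?thesis using f by (simp add: C0_on_def Cc_on_def)
qed

lemma C0_image_Cc_on:
  assumes U: "open_bisection \<G> U" and f: "f \<in> Cc_on \<G> \<L> U"
  shows "C0_image \<G> \<L> \<iota> U f (\<iota> f)"
proof -
  have "bnorm \<L> (bdiff \<L> (f \<gamma>) (f \<gamma>)) = 0" if "\<gamma> \<in> arrows \<G>" for \<gamma>
    using norm_bdiff[OF Cc_onD(4)[OF f that] Cc_onD(4)[OF f that]] by simp
  then show ?thesis
    unfolding C0_image_def using Cc_on_C0_on[OF U f] f by (intro conjI exI[of _ "\<lambda>n. f"]) auto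
qed

lemma sec_mult_unit_section_right:
  assumes f: "tame f" and g: "\<gamma> \<in> arrows \<G>"
  shows "coef (sec_mult \<G> \<L> f (unit_section \<G> \<L> a) \<gamma>) = a (src \<G> \<gamma>) * coef (f \<gamma>)"
proof -
  let ?h = "unit_section \<G> \<L> a"
  have qg: "quot \<gamma> \<gamma> = src \<G> \<gamma>" unfolding quot_def by (rule inv_mul[OF g])
  have z: "coef (f \<alpha>) * coef (?h (quot \<alpha> \<gamma>)) = 0"
    if a: "\<alpha> \<in> arrows \<G>" "rng \<G> \<alpha> = rng \<G> \<gamma>" "\<alpha> \<notin> {\<gamma>}" for \<alpha>
  proof -
    note q = quot[OF a(1) g a(2)]
    have "quot \<alpha> \<gamma> \<notin> units \<G>"
    proof
      assume "quot \<alpha> \<gamma> \<in> units \<G>"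
      then have "quot \<alpha> \<gamma> = src \<G> \<alpha>" using q(2) unit_rng by metis
      then have "\<gamma> = \<alpha>" using q(5) mul_src[OF a(1)] by simp
      then show False using a(3) by simp
    qed
    then show ?thesis using unit_section_coef[OF q(1)] by simp
  qed
  have "coef (conv_at \<G> \<L> f ?h \<gamma>) = (\<Sum>\<alpha>\<in>{\<gamma>}. coef (f \<alpha>) * coef (?h (quot \<alpha> \<gamma>)) * cocycle \<alpha> (quot \<alpha> \<gamma>))"
    by (rule conv_at_sum(2)[OF g tameD(2)[OF f] sections_onD[OF unit_section_section] _ _ z]) (use g in auto)
  then show ?thesis
    using g qg cocycle_src[OF g] unit_section_coef[OF src_closed[OF g]] src_in_units[OF g]
    by (simp add: sec_mult_def)
qed

lemma sec_mult_unit_section_left: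
  assumes f: "f \<in> sections_on \<L> (arrows \<G>)" and g: "\<gamma> \<in> arrows \<G>"
  shows "coef (sec_mult \<G> \<L> (unit_section \<G> \<L> a) f \<gamma>) = a (rng \<G> \<gamma>) * coef (f \<gamma>)"
proof -
  let ?h = "unit_section \<G> \<L> a" and ?x = "rng \<G> \<gamma>"
  have xa: "?x \<in> arrows \<G>" "rng \<G> ?x = rng \<G> \<gamma>" using g rng_closed rng_rng by auto
  have qg: "quot ?x \<gamma> = \<gamma>" unfolding quot_def inv_unit[OF rng_in_units[OF g]] by (rule mul_rng[OF g])
  have z: "coef (?h \<alpha>) * coef (f (quot \<alpha> \<gamma>)) = 0"
    if a: "\<alpha> \<in> arrows \<G>" "rng \<G> \<alpha> = rng \<G> \<gamma>" "\<alpha> \<notin> {?x}" for \<alpha>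
  proof -
    have "\<alpha> \<notin> units \<G>" using a unit_rng by auto
    then show ?thesis using unit_section_coef[OF a(1)] by simp
  qed
  have "coef (conv_at \<G> \<L> ?h f \<gamma>) = (\<Sum>\<alpha>\<in>{?x}. coef (?h \<alpha>) * coef (f (quot \<alpha> \<gamma>)) * cocycle \<alpha> (quot \<alpha> \<gamma>))"
    by (rule conv_at_sum(2)[OF g sections_onD[OF unit_section_section] sections_onD[OF f] _ _ z]) (use xa in auto)
  then show ?thesis
    using g qg cocycle_rng[OF g] unit_section_coef[OF xa(1)] rng_in_units[OF g]
    by (simp add: sec_mult_def)
qed

lemma tame_unit_section: "a \<in> Cc_units \<Longrightarrow> tame (unit_section \<G> \<L> a)"
  using Cc_tame unit_section_Cc by blast

lemma unit_section_mult:
  assumes "a \<in> Cc_units"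
  shows "sec_mult \<G> \<L> (unit_section \<G> \<L> a) (unit_section \<G> \<L> b) = unit_section \<G> \<L> (\<lambda>x. a x * b x)"
proof (rule sections_eqI[OF tame_mult_section[OF tame_unit_section[OF assms] unit_section_section] unit_section_section])
  fix \<gamma> assume g: "\<gamma> \<in> arrows \<G>"
  show "coef (sec_mult \<G> \<L> (unit_section \<G> \<L> a) (unit_section \<G> \<L> b) \<gamma>) = coef (unit_section \<G> \<L> (\<lambda>x. a x * b x) \<gamma>)"
    unfolding sec_mult_unit_section_left[OF unit_section_section g] unit_section_coef[OF g] using unit_rng by simp
qed

lemma unit_section_star:
  assumes "\<And>x. x \<in> units \<G> \<Longrightarrow> cnj (a x) = a x"
  shows "sec_star \<G> \<L> (unit_section \<G> \<L> a) = unit_section \<G> \<L> a"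
proof (rule sections_eqI[OF sec_star_section[OF unit_section_section] unit_section_section])
  fix \<gamma> assume g: "\<gamma> \<in> arrows \<G>"
  show "coef (sec_star \<G> \<L> (unit_section \<G> \<L> a) \<gamma>) = coef (unit_section \<G> \<L> a \<gamma>)"
  proof (cases "\<gamma> \<in> units \<G>")
    case True
    then show ?thesis
      unfolding sec_star_coef[OF unit_section_section g] inv_unit[OF True] unit_section_coef[OF g]
      using assms star_bunit coef_frame[OF g] by (simp add: frame_unit)
  next
    case False
    have "ginv \<G> \<gamma> \<notin> units \<G>" using inv_unit inv_inv[OF g] False by metis
    then show ?thesis
      unfolding sec_star_coef[OF unit_section_section g] unit_section_coef[OF g] unit_section_coef[OF inv_closed[OF g]]
      using False by simp
  qed
qed

lemma Cc_units_mult: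
  assumes a: "a \<in> Cc_units" and b: "continuous_map (unit_top \<G>) euclidean b" shows "(\<lambda>x. a x * b x) \<in> Cc_units"
  using assms unfolding Cc_units_def by (auto intro!: continuous_map_complex_mult)

lemma Cc_units_diff_scale:
  assumes a: "a \<in> Cc_units" and b: "b \<in> Cc_units" shows "(\<lambda>x. a x - k * b x) \<in> Cc_units"
proof -
  obtain C D where CD: "compactin (unit_top \<G>) C" "\<forall>x \<in> units \<G> - C. a x = 0"
      "compactin (unit_top \<G>) D" "\<forall>x \<in> units \<G> - D. b x = 0" using a b by (auto simp: Cc_units_def)
  have "continuous_map (unit_top \<G>) euclidean (\<lambda>x. a x - k * b x)"
    using a b by (intro continuous_map_diff continuous_map_complex_mult) (auto simp: Cc_units_def)
  moreover have "compactin (unit_top \<G>) (C \<union> D)" using CD by (simp add: compactin_Un)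
  ultimately show ?thesis unfolding Cc_units_def using CD by (intro CollectI conjI exI[of _ "C \<union> D"]) auto
qed

definition bump :: "'g set \<Rightarrow> 'g set \<Rightarrow> ('g \<Rightarrow> real) \<Rightarrow> bool" where
  "bump K C a \<longleftrightarrow> continuous_map (unit_top \<G>) euclideanreal a \<and> (\<forall>x \<in> units \<G>. 0 \<le> a x \<and> a x \<le> 1)
     \<and> (\<forall>x \<in> K. a x = 1) \<and> compactin (unit_top \<G>) C \<and> (\<forall>x \<in> units \<G> - C. a x = 0)"

lemma bumpD:
  assumes "bump K C a"
  shows "(\<lambda>x. complex_of_real (a x)) \<in> Cc_units" "continuous_map (unit_top \<G>) euclideanreal a"
    "x \<in> units \<G> \<Longrightarrow> 0 \<le> a x" "x \<in> units \<G> \<Longrightarrow> a x \<le> 1" "x \<in> K \<Longrightarrow> a x = 1"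
    "compactin (unit_top \<G>) C" "x \<in> units \<G> - C \<Longrightarrow> a x = 0"
proof -
  show a: "continuous_map (unit_top \<G>) euclideanreal a" "x \<in> units \<G> \<Longrightarrow> 0 \<le> a x" "x \<in> units \<G> \<Longrightarrow> a x \<le> 1"
    "x \<in> K \<Longrightarrow> a x = 1" "compactin (unit_top \<G>) C" "x \<in> units \<G> - C \<Longrightarrow> a x = 0"
    using assms by (auto simp: bump_def)
  show "(\<lambda>x. complex_of_real (a x)) \<in> Cc_units"
    unfolding Cc_units_def using continuous_map_complex_of_real[OF a(1)] assms by (auto simp: bump_def)
qed

lemma bump_exists:
  assumes "compactin (unit_top \<G>) K" "openin (unit_top \<G>) V" "K \<subseteq> V"
  obtains a C where "bump K C a" "C \<subseteq> V"
proof (rule bump_function[OF assms])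
  fix a :: "'g \<Rightarrow> real" and C
  assume a: "continuous_map (unit_top \<G>) euclideanreal a" "\<And>x. x \<in> units \<G> \<Longrightarrow> 0 \<le> a x \<and> a x \<le> 1"
    "\<And>x. x \<in> K \<Longrightarrow> a x = 1" "compactin (unit_top \<G>) C" "C \<subseteq> V" "\<And>x. x \<in> units \<G> - C \<Longrightarrow> a x = 0"
  then have "bump K C a" by (simp add: bump_def)
  then show thesis using a(5) by (rule that)
qed

text \<open>As \<open>U\<close> has at most one arrow with a given source, an arrow of \<open>U\<close> whose source lies in \<open>U\<close> is a
  unit. So the product with a function supported in the units of \<open>U\<close> lives on the unit space.\<close>

lemma sec_mult_cutoff:
  assumes U: "open_bisection \<G> U" and f: "f \<in> Cc_on \<G> \<L> U" and a: "a \<in> Cc_units"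
    and C: "compactin (unit_top \<G>) C" "C \<subseteq> U" "\<And>x. x \<in> units \<G> - C \<Longrightarrow> a x = 0"
  shows "(\<lambda>x. a x * coef (f x)) \<in> Cc_units"
    "sec_mult \<G> \<L> f (unit_section \<G> \<L> a) = unit_section \<G> \<L> (\<lambda>x. a x * coef (f x))"
proof -
  let ?b = "\<lambda>x. a x * coef (f x)"
  note ft = Cc_on_tame[OF U f]
  note oU = open_bisectionD(1)[OF U]
  have C': "C \<subseteq> units \<G>" using C(1) compactin_units by blast
  have "continuous_map (unit_top \<G>) euclidean ?b"
  proof (rule continuous_map_open_cover)
    have oUX: "openin (gtop \<G>) (U \<inter> units \<G>)" using oU units_open by blast
    then show "openin (unit_top \<G>) (U \<inter> units \<G>)" by (simp add: openin_unit_top_iff)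
    have "closedin (unit_top \<G>) C" using compactin_imp_closedin[OF unit_Hausdorff C(1)] .
    then show "openin (unit_top \<G>) (units \<G> - C)" by (metis openin_diff openin_topspace topspace_unit_top)
    show "topspace (unit_top \<G>) \<subseteq> U \<inter> units \<G> \<union> (units \<G> - C)" using C(2) by auto
    let ?Y = "subtopology (unit_top \<G>) (U \<inter> units \<G>)"
    have Y: "?Y = subtopology (gtop \<G>) (U \<inter> units \<G>)"
      unfolding unit_top_def by (simp add: subtopology_subtopology Int_absorb1)
    have fY: "continuous_map ?Y (btop \<L>) f"
      unfolding Y using continuous_map_from_subtopology[OF Cc_onD(2)[OF f], of "units \<G>"]
      by (simp add: subtopology_subtopology)
    have bY: "continuous_map ?Y (btop \<L>) (bunit \<L>)" by (rule continuous_map_from_subtopology[OF continuous_bunit])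
    have ub: "coef (bunit \<L> x) = 1" "proj \<L> (bunit \<L> x) = x" "proj \<L> (f x) = x" if "x \<in> units \<G>" for x
      using coef_frame[OF units_arrows[OF that]] frame_unit[OF that] fibre_proj[OF bunit_props(1)[OF that]]
        fibre_proj[OF Cc_onD(4)[OF f units_arrows[OF that]]] by auto
    have "continuous_map ?Y euclidean (\<lambda>x. coef (f x) / coef (bunit \<L> x))"
      using ub by (intro continuous_map_ratio fY bY) auto
    then have "continuous_map ?Y euclidean (\<lambda>x. coef (f x))"
      by (rule continuous_map_eq) (use ub in auto)
    moreover have "continuous_map ?Y euclidean a" using a by (simp add: Cc_units_def continuous_map_from_subtopology)
    ultimately show "continuous_map ?Y euclidean ?b" by (intro continuous_map_complex_mult)
    have "continuous_map (subtopology (unit_top \<G>) (units \<G> - C)) euclidean (\<lambda>x. 0::complex)" by simp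
    then show "continuous_map (subtopology (unit_top \<G>) (units \<G> - C)) euclidean ?b"
      by (rule continuous_map_eq) (use C(3) in auto)
  qed
  then show "?b \<in> Cc_units" unfolding Cc_units_def using C(1,3) by auto
  show "sec_mult \<G> \<L> f (unit_section \<G> \<L> a) = unit_section \<G> \<L> ?b"
  proof (rule sections_eqI[OF tame_mult_section[OF ft unit_section_section] unit_section_section])
    fix \<gamma> assume g: "\<gamma> \<in> arrows \<G>"
    have "a (src \<G> \<gamma>) * coef (f \<gamma>) = 0" if n: "\<gamma> \<notin> units \<G>"
    proof (rule ccontr)
      assume nz: "a (src \<G> \<gamma>) * coef (f \<gamma>) \<noteq> 0"
      then have "src \<G> \<gamma> \<in> U" using C(2,3) src_in_units[OF g] by auto
      moreover have "\<gamma> \<in> U"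
      proof (rule ccontr)
        assume "\<gamma> \<notin> U"
        then show False using nz Cc_onD(3)[OF f, of \<gamma>] coef_zero[OF g] g by simp
      qed
      ultimately have "\<gamma> = src \<G> \<gamma>"
        using inj_onD[OF open_bisectionD(3)[OF U], of \<gamma> "src \<G> \<gamma>"] src_src[OF g] by simp
      then show False using n src_in_units[OF g] by simp
    qed
    then show "coef (sec_mult \<G> \<L> f (unit_section \<G> \<L> a) \<gamma>) = coef (unit_section \<G> \<L> ?b \<gamma>)"
      unfolding sec_mult_unit_section_right[OF ft g] unit_section_coef[OF g] using unit_src by auto
  qed
qed

end

section \<open>Isotropy and topological freeness\<close>

context etale_groupoid
begin

lemma isotropy_at_unit: "x \<in> units \<G> \<Longrightarrow> x \<in> isotropy_at \<G> x"
  by (simp add: isotropy_at_def units_arrows unit_src unit_rng)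

lemma closedin_isotropy: "closedin (gtop \<G>) (isotropy \<G> - units \<G>)"
proof -
  have "closedin (gtop \<G>) {\<gamma> \<in> topspace (gtop \<G>). src \<G> \<gamma> = rng \<G> \<gamma>}"
    by (rule closedin_continuous_maps_eq[OF unit_Hausdorff continuous_src_unit_top continuous_rng_unit_top])
  then have "closedin (gtop \<G>) (isotropy \<G>)" by (simp add: isotropy_def)
  then show ?thesis using units_open by (rule closedin_diff)
qed

lemma topologically_free_imp_interior_empty:
  assumes "topologically_free \<G>"
  shows "gtop \<G> interior_of (isotropy \<G> - units \<G>) = {}"
proof (rule ccontr)
  assume "gtop \<G> interior_of (isotropy \<G> - units \<G>) \<noteq> {}"
  then obtain \<gamma> W where W: "openin (gtop \<G>) W" "\<gamma> \<in> W" "W \<subseteq> isotropy \<G> - units \<G>"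
    unfolding interior_of_def by blast
  have "rng \<G> \<gamma> \<in> units \<G>" using W rng_in_units by (auto simp: isotropy_def)
  then have "rng \<G> \<gamma> \<in> unit_top \<G> closure_of {x \<in> units \<G>. isotropy_at \<G> x = {x}}"
    using assms by (simp add: topologically_free_def)
  then obtain x where x: "x \<in> units \<G>" "isotropy_at \<G> x = {x}" "x \<in> rng \<G> ` W"
    using openin_rng_image[OF W(1)] W(2) unfolding in_closure_of by blast
  then obtain \<delta> where d: "\<delta> \<in> W" "x = rng \<G> \<delta>" by blast
  then have "\<delta> \<in> isotropy_at \<G> x" using W(3) by (auto simp: isotropy_def isotropy_at_def)
  then have "\<delta> = x" using x(2) by simp
  then show False using d W(3) x(1) by auto
qed

text \<open>The nontrivial isotropy is closed and \<open>U\<close> is homeomorphic to its range. So where the ranges of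
  nontrivial isotropy arrows of \<open>U\<close> are dense in an open set, there is an open set of such arrows.\<close>

lemma isotropy_range_nowhere_dense:
  assumes int: "gtop \<G> interior_of (isotropy \<G> - units \<G>) = {}" and U: "open_bisection \<G> U"
  shows "unit_top \<G> interior_of (unit_top \<G> closure_of (rng \<G> ` (U \<inter> (isotropy \<G> - units \<G>)))) = {}"
proof (rule ccontr)
  let ?I = "isotropy \<G> - units \<G>"
  let ?N = "rng \<G> ` (U \<inter> ?I)"
  note oU = open_bisectionD[OF U]
  assume "unit_top \<G> interior_of (unit_top \<G> closure_of ?N) \<noteq> {}"
  then obtain W x where W: "openin (unit_top \<G>) W" "W \<subseteq> unit_top \<G> closure_of ?N" "x \<in> W"
    unfolding interior_of_def by blast
  then have "x \<in> unit_top \<G> closure_of ?N" by blast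
  then obtain y where y: "y \<in> ?N" "y \<in> W" using W unfolding in_closure_of by blast
  define D where "D = U \<inter> {\<gamma> \<in> arrows \<G>. rng \<G> \<gamma> \<in> W}"
  have D: "openin (gtop \<G>) D" unfolding D_def by (rule openin_Int[OF oU(1) openin_rng_vimage[OF W(1)]])
  have "D \<subseteq> ?I"
  proof
    fix \<gamma> assume g: "\<gamma> \<in> D"
    show "\<gamma> \<in> ?I"
    proof (rule ccontr)
      assume n: "\<gamma> \<notin> ?I"
      (* a neighbourhood of \<gamma> in U without nontrivial isotropy: its range misses N *)
      define E where "E = U \<inter> (topspace (gtop \<G>) - ?I)"
      have E: "openin (gtop \<G>) E" unfolding E_def
        by (rule openin_Int[OF oU(1)]) (rule openin_diff[OF openin_topspace closedin_isotropy])
      have "rng \<G> \<gamma> \<in> rng \<G> ` E" using g n oU(4) by (auto simp: D_def E_def)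
      moreover have "rng \<G> \<gamma> \<in> unit_top \<G> closure_of ?N" using g W(2) by (auto simp: D_def)
      ultimately obtain z where "z \<in> ?N" "z \<in> rng \<G> ` E"
        using openin_rng_image[OF E] unfolding in_closure_of by blast
      then obtain \<alpha> \<beta> where ab: "\<alpha> \<in> U" "\<alpha> \<in> ?I" "\<beta> \<in> E" "rng \<G> \<alpha> = rng \<G> \<beta>" by auto
      then have "\<alpha> = \<beta>" using inj_onD[OF oU(2)] by (auto simp: E_def)
      then show False using ab by (simp add: E_def)
    qed
  qed
  moreover have "D \<noteq> {}" using y oU(4) by (auto simp: D_def)
  ultimately show False using int D interior_of_maximal by (metis subset_empty)
qed

end

section \<open>States\<close>

lemma cscale_0: "cscale 0 (b :: 'b::cstar_algebra) = 0"
  using cscale_of_real[of 0 b] by simp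

lemma stateD:
  assumes "\<phi> \<in> states"
  shows "bounded_linear \<phi>" "\<phi> (a + b) = \<phi> a + \<phi> b" "\<phi> (cscale c b) = c * \<phi> b" "\<phi> 0 = 0"
    "\<phi> (cadj b * b) \<in> \<real>\<^sub>\<ge>\<^sub>0"
proof -
  show "bounded_linear \<phi>" using assms by (simp add: states_def)
  then interpret bounded_linear \<phi> .
  show "\<phi> (a + b) = \<phi> a + \<phi> b" "\<phi> 0 = 0" by (rule add, rule zero)
  show "\<phi> (cscale c b) = c * \<phi> b" "\<phi> (cadj b * b) \<in> \<real>\<^sub>\<ge>\<^sub>0" using assms by (simp_all add: states_def)
qed

text \<open>Real and purely imaginary \<open>c\<close> give real affine functions of a real parameter that are
  bounded below, hence constant.\<close>

lemma nonneg_pencil_zero: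
  fixes A B p :: complex
  assumes "\<And>c. p + c * A + cnj c * B \<in> \<real>\<^sub>\<ge>\<^sub>0"
  shows "A = 0" "B = 0"
proof -
  have lin: "w = 0" if "\<And>t::real. p + of_real t * w \<in> \<real>\<^sub>\<ge>\<^sub>0" for w
  proof -
    have re: "Re p + t * Re w \<ge> 0" and im: "Im p + t * Im w = 0" for t
      using that[of t] by (auto simp: complex_nonneg_Reals_iff)
    have "Im w = 0" using im[of 0] im[of 1] by simp
    moreover have "Re w = 0"
    proof (rule ccontr)
      assume "Re w \<noteq> 0"
      then show False using re[of "- (Re p + 1) / Re w"] by simp
    qed
    ultimately show ?thesis by (simp add: complex_eq_iff)
  qed
  have "A + B = 0"
    using assms[of "of_real _"] by (intro lin) (simp add: algebra_simps)
  moreover have "\<i> * (A - B) = 0"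
    using assms[of "\<i> * of_real _"] by (intro lin) (simp add: algebra_simps)
  ultimately show "A = 0" "B = 0" by (simp_all add: complex_eq_iff)
qed

text \<open>The degenerate case of the Cauchy-Schwarz inequality, from positivity at \<open>y + c z\<close>.\<close>

lemma state_null:
  assumes \<phi>: "\<phi> \<in> states" and z: "\<phi> (cadj z * z) = 0"
  shows "\<phi> (cadj y * z) = 0" "\<phi> (cadj z * y) = 0"
proof -
  have "\<phi> (cadj y * y) + c * \<phi> (cadj y * z) + cnj c * \<phi> (cadj z * y) \<in> \<real>\<^sub>\<ge>\<^sub>0" for c
  proof -
    have "cadj (y + cscale c z) * (y + cscale c z) =
        cadj y * y + cscale c (cadj y * z) + (cscale (cnj c) (cadj z * y) + cscale (cnj c * c) (cadj z * z))"
      by (simp add: cadj_add cadj_cscale distrib_left distrib_right cscale_mult_left cscale_mult_right cscale_cscale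
          cscale_add_right algebra_simps)
    then show ?thesis using stateD(5)[OF \<phi>, of "y + cscale c z"] z by (simp add: stateD(2,3)[OF \<phi>])
  qed
  from nonneg_pencil_zero[OF this] show "\<phi> (cadj y * z) = 0" "\<phi> (cadj z * y) = 0" .
qed

locale completed_line_bundle = fell_line_bundle \<G> \<L>
  for \<G> :: "'g tgroupoid" and \<L> :: "('g, 'l) line_bundle" +
  fixes \<nu> :: "('g \<Rightarrow> 'l) \<Rightarrow> real" and \<iota> :: "('g \<Rightarrow> 'l) \<Rightarrow> 'b::cstar_algebra"
  assumes completion: "is_completion \<G> \<L> \<nu> \<iota>"
begin

lemma iota:
  assumes "f \<in> Cc \<G> \<L>"
  shows "norm (\<iota> f) = \<nu> f" "\<iota> (sec_star \<G> \<L> f) = cadj (\<iota> f)" "\<iota> (sec_scale \<G> \<L> c f) = cscale c (\<iota> f)"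
    "g \<in> Cc \<G> \<L> \<Longrightarrow> \<iota> (sec_add \<G> \<L> f g) = \<iota> f + \<iota> g"
    "g \<in> Cc \<G> \<L> \<Longrightarrow> \<iota> (sec_mult \<G> \<L> f g) = \<iota> f * \<iota> g"
  using completion assms by (auto simp: is_completion_def)

lemma iota_zero:
  assumes "f \<in> Cc \<G> \<L>" "\<And>\<gamma>. \<gamma> \<in> arrows \<G> \<Longrightarrow> coef (f \<gamma>) = 0" shows "\<iota> f = 0"
proof -
  note s = Cc_section[OF assms(1)]
  have "f = sec_scale \<G> \<L> 0 f"
    by (rule sections_eqI[OF s sec_scale_section[OF s]]) (simp add: sec_scale_coef[OF s] assms(2))
  then show ?thesis using iota(3)[OF assms(1), of 0] by (simp add: cscale_0)
qed

lemma extending_eval: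
  assumes "\<phi> \<in> states_extending_eval \<G> \<L> \<iota> x" "a \<in> Cc_units"
  shows "\<phi> \<in> states" "\<phi> (\<iota> (unit_section \<G> \<L> a)) = a x"
  using assms C0_image_Cc_on[OF open_bisection_units unit_section_Cc_on[OF assms(2)], of \<iota>]
    Cc_units_C0_units[OF assms(2)] by (auto simp: states_extending_eval_def)

text \<open>A function \<open>d\<close> vanishing at \<open>x\<close> is a null vector of the state, as the value at \<open>d\<^sup>* d\<close> is
  \<open>\<bar>d(x)\<bar>\<^sup>2\<close>.\<close>

lemma extending_eval_null:
  assumes \<phi>: "\<phi> \<in> states_extending_eval \<G> \<L> \<iota> x" and d: "d \<in> Cc_units" "d x = 0"
    and real: "\<And>y. y \<in> units \<G> \<Longrightarrow> cnj (d y) = d y"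
  shows "\<phi> (b * \<iota> (unit_section \<G> \<L> d)) = 0" "\<phi> (\<iota> (unit_section \<G> \<L> d) * b) = 0"
proof -
  let ?z = "\<iota> (unit_section \<G> \<L> d)"
  note c = unit_section_Cc[OF d(1)]
  have "sec_star \<G> \<L> (unit_section \<G> \<L> d) = unit_section \<G> \<L> d"
    by (rule unit_section_star) (rule real)
  then have adj: "cadj ?z = ?z" using iota(2)[OF c] by metis
  have "continuous_map (unit_top \<G>) euclidean d" using d by (simp add: Cc_units_def)
  then have dd: "(\<lambda>y. d y * d y) \<in> Cc_units" by (rule Cc_units_mult[OF d(1)])
  have "cadj ?z * ?z = \<iota> (unit_section \<G> \<L> (\<lambda>y. d y * d y))"
    unfolding adj iota(5)[OF c c, symmetric] unit_section_mult[OF d(1)] ..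
  then have "\<phi> (cadj ?z * ?z) = 0" using extending_eval(2)[OF \<phi> dd] d(2) by simp
  from state_null[OF extending_eval(1)[OF \<phi> d(1)] this, of "cadj b"] state_null[OF extending_eval(1)[OF \<phi> d(1)] this, of b]
  show "\<phi> (b * ?z) = 0" "\<phi> (?z * b) = 0" by (simp_all add: cadj_cadj adj)
qed

text \<open>With \<open>c = 1\<close> at \<open>x\<close> and on the sources and ranges of the support of \<open>f\<close>, we have
  \<open>f a - a(x) f = f (a - a(x) c)\<close>, and \<open>a - a(x) c\<close> vanishes at \<open>x\<close>, so the state annihilates the product.\<close>

lemma extending_eval_module:
  assumes \<phi>: "\<phi> \<in> states_extending_eval \<G> \<L> \<iota> x" and x: "x \<in> units \<G>"
    and U: "open_bisection \<G> U" and f: "f \<in> Cc_on \<G> \<L> U"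
    and a: "a \<in> Cc_units" and real: "\<And>y. y \<in> units \<G> \<Longrightarrow> cnj (a y) = a y"
  shows "\<phi> (\<iota> f * \<iota> (unit_section \<G> \<L> a)) = a x * \<phi> (\<iota> f)"
    "\<phi> (\<iota> (unit_section \<G> \<L> a) * \<iota> f) = a x * \<phi> (\<iota> f)"
proof -
  note fc = Cc.gen[OF U f] and ft = Cc_on_tame[OF U f] and fs = Cc_onD(1)[OF f]
  obtain K where K: "K \<subseteq> U" "compactin (gtop \<G>) K" "\<And>\<gamma>. \<gamma> \<in> arrows \<G> - K \<Longrightarrow> f \<gamma> = bzero \<L> \<gamma>"
    using Cc_on_compact[OF f] by metis
  let ?M = "src \<G> ` K \<union> rng \<G> ` K \<union> {x}"
  have "compactin (unit_top \<G>) (src \<G> ` K)" "compactin (unit_top \<G>) (rng \<G> ` K)"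
    using image_compactin[OF K(2) continuous_src_unit_top] image_compactin[OF K(2) continuous_rng_unit_top] .
  then have M: "compactin (unit_top \<G>) ?M" using x by (intro compactin_Un) auto
  obtain c C where "bump ?M C c"
    using bump_exists[OF M openin_topspace compactin_subset_topspace[OF M]] by blast
  note c = bumpD(1,5)[OF this]
  define d where "d = (\<lambda>y. a y - a x * complex_of_real (c y))"
  have d: "d \<in> Cc_units" unfolding d_def by (rule Cc_units_diff_scale[OF a c(1)])
  have dx: "d x = 0" using c(2)[of x] by (simp add: d_def)
  have dr: "cnj (d y) = d y" if "y \<in> units \<G>" for y using real[OF that] real[OF x] by (simp add: d_def)
  note ac = unit_section_Cc[OF a] and dc = unit_section_Cc[OF d]
  note dt = tame_unit_section[OF d] and at = tame_unit_section[OF a]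
  note sf = sec_scale_section[OF fs, of "a x"]
  have one: "c (src \<G> \<gamma>) = 1 \<and> c (rng \<G> \<gamma>) = 1 \<or> coef (f \<gamma>) = 0" if "\<gamma> \<in> arrows \<G>" for \<gamma>
    using c(2) K(3)[of \<gamma>] coef_zero[OF that] that by (cases "\<gamma> \<in> K") auto
  have "sec_mult \<G> \<L> f (unit_section \<G> \<L> a) = sec_add \<G> \<L> (sec_mult \<G> \<L> f (unit_section \<G> \<L> d)) (sec_scale \<G> \<L> (a x) f)"
  proof (rule sections_eqI)
    note m = tame_mult_section[OF ft unit_section_section]
    show "sec_mult \<G> \<L> f (unit_section \<G> \<L> a) \<in> sections_on \<L> (arrows \<G>)" by (rule m)
    show "sec_add \<G> \<L> (sec_mult \<G> \<L> f (unit_section \<G> \<L> d)) (sec_scale \<G> \<L> (a x) f) \<in> sections_on \<L> (arrows \<G>)"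
      by (rule sec_add_section[OF m sf])
    fix \<gamma> assume g: "\<gamma> \<in> arrows \<G>"
    show "coef (sec_mult \<G> \<L> f (unit_section \<G> \<L> a) \<gamma>) =
        coef (sec_add \<G> \<L> (sec_mult \<G> \<L> f (unit_section \<G> \<L> d)) (sec_scale \<G> \<L> (a x) f) \<gamma>)"
      unfolding sec_add_coef[OF m sf g] sec_scale_coef[OF fs g] sec_mult_unit_section_right[OF ft g]
      using one[OF g] by (auto simp: d_def algebra_simps)
  qed
  then have "\<iota> f * \<iota> (unit_section \<G> \<L> a) = \<iota> f * \<iota> (unit_section \<G> \<L> d) + cscale (a x) (\<iota> f)"
    using iota(5)[OF fc ac] iota(5)[OF fc dc] iota(4)[OF Cc_mult[OF fc dc] Cc.scale[OF fc]] iota(3)[OF fc] by simp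
  then show "\<phi> (\<iota> f * \<iota> (unit_section \<G> \<L> a)) = a x * \<phi> (\<iota> f)"
    using extending_eval_null(1)[OF \<phi> d dx dr] stateD(2,3)[OF extending_eval(1)[OF \<phi> a]] by simp
  have "sec_mult \<G> \<L> (unit_section \<G> \<L> a) f = sec_add \<G> \<L> (sec_mult \<G> \<L> (unit_section \<G> \<L> d) f) (sec_scale \<G> \<L> (a x) f)"
  proof (rule sections_eqI)
    note m = tame_mult_section[OF dt fs]
    show "sec_mult \<G> \<L> (unit_section \<G> \<L> a) f \<in> sections_on \<L> (arrows \<G>)" by (rule tame_mult_section[OF at fs])
    show "sec_add \<G> \<L> (sec_mult \<G> \<L> (unit_section \<G> \<L> d) f) (sec_scale \<G> \<L> (a x) f) \<in> sections_on \<L> (arrows \<G>)"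
      by (rule sec_add_section[OF m sf])
    fix \<gamma> assume g: "\<gamma> \<in> arrows \<G>"
    show "coef (sec_mult \<G> \<L> (unit_section \<G> \<L> a) f \<gamma>) =
        coef (sec_add \<G> \<L> (sec_mult \<G> \<L> (unit_section \<G> \<L> d) f) (sec_scale \<G> \<L> (a x) f) \<gamma>)"
      unfolding sec_add_coef[OF m sf g] sec_scale_coef[OF fs g] sec_mult_unit_section_left[OF fs g]
      using one[OF g] by (auto simp: d_def algebra_simps)
  qed
  then have "\<iota> (unit_section \<G> \<L> a) * \<iota> f = \<iota> (unit_section \<G> \<L> d) * \<iota> f + cscale (a x) (\<iota> f)"
    using iota(5)[OF ac fc] iota(5)[OF dc fc] iota(4)[OF Cc_mult[OF dc fc] Cc.scale[OF fc]] iota(3)[OF fc] by simp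
  then show "\<phi> (\<iota> (unit_section \<G> \<L> a) * \<iota> f) = a x * \<phi> (\<iota> f)"
    using extending_eval_null(2)[OF \<phi> d dx dr] stateD(2,3)[OF extending_eval(1)[OF \<phi> a]] by simp
qed

text \<open>A function that is 1 on the range of the support of \<open>f\<close> and 0 at \<open>x\<close> fixes \<open>f\<close>, while the state
  sees it as 0.\<close>

lemma extending_eval_off_range:
  assumes \<phi>: "\<phi> \<in> states_extending_eval \<G> \<L> \<iota> x" and x: "x \<in> units \<G>"
    and U: "open_bisection \<G> U" and f: "f \<in> Cc_on \<G> \<L> U" and n: "x \<notin> rng \<G> ` U"
  shows "\<phi> (\<iota> f) = 0"
proof -
  note fc = Cc.gen[OF U f] and fs = Cc_onD(1)[OF f]
  obtain K where K: "K \<subseteq> U" "compactin (gtop \<G>) K" "\<And>\<gamma>. \<gamma> \<in> arrows \<G> - K \<Longrightarrow> f \<gamma> = bzero \<L> \<gamma>"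
    using Cc_on_compact[OF f] by metis
  have 1: "compactin (unit_top \<G>) (rng \<G> ` K)" by (rule image_compactin[OF K(2) continuous_rng_unit_top])
  have 2: "openin (unit_top \<G>) (rng \<G> ` U)" by (rule openin_rng_image[OF open_bisectionD(1)[OF U]])
  obtain c C where b: "bump (rng \<G> ` K) C c" "C \<subseteq> rng \<G> ` U"
    using bump_exists[OF 1 2 image_mono[OF K(1)]] by blast
  note c = bumpD(1,5)[OF b(1)] b(2) bumpD(7)[OF b(1)]
  let ?c = "\<lambda>x. complex_of_real (c x)"
  have "sec_mult \<G> \<L> (unit_section \<G> \<L> ?c) f = f"
  proof (rule sections_eqI[OF tame_mult_section[OF tame_unit_section[OF c(1)] fs] fs])
    fix \<gamma> assume g: "\<gamma> \<in> arrows \<G>"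
    show "coef (sec_mult \<G> \<L> (unit_section \<G> \<L> ?c) f \<gamma>) = coef (f \<gamma>)"
      unfolding sec_mult_unit_section_left[OF fs g]
      using c(2) K(3)[of \<gamma>] coef_zero[OF g] g by (cases "\<gamma> \<in> K") auto
  qed
  then have "\<iota> (unit_section \<G> \<L> ?c) * \<iota> f = \<iota> f" using iota(5)[OF unit_section_Cc[OF c(1)] fc] by simp
  moreover have "\<phi> (\<iota> (unit_section \<G> \<L> ?c) * \<iota> f) = ?c x * \<phi> (\<iota> f)"
    by (rule extending_eval_module(2)[OF \<phi> x U f c(1)]) simp
  moreover have "c x = 0" using c(3,4) n x by blast
  ultimately show ?thesis by simp
qed

text \<open>If the arrow of \<open>U\<close> with range \<open>x\<close> has source different from \<open>x\<close>, a bump function \<open>a\<close> at \<open>x\<close>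
  of small support satisfies \<open>a f a = 0\<close>.\<close>

lemma extending_eval_moved:
  assumes \<phi>: "\<phi> \<in> states_extending_eval \<G> \<L> \<iota> x" and x: "x \<in> units \<G>"
    and U: "open_bisection \<G> U" and f: "f \<in> Cc_on \<G> \<L> U"
    and \<gamma>: "\<gamma> \<in> U" "rng \<G> \<gamma> = x" "src \<G> \<gamma> \<noteq> x"
  shows "\<phi> (\<iota> f) = 0"
proof -
  note oU = open_bisectionD[OF U] and fc = Cc.gen[OF U f] and fs = Cc_onD(1)[OF f] and ft = Cc_on_tame[OF U f]
  have s: "src \<G> \<gamma> \<in> units \<G>" using src_in_units \<gamma>(1) oU(4) by blast
  obtain V1 V2 where V: "openin (unit_top \<G>) V1" "openin (unit_top \<G>) V2" "x \<in> V1" "src \<G> \<gamma> \<in> V2" "disjnt V1 V2"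
    using unit_Hausdorff[unfolded Hausdorff_space_def, rule_format, of x "src \<G> \<gamma>"] x s \<gamma>(3) by auto
  define R where "R = rng \<G> ` (U \<inter> {\<alpha> \<in> arrows \<G>. src \<G> \<alpha> \<in> V2})"
  have R: "openin (unit_top \<G>) R"
    unfolding R_def by (rule openin_rng_image[OF openin_Int[OF oU(1) openin_src_vimage[OF V(2)]]])
  have xR: "x \<in> R" unfolding R_def using \<gamma> V(4) oU(4) by blast
  have 1: "compactin (unit_top \<G>) {x}" using x by simp
  have 2: "openin (unit_top \<G>) (V1 \<inter> R)" using V(1) R by (rule openin_Int)
  have 3: "{x} \<subseteq> V1 \<inter> R" using V(3) xR by simp
  obtain a C where b: "bump {x} C a" "C \<subseteq> V1 \<inter> R"
    using bump_exists[OF 1 2 3] by blast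
  note a = bumpD(1,5)[OF b(1)] b(2) bumpD(7)[OF b(1)]
  let ?a = "\<lambda>x. complex_of_real (a x)"
  let ?u = "unit_section \<G> \<L> ?a"
  note ac = unit_section_Cc[OF a(1)] and at = tame_unit_section[OF a(1)]
  note fac = sec_mult_Cc_on[OF U open_bisection_units f unit_section_Cc_on[OF a(1)]]
  note P = open_bisection_product[OF U open_bisection_units]
  have z: "a (rng \<G> \<alpha>) * a (src \<G> \<alpha>) = 0 \<or> coef (f \<alpha>) = 0" if aa: "\<alpha> \<in> arrows \<G>" for \<alpha>
  proof (rule ccontr)
    assume n: "\<not> ?thesis"
    then have aU: "\<alpha> \<in> U" using Cc_onD(3)[OF f, of \<alpha>] coef_zero[OF aa] aa by (cases "\<alpha> \<in> U") auto
    have "rng \<G> \<alpha> \<in> C" "src \<G> \<alpha> \<in> C" using n a(4) rng_in_units[OF aa] src_in_units[OF aa] by auto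
    then have r: "rng \<G> \<alpha> \<in> R" "src \<G> \<alpha> \<in> V1" using a(3) by auto
    then obtain \<beta> where b: "\<beta> \<in> U" "src \<G> \<beta> \<in> V2" "rng \<G> \<alpha> = rng \<G> \<beta>" unfolding R_def by auto
    then have "\<alpha> = \<beta>" using inj_onD[OF oU(2) _ aU] by blast
    then show False using r(2) b(2) V(5) by (auto simp: disjnt_iff)
  qed
  have "\<iota> (sec_mult \<G> \<L> ?u (sec_mult \<G> \<L> f ?u)) = 0"
  proof (rule iota_zero[OF Cc_mult[OF ac Cc_mult[OF fc ac]]])
    fix \<alpha> assume aa: "\<alpha> \<in> arrows \<G>"
    show "coef (sec_mult \<G> \<L> ?u (sec_mult \<G> \<L> f ?u) \<alpha>) = 0"
      unfolding sec_mult_unit_section_left[OF Cc_onD(1)[OF fac] aa] sec_mult_unit_section_right[OF ft aa]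
      using z[OF aa] by auto
  qed
  then have "\<iota> ?u * \<iota> (sec_mult \<G> \<L> f ?u) = 0" using iota(5)[OF ac Cc_mult[OF fc ac]] by simp
  then have "?a x * \<phi> (\<iota> (sec_mult \<G> \<L> f ?u)) = 0"
    using extending_eval_module(2)[OF \<phi> x P fac a(1)] stateD(4)[OF extending_eval(1)[OF \<phi> a(1)]] by simp
  then have "\<phi> (\<iota> (sec_mult \<G> \<L> f ?u)) = 0" using a(2) by simp
  moreover have "\<phi> (\<iota> (sec_mult \<G> \<L> f ?u)) = ?a x * \<phi> (\<iota> f)"
    using extending_eval_module(1)[OF \<phi> x U f a(1)] iota(5)[OF fc ac] by simp
  ultimately show ?thesis using a(2) by simp
qed

text \<open>After multiplication with a cutoff at \<open>x\<close> the section becomes a function on the unit space,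
  where the state is known.\<close>

lemma extending_eval_unit:
  assumes \<phi>: "\<phi> \<in> states_extending_eval \<G> \<L> \<iota> x" and x: "x \<in> units \<G>"
    and U: "open_bisection \<G> U" and f: "f \<in> Cc_on \<G> \<L> U" and xU: "x \<in> U"
  shows "\<phi> (\<iota> f) = coef (f x)"
proof -
  note fc = Cc.gen[OF U f]
  have V: "openin (unit_top \<G>) (U \<inter> units \<G>)"
    using open_bisectionD(1)[OF U] units_open by (auto simp: openin_unit_top_iff)
  have K: "compactin (unit_top \<G>) {x}" using x by simp
  have xV: "{x} \<subseteq> U \<inter> units \<G>" using x xU by simp
  obtain a C where b: "bump {x} C a" "C \<subseteq> U \<inter> units \<G>" using bump_exists[OF K V xV] by blast
  note a = bumpD(1,5,6)[OF b(1)] b(2) bumpD(7)[OF b(1)]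
  let ?a = "\<lambda>x. complex_of_real (a x)"
  have C: "C \<subseteq> U" "\<And>y. y \<in> units \<G> - C \<Longrightarrow> ?a y = 0" using a(4,5) by auto
  note cut = sec_mult_cutoff[OF U f a(1) a(3) C]
  have "\<phi> (\<iota> (sec_mult \<G> \<L> f (unit_section \<G> \<L> ?a))) = ?a x * \<phi> (\<iota> f)"
    using extending_eval_module(1)[OF \<phi> x U f a(1)] iota(5)[OF fc unit_section_Cc[OF a(1)]] by simp
  then show ?thesis using extending_eval(2)[OF \<phi> cut(1)] cut(2) a(2) by simp
qed

text \<open>On sections compactly supported in \<open>U\<close> all states extending the evaluation at \<open>x\<close> agree: there
  is no arrow of \<open>U\<close> with range \<open>x\<close>, or its source is another point, or it is the unit \<open>x\<close> itself. By
  continuity they agree on limits.\<close>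

lemma free_point_criterion:
  assumes U: "open_bisection \<G> U" and b: "C0_image \<G> \<L> \<iota> U h b"
    and x: "x \<in> units \<G>" "x \<notin> rng \<G> ` (U \<inter> (isotropy \<G> - units \<G>))"
  shows "x \<in> free_points \<G> \<L> \<iota> b"
proof -
  obtain f where f: "\<And>n::nat. f n \<in> Cc_on \<G> \<L> U" "(\<lambda>n. \<iota> (f n)) \<longlonglongrightarrow> b"
    using b unfolding C0_image_def by blast
  have "\<phi> b = \<psi> b" if p: "\<phi> \<in> states_extending_eval \<G> \<L> \<iota> x" "\<psi> \<in> states_extending_eval \<G> \<L> \<iota> x" for \<phi> \<psi>
  proof -
    have eq: "\<phi> (\<iota> (f n)) = \<psi> (\<iota> (f n))" for n
    proof (cases "x \<in> rng \<G> ` U")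
      case False
      then show ?thesis using extending_eval_off_range[OF _ x(1) U f(1)] p by metis
    next
      case True
      then obtain \<gamma> where g: "\<gamma> \<in> U" "rng \<G> \<gamma> = x" by blast
      show ?thesis
      proof (cases "src \<G> \<gamma> = x")
        case False
        then show ?thesis using extending_eval_moved[OF _ x(1) U f(1) g] p by metis
      next
        case True
        have "\<gamma> \<in> arrows \<G>" using g open_bisectionD(4)[OF U] by blast
        then have "\<gamma> \<in> isotropy \<G>" using True g(2) by (simp add: isotropy_def)
        then have "\<gamma> \<in> units \<G>" using x(2) g by blast
        then have "x \<in> U" using g unit_rng by simp
        then show ?thesis using extending_eval_unit[OF _ x(1) U f(1)] p by metis
      qed
    qed
    have "bounded_linear \<phi>" "bounded_linear \<psi>" using p stateD(1) by (auto simp: states_extending_eval_def)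
    then have "(\<lambda>n. \<phi> (\<iota> (f n))) \<longlonglongrightarrow> \<phi> b" "(\<lambda>n. \<psi> (\<iota> (f n))) \<longlonglongrightarrow> \<psi> b"
      using bounded_linear.tendsto f(2) by blast+
    then show ?thesis using eq LIMSEQ_unique by simp
  qed
  then show ?thesis using x(1) by (simp add: free_points_def)
qed

text \<open>Free points are found in the complement of the closure of a nowhere dense set.\<close>

theorem interior_empty_imp_smooth:
  assumes int: "gtop \<G> interior_of (isotropy \<G> - units \<G>) = {}" and n: "n \<in> groupoid_normalizers \<G> \<L> \<iota>"
  shows "smooth_element \<G> \<L> \<iota> n"
proof -
  obtain U h where U: "open_bisection \<G> U" "C0_image \<G> \<L> \<iota> U h n" using n by (auto simp: groupoid_normalizers_def)
  let ?X = "unit_top \<G>"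
  define N where "N = rng \<G> ` (U \<inter> (isotropy \<G> - units \<G>))"
  have Nu: "N \<subseteq> topspace ?X" using open_bisectionD(4)[OF U(1)] rng_in_units by (auto simp: N_def)
  have "?X closure_of (topspace ?X - ?X closure_of N) = topspace ?X - ?X interior_of (?X closure_of N)"
    by (rule closure_of_complement)
  then have dense: "?X closure_of (topspace ?X - ?X closure_of N) = units \<G>"
    using isotropy_range_nowhere_dense[OF int U(1)] by (simp add: N_def)
  have "topspace ?X - ?X closure_of N \<subseteq> free_points \<G> \<L> \<iota> n"
    using free_point_criterion[OF U] closure_of_subset[OF Nu] unfolding N_def by auto
  moreover have "openin ?X (topspace ?X - ?X closure_of N)" by (rule openin_diff[OF openin_topspace closedin_closure_of])
  ultimately have "topspace ?X - ?X closure_of N \<subseteq> ?X interior_of free_points \<G> \<L> \<iota> n"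
    by (simp add: interior_of_maximal)
  from closure_of_mono[OF this, of ?X] dense
  have "units \<G> \<subseteq> ?X closure_of (?X interior_of free_points \<G> \<L> \<iota> n)" by simp
  then show ?thesis
    unfolding smooth_element_def using closure_of_subset_topspace[of ?X] by (metis subset_antisym topspace_unit_top)
qed

end

section \<open>Regular representations on finitely supported vectors\<close>

text \<open>Schur's test, with one bound for rows and columns: split \<open>\<bar>M i j\<bar>\<close> into two square roots and use
  the Cauchy-Schwarz inequality in each row.\<close>

lemma schur_test:
  fixes M :: "'a \<Rightarrow> 'b \<Rightarrow> complex"
  assumes "finite F" "finite B" "C \<ge> 0"
    and row: "\<And>i. i \<in> F \<Longrightarrow> (\<Sum>j\<in>B. cmod (M i j)) \<le> C"
    and col: "\<And>j. j \<in> B \<Longrightarrow> (\<Sum>i\<in>F. cmod (M i j)) \<le> C"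
  shows "(\<Sum>i\<in>F. (cmod (\<Sum>j\<in>B. M i j * v j))\<^sup>2) \<le> C\<^sup>2 * (\<Sum>j\<in>B. (cmod (v j))\<^sup>2)"
proof -
  have r: "(cmod (\<Sum>j\<in>B. M i j * v j))\<^sup>2 \<le> C * (\<Sum>j\<in>B. cmod (M i j) * (cmod (v j))\<^sup>2)" if i: "i \<in> F" for i
  proof -
    have "cmod (\<Sum>j\<in>B. M i j * v j) \<le> (\<Sum>j\<in>B. sqrt (cmod (M i j)) * (sqrt (cmod (M i j)) * cmod (v j)))"
      by (rule order_trans[OF norm_sum]) (simp add: norm_mult mult.assoc[symmetric])
    then have "(cmod (\<Sum>j\<in>B. M i j * v j))\<^sup>2 \<le> (\<Sum>j\<in>B. sqrt (cmod (M i j)) * (sqrt (cmod (M i j)) * cmod (v j)))\<^sup>2"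
      by (rule power_mono) simp
    also have "\<dots> \<le> (\<Sum>j\<in>B. (sqrt (cmod (M i j)))\<^sup>2) * (\<Sum>j\<in>B. (sqrt (cmod (M i j)) * cmod (v j))\<^sup>2)"
      by (rule Cauchy_Schwarz_ineq_sum)
    also have "\<dots> = (\<Sum>j\<in>B. cmod (M i j)) * (\<Sum>j\<in>B. cmod (M i j) * (cmod (v j))\<^sup>2)"
      by (simp add: power_mult_distrib)
    also have "\<dots> \<le> C * (\<Sum>j\<in>B. cmod (M i j) * (cmod (v j))\<^sup>2)"
      by (intro mult_right_mono row i sum_nonneg) simp
    finally show ?thesis .
  qed
  have "(\<Sum>i\<in>F. (cmod (\<Sum>j\<in>B. M i j * v j))\<^sup>2) \<le> (\<Sum>i\<in>F. C * (\<Sum>j\<in>B. cmod (M i j) * (cmod (v j))\<^sup>2))"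
    by (intro sum_mono r)
  also have "\<dots> = C * (\<Sum>j\<in>B. \<Sum>i\<in>F. cmod (M i j) * (cmod (v j))\<^sup>2)"
    by (subst sum.swap) (simp add: sum_distrib_left)
  also have "\<dots> = C * (\<Sum>j\<in>B. (\<Sum>i\<in>F. cmod (M i j)) * (cmod (v j))\<^sup>2)"
    by (simp add: sum_distrib_right)
  also have "\<dots> \<le> C * (\<Sum>j\<in>B. C * (cmod (v j))\<^sup>2)"
    using assms(3) by (intro mult_left_mono sum_mono mult_right_mono col) auto
  also have "\<dots> = C\<^sup>2 * (\<Sum>j\<in>B. (cmod (v j))\<^sup>2)"
    by (simp add: sum_distrib_left power2_eq_square mult.assoc)
  finally show ?thesis .
qed

definition vsupp :: "('a \<Rightarrow> complex) \<Rightarrow> 'a set" where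
  "vsupp v = {i. v i \<noteq> 0}"

definition ip :: "('a \<Rightarrow> complex) \<Rightarrow> ('a \<Rightarrow> complex) \<Rightarrow> complex" where
  "ip u v = (\<Sum>i\<in>vsupp v. cnj (u i) * v i)"

definition vnorm :: "('a \<Rightarrow> complex) \<Rightarrow> real" where
  "vnorm v = L2_set (\<lambda>i. cmod (v i)) (vsupp v)"

lemma ip_sum: "\<lbrakk>finite B; vsupp v \<subseteq> B\<rbrakk> \<Longrightarrow> ip u v = (\<Sum>i\<in>B. cnj (u i) * v i)"
  unfolding ip_def by (rule sum.mono_neutral_left) (auto simp: vsupp_def)

lemma ip_sum_left: "\<lbrakk>finite (vsupp v); finite B; vsupp u \<subseteq> B\<rbrakk> \<Longrightarrow> ip u v = (\<Sum>i\<in>B. cnj (u i) * v i)"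
  by (subst ip_sum[of "vsupp v \<union> B"], simp, simp, rule sum.mono_neutral_right) (auto simp: vsupp_def)

lemma vnorm_sum:
  assumes "finite B" "vsupp v \<subseteq> B" shows "vnorm v = L2_set (\<lambda>i. cmod (v i)) B"
proof -
  have "(\<Sum>i\<in>vsupp v. (cmod (v i))\<^sup>2) = (\<Sum>i\<in>B. (cmod (v i))\<^sup>2)"
    by (rule sum.mono_neutral_left) (use assms in \<open>auto simp: vsupp_def\<close>)
  then show ?thesis by (simp add: vnorm_def L2_set_def)
qed

lemma vnorm_sq: "\<lbrakk>finite B; vsupp v \<subseteq> B\<rbrakk> \<Longrightarrow> (vnorm v)\<^sup>2 = (\<Sum>i\<in>B. (cmod (v i))\<^sup>2)"
  by (simp add: vnorm_sum L2_set_def sum_nonneg)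

lemma vnorm_nonneg: "vnorm v \<ge> 0"
  by (simp add: vnorm_def L2_set_def sum_nonneg)

lemma ip_self: assumes "finite (vsupp v)" shows "ip v v = of_real ((vnorm v)\<^sup>2)"
proof -
  have "cnj (v i) * v i = of_real ((cmod (v i))\<^sup>2)" for i by (simp only: complex_norm_square mult.commute)
  then show ?thesis unfolding ip_def vnorm_sq[OF assms order_refl] by simp
qed

lemma ip_bound: assumes "finite (vsupp u)" "finite (vsupp v)" shows "cmod (ip u v) \<le> vnorm u * vnorm v"
proof -
  let ?B = "vsupp u \<union> vsupp v"
  have "cmod (ip u v) \<le> (\<Sum>i\<in>?B. cmod (cnj (u i) * v i))"
    using assms by (subst ip_sum[of ?B]) (auto intro: norm_sum)
  also have "\<dots> = (\<Sum>i\<in>?B. \<bar>cmod (u i)\<bar> * \<bar>cmod (v i)\<bar>)" by (simp add: norm_mult)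
  also have "\<dots> \<le> L2_set (\<lambda>i. cmod (u i)) ?B * L2_set (\<lambda>i. cmod (v i)) ?B" by (rule L2_set_mult_ineq)
  finally show ?thesis using assms by (simp add: vnorm_sum[of ?B])
qed

lemma ip_cnj: "\<lbrakk>finite (vsupp u); finite (vsupp v)\<rbrakk> \<Longrightarrow> ip v u = cnj (ip u v)"
  by (subst ip_sum_left[of u "vsupp v"], simp_all add: ip_def mult.commute)

lemma vnorm_triangle:
  assumes "finite (vsupp u)" "finite (vsupp v)" shows "vnorm (\<lambda>i. u i + v i) \<le> vnorm u + vnorm v"
proof -
  let ?B = "vsupp u \<union> vsupp v"
  have "vnorm (\<lambda>i. u i + v i) = L2_set (\<lambda>i. cmod (u i + v i)) ?B"
    using assms by (intro vnorm_sum) (auto simp: vsupp_def)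
  also have "\<dots> \<le> L2_set (\<lambda>i. cmod (u i) + cmod (v i)) ?B"
    by (intro L2_set_mono) (auto intro: norm_triangle_ineq)
  also have "\<dots> \<le> L2_set (\<lambda>i. cmod (u i)) ?B + L2_set (\<lambda>i. cmod (v i)) ?B" by (rule L2_set_triangle_ineq)
  finally show ?thesis using assms by (simp add: vnorm_sum[of ?B])
qed

lemma vnorm_scale: "vnorm (\<lambda>i. c * v i) = cmod c * vnorm v"
proof (cases "c = 0")
  case True
  then show ?thesis by (simp add: vnorm_def L2_set_def vsupp_def)
next
  case False
  then have "vsupp (\<lambda>i. c * v i) = vsupp v" by (auto simp: vsupp_def)
  then show ?thesis by (simp add: vnorm_def norm_mult L2_set_right_distrib)
qed

lemma vnorm_eq_0: assumes "finite (vsupp v)" "vnorm v = 0" shows "v = (\<lambda>i. 0)"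
proof -
  have "\<forall>i\<in>vsupp v. (cmod (v i))\<^sup>2 = 0"
    using vnorm_sq[OF assms(1) order_refl] assms by (simp add: sum_nonneg_eq_0_iff)
  then show ?thesis by (auto simp: vsupp_def)
qed

context fell_line_bundle
begin

text \<open>The left convolution by \<open>f\<close> preserves sources, so it acts on \<open>\<ell>\<^sup>2\<close> of each source fibre; \<open>mat f\<close> is
  its matrix in the orthonormal basis given by \<open>frame\<close>. The entry at \<open>(\<gamma>, \<beta>)\<close> comes from the only
  arrow that multiplies \<open>\<beta>\<close> to \<open>\<gamma>\<close>.\<close>

definition rquot :: "'g \<Rightarrow> 'g \<Rightarrow> 'g" where
  "rquot \<gamma> \<beta> = gmul \<G> \<gamma> (ginv \<G> \<beta>)"

definition mat :: "('g \<Rightarrow> 'l) \<Rightarrow> 'g \<Rightarrow> 'g \<Rightarrow> complex" where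
  "mat f \<gamma> \<beta> = coef (f (rquot \<gamma> \<beta>)) * cocycle (rquot \<gamma> \<beta>) \<beta>"

lemma src_fibreD: "\<gamma> \<in> src_fibre \<G> x \<Longrightarrow> \<gamma> \<in> arrows \<G>" "\<gamma> \<in> src_fibre \<G> x \<Longrightarrow> src \<G> \<gamma> = x"
  by (auto simp: src_fibre_def)

lemma rquot:
  assumes "\<gamma> \<in> src_fibre \<G> x" "\<beta> \<in> src_fibre \<G> x"
  shows "rquot \<gamma> \<beta> \<in> arrows \<G>" "rng \<G> (rquot \<gamma> \<beta>) = rng \<G> \<gamma>" "src \<G> (rquot \<gamma> \<beta>) = rng \<G> \<beta>"
    "(rquot \<gamma> \<beta>, \<beta>) \<in> composable \<G>" "gmul \<G> (rquot \<gamma> \<beta>) \<beta> = \<gamma>" "quot (rquot \<gamma> \<beta>) \<gamma> = \<beta>"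
    "ginv \<G> (rquot \<gamma> \<beta>) = rquot \<beta> \<gamma>"
proof -
  have a: "\<gamma> \<in> arrows \<G>" "\<beta> \<in> arrows \<G>" "src \<G> \<gamma> = src \<G> \<beta>" using assms by (auto simp: src_fibre_def)
  have c: "(\<gamma>, ginv \<G> \<beta>) \<in> composable \<G>" using a by (intro composableI) (auto simp: inv_closed rng_inv)
  show r: "rquot \<gamma> \<beta> \<in> arrows \<G>" "rng \<G> (rquot \<gamma> \<beta>) = rng \<G> \<gamma>" "src \<G> (rquot \<gamma> \<beta>) = rng \<G> \<beta>"
    unfolding rquot_def using mul_closed[OF c] rng_mul[OF c] src_mul[OF c] src_inv a by auto
  show d: "(rquot \<gamma> \<beta>, \<beta>) \<in> composable \<G>" using r a by (intro composableI) auto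
  show e: "gmul \<G> (rquot \<gamma> \<beta>) \<beta> = \<gamma>" unfolding rquot_def by (rule mul_inv_cancel_right[OF a])
  show "quot (rquot \<gamma> \<beta>) \<gamma> = \<beta>" using quot_gmul[OF d] e by simp
  show "ginv \<G> (rquot \<gamma> \<beta>) = rquot \<beta> \<gamma>" unfolding rquot_def using inv_gmul[OF c] inv_inv[OF a(2)] by simp
qed

lemma rquot_quot:
  assumes "\<alpha> \<in> arrows \<G>" "\<gamma> \<in> src_fibre \<G> x" "rng \<G> \<alpha> = rng \<G> \<gamma>"
  shows "quot \<alpha> \<gamma> \<in> src_fibre \<G> x" "rquot \<gamma> (quot \<alpha> \<gamma>) = \<alpha>"
proof -
  note q = quot[OF assms(1) src_fibreD(1)[OF assms(2)] assms(3)]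
  show "quot \<alpha> \<gamma> \<in> src_fibre \<G> x" using q assms(2) by (auto simp: src_fibre_def)
  show "rquot \<gamma> (quot \<alpha> \<gamma>) = \<alpha>" unfolding rquot_def using mul_cancel_right[OF q(4)] q(5) by simp
qed

lemma mat_nonzero:
  assumes "\<gamma> \<in> src_fibre \<G> x" "\<beta> \<in> src_fibre \<G> x"
  shows "mat f \<gamma> \<beta> = 0 \<longleftrightarrow> coef (f (rquot \<gamma> \<beta>)) = 0" "cmod (mat f \<gamma> \<beta>) = cmod (coef (f (rquot \<gamma> \<beta>)))"
  using cocycle_nonzero[OF rquot(4)[OF assms]] norm_cocycle[OF rquot(4)[OF assms]]
  by (simp_all add: mat_def Real_Vector_Spaces.norm_mult)

lemma inj_rquot_left: "\<gamma> \<in> src_fibre \<G> x \<Longrightarrow> inj_on (rquot \<gamma>) (src_fibre \<G> x)"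
  by (rule inj_on_inverseI[of _ "\<lambda>\<alpha>. quot \<alpha> \<gamma>"]) (rule rquot(6))

lemma inj_rquot_right: "\<beta> \<in> src_fibre \<G> x \<Longrightarrow> inj_on (\<lambda>\<gamma>. rquot \<gamma> \<beta>) (src_fibre \<G> x)"
  by (rule inj_on_inverseI[of _ "\<lambda>\<alpha>. gmul \<G> \<alpha> \<beta>"]) (rule rquot(5))

lemma conv_at_mat:
  assumes f: "f \<in> sections_on \<L> (arrows \<G>)" and \<gamma>: "\<gamma> \<in> src_fibre \<G> x"
    and \<xi>: "\<And>\<beta>. \<beta> \<in> src_fibre \<G> x \<Longrightarrow> \<xi> \<beta> \<in> fibre \<L> \<beta>"
    and B: "finite B" "B \<subseteq> src_fibre \<G> x"
    and z: "\<And>\<beta>. \<lbrakk>\<beta> \<in> src_fibre \<G> x; \<beta> \<notin> B\<rbrakk> \<Longrightarrow> mat f \<gamma> \<beta> * coef (\<xi> \<beta>) = 0"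
  shows "conv_at \<G> \<L> f \<xi> \<gamma> \<in> fibre \<L> \<gamma>" "coef (conv_at \<G> \<L> f \<xi> \<gamma>) = (\<Sum>\<beta>\<in>B. mat f \<gamma> \<beta> * coef (\<xi> \<beta>))"
proof -
  note ga = src_fibreD(1)[OF \<gamma>]
  define A where "A = rquot \<gamma> ` B"
  have A: "finite A" "A \<subseteq> {\<alpha> \<in> arrows \<G>. rng \<G> \<alpha> = rng \<G> \<gamma>}"
    unfolding A_def using B rquot(1,2)[OF \<gamma>] by auto
  have zA: "coef (f \<alpha>) * coef (\<xi> (quot \<alpha> \<gamma>)) = 0"
    if a: "\<alpha> \<in> arrows \<G>" "rng \<G> \<alpha> = rng \<G> \<gamma>" "\<alpha> \<notin> A" for \<alpha>
  proof -
    note q = rquot_quot[OF a(1) \<gamma> a(2)]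
    have "quot \<alpha> \<gamma> \<notin> B" using a(3) q(2) unfolding A_def by force
    from z[OF q(1) this] show ?thesis using mat_nonzero(1)[OF \<gamma> q(1), of f] q(2) by auto
  qed
  have x: "\<xi> \<beta> \<in> fibre \<L> \<beta>" if "\<beta> \<in> arrows \<G>" "src \<G> \<beta> = src \<G> \<gamma>" for \<beta>
    using \<xi> that src_fibreD(2)[OF \<gamma>] by (simp add: src_fibre_def)
  note s = conv_at_sum[OF ga sections_onD[OF f] x A zA]
  show "conv_at \<G> \<L> f \<xi> \<gamma> \<in> fibre \<L> \<gamma>" by (rule s(1))
  have "coef (conv_at \<G> \<L> f \<xi> \<gamma>) = (\<Sum>\<alpha>\<in>rquot \<gamma> ` B. coef (f \<alpha>) * coef (\<xi> (quot \<alpha> \<gamma>)) * cocycle \<alpha> (quot \<alpha> \<gamma>))"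
    using s(2) unfolding A_def .
  also have "\<dots> = (\<Sum>\<beta>\<in>B. coef (f (rquot \<gamma> \<beta>)) * coef (\<xi> (quot (rquot \<gamma> \<beta>) \<gamma>)) * cocycle (rquot \<gamma> \<beta>) (quot (rquot \<gamma> \<beta>) \<gamma>))"
    by (subst sum.reindex[OF inj_on_subset[OF inj_rquot_left[OF \<gamma>] B(2)]]) (simp add: o_def)
  also have "\<dots> = (\<Sum>\<beta>\<in>B. mat f \<gamma> \<beta> * coef (\<xi> \<beta>))"
    by (rule sum.cong[OF refl]) (use rquot(6)[OF \<gamma>] B(2) in \<open>auto simp: mat_def subset_iff\<close>)
  finally show "coef (conv_at \<G> \<L> f \<xi> \<gamma>) = (\<Sum>\<beta>\<in>B. mat f \<gamma> \<beta> * coef (\<xi> \<beta>))" .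
qed

lemma mat_row_finite:
  assumes "tame f" "\<gamma> \<in> src_fibre \<G> x" shows "finite {\<beta> \<in> src_fibre \<G> x. mat f \<gamma> \<beta> \<noteq> 0}"
proof (rule finite_imageD[of "rquot \<gamma>"])
  show "finite (rquot \<gamma> ` {\<beta> \<in> src_fibre \<G> x. mat f \<gamma> \<beta> \<noteq> 0})"
    by (rule finite_subset[OF _ tameD(4)[OF assms(1), of "rng \<G> \<gamma>"]]) (use rquot(1,2)[OF assms(2)] mat_nonzero(1)[OF assms(2)] in auto)
  show "inj_on (rquot \<gamma>) {\<beta> \<in> src_fibre \<G> x. mat f \<gamma> \<beta> \<noteq> 0}"
    by (rule inj_on_subset[OF inj_rquot_left[OF assms(2)]]) auto
qed

lemma mat_column_finite:
  assumes "tame f" "\<beta> \<in> src_fibre \<G> x" shows "finite {\<gamma> \<in> src_fibre \<G> x. mat f \<gamma> \<beta> \<noteq> 0}"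
proof (rule finite_imageD[of "\<lambda>\<gamma>. rquot \<gamma> \<beta>"])
  show "finite ((\<lambda>\<gamma>. rquot \<gamma> \<beta>) ` {\<gamma> \<in> src_fibre \<G> x. mat f \<gamma> \<beta> \<noteq> 0})"
    by (rule finite_subset[OF _ tameD(3)[OF assms(1), of "rng \<G> \<beta>"]]) (use rquot(1,3)[OF _ assms(2)] mat_nonzero(1)[OF _ assms(2)] in auto)
  show "inj_on (\<lambda>\<gamma>. rquot \<gamma> \<beta>) {\<gamma> \<in> src_fibre \<G> x. mat f \<gamma> \<beta> \<noteq> 0}"
    by (rule inj_on_subset[OF inj_rquot_right[OF assms(2)]]) auto
qed

lemma mat_schur:
  assumes C: "schur_bounded f C" and F: "finite F" "F \<subseteq> src_fibre \<G> x" and B: "finite B" "B \<subseteq> src_fibre \<G> x"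
  shows "(\<Sum>\<gamma>\<in>F. (cmod (\<Sum>\<beta>\<in>B. mat f \<gamma> \<beta> * v \<beta>))\<^sup>2) \<le> C\<^sup>2 * (\<Sum>\<beta>\<in>B. (cmod (v \<beta>))\<^sup>2)"
proof (rule schur_test[OF F(1) B(1)])
  have "(\<Sum>\<gamma>\<in>{}. cmod (coef (f \<gamma>))) \<le> C"
    using C unfolding schur_bounded_def by (elim allE[of _ "{}"]) auto
  then show "C \<ge> 0" by simp
  fix \<gamma> assume "\<gamma> \<in> F"
  then have g: "\<gamma> \<in> src_fibre \<G> x" using F by blast
  have "(\<Sum>\<beta>\<in>B. cmod (mat f \<gamma> \<beta>)) = (\<Sum>\<beta>\<in>B. cmod (coef (f (rquot \<gamma> \<beta>))))"
    by (rule sum.cong[OF refl]) (use mat_nonzero(2)[OF g] B in auto)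
  also have "\<dots> = (\<Sum>\<alpha>\<in>rquot \<gamma> ` B. cmod (coef (f \<alpha>)))"
    by (subst sum.reindex[OF inj_on_subset[OF inj_rquot_left[OF g] B(2)]]) (simp add: o_def)
  also have "\<dots> \<le> C"
  proof -
    have "finite (rquot \<gamma> ` B)" "rquot \<gamma> ` B \<subseteq> arrows \<G>" "rng \<G> ` rquot \<gamma> ` B \<subseteq> {rng \<G> \<gamma>}"
      using B rquot(1,2)[OF g] by auto
    then show ?thesis using C unfolding schur_bounded_def by blast
  qed
  finally show "(\<Sum>\<beta>\<in>B. cmod (mat f \<gamma> \<beta>)) \<le> C" .
next
  fix \<beta> assume "\<beta> \<in> B"
  then have b: "\<beta> \<in> src_fibre \<G> x" using B by blast
  have "(\<Sum>\<gamma>\<in>F. cmod (mat f \<gamma> \<beta>)) = (\<Sum>\<gamma>\<in>F. cmod (coef (f (rquot \<gamma> \<beta>))))"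
    by (rule sum.cong[OF refl]) (use mat_nonzero(2)[OF _ b] F in auto)
  also have "\<dots> = (\<Sum>\<alpha>\<in>(\<lambda>\<gamma>. rquot \<gamma> \<beta>) ` F. cmod (coef (f \<alpha>)))"
    by (subst sum.reindex[OF inj_on_subset[OF inj_rquot_right[OF b] F(2)]]) (simp add: o_def)
  also have "\<dots> \<le> C"
  proof -
    have "finite ((\<lambda>\<gamma>. rquot \<gamma> \<beta>) ` F)" "(\<lambda>\<gamma>. rquot \<gamma> \<beta>) ` F \<subseteq> arrows \<G>"
      "src \<G> ` (\<lambda>\<gamma>. rquot \<gamma> \<beta>) ` F \<subseteq> {rng \<G> \<beta>}"
      using F rquot(1,3)[OF _ b] by auto
    then show ?thesis using C unfolding schur_bounded_def by blast
  qed
  finally show "(\<Sum>\<gamma>\<in>F. cmod (mat f \<gamma> \<beta>)) \<le> C" .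
qed

definition fvec :: "'g \<Rightarrow> ('g \<Rightarrow> complex) set" where
  "fvec x = {v. finite (vsupp v) \<and> vsupp v \<subseteq> src_fibre \<G> x}"

definition conv_op :: "'g \<Rightarrow> ('g \<Rightarrow> 'l) \<Rightarrow> ('g \<Rightarrow> complex) \<Rightarrow> 'g \<Rightarrow> complex" where
  "conv_op x f v \<gamma> = (if \<gamma> \<in> src_fibre \<G> x then \<Sum>\<beta>\<in>vsupp v. mat f \<gamma> \<beta> * v \<beta> else 0)"

lemma fvecD: "v \<in> fvec x \<Longrightarrow> finite (vsupp v)" "v \<in> fvec x \<Longrightarrow> vsupp v \<subseteq> src_fibre \<G> x"
  by (auto simp: fvec_def)

lemma conv_op_sum:
  assumes v: "v \<in> fvec x" and \<gamma>: "\<gamma> \<in> src_fibre \<G> x" and B: "finite B" "B \<subseteq> src_fibre \<G> x"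
    and z: "\<And>\<beta>. \<lbrakk>\<beta> \<in> src_fibre \<G> x; \<beta> \<notin> B\<rbrakk> \<Longrightarrow> mat f \<gamma> \<beta> * v \<beta> = 0"
  shows "conv_op x f v \<gamma> = (\<Sum>\<beta>\<in>B. mat f \<gamma> \<beta> * v \<beta>)"
proof -
  have "(\<Sum>\<beta>\<in>vsupp v. mat f \<gamma> \<beta> * v \<beta>) = (\<Sum>\<beta>\<in>vsupp v \<union> B. mat f \<gamma> \<beta> * v \<beta>)"
    by (rule sum.mono_neutral_left) (use fvecD(1)[OF v] B in \<open>auto simp: vsupp_def\<close>)
  also have "\<dots> = (\<Sum>\<beta>\<in>B. mat f \<gamma> \<beta> * v \<beta>)"
    by (rule sum.mono_neutral_right) (use fvecD[OF v] B z in auto)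
  finally show ?thesis using \<gamma> by (simp add: conv_op_def)
qed

lemma conv_op_fvec:
  assumes f: "tame f" and v: "v \<in> fvec x" shows "conv_op x f v \<in> fvec x"
proof -
  have "vsupp (conv_op x f v) \<subseteq> (\<Union>\<beta>\<in>vsupp v. {\<gamma> \<in> src_fibre \<G> x. mat f \<gamma> \<beta> \<noteq> 0})"
  proof
    fix \<gamma> assume "\<gamma> \<in> vsupp (conv_op x f v)"
    then have nz: "\<gamma> \<in> src_fibre \<G> x" "(\<Sum>\<beta>\<in>vsupp v. mat f \<gamma> \<beta> * v \<beta>) \<noteq> 0"
      by (auto simp: vsupp_def conv_op_def split: if_splits)
    then obtain \<beta> where "\<beta> \<in> vsupp v" "mat f \<gamma> \<beta> * v \<beta> \<noteq> 0" by (meson sum.neutral)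
    then show "\<gamma> \<in> (\<Union>\<beta>\<in>vsupp v. {\<gamma> \<in> src_fibre \<G> x. mat f \<gamma> \<beta> \<noteq> 0})" using nz(1) by auto
  qed
  moreover have "finite (\<Union>\<beta>\<in>vsupp v. {\<gamma> \<in> src_fibre \<G> x. mat f \<gamma> \<beta> \<noteq> 0})"
    using fvecD[OF v] mat_column_finite[OF f] by blast
  ultimately have "finite (vsupp (conv_op x f v))" by (rule finite_subset)
  then show ?thesis by (auto simp: fvec_def vsupp_def conv_op_def split: if_splits)
qed

lemma conv_op_bound:
  assumes f: "tame f" and C: "schur_bounded f C" "C \<ge> 0" and v: "v \<in> fvec x"
  shows "vnorm (conv_op x f v) \<le> C * vnorm v"
proof -
  let ?F = "vsupp (conv_op x f v)"
  note F = fvecD[OF conv_op_fvec[OF f v]] and B = fvecD[OF v]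
  have "(vnorm (conv_op x f v))\<^sup>2 = (\<Sum>\<gamma>\<in>?F. (cmod (\<Sum>\<beta>\<in>vsupp v. mat f \<gamma> \<beta> * v \<beta>))\<^sup>2)"
    unfolding vnorm_sq[OF F(1) order_refl] by (rule sum.cong[OF refl]) (use F(2) in \<open>auto simp: conv_op_def\<close>)
  also have "\<dots> \<le> C\<^sup>2 * (vnorm v)\<^sup>2"
    unfolding vnorm_sq[OF B(1) order_refl] by (rule mat_schur[OF C(1) F B])
  finally have "(vnorm (conv_op x f v))\<^sup>2 \<le> (C * vnorm v)\<^sup>2" by (simp add: power_mult_distrib)
  then show ?thesis by (rule power2_le_imp_le) (use C(2) vnorm_nonneg[of v] in simp)
qed

lemma conv_op_scale_vec:
  assumes "c \<noteq> 0" shows "conv_op x f (\<lambda>i. c * v i) = (\<lambda>i. c * conv_op x f v i)"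
proof
  have "vsupp (\<lambda>i. c * v i) = vsupp v" using assms by (auto simp: vsupp_def)
  then show "conv_op x f (\<lambda>i. c * v i) \<gamma> = c * conv_op x f v \<gamma>" for \<gamma>
    by (simp add: conv_op_def sum_distrib_left ac_simps)
qed

lemma conv_op_add:
  assumes "f \<in> sections_on \<L> (arrows \<G>)" "g \<in> sections_on \<L> (arrows \<G>)" "v \<in> fvec x"
  shows "conv_op x (sec_add \<G> \<L> f g) v = (\<lambda>i. conv_op x f v i + conv_op x g v i)"
proof
  fix \<gamma>
  have "mat (sec_add \<G> \<L> f g) \<gamma> \<beta> = mat f \<gamma> \<beta> + mat g \<gamma> \<beta>" if "\<gamma> \<in> src_fibre \<G> x" "\<beta> \<in> src_fibre \<G> x" for \<beta>
    unfolding mat_def sec_add_coef[OF assms(1,2) rquot(1)[OF that]] by (rule distrib_right)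
  then show "conv_op x (sec_add \<G> \<L> f g) v \<gamma> = conv_op x f v \<gamma> + conv_op x g v \<gamma>"
    using fvecD(2)[OF assms(3)] by (auto simp: conv_op_def distrib_right sum.distrib[symmetric] subset_iff intro!: sum.cong)
qed

lemma conv_op_scale:
  assumes "f \<in> sections_on \<L> (arrows \<G>)" "v \<in> fvec x"
  shows "conv_op x (sec_scale \<G> \<L> c f) v = (\<lambda>i. c * conv_op x f v i)"
proof
  fix \<gamma>
  have "mat (sec_scale \<G> \<L> c f) \<gamma> \<beta> = c * mat f \<gamma> \<beta>" if "\<gamma> \<in> src_fibre \<G> x" "\<beta> \<in> src_fibre \<G> x" for \<beta>
    unfolding mat_def sec_scale_coef[OF assms(1) rquot(1)[OF that]] by (rule mult.assoc)
  then show "conv_op x (sec_scale \<G> \<L> c f) v \<gamma> = c * conv_op x f v \<gamma>"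
    using fvecD(2)[OF assms(2)] by (auto simp: conv_op_def sum_distrib_left subset_iff mult.assoc intro!: sum.cong)
qed

lemma mat_star:
  assumes f: "f \<in> sections_on \<L> (arrows \<G>)" and "\<gamma> \<in> src_fibre \<G> x" "\<beta> \<in> src_fibre \<G> x"
  shows "mat (sec_star \<G> \<L> f) \<beta> \<gamma> = cnj (mat f \<gamma> \<beta>)"
proof -
  note r = rquot[OF assms(2,3)] and s = rquot[OF assms(3,2)]
  have "mat (sec_star \<G> \<L> f) \<beta> \<gamma> = cnj (coef (f (rquot \<gamma> \<beta>))) *
      (coef (bstar \<L> (frame (rquot \<gamma> \<beta>))) * cocycle (ginv \<G> (rquot \<gamma> \<beta>)) (gmul \<G> (rquot \<gamma> \<beta>) \<beta>))"
    unfolding mat_def sec_star_coef[OF f s(1)] s(7) r(5,7) by (rule mult.assoc)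
  then show ?thesis unfolding cocycle_star[OF r(4)] by (simp add: mat_def)
qed

lemma conv_op_adjoint:
  assumes f: "tame f" and u: "u \<in> fvec x" and v: "v \<in> fvec x"
  shows "ip u (conv_op x f v) = ip (conv_op x (sec_star \<G> \<L> f) u) v"
proof -
  note fs = tameD(1)[OF f]
  have "ip u (conv_op x f v) = (\<Sum>\<gamma>\<in>vsupp u. cnj (u \<gamma>) * conv_op x f v \<gamma>)"
    by (rule ip_sum_left[OF fvecD(1)[OF conv_op_fvec[OF f v]] fvecD(1)[OF u] order_refl])
  also have "\<dots> = (\<Sum>\<gamma>\<in>vsupp u. \<Sum>\<beta>\<in>vsupp v. cnj (u \<gamma>) * (mat f \<gamma> \<beta> * v \<beta>))"
    by (rule sum.cong[OF refl]) (use fvecD(2)[OF u] in \<open>auto simp: conv_op_def sum_distrib_left\<close>)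
  also have "\<dots> = (\<Sum>\<beta>\<in>vsupp v. \<Sum>\<gamma>\<in>vsupp u. cnj (mat (sec_star \<G> \<L> f) \<beta> \<gamma> * u \<gamma>) * v \<beta>)"
    by (subst sum.swap, rule sum.cong[OF refl], rule sum.cong[OF refl])
      (use mat_star[OF fs] fvecD(2)[OF u] fvecD(2)[OF v] in \<open>auto simp: subset_iff\<close>)
  also have "\<dots> = ip (conv_op x (sec_star \<G> \<L> f) u) v"
    unfolding ip_def by (rule sum.cong[OF refl]) (use fvecD(2)[OF v] in \<open>auto simp: conv_op_def sum_distrib_right\<close>)
  finally show ?thesis .
qed

text \<open>The twists of the two factors match those of the product by the cocycle identity.\<close>

lemma mat_mult:
  assumes f: "tame f" and g: "g \<in> sections_on \<L> (arrows \<G>)"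
    and \<gamma>: "\<gamma> \<in> src_fibre \<G> x" and \<delta>: "\<delta> \<in> src_fibre \<G> x"
  shows "mat (sec_mult \<G> \<L> f g) \<gamma> \<delta> = (\<Sum>\<kappa>\<in>conv_support f \<gamma>. mat f \<gamma> (quot \<kappa> \<gamma>) * mat g (quot \<kappa> \<gamma>) \<delta>)"
proof -
  note r = rquot[OF \<gamma> \<delta>]
  let ?\<rho> = "rquot \<gamma> \<delta>"
  have cs: "conv_support f ?\<rho> = conv_support f \<gamma>" unfolding conv_support_def r(2) ..
  have sub: "conv_support f \<gamma> \<subseteq> {\<alpha> \<in> arrows \<G>. rng \<G> \<alpha> = rng \<G> ?\<rho>}" unfolding r(2) by (rule conv_support_subset)
  have cl: "conv_support f ?\<rho> \<subseteq> conv_support f \<gamma>" using cs by simp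
  have "mat (sec_mult \<G> \<L> f g) \<gamma> \<delta> =
      (\<Sum>\<kappa>\<in>conv_support f \<gamma>. coef (f \<kappa>) * coef (g (quot \<kappa> ?\<rho>)) * cocycle \<kappa> (quot \<kappa> ?\<rho>)) * cocycle ?\<rho> \<delta>"
    unfolding mat_def tame_mult_coef[OF f g r(1) conv_support_finite[OF f] sub cl] ..
  also have "\<dots> = (\<Sum>\<kappa>\<in>conv_support f \<gamma>. mat f \<gamma> (quot \<kappa> \<gamma>) * mat g (quot \<kappa> \<gamma>) \<delta>)"
    unfolding sum_distrib_right
  proof (rule sum.cong[OF refl])
    fix \<kappa> assume "\<kappa> \<in> conv_support f \<gamma>"
    then have k: "\<kappa> \<in> arrows \<G>" "rng \<G> \<kappa> = rng \<G> \<gamma>" "rng \<G> \<kappa> = rng \<G> ?\<rho>" using r(2) by (auto simp: conv_support_def)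
    note q = quot[OF k(1) r(1) k(3)] and qg = quot[OF k(1) src_fibreD(1)[OF \<gamma>] k(2)] and rq = rquot_quot[OF k(1) \<gamma> k(2)]
    let ?l = "quot \<kappa> ?\<rho>"
    have ld: "(?l, \<delta>) \<in> composable \<G>" using q(1,3) r(3) src_fibreD(1)[OF \<delta>] by (intro composableI) auto
    have lm: "gmul \<G> ?l \<delta> = quot \<kappa> \<gamma>"
    proof -
      have "gmul \<G> \<kappa> (gmul \<G> ?l \<delta>) = \<gamma>" using mul_assoc[OF q(4) ld] q(5) r(5) by simp
      moreover have "(\<kappa>, gmul \<G> ?l \<delta>) \<in> composable \<G>"
        using k(1) mul_closed[OF ld] rng_mul[OF ld] q(2) by (intro composableI) auto
      ultimately show ?thesis using quot_gmul by metis
    qed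
    have rl: "rquot (quot \<kappa> \<gamma>) \<delta> = ?l" unfolding rquot_def[of "quot \<kappa> \<gamma>" \<delta>] using mul_cancel_right[OF ld] lm by simp
    have "cocycle \<kappa> ?l * cocycle ?\<rho> \<delta> = cocycle \<kappa> (quot \<kappa> \<gamma>) * cocycle ?l \<delta>"
      using cocycle_identity[OF q(4) ld] q(5) lm by simp
    then have "coef (f \<kappa>) * coef (g ?l) * (cocycle \<kappa> ?l * cocycle ?\<rho> \<delta>) =
        coef (f \<kappa>) * coef (g ?l) * (cocycle \<kappa> (quot \<kappa> \<gamma>) * cocycle ?l \<delta>)" by simp
    then show "coef (f \<kappa>) * coef (g ?l) * cocycle \<kappa> ?l * cocycle ?\<rho> \<delta> = mat f \<gamma> (quot \<kappa> \<gamma>) * mat g (quot \<kappa> \<gamma>) \<delta>"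
      unfolding mat_def rq(2) rl by (simp only: ac_simps)
  qed
  finally show ?thesis .
qed

lemma conv_op_mult:
  assumes f: "tame f" and g: "tame g" and v: "v \<in> fvec x"
  shows "conv_op x (sec_mult \<G> \<L> f g) v = conv_op x f (conv_op x g v)"
proof
  fix \<gamma>
  show "conv_op x (sec_mult \<G> \<L> f g) v \<gamma> = conv_op x f (conv_op x g v) \<gamma>"
  proof (cases "\<gamma> \<in> src_fibre \<G> x")
    case True
    let ?A = "conv_support f \<gamma>" and ?w = "conv_op x g v"
    have A: "\<kappa> \<in> arrows \<G>" "rng \<G> \<kappa> = rng \<G> \<gamma>" if "\<kappa> \<in> ?A" for \<kappa> using that by (auto simp: conv_support_def)
    have q: "quot \<kappa> \<gamma> \<in> src_fibre \<G> x" if "\<kappa> \<in> ?A" for \<kappa> using rquot_quot(1)[OF A(1)[OF that] True A(2)[OF that]] .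
    have inj: "inj_on (\<lambda>\<kappa>. quot \<kappa> \<gamma>) ?A"
      by (rule inj_on_inverseI[of _ "rquot \<gamma>"]) (rule rquot_quot(2)[OF A(1) True A(2)])
    have "conv_op x (sec_mult \<G> \<L> f g) v \<gamma> =
        (\<Sum>\<delta>\<in>vsupp v. (\<Sum>\<kappa>\<in>?A. mat f \<gamma> (quot \<kappa> \<gamma>) * mat g (quot \<kappa> \<gamma>) \<delta>) * v \<delta>)"
      unfolding conv_op_def using True fvecD(2)[OF v] mat_mult[OF f tameD(1)[OF g] True] by (auto intro!: sum.cong)
    also have "\<dots> = (\<Sum>\<kappa>\<in>?A. \<Sum>\<delta>\<in>vsupp v. mat f \<gamma> (quot \<kappa> \<gamma>) * (mat g (quot \<kappa> \<gamma>) \<delta> * v \<delta>))"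
      unfolding sum_distrib_right by (subst sum.swap) (simp add: mult.assoc)
    also have "\<dots> = (\<Sum>\<kappa>\<in>?A. mat f \<gamma> (quot \<kappa> \<gamma>) * ?w (quot \<kappa> \<gamma>))"
      by (rule sum.cong[OF refl]) (simp add: conv_op_def q sum_distrib_left)
    also have "\<dots> = (\<Sum>\<beta>\<in>(\<lambda>\<kappa>. quot \<kappa> \<gamma>) ` ?A. mat f \<gamma> \<beta> * ?w \<beta>)"
      by (subst sum.reindex[OF inj]) (simp add: o_def)
    also have "\<dots> = conv_op x f ?w \<gamma>"
    proof (rule conv_op_sum[OF conv_op_fvec[OF g v] True, symmetric])
      show "finite ((\<lambda>\<kappa>. quot \<kappa> \<gamma>) ` ?A)" using conv_support_finite[OF f] by blast
      show "(\<lambda>\<kappa>. quot \<kappa> \<gamma>) ` ?A \<subseteq> src_fibre \<G> x" using q by blast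
      fix \<beta> assume b: "\<beta> \<in> src_fibre \<G> x" "\<beta> \<notin> (\<lambda>\<kappa>. quot \<kappa> \<gamma>) ` ?A"
      note r = rquot[OF True b(1)]
      have "rquot \<gamma> \<beta> \<notin> ?A" using b(2) r(6) by force
      then have "coef (f (rquot \<gamma> \<beta>)) = 0" using r(1,2) by (auto simp: conv_support_def)
      then show "mat f \<gamma> \<beta> * ?w \<beta> = 0" by (simp add: mat_def)
    qed
    finally show ?thesis .
  qed (simp add: conv_op_def)
qed

section \<open>The C*-seminorm of a regular representation\<close>

text \<open>The norm of the convolution operator on finitely supported vectors. They form an invariant
  subspace, on which all inner products are finite sums.\<close>

definition rep_norm :: "'g \<Rightarrow> ('g \<Rightarrow> 'l) \<Rightarrow> real" where
  "rep_norm x f = Sup {vnorm (conv_op x f v) |v. v \<in> fvec x \<and> vnorm v \<le> 1}"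

lemma zero_fvec: "(\<lambda>i. 0) \<in> fvec x"
  by (simp add: fvec_def vsupp_def)

lemma vnorm_zero: "vnorm (\<lambda>i. 0) = 0"
  by (simp add: vnorm_def vsupp_def)

lemma conv_op_zero: "conv_op x f (\<lambda>i. 0) = (\<lambda>i. 0)"
  by (simp add: conv_op_def vsupp_def fun_eq_iff)

lemma rep_norm_bounds:
  assumes f: "tame f"
  shows "v \<in> fvec x \<Longrightarrow> vnorm (conv_op x f v) \<le> rep_norm x f * vnorm v" "rep_norm x f \<ge> 0"
    "\<lbrakk>M \<ge> 0; \<And>v. v \<in> fvec x \<Longrightarrow> vnorm v \<le> 1 \<Longrightarrow> vnorm (conv_op x f v) \<le> M\<rbrakk> \<Longrightarrow> rep_norm x f \<le> M"
proof -
  let ?S = "{vnorm (conv_op x f v) |v. v \<in> fvec x \<and> vnorm v \<le> 1}"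
  obtain C0 where C0: "schur_bounded f C0" using f by (auto simp: tame_def)
  then have "schur_bounded f (max C0 0)" unfolding schur_bounded_def by (meson max.coboundedI1)
  then obtain C where C: "schur_bounded f C" "C \<ge> 0" by (meson max.cobounded2)
  have bdd: "bdd_above ?S"
  proof (rule bdd_aboveI[of _ C])
    fix t assume "t \<in> ?S"
    then obtain v where v: "t = vnorm (conv_op x f v)" "v \<in> fvec x" "vnorm v \<le> 1" by blast
    have "t \<le> C * vnorm v" using conv_op_bound[OF f C v(2)] v(1) by simp
    also have "\<dots> \<le> C * 1" using v(3) C(2) by (rule mult_left_mono)
    finally show "t \<le> C" by simp
  qed
  have ub: "vnorm (conv_op x f v) \<le> rep_norm x f" if "v \<in> fvec x" "vnorm v \<le> 1" for v
    unfolding rep_norm_def by (rule cSup_upper[OF _ bdd]) (use that in blast)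
  show nn: "rep_norm x f \<ge> 0" using ub[OF zero_fvec] by (simp add: conv_op_zero vnorm_zero)
  show "rep_norm x f \<le> M" if M: "M \<ge> 0" "\<And>v. v \<in> fvec x \<Longrightarrow> vnorm v \<le> 1 \<Longrightarrow> vnorm (conv_op x f v) \<le> M"
    unfolding rep_norm_def
  proof (rule cSup_least)
    have "vnorm (conv_op x f (\<lambda>i. 0)) \<in> ?S"
      by (rule CollectI, rule exI[of _ "\<lambda>i. 0"]) (simp add: zero_fvec vnorm_zero)
    then show "?S \<noteq> {}" by blast
    show "t \<le> M" if "t \<in> ?S" for t using that M(2) by blast
  qed
  show "vnorm (conv_op x f v) \<le> rep_norm x f * vnorm v" if v: "v \<in> fvec x"
  proof (cases "vnorm v = 0")
    case True
    then have "v = (\<lambda>i. 0)" using vnorm_eq_0[OF fvecD(1)[OF v]] by simp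
    then show ?thesis by (simp add: conv_op_zero vnorm_zero)
  next
    case False
    let ?c = "complex_of_real (1 / vnorm v)"
    have c: "?c \<noteq> 0" "cmod ?c = 1 / vnorm v" using False vnorm_nonneg[of v] by (auto simp: norm_divide)
    have "vsupp (\<lambda>i. ?c * v i) = vsupp v" using c(1) by (auto simp: vsupp_def)
    then have w: "(\<lambda>i. ?c * v i) \<in> fvec x" using v by (simp add: fvec_def)
    have "vnorm (\<lambda>i. ?c * v i) = 1" unfolding vnorm_scale c(2) using False by simp
    with ub[OF w] have "vnorm (conv_op x f v) / vnorm v \<le> rep_norm x f"
      unfolding conv_op_scale_vec[OF c(1)] vnorm_scale c(2) by simp
    then show ?thesis using False vnorm_nonneg[of v] by (simp add: pos_divide_le_eq)
  qed
qed

lemma rep_norm_add: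
  assumes "tame f" "tame g" shows "rep_norm x (sec_add \<G> \<L> f g) \<le> rep_norm x f + rep_norm x g"
proof (rule rep_norm_bounds(3)[OF tame_add[OF assms]])
  note nn = rep_norm_bounds(2)[OF assms(1), of x] rep_norm_bounds(2)[OF assms(2), of x]
  show "0 \<le> rep_norm x f + rep_norm x g" using nn by simp
  fix v assume v: "v \<in> fvec x" "vnorm v \<le> 1"
  have "vnorm (conv_op x (sec_add \<G> \<L> f g) v) \<le> vnorm (conv_op x f v) + vnorm (conv_op x g v)"
    unfolding conv_op_add[OF tameD(1)[OF assms(1)] tameD(1)[OF assms(2)] v(1)]
    by (rule vnorm_triangle) (use conv_op_fvec v(1) assms fvecD(1) in blast)+
  also have "\<dots> \<le> rep_norm x f * vnorm v + rep_norm x g * vnorm v"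
    by (intro add_mono rep_norm_bounds(1) assms v(1))
  also have "\<dots> \<le> rep_norm x f * 1 + rep_norm x g * 1" using nn v(2) by (intro add_mono mult_left_mono)
  finally show "vnorm (conv_op x (sec_add \<G> \<L> f g) v) \<le> rep_norm x f + rep_norm x g" by simp
qed

lemma rep_norm_scale:
  assumes "tame f" shows "rep_norm x (sec_scale \<G> \<L> c f) = cmod c * rep_norm x f"
proof (rule antisym)
  note s = tameD(1)[OF assms] and t = tame_scale[OF assms, of c]
  note nn = rep_norm_bounds(2)[OF assms, of x]
  show "rep_norm x (sec_scale \<G> \<L> c f) \<le> cmod c * rep_norm x f"
  proof (rule rep_norm_bounds(3)[OF t])
    fix v assume v: "v \<in> fvec x" "vnorm v \<le> 1"
    have "vnorm (conv_op x f v) \<le> rep_norm x f * 1"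
      by (rule order_trans[OF rep_norm_bounds(1)[OF assms v(1)] mult_left_mono[OF v(2) nn]])
    then show "vnorm (conv_op x (sec_scale \<G> \<L> c f) v) \<le> cmod c * rep_norm x f"
      unfolding conv_op_scale[OF s v(1)] vnorm_scale by (simp add: mult_left_mono)
  qed (use nn in simp)
  show "cmod c * rep_norm x f \<le> rep_norm x (sec_scale \<G> \<L> c f)"
  proof (cases "c = 0")
    case True
    then show ?thesis using rep_norm_bounds(2)[OF t] by simp
  next
    case False
    note nn' = rep_norm_bounds(2)[OF t, of x]
    have "rep_norm x f \<le> rep_norm x (sec_scale \<G> \<L> c f) / cmod c"
    proof (rule rep_norm_bounds(3)[OF assms])
      fix v assume v: "v \<in> fvec x" "vnorm v \<le> 1"
      have "cmod c * vnorm (conv_op x f v) = vnorm (conv_op x (sec_scale \<G> \<L> c f) v)"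
        unfolding conv_op_scale[OF s v(1)] vnorm_scale ..
      also have "\<dots> \<le> rep_norm x (sec_scale \<G> \<L> c f) * 1"
        by (rule order_trans[OF rep_norm_bounds(1)[OF t v(1)] mult_left_mono[OF v(2) nn']])
      finally show "vnorm (conv_op x f v) \<le> rep_norm x (sec_scale \<G> \<L> c f) / cmod c"
        using False by (simp add: field_simps)
    qed (use nn' in simp)
    then show ?thesis using False by (simp add: field_simps)
  qed
qed

lemma tame_mult:
  assumes "f \<in> Cc \<G> \<L>" "g \<in> Cc \<G> \<L>" shows "tame (sec_mult \<G> \<L> f g)"
  using Cc_tame[OF Cc_mult[OF assms]] .

lemma rep_norm_mult:
  assumes fc: "f \<in> Cc \<G> \<L>" and gc: "g \<in> Cc \<G> \<L>"
  shows "rep_norm x (sec_mult \<G> \<L> f g) \<le> rep_norm x f * rep_norm x g"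
proof (rule rep_norm_bounds(3)[OF tame_mult[OF assms]])
  note f = Cc_tame[OF fc] and g = Cc_tame[OF gc]
  note nn = rep_norm_bounds(2)[OF f, of x] rep_norm_bounds(2)[OF g, of x]
  show "0 \<le> rep_norm x f * rep_norm x g" using nn by simp
  fix v assume v: "v \<in> fvec x" "vnorm v \<le> 1"
  have "vnorm (conv_op x (sec_mult \<G> \<L> f g) v) \<le> rep_norm x f * vnorm (conv_op x g v)"
    unfolding conv_op_mult[OF f g v(1)] by (rule rep_norm_bounds(1)[OF f conv_op_fvec[OF g v(1)]])
  also have "\<dots> \<le> rep_norm x f * (rep_norm x g * vnorm v)"
    using nn by (intro mult_left_mono rep_norm_bounds(1) g v(1))
  also have "\<dots> \<le> rep_norm x f * (rep_norm x g * 1)" using nn v(2) by (intro mult_left_mono)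
  finally show "vnorm (conv_op x (sec_mult \<G> \<L> f g) v) \<le> rep_norm x f * rep_norm x g" by simp
qed

lemma rep_norm_star_le:
  assumes f: "tame f" shows "rep_norm x (sec_star \<G> \<L> f) \<le> rep_norm x f"
proof (rule rep_norm_bounds(3)[OF tame_star[OF f] rep_norm_bounds(2)[OF f]])
  fix u assume u: "u \<in> fvec x" "vnorm u \<le> 1"
  define w where "w = conv_op x (sec_star \<G> \<L> f) u"
  have w: "w \<in> fvec x" unfolding w_def by (rule conv_op_fvec[OF tame_star[OF f] u(1)])
  note nn = rep_norm_bounds(2)[OF f, of x]
  have "(vnorm w)\<^sup>2 = cmod (ip w w)" unfolding ip_self[OF fvecD(1)[OF w]] by (simp add: norm_power)
  also have "ip w w = ip u (conv_op x f w)" using conv_op_adjoint[OF f u(1) w] by (simp add: w_def)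
  also have "cmod (ip u (conv_op x f w)) \<le> vnorm u * vnorm (conv_op x f w)"
    by (rule ip_bound[OF fvecD(1)[OF u(1)] fvecD(1)[OF conv_op_fvec[OF f w]]])
  also have "\<dots> \<le> 1 * (rep_norm x f * vnorm w)"
    using u(2) rep_norm_bounds(1)[OF f w] vnorm_nonneg by (intro mult_mono) auto
  finally have "vnorm w * vnorm w \<le> rep_norm x f * vnorm w" by (simp add: power2_eq_square)
  then show "vnorm w \<le> rep_norm x f"
    using vnorm_nonneg[of w] nn by (cases "vnorm w = 0") (auto simp: mult_le_cancel_right)
qed

text \<open>The usual computation for operators on a Hilbert space:
  \<open>\<parallel>T v\<parallel>\<^sup>2 = \<langle>T\<^sup>* T v, v\<rangle> \<le> \<parallel>T\<^sup>* T\<parallel> \<parallel>v\<parallel>\<^sup>2\<close>.\<close>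

lemma rep_norm_cstar:
  assumes fc: "f \<in> Cc \<G> \<L>"
  shows "rep_norm x (sec_mult \<G> \<L> (sec_star \<G> \<L> f) f) = (rep_norm x f)\<^sup>2"
proof (rule antisym)
  note f = Cc_tame[OF fc] and s = tame_star[OF Cc_tame[OF fc]] and t = tame_mult[OF Cc_star[OF fc] fc]
  note nn = rep_norm_bounds(2)[OF f, of x] rep_norm_bounds(2)[OF t, of x]
  have "rep_norm x (sec_mult \<G> \<L> (sec_star \<G> \<L> f) f) \<le> rep_norm x (sec_star \<G> \<L> f) * rep_norm x f"
    by (rule rep_norm_mult[OF Cc_star[OF fc] fc])
  also have "\<dots> \<le> rep_norm x f * rep_norm x f" by (rule mult_right_mono[OF rep_norm_star_le[OF f] nn(1)])
  finally show "rep_norm x (sec_mult \<G> \<L> (sec_star \<G> \<L> f) f) \<le> (rep_norm x f)\<^sup>2" by (simp add: power2_eq_square)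
  have "rep_norm x f \<le> sqrt (rep_norm x (sec_mult \<G> \<L> (sec_star \<G> \<L> f) f))"
  proof (rule rep_norm_bounds(3)[OF f])
    fix v assume v: "v \<in> fvec x" "vnorm v \<le> 1"
    note w = conv_op_fvec[OF f v(1)]
    have "(vnorm (conv_op x f v))\<^sup>2 = cmod (ip (conv_op x f v) (conv_op x f v))"
      unfolding ip_self[OF fvecD(1)[OF w]] by (simp add: norm_power)
    also have "ip (conv_op x f v) (conv_op x f v) = ip (conv_op x (sec_mult \<G> \<L> (sec_star \<G> \<L> f) f) v) v"
      unfolding conv_op_mult[OF s f v(1)] by (rule conv_op_adjoint[OF f w v(1)])
    also have "cmod \<dots> \<le> vnorm (conv_op x (sec_mult \<G> \<L> (sec_star \<G> \<L> f) f) v) * vnorm v"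
      by (rule ip_bound[OF fvecD(1)[OF conv_op_fvec[OF t v(1)]] fvecD(1)[OF v(1)]])
    also have "\<dots> \<le> (rep_norm x (sec_mult \<G> \<L> (sec_star \<G> \<L> f) f) * vnorm v) * vnorm v"
      by (intro mult_right_mono rep_norm_bounds(1)[OF t v(1)] vnorm_nonneg)
    also have "\<dots> \<le> (rep_norm x (sec_mult \<G> \<L> (sec_star \<G> \<L> f) f) * 1) * 1"
      using v(2) nn(2) vnorm_nonneg[of v] by (intro mult_mono) auto
    finally show "vnorm (conv_op x f v) \<le> sqrt (rep_norm x (sec_mult \<G> \<L> (sec_star \<G> \<L> f) f))"
      by (intro real_le_rsqrt) simp
  qed (use nn in simp)
  then have "(rep_norm x f)\<^sup>2 \<le> (sqrt (rep_norm x (sec_mult \<G> \<L> (sec_star \<G> \<L> f) f)))\<^sup>2"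
    using nn(1) by (rule power_mono)
  then show "(rep_norm x f)\<^sup>2 \<le> rep_norm x (sec_mult \<G> \<L> (sec_star \<G> \<L> f) f)" using nn(2) by simp
qed

text \<open>The maximum of a C*-norm and a C*-seminorm is a C*-norm, definite because the first one is. So
  the largest C*-norm dominates the seminorms of the regular representations.\<close>

lemma rep_norm_le_largest:
  assumes \<nu>: "largest_cstar_norm_on_Cc \<G> \<L> \<nu>" and f: "f \<in> Cc \<G> \<L>"
  shows "rep_norm x f \<le> \<nu> f"
proof -
  define \<mu> where "\<mu> f = max (\<nu> f) (rep_norm x f)" for f
  have c: "cstar_norm_on_Cc \<G> \<L> \<nu>" using \<nu> by (simp add: largest_cstar_norm_on_Cc_def)
  have nu: "0 \<le> \<nu> f" "\<nu> f = 0 \<longleftrightarrow> f = sec_zero \<G> \<L>" "\<nu> (sec_scale \<G> \<L> k f) = cmod k * \<nu> f"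
      "\<nu> (sec_mult \<G> \<L> (sec_star \<G> \<L> f) f) = (\<nu> f)\<^sup>2" if "f \<in> Cc \<G> \<L>" for f k
    using c that by (auto simp: cstar_norm_on_Cc_def)
  have nu2: "\<nu> (sec_add \<G> \<L> f g) \<le> \<nu> f + \<nu> g" "\<nu> (sec_mult \<G> \<L> f g) \<le> \<nu> f * \<nu> g" if "f \<in> Cc \<G> \<L>" "g \<in> Cc \<G> \<L>" for f g
    using c that by (auto simp: cstar_norm_on_Cc_def)
  have "cstar_norm_on_Cc \<G> \<L> \<mu>"
    unfolding cstar_norm_on_Cc_def
  proof (intro conjI ballI allI)
    fix f assume f: "f \<in> Cc \<G> \<L>"
    note r0 = rep_norm_bounds(2)[OF Cc_tame[OF f], of x]
    show "0 \<le> \<mu> f" using nu(1)[OF f] by (simp add: \<mu>_def)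
    show "\<mu> (sec_scale \<G> \<L> k f) = cmod k * \<mu> f" for k
      unfolding \<mu>_def nu(3)[OF f] rep_norm_scale[OF Cc_tame[OF f]] by (simp add: max_mult_distrib_left)
    show "\<mu> (sec_mult \<G> \<L> (sec_star \<G> \<L> f) f) = (\<mu> f)\<^sup>2"
      unfolding \<mu>_def nu(4)[OF f] rep_norm_cstar[OF f]
      using power_mono[of "\<nu> f" "rep_norm x f" 2] power_mono[of "rep_norm x f" "\<nu> f" 2] nu(1)[OF f] r0
      by (cases "\<nu> f \<le> rep_norm x f") (simp_all add: max_absorb1 max_absorb2)
    show "\<mu> f = 0 \<longleftrightarrow> f = sec_zero \<G> \<L>"
    proof
      assume "\<mu> f = 0"
      then have "\<nu> f = 0" using nu(1)[OF f] by (simp add: \<mu>_def max_def split: if_splits)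
      then show "f = sec_zero \<G> \<L>" using nu(2)[OF f] by simp
    next
      assume z: "f = sec_zero \<G> \<L>"
      have "f = sec_scale \<G> \<L> 0 f"
        unfolding z sec_scale_def sec_zero_def by (rule restrict_ext) (simp add: scale_bzero)
      then have "rep_norm x f = 0" using rep_norm_scale[OF Cc_tame[OF f], of x 0] by simp
      then show "\<mu> f = 0" using nu(2)[OF f] z by (simp add: \<mu>_def)
    qed
  next
    fix f g assume fg: "f \<in> Cc \<G> \<L>" "g \<in> Cc \<G> \<L>"
    note t = Cc_tame[OF fg(1)] Cc_tame[OF fg(2)]
    note r0 = rep_norm_bounds(2)[OF t(1), of x] rep_norm_bounds(2)[OF t(2), of x]
    have le: "\<nu> h \<le> \<mu> h" "rep_norm x h \<le> \<mu> h" for h by (simp_all add: \<mu>_def)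
    show "\<mu> (sec_add \<G> \<L> f g) \<le> \<mu> f + \<mu> g"
      unfolding \<mu>_def[of "sec_add \<G> \<L> f g"]
      using nu2(1)[OF fg] rep_norm_add[OF t, of x] le(1)[of f] le(1)[of g] le(2)[of f] le(2)[of g] by simp
    show "\<mu> (sec_mult \<G> \<L> f g) \<le> \<mu> f * \<mu> g"
      unfolding \<mu>_def[of "sec_mult \<G> \<L> f g"]
      using order_trans[OF nu2(2)[OF fg] mult_mono'[OF le(1) le(1) nu(1)[OF fg(1)] nu(1)[OF fg(2)]]]
        order_trans[OF rep_norm_mult[OF fg, of x] mult_mono'[OF le(2) le(2) r0]] by simp
  qed
  then have "\<mu> f \<le> \<nu> f" using \<nu> f by (simp add: largest_cstar_norm_on_Cc_def)
  then show ?thesis by (simp add: \<mu>_def)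
qed

end

section \<open>Comparison with the reduced norm\<close>

context fell_line_bundle
begin

text \<open>Boundedness of the regular representation on all of \<open>\<ell>\<^sup>2\<close>. It shows that the suprema defining
  the reduced norm are taken over bounded sets, without which they would carry no information.\<close>

lemma l2_schur:
  assumes f: "tame f" and C: "schur_bounded f C" "C \<ge> 0" and \<xi>: "\<xi> \<in> l2_sections \<G> \<L> x"
  shows "l2_norm \<G> \<L> x (regular_rep \<G> \<L> x f \<xi>) \<le> C * l2_norm \<G> \<L> x \<xi>"
proof -
  let ?S = "src_fibre \<G> x"
  let ?n = "\<lambda>\<gamma>. (bnorm \<L> (regular_rep \<G> \<L> x f \<xi> \<gamma>))\<^sup>2"
  have x: "\<xi> \<beta> \<in> fibre \<L> \<beta>" if "\<beta> \<in> ?S" for \<beta>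
    using \<xi> that sections_onD by (auto simp: l2_sections_def)
  have sm: "(\<lambda>\<beta>. (bnorm \<L> (\<xi> \<beta>))\<^sup>2) summable_on ?S" using \<xi> by (simp add: l2_sections_def)
  have nn: "(\<Sum>\<^sub>\<infinity>\<gamma>\<in>?S. (bnorm \<L> (\<xi> \<gamma>))\<^sup>2) \<ge> 0" by (rule infsum_nonneg) simp
  have part: "(\<Sum>\<gamma>\<in>F. ?n \<gamma>) \<le> C\<^sup>2 * (\<Sum>\<^sub>\<infinity>\<gamma>\<in>?S. (bnorm \<L> (\<xi> \<gamma>))\<^sup>2)" if F: "finite F" "F \<subseteq> ?S" for F
  proof -
    define B where "B = (\<Union>\<gamma>\<in>F. {\<beta> \<in> ?S. mat f \<gamma> \<beta> \<noteq> 0})"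
    have B: "finite B" "B \<subseteq> ?S" unfolding B_def using F mat_row_finite[OF f] by auto
    have n: "?n \<gamma> = (cmod (\<Sum>\<beta>\<in>B. mat f \<gamma> \<beta> * coef (\<xi> \<beta>)))\<^sup>2" if g: "\<gamma> \<in> F" for \<gamma>
    proof -
      have gS: "\<gamma> \<in> ?S" using g F by blast
      have z: "mat f \<gamma> \<beta> * coef (\<xi> \<beta>) = 0" if "\<beta> \<in> ?S" "\<beta> \<notin> B" for \<beta> using that g by (auto simp: B_def)
      note c = conv_at_mat[OF tameD(1)[OF f] gS x B z]
      show ?thesis using coef_norm[OF c(1)] c(2) gS by (simp add: regular_rep_def)
    qed
    have "(\<Sum>\<gamma>\<in>F. ?n \<gamma>) = (\<Sum>\<gamma>\<in>F. (cmod (\<Sum>\<beta>\<in>B. mat f \<gamma> \<beta> * coef (\<xi> \<beta>)))\<^sup>2)"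
      by (rule sum.cong[OF refl n])
    also have "\<dots> \<le> C\<^sup>2 * (\<Sum>\<beta>\<in>B. (cmod (coef (\<xi> \<beta>)))\<^sup>2)" by (rule mat_schur[OF C(1) F B])
    also have "(\<Sum>\<beta>\<in>B. (cmod (coef (\<xi> \<beta>)))\<^sup>2) = (\<Sum>\<beta>\<in>B. (bnorm \<L> (\<xi> \<beta>))\<^sup>2)"
      by (rule sum.cong[OF refl]) (use coef_norm[OF x] B(2) in auto)
    also have "C\<^sup>2 * \<dots> \<le> C\<^sup>2 * (\<Sum>\<^sub>\<infinity>\<gamma>\<in>?S. (bnorm \<L> (\<xi> \<gamma>))\<^sup>2)"
      by (intro mult_left_mono finite_sum_le_infsum[OF sm B]) auto
    finally show ?thesis .
  qed
  have "(\<Sum>\<^sub>\<infinity>\<gamma>\<in>?S. ?n \<gamma>) \<le> C\<^sup>2 * (\<Sum>\<^sub>\<infinity>\<gamma>\<in>?S. (bnorm \<L> (\<xi> \<gamma>))\<^sup>2)"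
  proof (cases "?n summable_on ?S")
    case True
    then show ?thesis by (rule infsum_le_finite_sums) (use part in blast)
  next
    case False
    then show ?thesis using nn by (simp add: infsum_not_exists)
  qed
  then have "l2_norm \<G> \<L> x (regular_rep \<G> \<L> x f \<xi>) \<le> sqrt (C\<^sup>2 * (\<Sum>\<^sub>\<infinity>\<gamma>\<in>?S. (bnorm \<L> (\<xi> \<gamma>))\<^sup>2))"
    unfolding l2_norm_def by (rule real_sqrt_le_mono)
  also have "\<dots> = C * l2_norm \<G> \<L> x \<xi>" using C(2) by (simp add: l2_norm_def real_sqrt_mult)
  finally show ?thesis .
qed

lemma finite_vector_l2:
  assumes v: "v \<in> fvec x"
  defines "\<xi> \<equiv> (\<lambda>\<gamma>\<in>src_fibre \<G> x. bscale \<L> (v \<gamma>) (frame \<gamma>))"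
  shows "\<xi> \<in> l2_sections \<G> \<L> x" "l2_norm \<G> \<L> x \<xi> = vnorm v"
    "\<And>\<gamma>. \<gamma> \<in> src_fibre \<G> x \<Longrightarrow> \<xi> \<gamma> \<in> fibre \<L> \<gamma> \<and> coef (\<xi> \<gamma>) = v \<gamma>"
proof -
  let ?S = "src_fibre \<G> x"
  show x: "\<xi> \<gamma> \<in> fibre \<L> \<gamma> \<and> coef (\<xi> \<gamma>) = v \<gamma>" if "\<gamma> \<in> ?S" for \<gamma>
    using that scale_closed[OF frame(1)] coef_scale_frame src_fibreD(1) by (simp add: \<xi>_def)
  then have n: "(bnorm \<L> (\<xi> \<gamma>))\<^sup>2 = (cmod (v \<gamma>))\<^sup>2" if "\<gamma> \<in> ?S" for \<gamma>
    using coef_norm that by metis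
  note f = fvecD[OF v]
  have hs: "((\<lambda>\<gamma>. (bnorm \<L> (\<xi> \<gamma>))\<^sup>2) has_sum (\<Sum>\<gamma>\<in>vsupp v. (bnorm \<L> (\<xi> \<gamma>))\<^sup>2)) ?S"
    by (rule has_sum_finite_neutralI[OF f]) (use n in \<open>auto simp: vsupp_def\<close>)
  have "\<xi> \<in> sections_on \<L> ?S" unfolding sections_on_def using x by (auto simp: \<xi>_def)
  then show "\<xi> \<in> l2_sections \<G> \<L> x" using hs by (auto simp: l2_sections_def summable_on_def)
  have "(\<Sum>\<^sub>\<infinity>\<gamma>\<in>?S. (bnorm \<L> (\<xi> \<gamma>))\<^sup>2) = (\<Sum>\<gamma>\<in>vsupp v. (cmod (v \<gamma>))\<^sup>2)"
    unfolding infsumI[OF hs] by (rule sum.cong[OF refl]) (use n f(2) in auto)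
  then show "l2_norm \<G> \<L> x \<xi> = vnorm v"
    by (simp add: l2_norm_def vnorm_def L2_set_def)
qed

lemma rep_norm_le_reduced:
  assumes f: "tame f" and x: "x \<in> units \<G>"
  shows "rep_norm x f \<le> reduced_norm \<G> \<L> f"
proof -
  let ?R = "\<lambda>x. {l2_norm \<G> \<L> x (regular_rep \<G> \<L> x f \<xi>) |\<xi>. \<xi> \<in> l2_sections \<G> \<L> x \<and> l2_norm \<G> \<L> x \<xi> \<le> 1}"
  obtain C0 where C0: "schur_bounded f C0" using f by (auto simp: tame_def)
  then have "schur_bounded f (max C0 0)" unfolding schur_bounded_def by (meson max.coboundedI1)
  then obtain C where C: "schur_bounded f C" "C \<ge> 0" by (meson max.cobounded2)
  have le: "t \<le> C" if t: "t \<in> ?R y" for t y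
  proof -
    obtain \<xi> where \<xi>: "t = l2_norm \<G> \<L> y (regular_rep \<G> \<L> y f \<xi>)" "\<xi> \<in> l2_sections \<G> \<L> y" "l2_norm \<G> \<L> y \<xi> \<le> 1"
      using t by blast
    have "t \<le> C * l2_norm \<G> \<L> y \<xi>" unfolding \<xi>(1) by (rule l2_schur[OF f C \<xi>(2)])
    also have "\<dots> \<le> C * 1" by (rule mult_left_mono[OF \<xi>(3) C(2)])
    finally show ?thesis by simp
  qed
  have bdd: "bdd_above (?R y)" for y by (rule bdd_aboveI[of _ C]) (rule le)
  have ne: "?R y \<noteq> {}" for y
    using finite_vector_l2(1,2)[OF zero_fvec, of y] vnorm_zero[where 'a='g] by fastforce
  have "regular_rep_norm \<G> \<L> y f \<le> C" for y
    unfolding regular_rep_norm_def by (rule cSup_least[OF ne le])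
  then have bdd2: "bdd_above (insert 0 ((\<lambda>x. regular_rep_norm \<G> \<L> x f) ` units \<G>))"
    using C(2) by (intro bdd_aboveI[of _ C]) auto
  have up: "regular_rep_norm \<G> \<L> x f \<le> reduced_norm \<G> \<L> f" "0 \<le> reduced_norm \<G> \<L> f"
    unfolding reduced_norm_def by (rule cSup_upper[OF _ bdd2]; use x in simp)+
  show ?thesis
  proof (rule rep_norm_bounds(3)[OF f up(2)])
    fix v assume v: "v \<in> fvec x" "vnorm v \<le> 1"
    define \<xi> where "\<xi> = (\<lambda>\<gamma>\<in>src_fibre \<G> x. bscale \<L> (v \<gamma>) (frame \<gamma>))"
    note fv = finite_vector_l2[OF v(1), folded \<xi>_def]
    define w where "w = conv_op x f v"
    have w: "w \<in> fvec x" unfolding w_def by (rule conv_op_fvec[OF f v(1)])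
    note fw = finite_vector_l2[OF w]
    have "regular_rep \<G> \<L> x f \<xi> = (\<lambda>\<gamma>\<in>src_fibre \<G> x. bscale \<L> (w \<gamma>) (frame \<gamma>))"
      unfolding regular_rep_def
    proof (rule restrict_ext)
      fix \<gamma> assume g: "\<gamma> \<in> src_fibre \<G> x"
      have z: "mat f \<gamma> \<beta> * coef (\<xi> \<beta>) = 0" if "\<beta> \<in> src_fibre \<G> x" "\<beta> \<notin> vsupp v" for \<beta>
        using fv(3)[OF that(1)] that(2) by (simp add: vsupp_def)
      have xf: "\<xi> \<beta> \<in> fibre \<L> \<beta>" if "\<beta> \<in> src_fibre \<G> x" for \<beta> using fv(3)[OF that] by simp
      have c1: "conv_at \<G> \<L> f \<xi> \<gamma> \<in> fibre \<L> \<gamma>"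
        by (rule conv_at_mat(1)[OF tameD(1)[OF f] g xf fvecD[OF v(1)] z])
      have c2: "coef (conv_at \<G> \<L> f \<xi> \<gamma>) = (\<Sum>\<beta>\<in>vsupp v. mat f \<gamma> \<beta> * coef (\<xi> \<beta>))"
        by (rule conv_at_mat(2)[OF tameD(1)[OF f] g xf fvecD[OF v(1)] z])
      have "coef (conv_at \<G> \<L> f \<xi> \<gamma>) = w \<gamma>"
        unfolding c2 w_def conv_op_def using g fv(3) fvecD(2)[OF v(1)] by (auto intro!: sum.cong)
      then show "conv_at \<G> \<L> f \<xi> \<gamma> = bscale \<L> (w \<gamma>) (frame \<gamma>)" using coef_eq[OF c1] by simp
    qed
    then have "vnorm w = l2_norm \<G> \<L> x (regular_rep \<G> \<L> x f \<xi>)" using fw(2) by simp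
    also have "\<dots> \<le> regular_rep_norm \<G> \<L> x f"
      unfolding regular_rep_norm_def by (rule cSup_upper[OF _ bdd]) (use fv(1,2) v(2) in auto)
    finally show "vnorm (conv_op x f v) \<le> reduced_norm \<G> \<L> f" using up(1) by (simp add: w_def)
  qed
qed

section \<open>Existence of sections\<close>

text \<open>A local section times a bump function on the unit space.\<close>

lemma section_nonzero_at:
  assumes g0: "\<gamma>0 \<in> arrows \<G>"
  obtains V f where "open_bisection \<G> V" "f \<in> Cc_on \<G> \<L> V" "\<gamma>0 \<in> V" "coef (f \<gamma>0) \<noteq> 0"
proof -
  have oa: "openin (gtop \<G>) (arrows \<G>)" by (metis openin_topspace topspace_gtop)
  obtain U V s where s: "open_bisection \<G> U" "U \<subseteq> arrows \<G>" "openin (gtop \<G>) V" "\<gamma>0 \<in> V" "V \<subseteq> U"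
    "continuous_map (subtopology (gtop \<G>) V) (btop \<L>) s" "\<And>\<gamma>. \<gamma> \<in> V \<Longrightarrow> s \<gamma> \<in> fibre \<L> \<gamma>" "s \<gamma>0 \<noteq> bzero \<L> \<gamma>0"
    using local_section[OF oa g0] by blast
  have V: "open_bisection \<G> V" by (rule open_bisection_subset[OF s(1,3,5)])
  note Va = open_bisectionD(4)[OF V]
  have 1: "compactin (unit_top \<G>) {rng \<G> \<gamma>0}" using rng_in_units[OF g0] by simp
  have 2: "openin (unit_top \<G>) (rng \<G> ` V)" by (rule openin_rng_image[OF s(3)])
  have 3: "{rng \<G> \<gamma>0} \<subseteq> rng \<G> ` V" using s(4) by simp
  obtain a C where b: "bump {rng \<G> \<gamma>0} C a" "C \<subseteq> rng \<G> ` V" using bump_exists[OF 1 2 3] by blast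
  define f where "f = (\<lambda>\<gamma>\<in>arrows \<G>. if \<gamma> \<in> V then bscale \<L> (complex_of_real (a (rng \<G> \<gamma>))) (s \<gamma>) else bzero \<L> \<gamma>)"
  have "f \<in> Cc_on \<G> \<L> V"
  proof (rule Cc_onI[OF _ _ _ _ _ Va])
    have "(if \<gamma> \<in> V then bscale \<L> (complex_of_real (a (rng \<G> \<gamma>))) (s \<gamma>) else bzero \<L> \<gamma>) \<in> fibre \<L> \<gamma>"
      if "\<gamma> \<in> arrows \<G>" for \<gamma>
      using scale_closed[OF s(7)] zero_closed[OF that] by simp
    then show "f \<in> sections_on \<L> (arrows \<G>)"
      unfolding f_def sections_on_def by (intro restrict_PiE_iff[THEN iffD2]) blast
    have "continuous_map (subtopology (gtop \<G>) V) euclideanreal (a \<circ> rng \<G>)"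
      by (rule continuous_map_compose[OF continuous_map_from_subtopology[OF continuous_rng_unit_top] bumpD(2)[OF b(1)]])
    then have "continuous_map (subtopology (gtop \<G>) V) euclidean (\<lambda>\<gamma>. complex_of_real (a (rng \<G> \<gamma>)))"
      by (intro continuous_map_complex_of_real) (simp add: o_def)
    from continuous_map_bscale[OF this s(6)]
    show "continuous_map (subtopology (gtop \<G>) V) (btop \<L>) f"
      by (rule continuous_map_eq) (auto simp: f_def)
    have C: "compactin (gtop \<G>) C" "C \<subseteq> units \<G>" using bumpD(6)[OF b(1)] compactin_units by auto
    have Cl: "C \<subseteq> {\<gamma> \<in> arrows \<G>. rng \<G> \<gamma> \<in> rng \<G> ` V}"
      using b(2) C(2) unit_rng units_arrows by (auto simp: subset_iff)
    show "compactin (gtop \<G>) (lift V ` C)"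
      by (rule image_compactin[OF _ continuous_lift[OF V]]) (use C(1) Cl in \<open>simp add: compactin_subtopology\<close>)
    show "lift V ` C \<subseteq> V"
    proof
      fix \<gamma> assume "\<gamma> \<in> lift V ` C"
      then obtain y where y: "y \<in> C" "\<gamma> = lift V y" by blast
      then obtain \<alpha> where al: "\<alpha> \<in> V" "rng \<G> \<alpha> = rng \<G> y" using Cl by force
      show "\<gamma> \<in> V" unfolding y(2) by (rule lift(1)[OF al])
    qed
    fix \<gamma> assume g: "\<gamma> \<in> arrows \<G> - lift V ` C"
    show "f \<gamma> = bzero \<L> \<gamma>"
    proof (cases "\<gamma> \<in> V")
      case True
      have "rng \<G> \<gamma> \<notin> C"
      proof
        assume "rng \<G> \<gamma> \<in> C"
        moreover have "lift V (rng \<G> \<gamma>) = \<gamma>" using lift_eq[OF V True, of "rng \<G> \<gamma>"] g rng_rng by simp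
        ultimately show False using g by (metis DiffD2 imageI)
      qed
      then have "a (rng \<G> \<gamma>) = 0" using bumpD(7)[OF b(1)] rng_in_units g by blast
      then show ?thesis using True g scale_zero[OF s(7)[OF True]] by (simp add: f_def)
    qed (use g in \<open>simp add: f_def\<close>)
  qed
  moreover have "coef (f \<gamma>0) \<noteq> 0"
  proof -
    have "a (rng \<G> \<gamma>0) = 1" using bumpD(5)[OF b(1)] by simp
    then have "f \<gamma>0 = s \<gamma>0" using g0 s(4) scale_one[OF s(7)[OF s(4)]] by (simp add: f_def)
    then show ?thesis using coef_eq_0_iff[OF s(7)[OF s(4)]] s(8) by simp
  qed
  ultimately show thesis using that[OF V _ s(4)] by blast
qed

end

section \<open>States from vectors\<close>

text \<open>The hypotheses say that \<open>q\<^sup>2 + (1 - y)\<^sup>2 = 1\<close> in the unitization, for commuting self-adjoint \<open>q\<close>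
  and \<open>y\<close>. So \<open>u = q + \<i> (1 - y)\<close> is a unitary multiplier with real part \<open>q\<close>, and \<open>q\<close> is a contraction.\<close>

lemma norm_le_1_of_circle:
  fixes q y :: "'b::cstar_algebra"
  assumes q: "cadj q = q" and y: "cadj y = y" and comm: "q * y = y * q" and circ: "q * q + y * y = y + y"
  shows "norm q \<le> 1"
proof -
  (* for s = \<i> the left multiplication by u, for s = -\<i> by its adjoint *)
  define L where "L s b = q * b + cscale s (b - y * b)" for s and b :: 'b
  have minus: "cadj (a - b) = cadj a - cadj b" for a b :: 'b
    using cadj_add[of "a - b" b] by (simp add: algebra_simps)
  have isom: "norm (L s b) = norm b" if s: "s * cnj s = 1" "cnj s = - s" for s b
  proof -
    have cs: "cscale s (a - b) = cscale s a - cscale s b" for s and a b :: 'b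
      using cscale_add_right[of s "a - b" b] by (simp add: algebra_simps)
    have neg: "cscale (- s) a = - cscale s a" for s and a :: 'b
      using cscale_add_left[of s "- s" a] cscale_0[of a] by (simp add: eq_neg_iff_add_eq_0 add.commute)
    have one: "cscale 1 a = a" for a :: 'b using cscale_of_real[of 1 a] by simp
    have zero: "cscale s (0 :: 'b) = 0" for s using cs[of s 0 0] by simp
    let ?b = "cadj b"
    have "cadj (L s b) * L s b = (?b * q - cscale s (?b - ?b * y)) * (q * b + cscale s (b - y * b))"
      by (simp add: L_def cadj_add cadj_mult cadj_cscale minus q y s(2) neg)
    also have "\<dots> = ?b * (q * q) * b + cscale s (?b * (y * q - q * y) * b) - cscale (s * s) (?b * (b - y * b - y * b + y * y * b))"
      by (simp add: algebra_simps cscale_mult_left cscale_mult_right cscale_cscale cs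
          cscale_add_right)
    also have "\<dots> = ?b * (q * q + y * y - (y + y)) * b + ?b * b"
    proof -
      have "s * s = -1" using s by (metis mult_minus_right neg_equal_iff_equal minus_minus)
      then show ?thesis by (simp add: comm neg one algebra_simps cscale_mult_left cscale_mult_right)
         (simp add: cscale_add_right cs algebra_simps one neg zero)
    qed
    also have "\<dots> = ?b * b" using circ by simp
    finally have "(norm (L s b))\<^sup>2 = (norm b)\<^sup>2" by (metis norm_cadj_mult)
    then show ?thesis by (simp add: power2_eq_iff_nonneg)
  qed
  have neg: "cscale (- s) a = - cscale s a" for s and a :: 'b
    using cscale_add_left[of s "- s" a] cscale_0[of a] by (simp add: eq_neg_iff_add_eq_0 add.commute)
  have "2 *\<^sub>R (q * q) = L \<i> q + L (- \<i>) q" by (simp add: L_def neg scaleR_2)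
  then have "2 * norm (q * q) \<le> norm (L \<i> q) + norm (L (- \<i>) q)"
    by (metis norm_triangle_ineq norm_scaleR abs_numeral)
  also have "\<dots> = 2 * norm q" using isom[of \<i> q] isom[of "- \<i>" q] by simp
  finally have "norm q * norm q \<le> 1 * norm q"
    using norm_cadj_mult[of q] q by (simp add: power2_eq_square)
  then show ?thesis by (cases "norm q = 0") (auto simp: mult_le_cancel_right)
qed

lemma continuous_cadj: "continuous_on UNIV (cadj :: 'b::cstar_algebra \<Rightarrow> 'b)"
proof -
  have le: "norm a \<le> norm (cadj a)" for a :: 'b
  proof (cases "a = 0")
    case False
    have "norm a * norm a \<le> norm (cadj a) * norm a"
      using norm_cadj_mult[of a] norm_mult_ineq[of "cadj a" a] by (simp add: power2_eq_square)
    then show ?thesis using False by simp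
  qed simp
  have eq: "norm (cadj a) = norm a" for a :: 'b using le[of a] le[of "cadj a"] by (simp add: cadj_cadj)
  have minus: "cadj (a - b) = cadj a - cadj b" for a b :: 'b
    using cadj_add[of "a - b" b] by (simp add: algebra_simps)
  show ?thesis
    unfolding continuous_on_iff
  proof (intro ballI allI impI)
    fix a :: 'b and \<epsilon> :: real assume "\<epsilon> > 0"
    then show "\<exists>d>0. \<forall>b\<in>UNIV. dist b a < d \<longrightarrow> dist (cadj b) (cadj a) < \<epsilon>"
      by (intro exI[of _ \<epsilon>]) (simp add: dist_norm eq flip: minus)
  qed
qed

context completed_line_bundle
begin

text \<open>For \<open>0 \<le> a \<le> 1\<close> the function \<open>y = 1 - sqrt (1 - a\<^sup>2)\<close> has compact support like \<open>a\<close>, and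
  \<open>a\<^sup>2 + (1 - y)\<^sup>2 = 1\<close>.\<close>

lemma norm_bump_le_1:
  assumes b: "bump K C a" shows "norm (\<iota> (unit_section \<G> \<L> (\<lambda>x. complex_of_real (a x)))) \<le> 1"
proof -
  define y where "y x = 1 - sqrt (1 - (a x)\<^sup>2)" for x
  let ?a = "\<lambda>x. complex_of_real (a x)" and ?y = "\<lambda>x. complex_of_real (y x)"
  let ?A = "unit_section \<G> \<L> ?a" and ?Y = "unit_section \<G> \<L> ?y"
  have ca: "continuous_map (unit_top \<G>) euclideanreal a" by (rule bumpD(2)[OF b])
  have "continuous_map (unit_top \<G>) euclideanreal ((\<lambda>t. 1 - sqrt (1 - t\<^sup>2)) \<circ> a)"
    by (rule continuous_map_compose[OF ca]) (auto intro!: continuous_intros)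
  then have cy: "continuous_map (unit_top \<G>) euclideanreal y" by (simp add: o_def y_def[abs_def])
  have ya: "y x = 0" if "a x = 0" for x using that by (simp add: y_def)
  have yu: "?y \<in> Cc_units"
    unfolding Cc_units_def using continuous_map_complex_of_real[OF cy] bumpD(6,7)[OF b] ya by auto
  note au = bumpD(1)[OF b]
  note Ac = unit_section_Cc[OF au] and Yc = unit_section_Cc[OF yu]
  have adj: "sec_star \<G> \<L> ?A = ?A" "sec_star \<G> \<L> ?Y = ?Y" by (rule unit_section_star; simp)+
  have circ: "a x * a x + y x * y x = y x + y x" if "x \<in> units \<G>" for x
  proof -
    have "(a x)\<^sup>2 \<le> 1" using bumpD(3,4)[OF b that] by (simp add: power_le_one)
    then have "(sqrt (1 - (a x)\<^sup>2))\<^sup>2 = 1 - (a x)\<^sup>2" by simp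
    then show ?thesis by (simp add: y_def power2_eq_square algebra_simps)
  qed
  have "sec_add \<G> \<L> (sec_mult \<G> \<L> ?A ?A) (sec_mult \<G> \<L> ?Y ?Y) = sec_add \<G> \<L> ?Y ?Y"
  proof (rule sections_eqI)
    note us = unit_section_section
    show "sec_add \<G> \<L> (sec_mult \<G> \<L> ?A ?A) (sec_mult \<G> \<L> ?Y ?Y) \<in> sections_on \<L> (arrows \<G>)"
      "sec_add \<G> \<L> ?Y ?Y \<in> sections_on \<L> (arrows \<G>)"
      unfolding unit_section_mult[OF au] unit_section_mult[OF yu] by (rule sec_add_section[OF us us])+
    fix \<gamma> assume g: "\<gamma> \<in> arrows \<G>"
    show "coef (sec_add \<G> \<L> (sec_mult \<G> \<L> ?A ?A) (sec_mult \<G> \<L> ?Y ?Y) \<gamma>) = coef (sec_add \<G> \<L> ?Y ?Y \<gamma>)"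
      unfolding unit_section_mult[OF au] unit_section_mult[OF yu] sec_add_coef[OF us us g] unit_section_coef[OF g]
      using arg_cong[OF circ[of \<gamma>], of complex_of_real] by simp
  qed
  from arg_cong[OF this, of \<iota>]
  have 1: "\<iota> ?A * \<iota> ?A + \<iota> ?Y * \<iota> ?Y = \<iota> ?Y + \<iota> ?Y"
    unfolding iota(4)[OF Cc_mult[OF Ac Ac] Cc_mult[OF Yc Yc]] iota(4)[OF Yc Yc] iota(5)[OF Ac Ac] iota(5)[OF Yc Yc] .
  have 2: "\<iota> ?A * \<iota> ?Y = \<iota> ?Y * \<iota> ?A"
    unfolding iota(5)[OF Ac Yc, symmetric] iota(5)[OF Yc Ac, symmetric] unit_section_mult[OF au] unit_section_mult[OF yu]
    by (simp add: mult.commute)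
  have 3: "cadj (\<iota> ?A) = \<iota> ?A" "cadj (\<iota> ?Y) = \<iota> ?Y"
    using iota(2)[OF Ac] iota(2)[OF Yc] adj by metis+
  show ?thesis by (rule norm_le_1_of_circle[OF 3 2 1])
qed

text \<open>Contractivity makes the functional well defined and uniformly continuous on the dense image; the
  other conditions pass to limits. The element \<open>e\<close> keeps the norm of the extension from being less than 1.\<close>

lemma state_extension:
  fixes \<psi> :: "('g \<Rightarrow> 'l) \<Rightarrow> complex"
  assumes add: "\<And>f g. \<lbrakk>f \<in> Cc \<G> \<L>; g \<in> Cc \<G> \<L>\<rbrakk> \<Longrightarrow> \<psi> (sec_add \<G> \<L> f g) = \<psi> f + \<psi> g"
    and scale: "\<And>f c. f \<in> Cc \<G> \<L> \<Longrightarrow> \<psi> (sec_scale \<G> \<L> c f) = c * \<psi> f"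
    and bound: "\<And>f. f \<in> Cc \<G> \<L> \<Longrightarrow> cmod (\<psi> f) \<le> norm (\<iota> f)"
    and pos: "\<And>f. f \<in> Cc \<G> \<L> \<Longrightarrow> \<psi> (sec_mult \<G> \<L> (sec_star \<G> \<L> f) f) \<in> \<real>\<^sub>\<ge>\<^sub>0"
    and e: "e \<in> Cc \<G> \<L>" "norm (\<iota> e) \<le> 1" "\<psi> e = 1"
  obtains \<phi> where "\<phi> \<in> states" "\<And>f. f \<in> Cc \<G> \<L> \<Longrightarrow> \<phi> (\<iota> f) = \<psi> f"
proof -
  let ?D = "\<iota> ` Cc \<G> \<L>"
  have diff: "cmod (\<psi> f - \<psi> g) \<le> norm (\<iota> f - \<iota> g)" if "f \<in> Cc \<G> \<L>" "g \<in> Cc \<G> \<L>" for f g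
  proof -
    note m = Cc.scale[OF that(2), of "-1"]
    have neg: "cscale (- 1) a = - a" for a :: 'b using cscale_of_real[of "-1" a] by simp
    have "\<psi> (sec_add \<G> \<L> f (sec_scale \<G> \<L> (-1) g)) = \<psi> f - \<psi> g" using add[OF that(1) m] scale[OF that(2)] by simp
    moreover have "\<iota> (sec_add \<G> \<L> f (sec_scale \<G> \<L> (-1) g)) = \<iota> f - \<iota> g"
      using iota(4)[OF that(1) m] iota(3)[OF that(2)] neg by simp
    ultimately show ?thesis using bound[OF Cc.add[OF that(1) m]] by simp
  qed
  define \<psi>' where "\<psi>' b = \<psi> (SOME f. f \<in> Cc \<G> \<L> \<and> \<iota> f = b)" for b
  have psi': "\<psi>' (\<iota> f) = \<psi> f" if f: "f \<in> Cc \<G> \<L>" for f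
  proof -
    let ?g = "SOME g. g \<in> Cc \<G> \<L> \<and> \<iota> g = \<iota> f"
    have "?g \<in> Cc \<G> \<L> \<and> \<iota> ?g = \<iota> f" by (rule someI[of _ f]) (simp add: f)
    then show ?thesis using diff[of ?g f] f by (simp add: \<psi>'_def)
  qed
  have uc: "uniformly_continuous_on ?D \<psi>'"
    unfolding uniformly_continuous_on_def
  proof (intro allI impI)
    fix \<epsilon> :: real assume "\<epsilon> > 0"
    then show "\<exists>d>0. \<forall>x\<in>?D. \<forall>x'\<in>?D. dist x' x < d \<longrightarrow> dist (\<psi>' x') (\<psi>' x) < \<epsilon>"
      using diff psi' by (intro exI[of _ \<epsilon>]) (auto simp: dist_norm intro: le_less_trans)
  qed
  have "\<exists>\<phi>. uniformly_continuous_on (closure ?D) \<phi> \<and> (\<forall>b \<in> ?D. \<psi>' b = \<phi> b)"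
    by (rule uniformly_continuous_on_extension_on_closure[OF uc]) blast
  then obtain \<phi> where \<phi>: "uniformly_continuous_on (closure ?D) \<phi>" "\<forall>b \<in> ?D. \<psi>' b = \<phi> b"
    by blast
  have dense: "closure ?D = UNIV" using completion by (simp add: is_completion_def)
  have cont: "continuous_on UNIV \<phi>" using uniformly_continuous_imp_continuous[OF \<phi>(1)] dense by simp
  have val: "\<phi> (\<iota> f) = \<psi> f" if "f \<in> Cc \<G> \<L>" for f using \<phi>(2) psi' that by simp
  have tends: "(\<lambda>n. \<phi> (s n)) \<longlonglongrightarrow> \<phi> b" if "s \<longlonglongrightarrow> b" for s b
    using continuous_on_tendsto_compose[OF cont that] by simp
  have approx: "\<exists>s. (\<forall>n::nat. s n \<in> Cc \<G> \<L>) \<and> (\<lambda>n. \<iota> (s n)) \<longlonglongrightarrow> b" for b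
  proof -
    have "b \<in> closure ?D" using dense by simp
    then obtain t where t: "\<forall>n. t n \<in> ?D" "t \<longlonglongrightarrow> b" unfolding closure_sequential by blast
    have "\<forall>n. \<exists>f. f \<in> Cc \<G> \<L> \<and> t n = \<iota> f" using t(1) by blast
    then obtain s where s: "\<forall>n. s n \<in> Cc \<G> \<L> \<and> t n = \<iota> (s n)" by metis
    then have "(\<lambda>n. \<iota> (s n)) = t" by auto
    then show ?thesis using s t(2) by auto
  qed
  have \<phi>_add: "\<phi> (a + b) = \<phi> a + \<phi> b" for a b
  proof -
    obtain s t where s: "\<And>n::nat. s n \<in> Cc \<G> \<L>" "(\<lambda>n. \<iota> (s n)) \<longlonglongrightarrow> a"
      and t: "\<And>n::nat. t n \<in> Cc \<G> \<L>" "(\<lambda>n. \<iota> (t n)) \<longlonglongrightarrow> b" using approx by metis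
    have "(\<lambda>n. \<phi> (\<iota> (s n) + \<iota> (t n))) \<longlonglongrightarrow> \<phi> (a + b)" by (rule tends[OF tendsto_add[OF s(2) t(2)]])
    moreover have "\<phi> (\<iota> (s n) + \<iota> (t n)) = \<phi> (\<iota> (s n)) + \<phi> (\<iota> (t n))" for n
      using val[OF Cc.add[OF s(1) t(1)], of n n] iota(4)[OF s(1) t(1)] add[OF s(1) t(1)] val[OF s(1)] val[OF t(1)] by simp
    moreover have "(\<lambda>n. \<phi> (\<iota> (s n)) + \<phi> (\<iota> (t n))) \<longlonglongrightarrow> \<phi> a + \<phi> b"
      by (rule tendsto_add[OF tends[OF s(2)] tends[OF t(2)]])
    ultimately show ?thesis using LIMSEQ_unique by simp
  qed
  have cscale_lim: "(\<lambda>n. cscale c (s n)) \<longlonglongrightarrow> cscale c b" if "s \<longlonglongrightarrow> b" for c b and s :: "nat \<Rightarrow> 'b"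
  proof -
    have "bounded_linear (cscale c :: 'b \<Rightarrow> 'b)"
    proof (rule bounded_linear_intro[of _ "cmod c"])
      show "cscale c (r *\<^sub>R a) = r *\<^sub>R cscale c a" for r and a :: 'b
        unfolding cscale_of_real[symmetric] cscale_cscale by (simp add: mult.commute)
    qed (simp_all add: cscale_add_right norm_cscale mult.commute)
    then show ?thesis using bounded_linear.tendsto that by blast
  qed
  have \<phi>_scale: "\<phi> (cscale c b) = c * \<phi> b" for c b
  proof -
    obtain s where s: "\<And>n::nat. s n \<in> Cc \<G> \<L>" "(\<lambda>n. \<iota> (s n)) \<longlonglongrightarrow> b" using approx by metis
    have "(\<lambda>n. \<phi> (cscale c (\<iota> (s n)))) \<longlonglongrightarrow> \<phi> (cscale c b)" by (rule tends[OF cscale_lim[OF s(2)]])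
    moreover have "\<phi> (cscale c (\<iota> (s n))) = c * \<phi> (\<iota> (s n))" for n
      using val[OF Cc.scale[OF s(1)], of c n] iota(3)[OF s(1)] scale[OF s(1)] val[OF s(1)] by simp
    moreover have "(\<lambda>n. c * \<phi> (\<iota> (s n))) \<longlonglongrightarrow> c * \<phi> b" by (rule tendsto_mult_left[OF tends[OF s(2)]])
    ultimately show ?thesis using LIMSEQ_unique by simp
  qed
  have \<phi>_bound: "norm (\<phi> b) \<le> norm b * 1" for b
  proof -
    obtain s where s: "\<And>n::nat. s n \<in> Cc \<G> \<L>" "(\<lambda>n. \<iota> (s n)) \<longlonglongrightarrow> b" using approx by metis
    have "norm (\<phi> b) \<le> norm b"
      by (rule LIMSEQ_le[OF tendsto_norm[OF tends[OF s(2)]] tendsto_norm[OF s(2)]]) (use bound s(1) val in auto)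
    then show ?thesis by simp
  qed
  have \<phi>_pos: "\<phi> (cadj b * b) \<in> \<real>\<^sub>\<ge>\<^sub>0" for b
  proof -
    obtain s where s: "\<And>n::nat. s n \<in> Cc \<G> \<L>" "(\<lambda>n. \<iota> (s n)) \<longlonglongrightarrow> b" using approx by metis
    have "(\<lambda>n. cadj (\<iota> (s n))) \<longlonglongrightarrow> cadj b" using continuous_on_tendsto_compose[OF continuous_cadj s(2)] by simp
    from tends[OF tendsto_mult[OF this s(2)]]
    have lim: "(\<lambda>n. \<phi> (cadj (\<iota> (s n)) * \<iota> (s n))) \<longlonglongrightarrow> \<phi> (cadj b * b)" .
    have "\<phi> (cadj (\<iota> (s n)) * \<iota> (s n)) \<in> \<real>\<^sub>\<ge>\<^sub>0" for n
      using pos[OF s(1)] val[OF Cc_mult[OF Cc_star[OF s(1)] s(1)], of n n] iota(5)[OF Cc_star[OF s(1)] s(1), of n n] iota(2)[OF s(1)] by simp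
    then show ?thesis by (rule closed_sequentially[OF closed_nonneg_Reals_complex _ lim])
  qed
  have bl: "bounded_linear \<phi>"
  proof (rule bounded_linear_intro[of _ 1])
    show "\<phi> (r *\<^sub>R b) = r *\<^sub>R \<phi> b" for r b
      using \<phi>_scale[of "of_real r" b] by (simp add: cscale_of_real scaleR_conv_of_real)
  qed (rule \<phi>_add, rule \<phi>_bound)
  have "onorm \<phi> \<le> 1" by (rule onorm_bound) (use \<phi>_bound in \<open>simp_all add: mult.commute\<close>)
  moreover have "onorm \<phi> \<ge> 1"
  proof -
    have "1 = norm (\<phi> (\<iota> e))" using val[OF e(1)] e(3) by simp
    also have "\<dots> \<le> onorm \<phi> * norm (\<iota> e)" by (rule onorm[OF bl])
    also have "\<dots> \<le> onorm \<phi> * 1" using e(2) onorm_pos_le[OF bl] by (rule mult_left_mono)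
    finally show ?thesis by simp
  qed
  ultimately have "\<phi> \<in> states" unfolding states_def using bl \<phi>_scale \<phi>_pos by simp
  then show thesis using that val by blast
qed

text \<open>Let \<open>\<gamma>\<close> be a nontrivial isotropy arrow at \<open>x\<close>. The vector states given by
  \<open>(\<delta>\<^sub>x + c \<delta>\<^sub>\<gamma>) / \<surd>2\<close>, \<open>\<bar>c\<bar> = 1\<close>, extend the evaluation at \<open>x\<close>, since functions on the unit space act
  diagonally on \<open>\<ell>\<^sup>2\<close> of the source fibre and take the value at \<open>x\<close> on both basis vectors. At \<open>f\<close> the
  values of these states are \<open>A + B c + D / c\<close>, where \<open>2 \<bar>D\<bar> = \<parallel>f \<gamma>\<parallel>\<close>; this is not constant in \<open>c\<close>.\<close>

lemma not_free_at_isotropy: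
  assumes dom: "\<And>f x. \<lbrakk>f \<in> Cc \<G> \<L>; x \<in> units \<G>\<rbrakk> \<Longrightarrow> rep_norm x f \<le> \<nu> f"
    and \<gamma>: "\<gamma> \<in> isotropy \<G> - units \<G>" and U: "open_bisection \<G> U" and f: "f \<in> Cc_on \<G> \<L> U"
    and nz: "coef (f \<gamma>) \<noteq> 0"
  shows "rng \<G> \<gamma> \<notin> free_points \<G> \<L> \<iota> (\<iota> f)"
proof
  define x where "x = rng \<G> \<gamma>"
  assume free: "rng \<G> \<gamma> \<in> free_points \<G> \<L> \<iota> (\<iota> f)"
  have ga: "\<gamma> \<in> arrows \<G>" "src \<G> \<gamma> = x" "rng \<G> \<gamma> = x" using \<gamma> by (auto simp: isotropy_def x_def)
  have xu: "x \<in> units \<G>" using rng_in_units[OF ga(1)] by (simp add: x_def)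
  have gx: "\<gamma> \<noteq> x" using \<gamma> xu by auto
  have S: "\<gamma> \<in> src_fibre \<G> x" "x \<in> src_fibre \<G> x" using ga xu units_arrows unit_src by (auto simp: src_fibre_def)
  define \<xi> where "\<xi> c = (\<lambda>i. if i = x then 1 else if i = \<gamma> then c else 0)" for c :: complex
  have supp: "vsupp (\<xi> c) \<subseteq> {x, \<gamma>}" for c by (auto simp: vsupp_def \<xi>_def)
  have fv: "\<xi> c \<in> fvec x" for c
    using finite_subset[OF supp[of c]] supp[of c] S by (auto simp: fvec_def)
  have vn: "(vnorm (\<xi> c))\<^sup>2 = 2" if "cmod c = 1" for c
    using vnorm_sq[OF _ supp[of c]] gx that by (simp add: \<xi>_def)
  define \<psi> where "\<psi> c f = ip (\<xi> c) (conv_op x f (\<xi> c)) / 2" for c f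
  have op: "conv_op x g (\<xi> c) \<beta> = mat g \<beta> x + mat g \<beta> \<gamma> * c" if "\<beta> \<in> src_fibre \<G> x" for g c \<beta>
  proof -
    have "conv_op x g (\<xi> c) \<beta> = (\<Sum>i\<in>{x, \<gamma>}. mat g \<beta> i * \<xi> c i)"
      by (rule conv_op_sum[OF fv that]) (use S supp[of c] in \<open>auto simp: vsupp_def\<close>)
    then show ?thesis using gx by (simp add: \<xi>_def)
  qed
  have val: "\<psi> c g = (mat g x x + mat g x \<gamma> * c + cnj c * (mat g \<gamma> x + mat g \<gamma> \<gamma> * c)) / 2" if g: "tame g" for c g
  proof -
    have "ip (\<xi> c) (conv_op x g (\<xi> c)) = (\<Sum>i\<in>{x, \<gamma>}. cnj (\<xi> c i) * conv_op x g (\<xi> c) i)"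
      by (rule ip_sum_left[OF fvecD(1)[OF conv_op_fvec[OF g fv]] _ supp]) simp
    then show ?thesis unfolding \<psi>_def using gx op[OF S(1)] op[OF S(2)] by (simp add: \<xi>_def)
  qed
  have rxx: "rquot x x = x" "rquot \<gamma> \<gamma> = x" "rquot \<gamma> x = \<gamma>"
    unfolding rquot_def inv_unit[OF xu] using gmul_unit[OF xu] mul_inv[OF ga(1)] ga(3) mul_src[OF ga(1)] ga(2) by auto
  have unit_val: "\<psi> c g = coef (g x)" if g: "g \<in> Cc_on \<G> \<L> (units \<G>)" and c: "cmod c = 1" for c g
  proof -
    have off: "mat g \<beta> \<delta> = 0" if b: "\<beta> \<in> src_fibre \<G> x" "\<delta> \<in> src_fibre \<G> x" "\<beta> \<noteq> \<delta>" for \<beta> \<delta>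
    proof -
      note r = rquot[OF b(1,2)]
      have "rquot \<beta> \<delta> \<notin> units \<G>"
      proof
        assume "rquot \<beta> \<delta> \<in> units \<G>"
        then have "rquot \<beta> \<delta> = rng \<G> \<delta>" using r(3) unit_src by metis
        then have "\<beta> = \<delta>" using r(5) mul_rng[OF src_fibreD(1)[OF b(2)]] by simp
        then show False using b(3) by simp
      qed
      then show ?thesis using Cc_onD(3)[OF g] r(1) coef_zero by (simp add: mat_def)
    qed
    have "cocycle x \<gamma> = 1" "cocycle x x = 1"
      using cocycle_rng[OF ga(1)] ga(3) cocycle_rng[OF units_arrows[OF xu]] unit_rng[OF xu] by auto
    then have d: "mat g x x = coef (g x)" "mat g \<gamma> \<gamma> = coef (g x)" by (simp_all add: mat_def rxx)
    have "cnj c * (coef (g x) * c) = coef (g x)"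
      using c complex_norm_square[of c] by (simp add: mult.commute mult.left_commute)
    then show ?thesis
      unfolding val[OF Cc_on_tame[OF open_bisection_units g]] d off[OF S(2,1) gx[symmetric]] off[OF S gx] by simp
  qed
  have ex: "\<exists>\<phi>. \<phi> \<in> states_extending_eval \<G> \<L> \<iota> x \<and> \<phi> (\<iota> f) = \<psi> c f" if c: "cmod c = 1" for c
  proof -
    have 1: "compactin (unit_top \<G>) {x}" using xu by simp
    have 3: "{x} \<subseteq> units \<G>" using xu by simp
    have 2: "openin (unit_top \<G>) (units \<G>)" by (metis openin_topspace topspace_unit_top)
    obtain a C where b: "bump {x} C a" using bump_exists[OF 1 2 3] by blast
    let ?e = "unit_section \<G> \<L> (\<lambda>x. complex_of_real (a x))"
    note eo = unit_section_Cc_on[OF bumpD(1)[OF b]]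
    note tm = Cc_tame
    have add: "\<psi> c (sec_add \<G> \<L> g h) = \<psi> c g + \<psi> c h" if "g \<in> Cc \<G> \<L>" "h \<in> Cc \<G> \<L>" for g h
    proof -
      have m: "mat (sec_add \<G> \<L> g h) \<beta> \<delta> = mat g \<beta> \<delta> + mat h \<beta> \<delta>" if "\<beta> \<in> src_fibre \<G> x" "\<delta> \<in> src_fibre \<G> x" for \<beta> \<delta>
        unfolding mat_def sec_add_coef[OF Cc_section[OF \<open>g \<in> Cc \<G> \<L>\<close>] Cc_section[OF \<open>h \<in> Cc \<G> \<L>\<close>] rquot(1)[OF that]]
        by (rule distrib_right)
      show ?thesis
        unfolding val[OF tm[OF Cc.add[OF that]]] val[OF tm[OF that(1)]] val[OF tm[OF that(2)]] m[OF S(1,1)] m[OF S(1,2)] m[OF S(2,1)] m[OF S(2,2)]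
        by (simp add: field_simps)
    qed
    have scale: "\<psi> c (sec_scale \<G> \<L> k g) = k * \<psi> c g" if "g \<in> Cc \<G> \<L>" for g k
    proof -
      have m: "mat (sec_scale \<G> \<L> k g) \<beta> \<delta> = k * mat g \<beta> \<delta>" if "\<beta> \<in> src_fibre \<G> x" "\<delta> \<in> src_fibre \<G> x" for \<beta> \<delta>
        unfolding mat_def sec_scale_coef[OF Cc_section[OF \<open>g \<in> Cc \<G> \<L>\<close>] rquot(1)[OF that]] by (rule mult.assoc)
      show ?thesis
        unfolding val[OF tm[OF Cc.scale[OF that]]] val[OF tm[OF that]] m[OF S(1,1)] m[OF S(1,2)] m[OF S(2,1)] m[OF S(2,2)]
        by (simp add: field_simps)
    qed
    have bound: "cmod (\<psi> c g) \<le> norm (\<iota> g)" if g: "g \<in> Cc \<G> \<L>" for g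
    proof -
      have "cmod (ip (\<xi> c) (conv_op x g (\<xi> c))) \<le> vnorm (\<xi> c) * vnorm (conv_op x g (\<xi> c))"
        by (rule ip_bound[OF fvecD(1)[OF fv] fvecD(1)[OF conv_op_fvec[OF tm[OF g] fv]]])
      also have "\<dots> \<le> vnorm (\<xi> c) * (rep_norm x g * vnorm (\<xi> c))"
        by (rule mult_left_mono[OF rep_norm_bounds(1)[OF tm[OF g] fv] vnorm_nonneg])
      also have "\<dots> = 2 * rep_norm x g" using vn[OF c] by (simp add: power2_eq_square)
      finally have "cmod (\<psi> c g) \<le> rep_norm x g" by (simp add: \<psi>_def norm_divide)
      also have "\<dots> \<le> norm (\<iota> g)" using dom[OF g xu] iota(1)[OF g] by simp
      finally show ?thesis .
    qed
    have pos: "\<psi> c (sec_mult \<G> \<L> (sec_star \<G> \<L> g) g) \<in> \<real>\<^sub>\<ge>\<^sub>0" if g: "g \<in> Cc \<G> \<L>" for g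
    proof -
      note t = tm[OF g] and w = conv_op_fvec[OF tm[OF g] fv[of c]]
      let ?w = "conv_op x g (\<xi> c)"
      note sw = conv_op_fvec[OF tame_star[OF t] w]
      have "ip (\<xi> c) (conv_op x (sec_mult \<G> \<L> (sec_star \<G> \<L> g) g) (\<xi> c)) = ip (\<xi> c) (conv_op x (sec_star \<G> \<L> g) ?w)"
        unfolding conv_op_mult[OF tame_star[OF t] t fv] ..
      also have "\<dots> = cnj (ip (conv_op x (sec_star \<G> \<L> g) ?w) (\<xi> c))"
        by (rule ip_cnj[OF fvecD(1)[OF sw] fvecD(1)[OF fv]])
      also have "\<dots> = cnj (ip ?w ?w)" unfolding conv_op_adjoint[OF t w fv] ..
      also have "\<dots> = of_real ((vnorm ?w)\<^sup>2)" unfolding ip_self[OF fvecD(1)[OF w]] by simp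
      finally have "\<psi> c (sec_mult \<G> \<L> (sec_star \<G> \<L> g) g) = of_real ((vnorm ?w)\<^sup>2 / 2)" by (simp add: \<psi>_def)
      then show ?thesis by (simp only: nonneg_Reals_of_real_iff) simp
    qed
    have "\<psi> c ?e = 1" using unit_val[OF eo c] unit_section_coef[OF units_arrows[OF xu]] xu bumpD(5)[OF b] by simp
    then obtain \<phi> where \<phi>: "\<phi> \<in> states" "\<And>g. g \<in> Cc \<G> \<L> \<Longrightarrow> \<phi> (\<iota> g) = \<psi> c g"
      using state_extension[of "\<psi> c" ?e, OF add scale bound pos unit_section_Cc[OF bumpD(1)[OF b]] norm_bump_le_1[OF b]] by blast
    have "\<phi> d = k x" if k: "C0_image \<G> \<L> \<iota> (units \<G>) (unit_section \<G> \<L> k) d" for k d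
    proof -
      obtain g where g: "\<And>n::nat. g n \<in> Cc_on \<G> \<L> (units \<G>)"
          "\<And>\<epsilon>. \<epsilon> > 0 \<Longrightarrow> \<exists>N. \<forall>n\<ge>N. \<forall>\<gamma> \<in> arrows \<G>. bnorm \<L> (bdiff \<L> (g n \<gamma>) (unit_section \<G> \<L> k \<gamma>)) < \<epsilon>"
          "(\<lambda>n. \<iota> (g n)) \<longlonglongrightarrow> d"
        using k unfolding C0_image_def by blast
      have bn: "bnorm \<L> (bdiff \<L> (g n x) (unit_section \<G> \<L> k x)) = cmod (coef (g n x) - k x)" for n
        using norm_bdiff[OF Cc_onD(4)[OF g(1) units_arrows[OF xu]] sections_onD[OF unit_section_section units_arrows[OF xu]]]
          unit_section_coef[OF units_arrows[OF xu]] xu by simp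
      have "(\<lambda>n. coef (g n x)) \<longlonglongrightarrow> k x"
      proof (rule LIMSEQ_I)
        fix \<epsilon> :: real assume "\<epsilon> > 0"
        then obtain N where "\<forall>n\<ge>N. \<forall>\<gamma> \<in> arrows \<G>. bnorm \<L> (bdiff \<L> (g n \<gamma>) (unit_section \<G> \<L> k \<gamma>)) < \<epsilon>"
          using g(2) by blast
        then show "\<exists>N. \<forall>n\<ge>N. norm (coef (g n x) - k x) < \<epsilon>" using bn units_arrows[OF xu] by metis
      qed
      moreover have "\<phi> (\<iota> (g n)) = coef (g n x)" for n
        using \<phi>(2)[OF Cc.gen[OF open_bisection_units g(1)]] unit_val[OF g(1) c] by simp
      moreover have "(\<lambda>n. \<phi> (\<iota> (g n))) \<longlonglongrightarrow> \<phi> d" by (rule bounded_linear.tendsto[OF stateD(1)[OF \<phi>(1)] g(3)])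
      ultimately show ?thesis using LIMSEQ_unique by simp
    qed
    then have "\<phi> \<in> states_extending_eval \<G> \<L> \<iota> x" unfolding states_extending_eval_def using \<phi>(1) by simp
    then show ?thesis using \<phi>(2)[OF Cc.gen[OF U f]] by blast
  qed
  have const: "\<psi> c f = \<psi> d f" if cd: "cmod c = 1" "cmod d = 1" for c d
  proof -
    obtain \<phi>1 where p1: "\<phi>1 \<in> states_extending_eval \<G> \<L> \<iota> x" "\<phi>1 (\<iota> f) = \<psi> c f" using ex[OF cd(1)] by blast
    obtain \<phi>2 where p2: "\<phi>2 \<in> states_extending_eval \<G> \<L> \<iota> x" "\<phi>2 (\<iota> f) = \<psi> d f" using ex[OF cd(2)] by blast
    have "\<phi>1 (\<iota> f) = \<phi>2 (\<iota> f)"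
      using free p1(1) p2(1) unfolding free_points_def x_def[symmetric] by blast
    then show ?thesis using p1(2) p2(2) by simp
  qed
  note vf = val[OF Cc_on_tame[OF U f]]
  (* the four points 1, -1, \<i>, -\<i> of the circle isolate B and D *)
  have "\<psi> 1 f - \<psi> (- 1) f = mat f x \<gamma> + mat f \<gamma> x"
    unfolding vf by (simp add: diff_divide_distrib add_divide_distrib algebra_simps)
  then have "mat f x \<gamma> + mat f \<gamma> x = 0" using const[of 1 "-1"] by simp
  moreover have "\<psi> \<i> f - \<psi> (- \<i>) f = \<i> * (mat f x \<gamma> - mat f \<gamma> x)"
    unfolding vf by (simp add: diff_divide_distrib add_divide_distrib algebra_simps)
  then have "mat f x \<gamma> - mat f \<gamma> x = 0" using const[of \<i> "- \<i>"] by simp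
  ultimately have "mat f \<gamma> x = 0" by simp
  then show False using mat_nonzero(1)[OF S, of f] nz rxx(3) by simp
qed

text \<open>By the Lindelof property countably many sections suffice to have one that is nonzero at any
  given nontrivial isotropy arrow. The points in the interiors of their sets of free points have
  trivial isotropy, and they are dense by the Baire property of the unit space.\<close>

theorem smooth_imp_topologically_free:
  assumes dom: "\<And>f x. \<lbrakk>f \<in> Cc \<G> \<L>; x \<in> units \<G>\<rbrakk> \<Longrightarrow> rep_norm x f \<le> \<nu> f"
    and sc: "second_countable (gtop \<G>)"
    and smooth: "\<And>n. n \<in> groupoid_normalizers \<G> \<L> \<iota> \<Longrightarrow> smooth_element \<G> \<L> \<iota> n"
  shows "topologically_free \<G>"
proof -
  let ?I = "isotropy \<G> - units \<G>" and ?X = "unit_top \<G>"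
  have "\<exists>U f. open_bisection \<G> U \<and> f \<in> Cc_on \<G> \<L> U \<and> \<gamma> \<in> U \<and> coef (f \<gamma>) \<noteq> 0" if g: "\<gamma> \<in> ?I" for \<gamma>
  proof -
    have "\<gamma> \<in> arrows \<G>" using g by (simp add: isotropy_def)
    then obtain V f where "open_bisection \<G> V" "f \<in> Cc_on \<G> \<L> V" "\<gamma> \<in> V" "coef (f \<gamma>) \<noteq> 0"
      by (rule section_nonzero_at)
    then show ?thesis by blast
  qed
  then obtain U f where Uf: "\<And>\<gamma>. \<gamma> \<in> ?I \<Longrightarrow> open_bisection \<G> (U \<gamma>) \<and> f \<gamma> \<in> Cc_on \<G> \<L> (U \<gamma>) \<and> \<gamma> \<in> U \<gamma> \<and> coef (f \<gamma> \<gamma>) \<noteq> 0"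
    by metis
  define V where "V \<gamma> = {\<delta> \<in> U \<gamma>. coef (f \<gamma> \<delta>) \<noteq> 0}" for \<gamma>
  have oV: "openin (gtop \<G>) (V \<gamma>)" if g: "\<gamma> \<in> ?I" for \<gamma>
  proof -
    note u = Uf[OF g]
    have Ua: "U \<gamma> \<subseteq> arrows \<G>" using open_bisectionD(4) u by blast
    have "continuous_map (subtopology (gtop \<G>) (U \<gamma>)) euclideanreal (\<lambda>\<delta>. bnorm \<L> (f \<gamma> \<delta>))"
      using continuous_map_bnorm Cc_onD(2) u by blast
    from openin_continuous_map_preimage[OF this, of "- {0}"]
    have "openin (subtopology (gtop \<G>) (U \<gamma>)) {\<delta> \<in> topspace (subtopology (gtop \<G>) (U \<gamma>)). bnorm \<L> (f \<gamma> \<delta>) \<in> - {0}}"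
      by (simp add: open_Compl)
    moreover have "{\<delta> \<in> topspace (subtopology (gtop \<G>) (U \<gamma>)). bnorm \<L> (f \<gamma> \<delta>) \<in> - {0}} = V \<gamma>"
    proof -
      have "bnorm \<L> (f \<gamma> \<delta>) = cmod (coef (f \<gamma> \<delta>))" if "\<delta> \<in> U \<gamma>" for \<delta>
        using coef_norm[OF Cc_onD(4)] u that Ua by fastforce
      then show ?thesis using Ua by (auto simp: V_def)
    qed
    ultimately show ?thesis using openin_trans_full open_bisectionD(1) u by metis
  qed
  define M where "M = \<Union>(V ` ?I)"
  have oM: "openin (gtop \<G>) M" unfolding M_def using oV by blast
  have topM: "topspace (subtopology (gtop \<G>) M) = M" using openin_subset[OF oM] by auto
  have L: "Lindelof_space (subtopology (gtop \<G>) M)"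
    using second_countable_imp_Lindelof_space[OF second_countable_subtopology[OF sc]] .
  have cover: "Ball (V ` ?I) (openin (subtopology (gtop \<G>) M)) \<and> \<Union>(V ` ?I) = topspace (subtopology (gtop \<G>) M)"
    unfolding topM openin_open_subtopology[OF oM] using oV by (auto simp: M_def)
  have "\<exists>\<V>. countable \<V> \<and> \<V> \<subseteq> V ` ?I \<and> \<Union>\<V> = topspace (subtopology (gtop \<G>) M)"
    by (rule mp[OF spec[OF L[unfolded Lindelof_space_def], of "V ` ?I"]]) (use cover in blast)
  then obtain \<V> where \<V>: "countable \<V>" "\<V> \<subseteq> V ` ?I" "\<Union>\<V> = M" unfolding topM by blast
  obtain J where J: "countable J" "J \<subseteq> ?I" "\<V> = V ` J"
    using iffD1[OF countable_subset_image conjI[OF \<V>(1,2)]] by blast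
  have JM: "\<Union>(V ` J) = M" using \<V>(3) J(3) by simp
  define \<D> where "\<D> = (\<lambda>\<gamma>. ?X interior_of free_points \<G> \<L> \<iota> (\<iota> (f \<gamma>))) ` J"
  have "?X closure_of \<Inter>\<D> = topspace ?X"
  proof (rule Baire_category)
    show "completely_metrizable_space ?X \<or> locally_compact_space ?X \<and> regular_space ?X"
      using unit_locally_compact unit_regular by blast
    show "countable \<D>" unfolding \<D>_def using J(1) by blast
    fix T assume "T \<in> \<D>"
    then obtain \<gamma> where g: "\<gamma> \<in> J" "T = ?X interior_of free_points \<G> \<L> \<iota> (\<iota> (f \<gamma>))" by (auto simp: \<D>_def)
    have "\<iota> (f \<gamma>) \<in> groupoid_normalizers \<G> \<L> \<iota>"
      unfolding groupoid_normalizers_def using C0_image_Cc_on Uf J(2) g(1) by blast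
    from smooth[OF this] show "openin ?X T \<and> ?X closure_of T = topspace ?X"
      unfolding smooth_element_def g(2) by simp
  qed
  then have "units \<G> \<subseteq> ?X closure_of (units \<G> \<inter> \<Inter>\<D>)"
    using closure_of_restrict[of ?X "\<Inter>\<D>"] by simp
  moreover have "units \<G> \<inter> \<Inter>\<D> \<subseteq> {x \<in> units \<G>. isotropy_at \<G> x = {x}}"
  proof
    fix x assume x: "x \<in> units \<G> \<inter> \<Inter>\<D>"
    have "\<gamma> = x" if g: "\<gamma> \<in> isotropy_at \<G> x" for \<gamma>
    proof (rule ccontr)
      assume ne: "\<gamma> \<noteq> x"
      have gi: "\<gamma> \<in> ?I" using g ne unit_rng by (auto simp: isotropy_at_def isotropy_def)
      have "\<gamma> \<in> V \<gamma>" using Uf[OF gi] by (simp add: V_def)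
      then have "\<gamma> \<in> \<Union>(V ` J)" unfolding JM M_def using gi by blast
      then obtain \<delta> where d: "\<delta> \<in> J" "\<gamma> \<in> V \<delta>" by blast
      have dI: "\<delta> \<in> ?I" using d(1) J(2) by blast
      have "rng \<G> \<gamma> \<notin> free_points \<G> \<L> \<iota> (\<iota> (f \<delta>))"
        using not_free_at_isotropy[OF dom gi, of "U \<delta>" "f \<delta>"] Uf[OF dI] d(2) by (simp add: V_def)
      moreover have "x \<in> ?X interior_of free_points \<G> \<L> \<iota> (\<iota> (f \<delta>))" using x d(1) by (auto simp: \<D>_def)
      then have "x \<in> free_points \<G> \<L> \<iota> (\<iota> (f \<delta>))" by (rule subsetD[OF interior_of_subset])
      ultimately show False using g by (simp add: isotropy_at_def)
    qed
    then show "x \<in> {x \<in> units \<G>. isotropy_at \<G> x = {x}}" using x isotropy_at_unit by blast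
  qed
  ultimately have "units \<G> \<subseteq> ?X closure_of {x \<in> units \<G>. isotropy_at \<G> x = {x}}"
    using closure_of_mono by blast
  then show ?thesis
    unfolding topologically_free_def using closure_of_subset_topspace[of ?X] by (metis subset_antisym topspace_unit_top)
qed

end

theorem proposition17p8:
  fixes \<G> :: "'g tgroupoid"
    and \<L> :: "('g, 'l) line_bundle"
    and \<iota> :: "('g \<Rightarrow> 'l) \<Rightarrow> 'b::cstar_algebra"
  assumes "etale_groupoid \<G>"
    and "fell_line_bundle \<G> \<L>"
    and "is_full_cstar_algebra \<G> \<L> \<iota> \<or> is_reduced_cstar_algebra \<G> \<L> \<iota>"
  shows "(topologically_free \<G> \<longrightarrow> gtop \<G> interior_of (isotropy \<G> - units \<G>) = {})
    \<and> (gtop \<G> interior_of (isotropy \<G> - units \<G>) = {}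
         \<longrightarrow> (\<forall>n \<in> groupoid_normalizers \<G> \<L> \<iota>. smooth_element \<G> \<L> \<iota> n))
    \<and> (second_countable (gtop \<G>)
         \<longrightarrow> (\<forall>n \<in> groupoid_normalizers \<G> \<L> \<iota>. smooth_element \<G> \<L> \<iota> n)
         \<longrightarrow> topologically_free \<G>)"
proof -
  interpret fell_line_bundle \<G> \<L> by (rule assms(2))
  obtain \<nu> where \<nu>: "is_completion \<G> \<L> \<nu> \<iota>"
    and dom: "\<And>f x. \<lbrakk>f \<in> Cc \<G> \<L>; x \<in> units \<G>\<rbrakk> \<Longrightarrow> rep_norm x f \<le> \<nu> f"
    using assms(3)
  proof
    assume "is_full_cstar_algebra \<G> \<L> \<iota>"
    then obtain \<nu> where "largest_cstar_norm_on_Cc \<G> \<L> \<nu>" "is_completion \<G> \<L> \<nu> \<iota>"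
      by (auto simp: is_full_cstar_algebra_def)
    then show thesis using that rep_norm_le_largest by blast
  next
    assume "is_reduced_cstar_algebra \<G> \<L> \<iota>"
    then have "is_completion \<G> \<L> (reduced_norm \<G> \<L>) \<iota>" by (simp add: is_reduced_cstar_algebra_def)
    then show thesis using that rep_norm_le_reduced[OF Cc_tame] by blast
  qed
  interpret completed_line_bundle \<G> \<L> \<nu> \<iota> by unfold_locales (rule \<nu>)
  show ?thesis
    using topologically_free_imp_interior_empty interior_empty_imp_smooth smooth_imp_topologically_free[OF dom] by blast
qed

end
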